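(* Let $M$ and $M'$ be smooth (resp. real-analytic) strongly nondegenerate hypersurface type almost CR manifolds of the same dimension. Then for every $p_0\in M$ and $\Lambda_0\in G^2_{p_0}(M,M')$, there exist an open neighborhood $\Omega$ of $\Lambda_0$ in $G^2(M,M')$ and a smooth (resp. real-analytic) map $\Phi\colon\Omega\to G^3(M,M')$ such that every smooth CR-diffeomorphism $f$ between open pieces of $M$ and $M'$ satisfies the complete differential system $$j^3_pf=\Phi(j^2_pf)$$ whenever $p\in M$ is in the domain of definition of $f$ and $j^2_pf\in\Omega$.
   Context: An almost CR structure on a real manifold $M$ is a real subbundle $H\subset TM$ with a bundle automorphism $J\colon H\to H$, $J^2=-\mathrm{id}$; equivalently the $i$-eigenbundle $H^{1,0}\subset\mathbb C\otimes H$ of $J$. It is of hypersurface type if $H$ has corank $1$ in $TM$. No integrability is assumed. Levi form at $p$: $\mathcal L^{1,0}_p\colon H^{1,0}_p\times H^{1,0}_p\to(\mathbb C\otimes T_p)/(\mathbb C\otimes H_p)$, $\mathcal L^{1,0}_p(X_p,Y_p)=\frac1{2i}[\overline X,Y]_p$ mod $\mathbb C\otimes H_p$. Non-integrability tensor: $\mathcal N_p(X_p,Y_p)=[X,Y]_p$ mod $H^{1,0}_p$, with transversal component $\mathcal N^w_p$ its class mod $\mathbb C\otimes H_p$. Here $X,Y$ are sections of $H^{1,0}$. A hypersurface type almost CR manifold is strongly nondegenerate if at every point $p$ the form $\mathcal L^{1,0}_p$ is nondegenerate and moreover: $6i\,\mathcal L^{1,0}_p(\xi,\eta)+\mathcal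 N^w_p(\xi,\eta)=0$ for all $\eta\in H^{1,0}_p$ implies $\xi=0$. A CR-diffeomorphism between almost CR manifolds is a diffeomorphism transforming the almost CR structure of the first into that of the second. $G^k(M,M')$ is the space of all $k$-jets of (locally) invertible maps from $M$ to $M'$; $G^k_p(M,M')\subset G^k(M,M')$ is the subset of jets with source $p$; $j^k_pf$ is the $k$-jet of $f$ at $p$.
   Formalization: The manifolds are assumed to have dimension at least 2, so H is nonzero; in dimension 1 (H = 0) both nondegeneracy conditions are vacuous and the claim fails, since x and x + x³ on the real line are CR-diffeomorphisms near 0 with equal 2-jets but different 3-jets at 0. *)

theory Defs
  imports "HOL-Analysis.Analysis"
begin

section \<open>Smooth and real-analytic maps between Euclidean spaces\<close>

datatype regularity = Smooth | Analytic

primrec Ck_on :: "nat \<Rightarrow> 'e set \<Rightarrow> ('e::real_normed_vector \<Rightarrow> 'f::real_normed_vector) \<Rightarrow> bool" where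
  "Ck_on 0 S f \<longleftrightarrow> continuous_on S f"
| "Ck_on (Suc k) S f \<longleftrightarrow>
     (\<forall>x\<in>S. f differentiable at x) \<and> (\<forall>v. Ck_on k S (\<lambda>x. frechet_derivative f (at x) v))"

text \<open>Multi-indices are the functions \<open>\<alpha>\<close> from the standard basis to the naturals that are
  \<open>undefined\<close> off the basis. The sum is an unordered power series.\<close>

definition power_series_at :: "('e::euclidean_space \<Rightarrow> 'f::real_normed_vector) \<Rightarrow> 'e \<Rightarrow> bool" where
  "power_series_at f a \<longleftrightarrow>
     (\<exists>r>0. \<exists>C. \<forall>x\<in>ball a r.
        ((\<lambda>\<alpha>. (\<Prod>b\<in>Basis. ((x - a) \<bullet> b) ^ \<alpha> b) *\<^sub>R C \<alpha>) has_sum f x) (Basis \<rightarrow>\<^sub>E (UNIV :: nat set)))"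

primrec regular_on_open ::
  "regularity \<Rightarrow> 'e set \<Rightarrow> ('e::euclidean_space \<Rightarrow> 'f::real_normed_vector) \<Rightarrow> bool" where
  "regular_on_open Smooth S f \<longleftrightarrow> (\<forall>k. Ck_on k S f)"
| "regular_on_open Analytic S f \<longleftrightarrow> (\<forall>a\<in>S. power_series_at f a)"

text \<open>On an arbitrary set, a map is smooth (analytic) if it extends locally to a smooth (analytic) map
  on an open set; for open \<open>S\<close> this is \<^const>\<open>regular_on_open\<close>. The general case is needed for jet
  spaces only, whose charts below take values in a linear subspace (see \<open>jet2_coords\<close>).\<close>

definition regular_on ::
  "regularity \<Rightarrow> 'e set \<Rightarrow> ('e::euclidean_space \<Rightarrow> 'f::real_normed_vector) \<Rightarrow> bool" where
  "regular_on \<rho> S f \<longleftrightarrow>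
     (\<forall>x\<in>S. \<exists>U g. open U \<and> x \<in> U \<and> regular_on_open \<rho> U g \<and> (\<forall>y\<in>U \<inter> S. g y = f y))"

text \<open>\<open>iter_deriv [v\<^sub>1, \<dots>, v\<^sub>k] f x\<close> is the iterated directional derivative
  \<open>\<partial>\<^bsub>v\<^sub>1\<^esub> \<dots> \<partial>\<^bsub>v\<^sub>k\<^esub> f\<close> at \<open>x\<close>.\<close>

primrec iter_deriv ::
  "'e list \<Rightarrow> ('e::real_normed_vector \<Rightarrow> 'f::real_normed_vector) \<Rightarrow> 'e \<Rightarrow> 'f" where
  "iter_deriv [] f = f"
| "iter_deriv (v # vs) f = (\<lambda>x. frechet_derivative (iter_deriv vs f) (at x) v)"


section \<open>Manifolds and maps between them\<close>

text \<open>A chart is a domain together with a coordinate map. The topology of a manifold is the one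
  determined by its atlas.\<close>

type_synonym ('a, 'e) chart = "'a set \<times> ('a \<Rightarrow> 'e)"

definition atlas_topology :: "('a, 'e::topological_space) chart set \<Rightarrow> 'a topology" where
  "atlas_topology A = topology (\<lambda>W. W \<subseteq> \<Union> (fst ` A) \<and>
     (\<forall>c\<in>A. \<exists>S. open S \<and> W \<inter> fst c = {p \<in> fst c. snd c p \<in> S}))"

lemma openin_atlas_topology:
  "openin (atlas_topology A) W \<longleftrightarrow> W \<subseteq> \<Union> (fst ` A) \<and>
     (\<forall>c\<in>A. \<exists>S. open S \<and> W \<inter> fst c = {p \<in> fst c. snd c p \<in> S})"
proof -
  define Q where "Q = (\<lambda>W (c :: ('a, 'b) chart). \<exists>S. open S \<and> W \<inter> fst c = {p \<in> fst c. snd c p \<in> S})"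
  have Int: "Q (W \<inter> W') c" if QW: "Q W c" "Q W' c" for W W' c
  proof -
    obtain S S' where "open S" "open S'"
      and eq: "W \<inter> fst c = {p \<in> fst c. snd c p \<in> S}" "W' \<inter> fst c = {p \<in> fst c. snd c p \<in> S'}"
      using QW unfolding Q_def by blast
    moreover have "(W \<inter> W') \<inter> fst c = {p \<in> fst c. snd c p \<in> S \<inter> S'}"
      using eq by blast
    ultimately show ?thesis unfolding Q_def by blast
  qed
  have Un: "Q (\<Union>K) c" if QK: "\<forall>W\<in>K. Q W c" for K c
  proof -
    have "\<forall>W\<in>K. \<exists>S. open S \<and> W \<inter> fst c = {p \<in> fst c. snd c p \<in> S}"
      using QK unfolding Q_def .
    then obtain S where S: "\<forall>W\<in>K. open (S W) \<and> W \<inter> fst c = {p \<in> fst c. snd c p \<in> S W}"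
      by (rule bchoice[THEN exE])
    have "p \<in> W \<longleftrightarrow> snd c p \<in> S W" if "W \<in> K" "p \<in> fst c" for W p
      using S that by blast
    then have "\<Union>K \<inter> fst c = {p \<in> fst c. snd c p \<in> (\<Union>W\<in>K. S W)}" by blast
    moreover have "open (\<Union>W\<in>K. S W)" using S by (intro open_UN) blast
    ultimately show ?thesis unfolding Q_def by blast
  qed
  have "istopology (\<lambda>W. W \<subseteq> \<Union> (fst ` A) \<and> (\<forall>c\<in>A. Q W c))"
    unfolding istopology_def
  proof (intro conjI allI impI ballI)
    fix W W' c assume "W \<subseteq> \<Union> (fst ` A) \<and> (\<forall>c\<in>A. Q W c)" "W' \<subseteq> \<Union> (fst ` A) \<and> (\<forall>c\<in>A. Q W' c)"
    then show "W \<inter> W' \<subseteq> \<Union> (fst ` A)" "c \<in> A \<Longrightarrow> Q (W \<inter> W') c"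
      by (blast, simp add: Int)
  next
    fix K c assume "\<forall>W\<in>K. W \<subseteq> \<Union> (fst ` A) \<and> (\<forall>c\<in>A. Q W c)"
    then show "\<Union>K \<subseteq> \<Union> (fst ` A)" "c \<in> A \<Longrightarrow> Q (\<Union>K) c"
      by (blast, simp add: Un)
  qed
  then show ?thesis
    unfolding atlas_topology_def Q_def by (subst topology_inverse') simp_all
qed

abbreviation points :: "('a, 'e::topological_space) chart set \<Rightarrow> 'a set" where
  "points A \<equiv> topspace (atlas_topology A)"

definition local_rep :: "('a, 'e) chart \<Rightarrow> ('b, 'f) chart \<Rightarrow> ('a \<Rightarrow> 'b) \<Rightarrow> 'e \<Rightarrow> 'f" where
  "local_rep c d f = snd d \<circ> f \<circ> inv_into (fst c) (snd c)"

definition manifold :: "regularity \<Rightarrow> ('a, 'e::euclidean_space) chart set \<Rightarrow> bool" where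
  "manifold \<rho> A \<longleftrightarrow>
     (\<forall>c\<in>A. inj_on (snd c) (fst c) \<and> open (snd c ` fst c)) \<and>
     (\<forall>c\<in>A. \<forall>d\<in>A. open (snd c ` (fst c \<inter> fst d)) \<and>
        regular_on \<rho> (snd c ` (fst c \<inter> fst d)) (local_rep c d (\<lambda>p. p))) \<and>
     Hausdorff_space (atlas_topology A) \<and> second_countable (atlas_topology A)"

text \<open>The openness condition is the continuity of \<open>f\<close> on \<open>W\<close> when \<open>W\<close> is open.\<close>

definition regular_map ::
  "regularity \<Rightarrow> ('a, 'e::euclidean_space) chart set \<Rightarrow> ('b, 'f::euclidean_space) chart set \<Rightarrow>
   'a set \<Rightarrow> ('a \<Rightarrow> 'b) \<Rightarrow> bool" where
  "regular_map \<rho> A B W f \<longleftrightarrow> openin (atlas_topology A) W \<and> f ` W \<subseteq> points B \<and>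
     (\<forall>c\<in>A. \<forall>d\<in>B. let V = {p \<in> W \<inter> fst c. f p \<in> fst d} in
        openin (atlas_topology A) V \<and> regular_on \<rho> (snd c ` V) (local_rep c d f))"

definition diffeo ::
  "('a, 'e::euclidean_space) chart set \<Rightarrow> ('b, 'f::euclidean_space) chart set \<Rightarrow>
   'a set \<Rightarrow> 'b set \<Rightarrow> ('a \<Rightarrow> 'b) \<Rightarrow> bool" where
  "diffeo A B W W' f \<longleftrightarrow> bij_betw f W W' \<and>
     regular_map Smooth A B W f \<and> regular_map Smooth B A W' (inv_into W f)"


section \<open>Jet spaces\<close>

text \<open>Maps are total functions of which only the germ at \<open>p\<close> matters; a \<open>k\<close>-jet is its source
  paired with the class of all smooth maps having contact of order \<open>k\<close> there.\<close>

type_synonym ('a, 'b) jet = "'a \<times> ('a \<Rightarrow> 'b) set"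

definition contact ::
  "nat \<Rightarrow> ('a, 'e::euclidean_space) chart set \<Rightarrow> ('b, 'f::euclidean_space) chart set \<Rightarrow>
   'a \<Rightarrow> ('a \<Rightarrow> 'b) \<Rightarrow> ('a \<Rightarrow> 'b) \<Rightarrow> bool" where
  "contact k A B p f g \<longleftrightarrow> g p = f p \<and>
     (\<forall>c\<in>A. \<forall>d\<in>B. p \<in> fst c \<and> f p \<in> fst d \<longrightarrow>
        (\<forall>vs. length vs \<le> k \<longrightarrow>
           iter_deriv vs (local_rep c d g) (snd c p) = iter_deriv vs (local_rep c d f) (snd c p)))"

definition jet ::
  "nat \<Rightarrow> ('a, 'e::euclidean_space) chart set \<Rightarrow> ('b, 'f::euclidean_space) chart set \<Rightarrow>
   'a \<Rightarrow> ('a \<Rightarrow> 'b) \<Rightarrow> ('a, 'b) jet" where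
  "jet k A B p f =
     (p, {g. (\<exists>W. p \<in> W \<and> regular_map Smooth A B W g) \<and> contact k A B p f g})"

definition jet_space ::
  "nat \<Rightarrow> ('a, 'e::euclidean_space) chart set \<Rightarrow> ('b, 'f::euclidean_space) chart set \<Rightarrow>
   ('a, 'b) jet set" where
  "jet_space k A B = {jet k A B p f | p f. \<exists>W W'. p \<in> W \<and> diffeo A B W W' f}"

definition jet_space_at ::
  "nat \<Rightarrow> ('a, 'e::euclidean_space) chart set \<Rightarrow> ('b, 'f::euclidean_space) chart set \<Rightarrow>
   'a \<Rightarrow> ('a, 'b) jet set" where
  "jet_space_at k A B p = {\<Lambda> \<in> jet_space k A B. fst \<Lambda> = p}"

definition jet_rep :: "('a, 'b) jet \<Rightarrow> 'a \<Rightarrow> 'b" where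
  "jet_rep \<Lambda> = (SOME f. f \<in> snd \<Lambda>)"

definition jet_target :: "('a, 'b) jet \<Rightarrow> 'b" where
  "jet_target \<Lambda> = jet_rep \<Lambda> (fst \<Lambda>)"

text \<open>Charts of \<open>M\<close> and \<open>M'\<close> induce the usual jet coordinates: source, target and all partial
  derivatives of the local representative up to order 2 or 3. The mixed partials are listed
  redundantly, so the coordinates range over a relatively open subset of the linear subspace of
  tensors that are symmetric in the differentiation indices.\<close>

definition jet2_coords ::
  "('a, real^'n) chart \<Rightarrow> ('b, real^'n) chart \<Rightarrow> ('a, 'b) jet \<Rightarrow>
   (real^'n) \<times> (real^'n) \<times> (real^'n^'n) \<times> (real^'n^'n^'n)" where
  "jet2_coords c d \<Lambda> =
     (let x = snd c (fst \<Lambda>); F = local_rep c d (jet_rep \<Lambda>)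
      in (x, F x,
          \<chi> i. iter_deriv [axis i 1] F x,
          \<chi> i j. iter_deriv [axis i 1, axis j 1] F x))"

definition jet3_coords ::
  "('a, real^'n) chart \<Rightarrow> ('b, real^'n) chart \<Rightarrow> ('a, 'b) jet \<Rightarrow>
   ((real^'n) \<times> (real^'n) \<times> (real^'n^'n) \<times> (real^'n^'n^'n)) \<times> (real^'n^'n^'n^'n)" where
  "jet3_coords c d \<Lambda> =
     (let x = snd c (fst \<Lambda>); F = local_rep c d (jet_rep \<Lambda>)
      in (jet2_coords c d \<Lambda>, \<chi> i j k. iter_deriv [axis i 1, axis j 1, axis k 1] F x))"

definition jet_atlas ::
  "nat \<Rightarrow> (('a, 'e::euclidean_space) chart \<Rightarrow> ('b, 'f::euclidean_space) chart \<Rightarrow> ('a, 'b) jet \<Rightarrow> 'g) \<Rightarrow>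
   ('a, 'e) chart set \<Rightarrow> ('b, 'f) chart set \<Rightarrow> (('a, 'b) jet, 'g) chart set" where
  "jet_atlas k coords A B =
     {({\<Lambda> \<in> jet_space k A B. fst \<Lambda> \<in> fst c \<and> jet_target \<Lambda> \<in> fst d}, coords c d) | c d.
        c \<in> A \<and> d \<in> B}"

abbreviation jet2_atlas where "jet2_atlas A B \<equiv> jet_atlas 2 jet2_coords A B"

abbreviation jet3_atlas where "jet3_atlas A B \<equiv> jet_atlas 3 jet3_coords A B"


section \<open>Almost CR structures\<close>

text \<open>The tangent bundle is glued from the pieces \<open>\<phi>(U) \<times> \<real>\<^sup>n\<close>, one for each chart \<open>c = (U, \<phi>)\<close>, by
  the Jacobians of the chart changes. Accordingly, a subbundle \<open>H\<close> with its automorphism \<open>J\<close> is given by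
  the expressions \<open>H c x\<close> and \<open>J c x\<close> of the fibre and of the automorphism in each chart \<open>c\<close> at
  the point with coordinates \<open>x\<close>, matching under chart changes. The value of \<open>J c x\<close> matters only on
  \<open>H c x\<close>.\<close>

type_synonym 'n distribution = "real^'n \<Rightarrow> (real^'n) set"
type_synonym 'n endo_field = "real^'n \<Rightarrow> real^'n \<Rightarrow> real^'n"

definition almost_CR_on ::
  "regularity \<Rightarrow> (real^'n) set \<Rightarrow> 'n distribution \<Rightarrow> 'n endo_field \<Rightarrow> bool" where
  "almost_CR_on \<rho> S H J \<longleftrightarrow>
     (\<forall>x\<in>S. subspace (H x) \<and>
        (\<forall>v\<in>H x. J x v \<in> H x \<and> J x (J x v) = - v) \<and>
        (\<forall>u\<in>H x. \<forall>v\<in>H x. J x (u + v) = J x u + J x v) \<and>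
        (\<forall>v\<in>H x. \<forall>a. J x (a *\<^sub>R v) = a *\<^sub>R J x v)) \<and>
     (\<forall>x\<in>S. \<exists>W k (e :: nat \<Rightarrow> real^'n \<Rightarrow> real^'n). open W \<and> x \<in> W \<and> W \<subseteq> S \<and>
        (\<forall>i<k. regular_on \<rho> W (e i) \<and> regular_on \<rho> W (\<lambda>y. J y (e i y))) \<and>
        (\<forall>y\<in>W. inj_on (\<lambda>i. e i y) {..<k} \<and> independent ((\<lambda>i. e i y) ` {..<k}) \<and>
           span ((\<lambda>i. e i y) ` {..<k}) = H y))"

definition transforms_CR ::
  "(real^'n \<Rightarrow> real^'m) \<Rightarrow> (real^'n) set \<Rightarrow> (real^'n \<Rightarrow> real^'n) \<Rightarrow>
   (real^'m) set \<Rightarrow> (real^'m \<Rightarrow> real^'m) \<Rightarrow> bool" where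
  "transforms_CR D H J H' J' \<longleftrightarrow> D ` H = H' \<and> (\<forall>v\<in>H. D (J v) = J' (D v))"

definition almost_CR_manifold ::
  "regularity \<Rightarrow> ('a, real^'n) chart set \<Rightarrow> (('a, real^'n) chart \<Rightarrow> 'n distribution) \<Rightarrow>
   (('a, real^'n) chart \<Rightarrow> 'n endo_field) \<Rightarrow> bool" where
  "almost_CR_manifold \<rho> A H J \<longleftrightarrow> manifold \<rho> A \<and>
     (\<forall>c\<in>A. almost_CR_on \<rho> (snd c ` fst c) (H c) (J c)) \<and>
     (\<forall>c\<in>A. \<forall>d\<in>A. \<forall>p\<in>fst c \<inter> fst d.
        transforms_CR (frechet_derivative (local_rep c d (\<lambda>q. q)) (at (snd c p)))
          (H c (snd c p)) (J c (snd c p)) (H d (snd d p)) (J d (snd d p)))"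

definition hypersurface_type ::
  "('a, real^'n) chart set \<Rightarrow> (('a, real^'n) chart \<Rightarrow> 'n distribution) \<Rightarrow> bool" where
  "hypersurface_type A H \<longleftrightarrow> (\<forall>c\<in>A. \<forall>x\<in>snd c ` fst c. dim (H c x) + 1 = CARD('n))"

definition CR_diffeo ::
  "('a, real^'n) chart set \<Rightarrow> (('a, real^'n) chart \<Rightarrow> 'n distribution) \<Rightarrow>
   (('a, real^'n) chart \<Rightarrow> 'n endo_field) \<Rightarrow>
   ('b, real^'m) chart set \<Rightarrow> (('b, real^'m) chart \<Rightarrow> 'm distribution) \<Rightarrow>
   (('b, real^'m) chart \<Rightarrow> 'm endo_field) \<Rightarrow>
   'a set \<Rightarrow> 'b set \<Rightarrow> ('a \<Rightarrow> 'b) \<Rightarrow> bool" where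
  "CR_diffeo A H J B H' J' W W' f \<longleftrightarrow> diffeo A B W W' f \<and>
     (\<forall>c\<in>A. \<forall>d\<in>B. \<forall>p\<in>W \<inter> fst c. f p \<in> fst d \<longrightarrow>
        transforms_CR (frechet_derivative (local_rep c d f) (at (snd c p)))
          (H c (snd c p)) (J c (snd c p)) (H' d (snd d (f p))) (J' d (snd d (f p))))"


section \<open>Levi form, non-integrability tensor, strong nondegeneracy\<close>

definition Re_vec :: "complex^'n \<Rightarrow> real^'n" where "Re_vec z = (\<chi> i. Re (z $ i))"
definition Im_vec :: "complex^'n \<Rightarrow> real^'n" where "Im_vec z = (\<chi> i. Im (z $ i))"
definition cnj_vec :: "complex^'n \<Rightarrow> complex^'n" where "cnj_vec z = (\<chi> i. cnj (z $ i))"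

definition complexified :: "(real^'n) set \<Rightarrow> (complex^'n) set" where
  "complexified H = {z. Re_vec z \<in> H \<and> Im_vec z \<in> H}"

text \<open>With \<open>J\<close> extended complex-linearly, the condition below is \<open>J z = \<i> z\<close> split into real and
  imaginary parts.\<close>

definition H10 :: "(real^'n) set \<Rightarrow> (real^'n \<Rightarrow> real^'n) \<Rightarrow> (complex^'n) set" where
  "H10 H J = {z \<in> complexified H. J (Re_vec z) = - Im_vec z \<and> J (Im_vec z) = Re_vec z}"

text \<open>Lie bracket of complex vector fields on an open subset of \<open>\<real>\<^sup>n\<close>.\<close>

definition lie_bracket ::
  "(real^'n \<Rightarrow> complex^'n) \<Rightarrow> (real^'n \<Rightarrow> complex^'n) \<Rightarrow> real^'n \<Rightarrow> complex^'n" where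
  "lie_bracket X Y x =
     (\<Sum>j\<in>UNIV. (X x $ j) *s frechet_derivative Y (at x) (axis j 1)
              - (Y x $ j) *s frechet_derivative X (at x) (axis j 1))"

definition H10_section ::
  "(real^'n) set \<Rightarrow> 'n distribution \<Rightarrow> 'n endo_field \<Rightarrow> (real^'n \<Rightarrow> complex^'n) \<Rightarrow> bool" where
  "H10_section W H J X \<longleftrightarrow> regular_on Smooth W X \<and> (\<forall>y\<in>W. X y \<in> H10 (H y) (J y))"

text \<open>An element of a quotient space is represented by the corresponding coset, so the zero element of
  the quotient by \<open>V\<close> is \<open>V\<close> itself. Each coset is formed from all local sections
  extending the two given vectors. Throughout, \<open>S\<close> is the image of a chart.\<close>

definition levi_form ::
  "(real^'n) set \<Rightarrow> 'n distribution \<Rightarrow> 'n endo_field \<Rightarrow> real^'n \<Rightarrow>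
   complex^'n \<Rightarrow> complex^'n \<Rightarrow> (complex^'n) set" where
  "levi_form S H J x \<xi> \<eta> =
     {w. \<exists>W X Y. open W \<and> x \<in> W \<and> W \<subseteq> S \<and> H10_section W H J X \<and> H10_section W H J Y \<and>
        X x = \<xi> \<and> Y x = \<eta> \<and>
        w - (1 / (2 * \<i>)) *s lie_bracket (\<lambda>y. cnj_vec (X y)) Y x \<in> complexified (H x)}"

definition nonintegrability_tensor ::
  "(real^'n) set \<Rightarrow> 'n distribution \<Rightarrow> 'n endo_field \<Rightarrow> real^'n \<Rightarrow>
   complex^'n \<Rightarrow> complex^'n \<Rightarrow> (complex^'n) set" where
  "nonintegrability_tensor S H J x \<xi> \<eta> =
     {w. \<exists>W X Y. open W \<and> x \<in> W \<and> W \<subseteq> S \<and> H10_section W H J X \<and> H10_section W H J Y \<and>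
        X x = \<xi> \<and> Y x = \<eta> \<and> w - lie_bracket X Y x \<in> H10 (H x) (J x)}"

definition transversal_nonintegrability ::
  "(real^'n) set \<Rightarrow> 'n distribution \<Rightarrow> 'n endo_field \<Rightarrow> real^'n \<Rightarrow>
   complex^'n \<Rightarrow> complex^'n \<Rightarrow> (complex^'n) set" where
  "transversal_nonintegrability S H J x \<xi> \<eta> =
     {w. \<exists>u\<in>nonintegrability_tensor S H J x \<xi> \<eta>. w - u \<in> complexified (H x)}"

definition strongly_nondegenerate_at ::
  "(real^'n) set \<Rightarrow> 'n distribution \<Rightarrow> 'n endo_field \<Rightarrow> real^'n \<Rightarrow> bool" where
  "strongly_nondegenerate_at S H J x \<longleftrightarrow>
     (\<forall>\<xi>\<in>H10 (H x) (J x).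
        (\<forall>\<eta>\<in>H10 (H x) (J x). levi_form S H J x \<xi> \<eta> = complexified (H x)) \<longrightarrow> \<xi> = 0) \<and>
     (\<forall>\<xi>\<in>H10 (H x) (J x).
        (\<forall>\<eta>\<in>H10 (H x) (J x).
           {(6 * \<i>) *s u + w | u w. u \<in> levi_form S H J x \<xi> \<eta> \<and>
              w \<in> transversal_nonintegrability S H J x \<xi> \<eta>} = complexified (H x)) \<longrightarrow> \<xi> = 0)"

text \<open>All notions above are invariant under changes of coordinates, so it is immaterial that the
  condition is imposed in every chart rather than in one chart around each point.\<close>

definition strongly_nondegenerate ::
  "('a, real^'n) chart set \<Rightarrow> (('a, real^'n) chart \<Rightarrow> 'n distribution) \<Rightarrow>
   (('a, real^'n) chart \<Rightarrow> 'n endo_field) \<Rightarrow> bool" where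
  "strongly_nondegenerate A H J \<longleftrightarrow>
     (\<forall>c\<in>A. \<forall>x\<in>snd c ` fst c. strongly_nondegenerate_at (snd c ` fst c) (H c) (J c) x)"

end

theory Submission
  imports Defs
begin

text \<open>Choose complex frames \<open>E i\<close> of \<open>M\<close> and \<open>E' j\<close> of \<open>M'\<close> made of a real transversal field, a basis of
  \<open>H\<^sup>1\<^sup>,\<^sup>0\<close> and its conjugate, and write the differential of a CR-diffeomorphism as
  \<open>E i \<mapsto> (\<Sum>j. A i j E' j)\<close>. Comparing brackets gives
  \<open>E i (A j k) - E j (A i k) + (\<Sum>p q. A i p A j q c' p q k) = (\<Sum>p. c i j p A p k)\<close>, where \<open>A i j = 0\<close> for
  \<open>E i\<close> in \<open>H\<^sup>1\<^sup>,\<^sup>0\<close> and \<open>E' j\<close> not. Hence many first derivatives of \<open>A\<close> are functions of the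
  1-jet, and differentiating the invariance of the Levi form and commuting \<open>E a\<close> with
  \<open>E (bar b)\<close> expresses the remaining ones, by inversion of the Levi matrix, through the 1-jet and the
  single quantity \<open>\<tau>\<close>, the derivative of \<open>A t t\<close> in the transversal direction. Further commutators do
  the same for the derivatives of \<open>\<tau>\<close>. So all third derivatives of the map are functions, regular in
  the charts, of its 2-jet. On jets, \<open>\<Phi>\<close> is realized by cubic polynomials in the charts used.\<close>

section \<open>Power series in several variables\<close>

text \<open>Two features shape the argument. Without integrability, brackets of fields of type (1,0)
  have components in every direction, so each relation is read modulo the ring of quantities already
  known and only its unknown terms are tracked. And the 1-jet cannot suffice: on a hyperquadric the
  local automorphisms with a prescribed 1-jet at a point form a family with one real parameter, and
  \<open>\<tau>\<close> measures that parameter. The unknowns are found from linear systems whose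
  coefficients depend on the CR dimension \<open>M\<close>; the factors to be inverted are
  \<open>M\<close>, \<open>M + 1\<close>, \<open>M + 2\<close> and \<open>M * M - 1\<close>. The
  last one vanishes for \<open>M = 1\<close>, which forces a separate relation on three-dimensional
  manifolds. Matrices are inverted by Cramer's rule, so that the result is smooth or analytic along
  with the data. This requires a calculus common to both regularities, whose analytic half rests on
  norms of power series.\<close>

abbreviation multi_indices :: "('e::euclidean_space \<Rightarrow> nat) set" where
  "multi_indices \<equiv> Basis \<rightarrow>\<^sub>E UNIV"

definition monom_at :: "('e::euclidean_space \<Rightarrow> nat) \<Rightarrow> 'e \<Rightarrow> real" where
  "monom_at \<alpha> z = (\<Prod>b\<in>Basis. (z \<bullet> b) ^ \<alpha> b)"

definition mdeg :: "('e::euclidean_space \<Rightarrow> nat) \<Rightarrow> nat" where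
  "mdeg \<alpha> = (\<Sum>b\<in>Basis. \<alpha> b)"

definition box_at :: "'e::euclidean_space \<Rightarrow> real \<Rightarrow> 'e set" where
  "box_at a r = {x. \<forall>b\<in>Basis. \<bar>(x - a) \<bullet> b\<bar> \<le> r}"

text \<open>The functions given on a box by a power series of weighted \<open>\<ell>\<^sup>1\<close>-norm at most \<open>M\<close>. They behave like
  a Banach algebra under sums and products, which gives composition without rearrangements of
  multiple series.\<close>

definition ps_bound :: "'e::euclidean_space \<Rightarrow> real \<Rightarrow> real \<Rightarrow> ('e \<Rightarrow> real) \<Rightarrow> bool" where
  "ps_bound a r M f \<longleftrightarrow> (\<exists>C. (\<lambda>\<alpha>. \<bar>C \<alpha>\<bar> * r ^ mdeg \<alpha>) summable_on multi_indices \<and>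
      infsum (\<lambda>\<alpha>. \<bar>C \<alpha>\<bar> * r ^ mdeg \<alpha>) multi_indices \<le> M \<and>
      (\<forall>x\<in>box_at a r. ((\<lambda>\<alpha>. monom_at \<alpha> (x - a) * C \<alpha>) has_sum f x) multi_indices))"

lemma monom_at_bound:
  assumes "\<And>b. b \<in> Basis \<Longrightarrow> \<bar>z \<bullet> b\<bar> \<le> r"
  shows "\<bar>monom_at \<alpha> z\<bar> \<le> r ^ mdeg \<alpha>"
proof -
  have "\<bar>monom_at \<alpha> z\<bar> = (\<Prod>b\<in>Basis. \<bar>z \<bullet> b\<bar> ^ \<alpha> b)"
    unfolding monom_at_def by (simp add: abs_prod power_abs)
  also have "\<dots> \<le> (\<Prod>b\<in>Basis. r ^ \<alpha> b)"
    by (intro prod_mono) (auto intro!: power_mono assms)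
  also have "\<dots> = r ^ mdeg \<alpha>" by (simp add: mdeg_def power_sum)
  finally show ?thesis .
qed

lemma ps_bound_mono: "ps_bound a r M f \<Longrightarrow> M \<le> M' \<Longrightarrow> ps_bound a r M' f"
  unfolding ps_bound_def by force

lemma ps_bound_cong: "ps_bound a r M f \<Longrightarrow> (\<And>x. x \<in> box_at a r \<Longrightarrow> f x = g x) \<Longrightarrow> ps_bound a r M g"
  unfolding ps_bound_def by force

lemma ps_bound_nonneg: "ps_bound a r M f \<Longrightarrow> 0 \<le> r \<Longrightarrow> 0 \<le> M"
  unfolding ps_bound_def by (meson abs_ge_zero infsum_nonneg mult_nonneg_nonneg order_trans zero_le_power)

lemma ps_bound_abs_le:
  assumes "ps_bound a r M f" "x \<in> box_at a r"
  shows "\<bar>f x\<bar> \<le> M"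
proof -
  obtain C where C: "(\<lambda>\<alpha>. \<bar>C \<alpha>\<bar> * r ^ mdeg \<alpha>) summable_on multi_indices"
    "infsum (\<lambda>\<alpha>. \<bar>C \<alpha>\<bar> * r ^ mdeg \<alpha>) multi_indices \<le> M"
    "((\<lambda>\<alpha>. monom_at \<alpha> (x - a) * C \<alpha>) has_sum f x) multi_indices"
    using assms unfolding ps_bound_def by blast
  have le: "\<bar>monom_at \<alpha> (x - a) * C \<alpha>\<bar> \<le> \<bar>C \<alpha>\<bar> * r ^ mdeg \<alpha>" for \<alpha>
    using monom_at_bound[of "x - a" r \<alpha>] assms(2)
    by (auto simp: box_at_def abs_mult mult.commute intro!: mult_left_mono)
  have "norm (f x) \<le> infsum (\<lambda>\<alpha>. \<bar>C \<alpha>\<bar> * r ^ mdeg \<alpha>) multi_indices"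
    using norm_infsum_le[OF C(3) has_sum_infsum[OF C(1)]] le by auto
  with C(2) show ?thesis by simp
qed

lemma ps_bound_shrink:
  assumes f: "ps_bound a r M f" and s: "0 \<le> s" "s \<le> r"
  shows "ps_bound a s M f"
proof -
  obtain C where C: "(\<lambda>\<alpha>. \<bar>C \<alpha>\<bar> * r ^ mdeg \<alpha>) summable_on multi_indices"
    "infsum (\<lambda>\<alpha>. \<bar>C \<alpha>\<bar> * r ^ mdeg \<alpha>) multi_indices \<le> M"
    "\<forall>x\<in>box_at a r. ((\<lambda>\<alpha>. monom_at \<alpha> (x - a) * C \<alpha>) has_sum f x) multi_indices"
    using f unfolding ps_bound_def by blast
  have le: "\<bar>C \<alpha>\<bar> * s ^ mdeg \<alpha> \<le> \<bar>C \<alpha>\<bar> * r ^ mdeg \<alpha>" for \<alpha>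
    using s by (intro mult_left_mono power_mono) auto
  have sm: "(\<lambda>\<alpha>. \<bar>C \<alpha>\<bar> * s ^ mdeg \<alpha>) summable_on multi_indices"
    by (rule summable_on_comparison_test[OF C(1)]) (use le s in auto)
  moreover have "infsum (\<lambda>\<alpha>. \<bar>C \<alpha>\<bar> * s ^ mdeg \<alpha>) multi_indices \<le> M"
    using infsum_mono[OF sm C(1)] le C(2) by force
  moreover have "box_at a s \<subseteq> box_at a r" using s unfolding box_at_def by fastforce
  ultimately show ?thesis using C(3) unfolding ps_bound_def by blast
qed

text \<open>Completeness of the algebra: the double series over family and multi-index converges
  absolutely, so the two summations may be exchanged. Products, compositions and derivatives below
  are all obtained as sums of such families.\<close>

lemma ps_bound_has_sum:
  fixes f :: "'k \<Rightarrow> 'e::euclidean_space \<Rightarrow> real"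
  assumes f: "\<And>k. k \<in> K \<Longrightarrow> ps_bound a r (M k) (f k)" and M: "M summable_on K" and r: "0 \<le> r"
    and F: "\<And>x. x \<in> box_at a r \<Longrightarrow> ((\<lambda>k. f k x) has_sum F x) K"
  shows "ps_bound a r (infsum M K) F"
proof -
  have "\<forall>k\<in>K. \<exists>C. (\<lambda>\<alpha>. \<bar>C \<alpha>\<bar> * r ^ mdeg \<alpha>) summable_on multi_indices \<and>
      infsum (\<lambda>\<alpha>. \<bar>C \<alpha>\<bar> * r ^ mdeg \<alpha>) multi_indices \<le> M k \<and>
      (\<forall>x\<in>box_at a r. ((\<lambda>\<alpha>. monom_at \<alpha> (x - a) * C \<alpha>) has_sum f k x) multi_indices)"
    using f unfolding ps_bound_def by blast
  from bchoice[OF this] obtain C where C1: "\<And>k. k \<in> K \<Longrightarrow> (\<lambda>\<alpha>. \<bar>C k \<alpha>\<bar> * r ^ mdeg \<alpha>) summable_on multi_indices"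
    and C2: "\<And>k. k \<in> K \<Longrightarrow> infsum (\<lambda>\<alpha>. \<bar>C k \<alpha>\<bar> * r ^ mdeg \<alpha>) multi_indices \<le> M k"
    and C3: "\<And>k x. k \<in> K \<Longrightarrow> x \<in> box_at a r \<Longrightarrow>
      ((\<lambda>\<alpha>. monom_at \<alpha> (x - a) * C k \<alpha>) has_sum f k x) multi_indices"
    by blast
  let ?N = "\<lambda>k. infsum (\<lambda>\<alpha>. \<bar>C k \<alpha>\<bar> * r ^ mdeg \<alpha>) multi_indices"
  have N0: "0 \<le> ?N k" for k using r by (intro infsum_nonneg) auto
  have N: "?N summable_on K"
    by (rule summable_on_comparison_test[OF M]) (use C2 N0 in auto)
  have S: "(\<lambda>(k, \<alpha>). \<bar>C k \<alpha>\<bar> * r ^ mdeg \<alpha>) summable_on (K \<times> multi_indices)"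
    by (rule summable_on_SigmaI[where g = ?N]) (use C1 N r in auto)
  have S': "(\<lambda>(\<alpha>, k). \<bar>C k \<alpha>\<bar> * r ^ mdeg \<alpha>) summable_on (multi_indices \<times> K)"
    using S by (subst (asm) summable_on_swap) (simp add: case_prod_unfold)
  have Ck: "(\<lambda>k. \<bar>C k \<alpha>\<bar> * r ^ mdeg \<alpha>) summable_on K" if "\<alpha> \<in> multi_indices" for \<alpha>
    using summable_on_SigmaD1[OF S' that] by simp
  \<comment> \<open>For \<open>r = 0\<close> the weights \<open>r ^ mdeg \<alpha>\<close> control
    only the constant coefficient, and the other coefficients need not be summable over the family.
    Their monomials vanish on the box, which is then a point, so 0 serves as a default.\<close>
  define D where "D \<alpha> = (if r = 0 \<and> mdeg \<alpha> \<noteq> 0 then 0 else infsum (\<lambda>k. C k \<alpha>) K)" for \<alpha>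
  have absC: "(\<lambda>k. \<bar>C k \<alpha>\<bar>) summable_on K" if "\<alpha> \<in> multi_indices" "\<not> (r = 0 \<and> mdeg \<alpha> \<noteq> 0)" for \<alpha>
  proof -
    have "r ^ mdeg \<alpha> \<noteq> 0" using that by auto
    then show ?thesis using Ck[OF that(1)] summable_on_cmult_left'[of "r ^ mdeg \<alpha>" "\<lambda>k. \<bar>C k \<alpha>\<bar>" K] by simp
  qed
  have Cs: "(\<lambda>k. C k \<alpha>) summable_on K" if "\<alpha> \<in> multi_indices" "\<not> (r = 0 \<and> mdeg \<alpha> \<noteq> 0)" for \<alpha>
    using absC[OF that] summable_on_iff_abs_summable_on_real[of "\<lambda>k. C k \<alpha>" K] by simp
  let ?B = "\<lambda>\<alpha>. infsum (\<lambda>k. \<bar>C k \<alpha>\<bar> * r ^ mdeg \<alpha>) K"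
  have B: "?B summable_on multi_indices"
    using summable_on_Sigma_banach[OF S'] by simp
  have Dle: "\<bar>D \<alpha>\<bar> * r ^ mdeg \<alpha> \<le> ?B \<alpha>" if "\<alpha> \<in> multi_indices" for \<alpha>
  proof (cases "r = 0 \<and> mdeg \<alpha> \<noteq> 0")
    case True
    then show ?thesis by (simp add: D_def power_0_left)
  next
    case False
    have "\<bar>infsum (\<lambda>k. C k \<alpha>) K\<bar> \<le> infsum (\<lambda>k. \<bar>C k \<alpha>\<bar>) K"
      using norm_infsum_bound[of "\<lambda>k. C k \<alpha>" K] absC[OF that False] by simp
    then have "\<bar>D \<alpha>\<bar> * r ^ mdeg \<alpha> \<le> infsum (\<lambda>k. \<bar>C k \<alpha>\<bar>) K * r ^ mdeg \<alpha>"
      using r by (intro mult_right_mono) (use False in \<open>auto simp: D_def\<close>)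
    also have "\<dots> = ?B \<alpha>" by (simp add: infsum_cmult_left')
    finally show ?thesis .
  qed
  have D1: "(\<lambda>\<alpha>. \<bar>D \<alpha>\<bar> * r ^ mdeg \<alpha>) summable_on multi_indices"
    by (rule summable_on_comparison_test[OF B]) (use Dle r in auto)
  have "infsum (\<lambda>\<alpha>. \<bar>D \<alpha>\<bar> * r ^ mdeg \<alpha>) multi_indices \<le> infsum ?B multi_indices"
    by (rule infsum_mono[OF D1 B]) (use Dle in auto)
  also have "\<dots> = infsum ?N K"
    using infsum_swap_banach[of "\<lambda>\<alpha> k. \<bar>C k \<alpha>\<bar> * r ^ mdeg \<alpha>" multi_indices K] S' by simp
  also have "\<dots> \<le> infsum M K" by (rule infsum_mono[OF N M]) (use C2 in auto)
  finally have D2: "infsum (\<lambda>\<alpha>. \<bar>D \<alpha>\<bar> * r ^ mdeg \<alpha>) multi_indices \<le> infsum M K" .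
  have "((\<lambda>\<alpha>. monom_at \<alpha> (x - a) * D \<alpha>) has_sum F x) multi_indices" if x: "x \<in> box_at a r" for x
  proof -
    have le: "\<bar>monom_at \<alpha> (x - a) * C k \<alpha>\<bar> \<le> \<bar>C k \<alpha>\<bar> * r ^ mdeg \<alpha>" for k \<alpha>
      using monom_at_bound[of "x - a" r \<alpha>] x
      by (auto simp: box_at_def abs_mult mult.commute intro!: mult_left_mono)
    have T: "(\<lambda>p. norm (monom_at (snd p) (x - a) * C (fst p) (snd p))) summable_on (K \<times> multi_indices)"
      by (rule summable_on_comparison_test[OF S]) (use le in auto)
    then have "(\<lambda>p. monom_at (snd p) (x - a) * C (fst p) (snd p)) summable_on (K \<times> multi_indices)"
      by (rule abs_summable_summable)
    then have "((\<lambda>p. monom_at (snd p) (x - a) * C (fst p) (snd p)) has_sum F x) (K \<times> multi_indices)"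
      by (intro has_sum_SigmaI[where g = "\<lambda>k. f k x"]) (use C3 x F in auto)
    then have T': "((\<lambda>p. monom_at (fst p) (x - a) * C (snd p) (fst p)) has_sum F x) (multi_indices \<times> K)"
      by (subst (asm) has_sum_swap) (simp add: case_prod_unfold)
    show ?thesis
    proof (rule has_sum_SigmaD[OF T'])
      fix \<alpha> :: "'e \<Rightarrow> nat" assume \<alpha>: "\<alpha> \<in> multi_indices"
      show "((\<lambda>k. monom_at (fst (\<alpha>, k)) (x - a) * C (snd (\<alpha>, k)) (fst (\<alpha>, k))) has_sum
          monom_at \<alpha> (x - a) * D \<alpha>) K"
      proof (cases "r = 0 \<and> mdeg \<alpha> \<noteq> 0")
        case True
        then have "monom_at \<alpha> (x - a) = 0"
          using monom_at_bound[of "x - a" r \<alpha>] x by (auto simp: box_at_def power_0_left)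
        then show ?thesis by simp
      next
        case False
        then show ?thesis using Cs[OF \<alpha> False] by (auto simp: D_def intro!: has_sum_cmult_right)
      qed
    qed
  qed
  with D1 D2 show ?thesis unfolding ps_bound_def by blast
qed

lemma ps_bound_sum:
  assumes "finite K" "\<And>k. k \<in> K \<Longrightarrow> ps_bound a r (M k) (f k)" "0 \<le> r"
  shows "ps_bound a r (\<Sum>k\<in>K. M k) (\<lambda>x. \<Sum>k\<in>K. f k x)"
  using ps_bound_has_sum[of K a r M f "\<lambda>x. \<Sum>k\<in>K. f k x"] assms by simp

lemma ps_bound_cmult:
  assumes "ps_bound a r M f"
  shows "ps_bound a r (\<bar>c\<bar> * M) (\<lambda>x. c * f x)"
proof -
  obtain C where C: "(\<lambda>\<alpha>. \<bar>C \<alpha>\<bar> * r ^ mdeg \<alpha>) summable_on multi_indices"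
    "infsum (\<lambda>\<alpha>. \<bar>C \<alpha>\<bar> * r ^ mdeg \<alpha>) multi_indices \<le> M"
    "\<forall>x\<in>box_at a r. ((\<lambda>\<alpha>. monom_at \<alpha> (x - a) * C \<alpha>) has_sum f x) multi_indices"
    using assms unfolding ps_bound_def by blast
  have eq: "\<bar>c * C \<alpha>\<bar> * r ^ mdeg \<alpha> = \<bar>c\<bar> * (\<bar>C \<alpha>\<bar> * r ^ mdeg \<alpha>)" for \<alpha> by (simp add: abs_mult)
  show ?thesis unfolding ps_bound_def
  proof (intro exI[of _ "\<lambda>\<alpha>. c * C \<alpha>"] conjI ballI)
    show "(\<lambda>\<alpha>. \<bar>c * C \<alpha>\<bar> * r ^ mdeg \<alpha>) summable_on multi_indices"
      unfolding eq by (rule summable_on_cmult_right[OF C(1)])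
    show "infsum (\<lambda>\<alpha>. \<bar>c * C \<alpha>\<bar> * r ^ mdeg \<alpha>) multi_indices \<le> \<bar>c\<bar> * M"
      unfolding eq infsum_cmult_right' using C(2) by (intro mult_left_mono) auto
    show "((\<lambda>\<alpha>. monom_at \<alpha> (x - a) * (c * C \<alpha>)) has_sum c * f x) multi_indices" if "x \<in> box_at a r" for x
      using has_sum_cmult_right[OF C(3)[rule_format, OF that], of c] by (simp add: mult.left_commute)
  qed
qed

lemma ps_bound_monom:
  fixes a :: "'e::euclidean_space"
  assumes "\<beta> \<in> multi_indices"
  shows "ps_bound a r (r ^ mdeg \<beta>) (\<lambda>x. monom_at \<beta> (x - a))"
proof -
  let ?C = "\<lambda>\<alpha>. if \<alpha> = \<beta> then 1 else 0 :: real"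
  have fin: "((\<lambda>\<alpha>. g \<alpha> * ?C \<alpha>) has_sum g \<beta>) multi_indices" for g :: "_ \<Rightarrow> real"
    by (rule has_sum_finite_neutralI[of "{\<beta>}"]) (use assms in auto)
  have "((\<lambda>\<alpha>. \<bar>?C \<alpha>\<bar> * r ^ mdeg \<alpha>) has_sum r ^ mdeg \<beta>) multi_indices"
    by (rule has_sum_finite_neutralI[of "{\<beta>}"]) (use assms in auto)
  then have "(\<lambda>\<alpha>. \<bar>?C \<alpha>\<bar> * r ^ mdeg \<alpha>) summable_on multi_indices"
    "infsum (\<lambda>\<alpha>. \<bar>?C \<alpha>\<bar> * r ^ mdeg \<alpha>) multi_indices \<le> r ^ mdeg \<beta>"
    using has_sum_imp_summable infsumI by fastforce+
  then show ?thesis unfolding ps_bound_def using fin by (intro exI[of _ ?C]) auto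
qed

lemma monom_at_add:
  "(\<lambda>b\<in>Basis. \<alpha> b + \<beta> b) \<in> multi_indices" "mdeg (\<lambda>b\<in>Basis. \<alpha> b + \<beta> b) = mdeg \<alpha> + mdeg \<beta>"
  "monom_at (\<lambda>b\<in>Basis. \<alpha> b + \<beta> b) z = monom_at \<alpha> z * monom_at \<beta> z"
  by (auto simp: mdeg_def monom_at_def power_add prod.distrib sum.distrib)

text \<open>A shift of the coefficients, written as a sum of one-term series so that no reindexing
  of multi-indices is needed.\<close>

lemma ps_bound_mult_monom:
  assumes f: "ps_bound a r M f" and r: "0 \<le> r"
  shows "ps_bound a r (M * r ^ mdeg \<beta>) (\<lambda>x. f x * monom_at \<beta> (x - a))"
proof -
  obtain C where C: "(\<lambda>\<alpha>. \<bar>C \<alpha>\<bar> * r ^ mdeg \<alpha>) summable_on multi_indices"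
    "infsum (\<lambda>\<alpha>. \<bar>C \<alpha>\<bar> * r ^ mdeg \<alpha>) multi_indices \<le> M"
    "\<forall>x\<in>box_at a r. ((\<lambda>\<alpha>. monom_at \<alpha> (x - a) * C \<alpha>) has_sum f x) multi_indices"
    using f unfolding ps_bound_def by blast
  have "ps_bound a r (infsum (\<lambda>\<alpha>. \<bar>C \<alpha>\<bar> * r ^ (mdeg \<alpha> + mdeg \<beta>)) multi_indices)
      (\<lambda>x. f x * monom_at \<beta> (x - a))"
  proof (rule ps_bound_has_sum[where f = "\<lambda>\<alpha> x. C \<alpha> * monom_at (\<lambda>b\<in>Basis. \<alpha> b + \<beta> b) (x - a)"])
    fix \<alpha> :: "'a \<Rightarrow> nat"
    show "ps_bound a r (\<bar>C \<alpha>\<bar> * r ^ (mdeg \<alpha> + mdeg \<beta>)) (\<lambda>x. C \<alpha> * monom_at (\<lambda>b\<in>Basis. \<alpha> b + \<beta> b) (x - a))"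
      using ps_bound_cmult[OF ps_bound_monom[OF monom_at_add(1)], of a r "C \<alpha>" \<alpha> \<beta>] by (simp add: monom_at_add)
  next
    show "(\<lambda>\<alpha>. \<bar>C \<alpha>\<bar> * r ^ (mdeg \<alpha> + mdeg \<beta>)) summable_on multi_indices"
      using summable_on_cmult_left[OF C(1), of "r ^ mdeg \<beta>"] by (simp add: power_add mult.assoc)
  next
    fix x assume "x \<in> box_at a r"
    then show "((\<lambda>\<alpha>. C \<alpha> * monom_at (\<lambda>b\<in>Basis. \<alpha> b + \<beta> b) (x - a)) has_sum f x * monom_at \<beta> (x - a)) multi_indices"
      using has_sum_cmult_left[OF C(3)[rule_format], of x "monom_at \<beta> (x - a)"]
      by (simp add: monom_at_add mult_ac)
  qed (rule r)
  moreover have "infsum (\<lambda>\<alpha>. \<bar>C \<alpha>\<bar> * r ^ (mdeg \<alpha> + mdeg \<beta>)) multi_indices \<le> M * r ^ mdeg \<beta>"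
  proof -
    have "infsum (\<lambda>\<alpha>. \<bar>C \<alpha>\<bar> * r ^ (mdeg \<alpha> + mdeg \<beta>)) multi_indices
        = infsum (\<lambda>\<alpha>. \<bar>C \<alpha>\<bar> * r ^ mdeg \<alpha>) multi_indices * r ^ mdeg \<beta>"
      by (simp add: power_add mult.assoc[symmetric] infsum_cmult_left')
    then show ?thesis using C(2) r by (simp add: mult_right_mono)
  qed
  ultimately show ?thesis by (rule ps_bound_mono)
qed

text \<open>Only \<open>g\<close> is expanded: the product is a sum of multiples of \<open>f\<close>
  times a monomial, each of norm at most \<open>M * r ^ mdeg \<alpha>\<close> before scaling. This
  replaces the Cauchy product.\<close>

lemma ps_bound_mult:
  assumes f: "ps_bound a r M f" and g: "ps_bound a r N g" and r: "0 \<le> r"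
  shows "ps_bound a r (M * N) (\<lambda>x. f x * g x)"
proof -
  obtain C where C: "(\<lambda>\<alpha>. \<bar>C \<alpha>\<bar> * r ^ mdeg \<alpha>) summable_on multi_indices"
    "infsum (\<lambda>\<alpha>. \<bar>C \<alpha>\<bar> * r ^ mdeg \<alpha>) multi_indices \<le> N"
    "\<forall>x\<in>box_at a r. ((\<lambda>\<alpha>. monom_at \<alpha> (x - a) * C \<alpha>) has_sum g x) multi_indices"
    using g unfolding ps_bound_def by blast
  have M: "0 \<le> M" using ps_bound_nonneg[OF f r] .
  have "ps_bound a r (infsum (\<lambda>\<alpha>. M * (\<bar>C \<alpha>\<bar> * r ^ mdeg \<alpha>)) multi_indices) (\<lambda>x. f x * g x)"
  proof (rule ps_bound_has_sum[where f = "\<lambda>\<alpha> x. C \<alpha> * (f x * monom_at \<alpha> (x - a))"])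
    fix \<alpha> :: "'a \<Rightarrow> nat"
    show "ps_bound a r (M * (\<bar>C \<alpha>\<bar> * r ^ mdeg \<alpha>)) (\<lambda>x. C \<alpha> * (f x * monom_at \<alpha> (x - a)))"
      using ps_bound_cmult[OF ps_bound_mult_monom[OF f r], of "C \<alpha>" \<alpha>] by (simp add: mult_ac)
  next
    show "(\<lambda>\<alpha>. M * (\<bar>C \<alpha>\<bar> * r ^ mdeg \<alpha>)) summable_on multi_indices"
      by (rule summable_on_cmult_right[OF C(1)])
  next
    fix x assume "x \<in> box_at a r"
    then show "((\<lambda>\<alpha>. C \<alpha> * (f x * monom_at \<alpha> (x - a))) has_sum f x * g x) multi_indices"
      using has_sum_cmult_right[OF C(3)[rule_format], of x "f x"] by (simp add: mult_ac)
  qed (rule r)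
  then show ?thesis
    by (rule ps_bound_mono) (use C(2) M in \<open>auto simp: infsum_cmult_right' intro!: mult_left_mono\<close>)
qed

lemma ps_bound_const: "ps_bound a r \<bar>c\<bar> (\<lambda>x. c)"
proof -
  have 0: "(\<lambda>b\<in>Basis. 0) \<in> multi_indices" "mdeg (\<lambda>b\<in>Basis. 0) = 0" "monom_at (\<lambda>b\<in>Basis. 0) z = 1" for z :: 'a
    by (auto simp: mdeg_def monom_at_def)
  show ?thesis using ps_bound_cmult[OF ps_bound_monom[OF 0(1)], of a r c] by (simp add: 0)
qed

lemma ps_bound_coord:
  assumes b: "b \<in> Basis"
  shows "ps_bound a r r (\<lambda>x. (x - a) \<bullet> b)"
proof -
  let ?\<beta> = "\<lambda>b'\<in>Basis. if b' = b then 1 else 0 :: nat"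
  have 0: "?\<beta> \<in> multi_indices" "mdeg ?\<beta> = 1" "monom_at ?\<beta> z = z \<bullet> b" for z
  proof -
    show "?\<beta> \<in> multi_indices" "mdeg ?\<beta> = 1" using b by (auto simp: mdeg_def sum.delta)
    have "monom_at ?\<beta> z = (\<Prod>c\<in>Basis. if c = b then z \<bullet> b else 1)"
      unfolding monom_at_def by (rule prod.cong) auto
    then show "monom_at ?\<beta> z = z \<bullet> b" using b by (simp add: prod.delta)
  qed
  show ?thesis using ps_bound_monom[OF 0(1), of a r] by (simp add: 0)
qed

lemma ps_bound_add:
  assumes "ps_bound a r M f" "ps_bound a r N g" "0 \<le> r"
  shows "ps_bound a r (M + N) (\<lambda>x. f x + g x)"
  using ps_bound_sum[of "{0::nat, 1}" a r "\<lambda>k. if k = 0 then M else N" "\<lambda>k. if k = 0 then f else g"] assms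
  by simp

lemma ps_bound_power:
  assumes "ps_bound a r M f" "0 \<le> r"
  shows "ps_bound a r (M ^ n) (\<lambda>x. f x ^ n)"
proof (induction n)
  case 0
  then show ?case using ps_bound_const[of a r 1] by simp
next
  case (Suc n)
  then show ?case using ps_bound_mult[OF assms(1) Suc assms(2)] by simp
qed

lemma ps_bound_prod:
  assumes "finite K" "\<And>k. k \<in> K \<Longrightarrow> ps_bound a r (M k) (f k)" "0 \<le> r"
  shows "ps_bound a r (\<Prod>k\<in>K. M k) (\<lambda>x. \<Prod>k\<in>K. f k x)"
  using assms(1,2)
proof (induction K)
  case empty
  then show ?case using ps_bound_const[of a r 1] by simp
next
  case (insert k K)
  then show ?case using ps_bound_mult[of a r "M k" "f k" "prod M K" "\<lambda>x. \<Prod>k\<in>K. f k x"] assms(3) by simp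
qed

text \<open>Substitution works monomial by monomial: \<open>monom_at \<alpha> (f x - y)\<close> is a
  product of series of norm \<open>s\<close>, hence of norm \<open>s ^ mdeg \<alpha>\<close>, which
  is exactly the weight summed in the norm of \<open>g\<close>.\<close>

lemma ps_bound_compose:
  fixes f :: "'e::euclidean_space \<Rightarrow> 'f::euclidean_space"
  assumes g: "ps_bound y s M g" and r: "0 \<le> r"
    and f: "\<And>b. b \<in> Basis \<Longrightarrow> ps_bound a r s (\<lambda>x. (f x - y) \<bullet> b)"
  shows "ps_bound a r M (\<lambda>x. g (f x))"
proof -
  obtain C where C: "(\<lambda>\<alpha>. \<bar>C \<alpha>\<bar> * s ^ mdeg \<alpha>) summable_on multi_indices"
    "infsum (\<lambda>\<alpha>. \<bar>C \<alpha>\<bar> * s ^ mdeg \<alpha>) multi_indices \<le> M"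
    "\<forall>x\<in>box_at y s. ((\<lambda>\<alpha>. monom_at \<alpha> (x - y) * C \<alpha>) has_sum g x) multi_indices"
    using g unfolding ps_bound_def by blast
  have "ps_bound a r (infsum (\<lambda>\<alpha>. \<bar>C \<alpha>\<bar> * s ^ mdeg \<alpha>) multi_indices) (\<lambda>x. g (f x))"
  proof (rule ps_bound_has_sum[where f = "\<lambda>\<alpha> x. C \<alpha> * monom_at \<alpha> (f x - y)"])
    fix \<alpha> :: "'f \<Rightarrow> nat"
    have "ps_bound a r (\<Prod>b\<in>Basis. s ^ \<alpha> b) (\<lambda>x. monom_at \<alpha> (f x - y))"
      unfolding monom_at_def by (intro ps_bound_prod ps_bound_power f r) auto
    then show "ps_bound a r (\<bar>C \<alpha>\<bar> * s ^ mdeg \<alpha>) (\<lambda>x. C \<alpha> * monom_at \<alpha> (f x - y))"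
      using ps_bound_cmult by (auto simp: mdeg_def power_sum)
  next
    fix x assume "x \<in> box_at a r"
    then have "f x \<in> box_at y s" using ps_bound_abs_le[OF f] by (auto simp: box_at_def)
    then show "((\<lambda>\<alpha>. C \<alpha> * monom_at \<alpha> (f x - y)) has_sum g (f x)) multi_indices"
      using C(3) by (simp add: mult.commute)
  qed (use C r in auto)
  then show ?thesis using C(2) by (rule ps_bound_mono)
qed

text \<open>Composition with the identity, expanded at the new centre: there each coordinate of
  \<open>x - a\<close> has norm at most \<open>\<bar>(b - a) \<bullet> c\<bar> + s\<close>.\<close>

lemma ps_bound_recenter:
  assumes f: "ps_bound a r M f" and s: "0 \<le> s" "\<And>c. c \<in> Basis \<Longrightarrow> \<bar>(b - a) \<bullet> c\<bar> + s \<le> r"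
  shows "ps_bound b s M f"
proof (rule ps_bound_compose[where f = "\<lambda>x. x", OF f s(1)])
  fix c :: 'a assume c: "c \<in> Basis"
  have "ps_bound b s (\<bar>(b - a) \<bullet> c\<bar> + s) (\<lambda>x. (b - a) \<bullet> c + (x - b) \<bullet> c)"
    by (intro ps_bound_add ps_bound_const ps_bound_coord c s)
  then show "ps_bound b s r (\<lambda>x. (x - a) \<bullet> c)"
    by (rule ps_bound_mono[OF ps_bound_cong]) (use s(2)[OF c] in \<open>auto simp: inner_diff_left\<close>)
qed

text \<open>The series of \<open>f x - f a\<close> has no constant term, so scaling the radius by
  \<open>q\<close> gains at least one factor \<open>q\<close> in every term. This makes room for
  composition.\<close>

lemma ps_bound_small:
  assumes f: "ps_bound a r M f" and r: "0 < r" and s: "0 < s"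
  obtains r' where "0 < r'" "r' \<le> r" "ps_bound a r' s (\<lambda>x. f x - f a)"
proof -
  obtain C where C: "(\<lambda>\<alpha>. \<bar>C \<alpha>\<bar> * r ^ mdeg \<alpha>) summable_on multi_indices"
    "infsum (\<lambda>\<alpha>. \<bar>C \<alpha>\<bar> * r ^ mdeg \<alpha>) multi_indices \<le> M"
    and C3: "\<And>x. x\<in>box_at a r \<Longrightarrow> ((\<lambda>\<alpha>. monom_at \<alpha> (x - a) * C \<alpha>) has_sum f x) multi_indices"
    using f unfolding ps_bound_def by blast
  have M: "0 \<le> M" using ps_bound_nonneg[OF f] r by simp
  let ?o = "\<lambda>b\<in>Basis. 0 :: nat"
  define D where "D \<alpha> = (if \<alpha> = ?o then 0 else C \<alpha>)" for \<alpha>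
  have o: "?o \<in> multi_indices" "mdeg ?o = 0" "monom_at ?o z = 1" for z :: 'a
    by (auto simp: mdeg_def monom_at_def)
  have deg: "\<alpha> = ?o" if "\<alpha> \<in> multi_indices" "mdeg \<alpha> = 0" for \<alpha> :: "'a \<Rightarrow> nat"
    using that by (auto simp: mdeg_def fun_eq_iff PiE_def extensional_def)
  have 0: "monom_at \<alpha> (0::'a) = 0" if "mdeg \<alpha> \<noteq> 0" for \<alpha>
    using monom_at_bound[of "0::'a" 0 \<alpha>] that by (simp add: power_0_left)
  have "((\<lambda>\<alpha>. monom_at \<alpha> (a - a) * C \<alpha>) has_sum C ?o) multi_indices"
    by (rule has_sum_finite_neutralI[of "{?o}"]) (use o 0 deg in auto)
  moreover have "((\<lambda>\<alpha>. monom_at \<alpha> (a - a) * C \<alpha>) has_sum f a) multi_indices"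
    using C3[of a] r by (auto simp: box_at_def)
  ultimately have fa: "f a = C ?o" using has_sum_unique by blast
  have D: "((\<lambda>\<alpha>. monom_at \<alpha> (x - a) * D \<alpha>) has_sum f x - f a) multi_indices" if "x \<in> box_at a r" for x
  proof -
    have "((\<lambda>\<alpha>. if \<alpha> = ?o then - C ?o else 0) has_sum - C ?o) multi_indices"
      by (rule has_sum_finite_neutralI[of "{?o}"]) (use o in auto)
    from has_sum_add[OF C3[OF that] this]
    have "((\<lambda>\<alpha>. monom_at \<alpha> (x - a) * C \<alpha> + (if \<alpha> = ?o then - C ?o else 0)) has_sum f x + - C ?o) multi_indices" .
    moreover have "monom_at \<alpha> (x - a) * C \<alpha> + (if \<alpha> = ?o then - C ?o else 0) = monom_at \<alpha> (x - a) * D \<alpha>" for \<alpha>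
      by (auto simp: D_def o)
    ultimately show ?thesis by (simp add: fa)
  qed
  \<comment> \<open>Chosen for \<open>q * M \<le> s\<close>; the \<open>+ 1\<close> guards against
    \<open>M = 0\<close>.\<close>
  define q where "q = min 1 (s / (M + 1))"
  have q: "0 < q" "q \<le> 1" using s M by (auto simp: q_def)
  have "q * (M + 1) \<le> s / (M + 1) * (M + 1)" using M by (intro mult_right_mono) (auto simp: q_def)
  also have "\<dots> = s" using M by simp
  finally have qM: "q * M \<le> s" using M q by (simp add: distrib_left)
  have le: "\<bar>D \<alpha>\<bar> * (q * r) ^ mdeg \<alpha> \<le> q * (\<bar>C \<alpha>\<bar> * r ^ mdeg \<alpha>)" if "\<alpha> \<in> multi_indices" for \<alpha>
  proof (cases "\<alpha> = ?o")
    case True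
    then show ?thesis using r q by (simp add: D_def)
  next
    case False
    then have "mdeg \<alpha> \<noteq> 0" using deg[OF that] by blast
    then obtain n where n: "mdeg \<alpha> = Suc n" using not0_implies_Suc by blast
    have "q ^ n \<le> 1" using q by (simp add: power_le_one)
    then have "q * q ^ n * (\<bar>C \<alpha>\<bar> * r ^ mdeg \<alpha>) \<le> q * 1 * (\<bar>C \<alpha>\<bar> * r ^ mdeg \<alpha>)"
      using q r by (intro mult_right_mono mult_left_mono) auto
    then show ?thesis using False n by (simp add: D_def power_mult_distrib mult_ac)
  qed
  have sm: "(\<lambda>\<alpha>. q * (\<bar>C \<alpha>\<bar> * r ^ mdeg \<alpha>)) summable_on multi_indices"
    by (rule summable_on_cmult_right[OF C(1)])
  have sD: "(\<lambda>\<alpha>. \<bar>D \<alpha>\<bar> * (q * r) ^ mdeg \<alpha>) summable_on multi_indices"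
    by (rule summable_on_comparison_test[OF sm]) (use le q r in auto)
  have "infsum (\<lambda>\<alpha>. \<bar>D \<alpha>\<bar> * (q * r) ^ mdeg \<alpha>) multi_indices \<le> infsum (\<lambda>\<alpha>. q * (\<bar>C \<alpha>\<bar> * r ^ mdeg \<alpha>)) multi_indices"
    by (rule infsum_mono[OF sD sm]) (use le in auto)
  also have "\<dots> \<le> q * M" using C(2) q by (simp add: infsum_cmult_right' mult_left_mono)
  finally have iD: "infsum (\<lambda>\<alpha>. \<bar>D \<alpha>\<bar> * (q * r) ^ mdeg \<alpha>) multi_indices \<le> s" using qM by simp
  have "q * r \<le> r" using q r by simp
  then have "box_at a (q * r) \<subseteq> box_at a r" by (force simp: box_at_def)
  then have "ps_bound a (q * r) s (\<lambda>x. f x - f a)"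
    unfolding ps_bound_def using sD iD D by blast
  then show thesis using that[of "q * r"] q r by simp
qed

lemma infinite_multi_indices: "infinite (multi_indices :: ('e::euclidean_space \<Rightarrow> nat) set)"
proof -
  have "inj (\<lambda>n::nat. \<lambda>b\<in>(Basis :: 'e set). n)"
  proof (rule injI)
    fix m n :: nat assume "(\<lambda>b\<in>(Basis :: 'e set). m) = (\<lambda>b\<in>Basis. n)"
    moreover obtain b :: 'e where b: "b \<in> Basis" using nonempty_Basis by blast
    ultimately have "(\<lambda>b\<in>(Basis :: 'e set). m) b = (\<lambda>b\<in>Basis. n) b" by simp
    then show "m = n" using b by simp
  qed
  then have "infinite (range (\<lambda>n::nat. \<lambda>b\<in>(Basis :: 'e set). n))" by (simp add: finite_image_iff)
  moreover have "range (\<lambda>n::nat. \<lambda>b\<in>(Basis :: 'e set). n) \<subseteq> multi_indices" by auto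
  ultimately show ?thesis using finite_subset by blast
qed

lemma countable_multi_indices: "countable (multi_indices :: ('e::euclidean_space \<Rightarrow> nat) set)"
  by (intro countable_PiE) auto

lemma open_box_interior:
  assumes "\<And>c. c \<in> Basis \<Longrightarrow> \<bar>(x - a) \<bullet> c\<bar> < r"
  shows "\<exists>e>0. \<forall>c\<in>Basis. \<bar>(x - a) \<bullet> c\<bar> + e \<le> r"
proof -
  define e where "e = Min ((\<lambda>c. r - \<bar>(x - a) \<bullet> c\<bar>) ` Basis)"
  have "0 < e" unfolding e_def by (subst Min_gr_iff) (use assms in auto)
  moreover have "e \<le> r - \<bar>(x - a) \<bullet> c\<bar>" if "c \<in> Basis" for c
    unfolding e_def by (rule Min_le) (use that in auto)
  ultimately show ?thesis by (intro exI[of _ e]) (simp add: le_diff_eq add.commute)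
qed

text \<open>The terms of degree at most 1 form a differentiable polynomial. Each remaining term
  carries a factor \<open>(norm (x - a) / r)^2\<close>, so their sum has derivative 0 at
  \<open>a\<close>.\<close>

lemma ps_bound_imp_differentiable:
  fixes a :: "'e::euclidean_space"
  assumes f: "ps_bound a r M f" and r: "0 < r"
  shows "f differentiable (at a)"
proof -
  obtain C where C: "(\<lambda>\<alpha>. \<bar>C \<alpha>\<bar> * r ^ mdeg \<alpha>) summable_on multi_indices"
    "infsum (\<lambda>\<alpha>. \<bar>C \<alpha>\<bar> * r ^ mdeg \<alpha>) multi_indices \<le> M"
    and C3: "\<And>x. x\<in>box_at a r \<Longrightarrow> ((\<lambda>\<alpha>. monom_at \<alpha> (x - a) * C \<alpha>) has_sum f x) multi_indices"
    using f unfolding ps_bound_def by blast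
  define F1 where "F1 = {\<alpha> \<in> multi_indices. mdeg (\<alpha> :: 'e \<Rightarrow> nat) \<le> 1}"
  have "F1 \<subseteq> Basis \<rightarrow>\<^sub>E {0, 1}"
  proof
    fix \<alpha> :: "'e \<Rightarrow> nat" assume \<alpha>: "\<alpha> \<in> F1"
    have "\<alpha> b \<le> 1" if "b \<in> Basis" for b
      using member_le_sum[of b Basis \<alpha>] \<alpha> that by (simp add: F1_def mdeg_def)
    then show "\<alpha> \<in> Basis \<rightarrow>\<^sub>E {0, 1}" using \<alpha> by (force simp: F1_def PiE_iff le_Suc_eq)
  qed
  then have fin: "finite F1" using finite_subset finite_PiE[of Basis "\<lambda>_. {0, 1 :: nat}"] by auto
  define P where "P x = (\<Sum>\<alpha>\<in>F1. monom_at \<alpha> (x - a) * C \<alpha>)" for x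
  have "P differentiable (at a)"
  proof -
    have "((\<lambda>x. ((x - a) \<bullet> b) ^ n) has_derivative (\<lambda>h. of_nat n * (h \<bullet> b) * ((a - a) \<bullet> b) ^ (n - 1))) (at a)" for b n
      by (auto intro!: derivative_eq_intros)
    then show ?thesis unfolding P_def monom_at_def
      by (intro differentiable_sum differentiable_mult differentiable_const ballI fin
          differentiableI[OF has_derivative_prod])
  qed
  then obtain P' where P': "(P has_derivative P') (at a)" unfolding differentiable_def by blast
  define R where "R x = f x - P x" for x
  have R: "\<bar>R x\<bar> \<le> M * (norm (x - a) / r)^2" if x: "norm (x - a) \<le> r" for x
  proof -
    have le: "\<bar>(x - a) \<bullet> b\<bar> \<le> norm (x - a)" if "b \<in> Basis" for b
      using Basis_le_norm[OF that] .
    then have xb: "x \<in> box_at a r" using x unfolding box_at_def by force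
    have "((\<lambda>\<alpha>. if \<alpha> \<in> F1 then - (monom_at \<alpha> (x - a) * C \<alpha>) else 0) has_sum - P x) multi_indices"
      by (rule has_sum_finite_neutralI[OF fin]) (auto simp: F1_def P_def sum_negf)
    from has_sum_add[OF C3[OF xb] this]
    have hs: "((\<lambda>\<alpha>. monom_at \<alpha> (x - a) * C \<alpha> + (if \<alpha> \<in> F1 then - (monom_at \<alpha> (x - a) * C \<alpha>) else 0))
        has_sum R x) multi_indices" by (simp add: R_def)
    define q where "q = norm (x - a) / r"
    have q: "0 \<le> q" "q \<le> 1" using r x by (auto simp: q_def)
    have b: "\<bar>monom_at \<alpha> (x - a) * C \<alpha> + (if \<alpha> \<in> F1 then - (monom_at \<alpha> (x - a) * C \<alpha>) else 0)\<bar>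
        \<le> q^2 * (\<bar>C \<alpha>\<bar> * r ^ mdeg \<alpha>)" if "\<alpha> \<in> multi_indices" for \<alpha>
    proof (cases "\<alpha> \<in> F1")
      case True
      then show ?thesis using q r by simp
    next
      case False
      then have d: "2 \<le> mdeg \<alpha>" using that by (simp add: F1_def)
      have "norm (x - a) = q * r" using r by (simp add: q_def)
      then have "\<bar>monom_at \<alpha> (x - a)\<bar> \<le> (q * r) ^ mdeg \<alpha>" using monom_at_bound[OF le, of \<alpha>] by simp
      also have "\<dots> = q ^ mdeg \<alpha> * r ^ mdeg \<alpha>" by (simp add: power_mult_distrib)
      also have "\<dots> \<le> q^2 * r ^ mdeg \<alpha>"
        using power_decreasing[OF d q] r by (intro mult_right_mono) auto
      finally have "\<bar>monom_at \<alpha> (x - a)\<bar> * \<bar>C \<alpha>\<bar> \<le> q^2 * r ^ mdeg \<alpha> * \<bar>C \<alpha>\<bar>"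
        by (rule mult_right_mono) simp
      then show ?thesis using False by (simp add: abs_mult mult_ac)
    qed
    have "norm (R x) \<le> q^2 * infsum (\<lambda>\<alpha>. \<bar>C \<alpha>\<bar> * r ^ mdeg \<alpha>) multi_indices"
      by (rule norm_infsum_le[OF hs has_sum_cmult_right[OF has_sum_infsum[OF C(1)]]]) (use b in auto)
    also have "\<dots> \<le> q^2 * M" using C(2) by (intro mult_left_mono) auto
    finally show ?thesis by (simp add: q_def mult.commute)
  qed
  have Ra: "R a = 0" using R[of a] r by simp
  have "(R has_derivative (\<lambda>h. 0)) (at a)"
    unfolding has_derivative_at_alt
  proof (intro conjI allI impI)
    fix e :: real assume e: "0 < e"
    have M: "0 \<le> M" using ps_bound_nonneg[OF f] r by simp
    define d where "d = min r (e * r^2 / (M + 1))"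
    have d: "0 < d" using e r M by (auto simp: d_def)
    have "norm (R y - R a - 0) \<le> e * norm (y - a)" if "norm (y - a) < d" for y
    proof -
      have "norm (y - a) \<le> e * r^2 / (M + 1)" "norm (y - a) \<le> r" using that by (auto simp: d_def)
      then have 1: "(M + 1) * norm (y - a) \<le> e * r^2"
        using M by (simp add: pos_le_divide_eq mult.commute)
      have "M * norm (y - a) \<le> (M + 1) * norm (y - a)" by (intro mult_right_mono) auto
      with 1 have 2: "M * norm (y - a) \<le> e * r^2" by linarith
      have "\<bar>R y\<bar> \<le> M * (norm (y - a) / r)^2" by (rule R) fact
      also have "\<dots> = (M * norm (y - a)) * norm (y - a) / r^2" by (simp add: power2_eq_square)
      also have "\<dots> \<le> (e * r^2) * norm (y - a) / r^2"
        by (intro divide_right_mono mult_right_mono 2) auto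
      also have "\<dots> = e * norm (y - a)" using r by simp
      finally show ?thesis by (simp add: Ra)
    qed
    then show "\<exists>d>0. \<forall>y. norm (y - a) < d \<longrightarrow> norm (R y - R a - 0) \<le> e * norm (y - a)" using d by blast
  qed simp
  from has_derivative_add[OF P' this] have "((\<lambda>x. P x + R x) has_derivative (\<lambda>h. P' h + 0)) (at a)" .
  then show ?thesis unfolding differentiable_def R_def by auto
qed

definition monom_deriv :: "'e::euclidean_space \<Rightarrow> ('e \<Rightarrow> nat) \<Rightarrow> 'e \<Rightarrow> real" where
  "monom_deriv v \<alpha> z =
     (\<Sum>c\<in>Basis. (v \<bullet> c) * (of_nat (\<alpha> c) * ((z \<bullet> c) ^ (\<alpha> c - 1) * (\<Prod>b\<in>Basis - {c}. (z \<bullet> b) ^ \<alpha> b))))"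

lemma monom_at_line_deriv:
  "((\<lambda>t. monom_at \<alpha> (z + t *\<^sub>R v)) has_field_derivative monom_deriv v \<alpha> (z + t *\<^sub>R v)) (at t within S)"
proof -
  have "((\<lambda>t. ((z + t *\<^sub>R v) \<bullet> b) ^ \<alpha> b) has_derivative
      (\<lambda>h. h * ((v \<bullet> b) * (of_nat (\<alpha> b) * ((z + t *\<^sub>R v) \<bullet> b) ^ (\<alpha> b - 1))))) (at t within S)" for b
    by (auto intro!: derivative_eq_intros simp: inner_add_left mult_ac)
  then have "((\<lambda>t. monom_at \<alpha> (z + t *\<^sub>R v)) has_derivative
     (\<lambda>h. \<Sum>c\<in>Basis. h * ((v \<bullet> c) * (of_nat (\<alpha> c) * ((z + t *\<^sub>R v) \<bullet> c) ^ (\<alpha> c - 1))) *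
        (\<Prod>b\<in>Basis - {c}. ((z + t *\<^sub>R v) \<bullet> b) ^ \<alpha> b))) (at t within S)"
    unfolding monom_at_def by (intro has_derivative_prod) auto
  moreover have "(\<lambda>h. \<Sum>c\<in>Basis. h * ((v \<bullet> c) * (of_nat (\<alpha> c) * ((z + t *\<^sub>R v) \<bullet> c) ^ (\<alpha> c - 1))) *
        (\<Prod>b\<in>Basis - {c}. ((z + t *\<^sub>R v) \<bullet> b) ^ \<alpha> b)) = (*) (monom_deriv v \<alpha> (z + t *\<^sub>R v))"
    by (auto simp: monom_deriv_def sum_distrib_left sum_distrib_right mult_ac intro!: sum.cong)
  ultimately show ?thesis unfolding has_field_derivative_def by simp
qed

text \<open>The exponent brought down by differentiation is absorbed by halving the radius, since
  \<open>Suc n \<le> 2 ^ n\<close>; the factor \<open>2 / r\<close> pays for the lost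
  degree.\<close>

lemma ps_bound_monom_deriv:
  fixes v :: "'e::euclidean_space"
  assumes r: "0 < r"
  shows "ps_bound a (r / 2) ((\<Sum>c\<in>Basis. \<bar>v \<bullet> c\<bar>) * (2 / r) * r ^ mdeg \<alpha>) (\<lambda>x. monom_deriv v \<alpha> (x - a))"
proof -
  have "ps_bound a (r / 2) (\<Sum>c\<in>Basis. \<bar>v \<bullet> c\<bar> * ((2 / r) * r ^ mdeg \<alpha>)) (\<lambda>x. monom_deriv v \<alpha> (x - a))"
    unfolding monom_deriv_def
  proof (intro ps_bound_sum ps_bound_cmult)
    fix c :: 'e assume c: "c \<in> Basis"
    have "ps_bound a (r/2) (\<bar>of_nat (\<alpha> c)\<bar> * ((r/2) ^ (\<alpha> c - 1) * (\<Prod>b\<in>Basis - {c}. (r/2) ^ \<alpha> b)))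
      (\<lambda>x. of_nat (\<alpha> c) * (((x - a) \<bullet> c) ^ (\<alpha> c - 1) * (\<Prod>b\<in>Basis - {c}. ((x - a) \<bullet> b) ^ \<alpha> b)))"
      by (intro ps_bound_cmult ps_bound_mult ps_bound_prod ps_bound_power ps_bound_coord c)
        (use r in auto)
    moreover have "\<bar>of_nat (\<alpha> c)\<bar> * ((r/2) ^ (\<alpha> c - 1) * (\<Prod>b\<in>Basis - {c}. (r/2) ^ \<alpha> b)) \<le> (2 / r) * r ^ mdeg \<alpha>"
    proof (cases "\<alpha> c")
      case 0
      then show ?thesis using r by simp
    next
      case (Suc n)
      define N where "N = (\<Sum>b\<in>Basis - {c}. \<alpha> b)"
      have deg: "mdeg \<alpha> = Suc (n + N)"
        unfolding mdeg_def N_def using sum.remove[OF finite_Basis c, of \<alpha>] Suc by simp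
      have "real (Suc n) \<le> 2 ^ (n + N)"
      proof -
        have "Suc n \<le> 2 ^ n" by (induction n) auto
        also have "\<dots> \<le> 2 ^ (n + N)" by (simp add: power_add)
        finally have "real (Suc n) \<le> real (2 ^ (n + N))" by (rule of_nat_mono)
        then show ?thesis by simp
      qed
      then have "real (Suc n) * (r/2) ^ (n + N) \<le> 2 ^ (n + N) * (r/2) ^ (n + N)"
        using r by (intro mult_right_mono) auto
      also have "\<dots> = r ^ (n + N)" by (simp add: power_mult_distrib[symmetric])
      also have "\<dots> \<le> 2 * r ^ (n + N)" using r by simp
      finally show ?thesis using r Suc by (simp add: deg power_add power_sum[symmetric] N_def[symmetric])
    qed
    ultimately show "ps_bound a (r/2) (2 / r * r ^ mdeg \<alpha>)
      (\<lambda>x. of_nat (\<alpha> c) * (((x - a) \<bullet> c) ^ (\<alpha> c - 1) * (\<Prod>b\<in>Basis - {c}. ((x - a) \<bullet> b) ^ \<alpha> b)))"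
      by (rule ps_bound_mono)
  qed (use r in auto)
  then show ?thesis by (simp only: sum_distrib_right mult.assoc)
qed

text \<open>Differentiability at \<open>x\<close> follows after recentring, so only the value at
  \<open>v\<close> has to be identified. That concerns the line through \<open>x\<close> in
  direction \<open>v\<close>, on which the series may be differentiated term by term because the
  derived series converges uniformly.\<close>

lemma ps_bound_deriv:
  fixes a v :: "'e::euclidean_space"
  assumes f: "ps_bound a r M f" and r: "0 < r"
  shows "\<exists>M' G. ps_bound a (r / 2) M' G \<and>
    (\<forall>x. (\<forall>c\<in>Basis. \<bar>(x - a) \<bullet> c\<bar> < r / 2) \<longrightarrow> f differentiable (at x) \<and> frechet_derivative f (at x) v = G x)"
proof -
  obtain C where C: "(\<lambda>\<alpha>. \<bar>C \<alpha>\<bar> * r ^ mdeg \<alpha>) summable_on multi_indices"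
    "infsum (\<lambda>\<alpha>. \<bar>C \<alpha>\<bar> * r ^ mdeg \<alpha>) multi_indices \<le> M"
    and C3: "\<And>x. x\<in>box_at a r \<Longrightarrow> ((\<lambda>\<alpha>. monom_at \<alpha> (x - a) * C \<alpha>) has_sum f x) multi_indices"
    using f unfolding ps_bound_def by blast
  let ?s = "r / 2"
  define V where "V = (\<Sum>c\<in>Basis. \<bar>v \<bullet> c\<bar>) * (2 / r)"
  have V: "0 \<le> V" using r by (simp add: V_def sum_nonneg)
  define N where "N \<alpha> = V * (\<bar>C \<alpha>\<bar> * r ^ mdeg \<alpha>)" for \<alpha>
  define h where "h \<alpha> x = C \<alpha> * monom_deriv v \<alpha> (x - a)" for \<alpha> x
  define G where "G x = infsum (\<lambda>\<alpha>. h \<alpha> x) multi_indices" for x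
  have N: "N summable_on multi_indices" unfolding N_def by (rule summable_on_cmult_right[OF C(1)])
  have h: "ps_bound a ?s (N \<alpha>) (h \<alpha>)" for \<alpha>
    using ps_bound_cmult[OF ps_bound_monom_deriv[OF r, of a v \<alpha>], of "C \<alpha>"]
    unfolding N_def h_def[abs_def] V_def by (simp add: mult_ac)
  have hN: "\<bar>h \<alpha> x\<bar> \<le> N \<alpha>" if "x \<in> box_at a ?s" for \<alpha> x by (rule ps_bound_abs_le[OF h that])
  have hs: "(\<lambda>\<alpha>. h \<alpha> x) summable_on multi_indices" if "x \<in> box_at a ?s" for x
    by (rule abs_summable_summable) (rule summable_on_comparison_test[OF N], use hN[OF that] in auto)
  have G: "ps_bound a ?s (infsum N multi_indices) G"
    by (rule ps_bound_has_sum[OF h N]) (use r hs in \<open>auto simp: G_def\<close>)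
  have "f differentiable (at x) \<and> frechet_derivative f (at x) v = G x"
    if x: "\<forall>c\<in>Basis. \<bar>(x - a) \<bullet> c\<bar> < ?s" for x
  proof
    obtain e where e: "0 < e" "\<And>c. c \<in> Basis \<Longrightarrow> \<bar>(x - a) \<bullet> c\<bar> + e \<le> ?s"
      using open_box_interior[of x a ?s] x by blast
    have "ps_bound x e M f" by (rule ps_bound_recenter[OF f]) (use e r in fastforce)+
    then show diff: "f differentiable (at x)" using ps_bound_imp_differentiable e(1) by blast
    \<comment> \<open>For \<open>\<bar>t\<bar> \<le> d\<close> the point
      \<open>x + t *\<^sub>R v\<close> stays in the box of radius \<open>r / 2\<close>, where
      \<open>N\<close> dominates the derived series.\<close>
    define d where "d = e / (norm v + 1)"
    have d: "0 < d" using e by (simp add: d_def add_nonneg_pos)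
    have box: "x + t *\<^sub>R v \<in> box_at a ?s" if t: "t \<in> {-d..d}" for t
    proof -
      have "\<bar>t\<bar> * norm v \<le> d * (norm v + 1)" using t by (intro mult_mono) auto
      also have "\<dots> = e" using d by (simp add: d_def add_nonneg_eq_0_iff)
      finally have tv: "norm (t *\<^sub>R v) \<le> e" by simp
      have "\<bar>(x + t *\<^sub>R v - a) \<bullet> c\<bar> \<le> ?s" if "c \<in> Basis" for c
      proof -
        have "(x + t *\<^sub>R v - a) \<bullet> c = (x - a) \<bullet> c + (t *\<^sub>R v) \<bullet> c" by (simp add: inner_simps)
        moreover have "\<bar>(t *\<^sub>R v) \<bullet> c\<bar> \<le> e" using Basis_le_norm[OF that, of "t *\<^sub>R v"] tv by linarith
        ultimately show ?thesis using e(2)[OF that] by linarith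
      qed
      then show ?thesis by (simp add: box_at_def)
    qed
    have sub: "box_at a ?s \<subseteq> box_at a r" using r by (force simp: box_at_def)
    \<comment> \<open>Enumerating the multi-indices turns unordered sums into ordinary series, to
      which the one-variable theorem on termwise differentiation applies.\<close>
    let ?\<alpha> = "from_nat_into (multi_indices :: ('e \<Rightarrow> nat) set)"
    have bij: "bij_betw ?\<alpha> UNIV multi_indices"
      by (rule bij_betw_from_nat_into[OF countable_multi_indices infinite_multi_indices])
    have sN: "summable (\<lambda>n. N (?\<alpha> n))"
      using N summable_on_reindex_bij_betw[OF bij, of N] by (auto intro: summable_on_imp_summable)
    have fs: "(\<lambda>n. monom_at (?\<alpha> n) (x - a + t *\<^sub>R v) * C (?\<alpha> n)) sums f (x + t *\<^sub>R v)" if "t \<in> {-d..d}" for t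
      using C3[of "x + t *\<^sub>R v"] box[OF that] sub has_sum_reindex_bij_betw[OF bij, of "\<lambda>\<alpha>. monom_at \<alpha> (x - a + t *\<^sub>R v) * C \<alpha>"]
      by (auto intro!: has_sum_imp_sums simp: add_diff_eq diff_add_eq)
    have der: "((\<lambda>t. monom_at (?\<alpha> n) (x - a + t *\<^sub>R v) * C (?\<alpha> n)) has_field_derivative
        h (?\<alpha> n) (x + t *\<^sub>R v)) (at t within {-d..d})" for n t
      using DERIV_cmult[OF monom_at_line_deriv[of "?\<alpha> n" "x - a" v t "{-d..d}"], of "C (?\<alpha> n)"]
      by (simp add: h_def mult.commute add_diff_eq diff_add_eq)
    have "\<exists>g. \<forall>t\<in>{-d..d}. (\<lambda>n. monom_at (?\<alpha> n) (x - a + t *\<^sub>R v) * C (?\<alpha> n)) sums g t \<and>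
        (g has_field_derivative (\<Sum>n. h (?\<alpha> n) (x + t *\<^sub>R v))) (at t within {-d..d})"
    proof (rule has_field_derivative_series[where ?x0.0 = 0])
      show "uniform_limit {-d..d} (\<lambda>n t. \<Sum>i<n. h (?\<alpha> i) (x + t *\<^sub>R v)) (\<lambda>t. \<Sum>i. h (?\<alpha> i) (x + t *\<^sub>R v)) sequentially"
        by (rule Weierstrass_m_test[OF _ sN]) (use hN box in auto)
      show "summable (\<lambda>n. monom_at (?\<alpha> n) (x - a + 0 *\<^sub>R v) * C (?\<alpha> n))"
        using fs[of 0] d by (auto simp: sums_iff)
    qed (use der d in auto)
    then obtain g where g: "\<And>t. t \<in> {-d..d} \<Longrightarrow> (\<lambda>n. monom_at (?\<alpha> n) (x - a + t *\<^sub>R v) * C (?\<alpha> n)) sums g t"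
      "\<And>t. t \<in> {-d..d} \<Longrightarrow> (g has_field_derivative (\<Sum>n. h (?\<alpha> n) (x + t *\<^sub>R v))) (at t within {-d..d})"
      by blast
    have "(\<lambda>n. h (?\<alpha> n) x) sums G x"
      using has_sum_infsum[OF hs[of x]] box[of 0] d has_sum_reindex_bij_betw[OF bij, of "\<lambda>\<alpha>. h \<alpha> x"]
      by (auto intro!: has_sum_imp_sums simp: G_def)
    then have g0: "(g has_field_derivative G x) (at 0)"
      using g(2)[of 0] d at_within_interior[of 0 "{-d..d}"] by (simp add: sums_iff)
    have "((\<lambda>t. f (x + t *\<^sub>R v)) has_field_derivative G x) (at 0)"
    proof (rule DERIV_cong_ev[THEN iffD1, OF refl _ refl g0])
      have "\<forall>\<^sub>F t in nhds 0. t \<in> {-d<..<d}" using d by (intro eventually_nhds_in_open) auto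
      then show "\<forall>\<^sub>F t in nhds 0. g t = f (x + t *\<^sub>R v)"
        by eventually_elim (rule sums_unique2[OF g(1) fs], auto)
    qed
    moreover have "((\<lambda>t. f (x + t *\<^sub>R v)) has_derivative (\<lambda>s. frechet_derivative f (at x) (s *\<^sub>R v))) (at 0)"
      by (rule has_derivative_compose[of "\<lambda>t. x + t *\<^sub>R v" "\<lambda>s. s *\<^sub>R v" 0 UNIV f])
        (use diff in \<open>auto intro!: derivative_eq_intros simp: frechet_derivative_works[symmetric]\<close>)
    ultimately have "(\<lambda>s. frechet_derivative f (at x) (s *\<^sub>R v)) = (*) (G x)"
      unfolding has_field_derivative_def using has_derivative_unique by blast
    from fun_cong[OF this, of 1] show "frechet_derivative f (at x) v = G x" by simp
  qed
  with G show ?thesis by blast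
qed

text \<open>The norm is at most the sum of the absolute coordinates; the \<open>+ 1\<close> makes
  the inequality strict.\<close>

lemma box_at_subset_ball:
  fixes a :: "'e::euclidean_space"
  assumes "0 < r"
  shows "box_at a (r / (of_nat DIM('e) + 1)) \<subseteq> ball a r"
proof
  fix x assume x: "x \<in> box_at a (r / (of_nat DIM('e) + 1))"
  have "norm (x - a) \<le> (\<Sum>b\<in>Basis. \<bar>(x - a) \<bullet> b\<bar>)" by (rule norm_le_l1)
  also have "\<dots> \<le> (\<Sum>b\<in>(Basis :: 'e set). r / (of_nat DIM('e) + 1))"
    using x by (intro sum_mono) (auto simp: box_at_def)
  also have "\<dots> = of_nat DIM('e) * r / (of_nat DIM('e) + 1)" by simp
  also have "\<dots> < r" using assms by (simp add: field_simps)
  finally show "x \<in> ball a r" by (simp add: dist_norm norm_minus_commute)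
qed

lemma ball_subset_box_at: "ball a r \<subseteq> box_at a r"
proof
  fix x assume "x \<in> ball a r"
  then have "norm (x - a) \<le> r" by (simp add: dist_norm norm_minus_commute)
  then show "x \<in> box_at a r" unfolding box_at_def using Basis_le_norm order_trans by blast
qed

lemma power_series_at_iff_ps_bound:
  fixes f :: "'e::euclidean_space \<Rightarrow> real"
  shows "power_series_at f a \<longleftrightarrow> (\<exists>r>0. \<exists>M. ps_bound a r M f)"
proof
  assume "power_series_at f a"
  then obtain r C where r: "0 < r" and C: "\<And>x. x \<in> ball a r \<Longrightarrow>
      ((\<lambda>\<alpha>. monom_at \<alpha> (x - a) * C \<alpha>) has_sum f x) multi_indices"
    unfolding power_series_at_def monom_at_def real_scaleR_def by blast
  define s where "s = r / (of_nat DIM('e) + 1)"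
  have s: "0 < s" using r by (simp add: s_def add_nonneg_pos)
  have sub: "box_at a s \<subseteq> ball a r" unfolding s_def by (rule box_at_subset_ball[OF r])
  \<comment> \<open>This is the corner of the box, where each monomial equals its weight
    \<open>s ^ mdeg \<alpha>\<close>. Unordered convergence of a real series is absolute, so
    convergence at this one point bounds the norm.\<close>
  have "((a + s *\<^sub>R One) - a) \<bullet> b = s" if "b \<in> Basis" for b using that by simp
  then have m: "monom_at \<alpha> ((a + s *\<^sub>R One) - a) = s ^ mdeg \<alpha>" for \<alpha> :: "'e \<Rightarrow> nat"
    unfolding monom_at_def mdeg_def by (simp add: power_sum)
  have "a + s *\<^sub>R One \<in> box_at a s" unfolding box_at_def using s by simp
  then have "(\<lambda>\<alpha>. s ^ mdeg \<alpha> * C \<alpha>) summable_on multi_indices"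
    using C[of "a + s *\<^sub>R One"] sub has_sum_imp_summable unfolding m by blast
  then have "(\<lambda>\<alpha>. \<bar>C \<alpha>\<bar> * s ^ mdeg \<alpha>) summable_on multi_indices"
    using summable_on_iff_abs_summable_on_real[of "\<lambda>\<alpha>. s ^ mdeg \<alpha> * C \<alpha>" multi_indices] s
    by (simp add: abs_mult mult.commute)
  then have "ps_bound a s (infsum (\<lambda>\<alpha>. \<bar>C \<alpha>\<bar> * s ^ mdeg \<alpha>) multi_indices) f"
    unfolding ps_bound_def using C sub by blast
  with s show "\<exists>r>0. \<exists>M. ps_bound a r M f" by blast
next
  assume "\<exists>r>0. \<exists>M. ps_bound a r M f"
  then obtain r C where r: "0 < r" and C: "\<And>x. x \<in> box_at a r \<Longrightarrow>
      ((\<lambda>\<alpha>. monom_at \<alpha> (x - a) * C \<alpha>) has_sum f x) multi_indices"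
    unfolding ps_bound_def by blast
  show "power_series_at f a"
    unfolding power_series_at_def
  proof (intro exI conjI ballI)
    fix x assume "x \<in> ball a r"
    then show "((\<lambda>\<alpha>. (\<Prod>b\<in>Basis. ((x - a) \<bullet> b) ^ \<alpha> b) *\<^sub>R C \<alpha>) has_sum f x) multi_indices"
      using C ball_subset_box_at unfolding monom_at_def real_scaleR_def by blast
  qed (rule r)
qed

lemma has_sum_finite_sum:
  fixes f :: "'b \<Rightarrow> 'a \<Rightarrow> 'c::real_normed_vector"
  assumes "finite B" "\<And>b. b \<in> B \<Longrightarrow> (f b has_sum s b) A"
  shows "((\<lambda>x. \<Sum>b\<in>B. f b x) has_sum (\<Sum>b\<in>B. s b)) A"
  using assms by (induction B) (auto intro!: has_sum_add)

lemma power_series_at_componentwise: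
  fixes f :: "'e::euclidean_space \<Rightarrow> 'f::euclidean_space"
  shows "power_series_at f a \<longleftrightarrow> (\<forall>b\<in>Basis. power_series_at (\<lambda>x. f x \<bullet> b) a)"
proof
  assume "power_series_at f a"
  then obtain r C where r: "0 < r" and C: "\<And>x. x \<in> ball a r \<Longrightarrow>
      ((\<lambda>\<alpha>. (\<Prod>b\<in>Basis. ((x - a) \<bullet> b) ^ \<alpha> b) *\<^sub>R C \<alpha>) has_sum f x) multi_indices"
    unfolding power_series_at_def by blast
  show "\<forall>b\<in>Basis. power_series_at (\<lambda>x. f x \<bullet> b) a"
  proof
    fix b :: 'f
    have "((\<lambda>\<alpha>. (\<Prod>b\<in>Basis. ((x - a) \<bullet> b) ^ \<alpha> b) *\<^sub>R (C \<alpha> \<bullet> b)) has_sum f x \<bullet> b) multi_indices"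
      if "x \<in> ball a r" for x
      using has_sum_bounded_linear[OF bounded_linear_inner_left[of b] C[OF that]] by simp
    with r show "power_series_at (\<lambda>x. f x \<bullet> b) a"
      unfolding power_series_at_def by (intro exI[of _ r] conjI exI[of _ "\<lambda>\<alpha>. C \<alpha> \<bullet> b"]) auto
  qed
next
  assume "\<forall>b\<in>Basis. power_series_at (\<lambda>x. f x \<bullet> b) a"
  then have "\<forall>b\<in>Basis. \<exists>q. 0 < fst q \<and> (\<forall>x\<in>ball a (fst q).
      ((\<lambda>\<alpha>. (\<Prod>b\<in>Basis. ((x - a) \<bullet> b) ^ \<alpha> b) *\<^sub>R snd q \<alpha>) has_sum f x \<bullet> b) multi_indices)"
  proof (intro ballI)
    fix b :: 'f assume "b \<in> Basis"
    with \<open>\<forall>b\<in>Basis. power_series_at (\<lambda>x. f x \<bullet> b) a\<close> have "power_series_at (\<lambda>x. f x \<bullet> b) a" by (rule bspec)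
    then obtain r C where "0 < r" "\<forall>x\<in>ball a r.
      ((\<lambda>\<alpha>. (\<Prod>b\<in>Basis. ((x - a) \<bullet> b) ^ \<alpha> b) *\<^sub>R C \<alpha>) has_sum f x \<bullet> b) multi_indices"
      unfolding power_series_at_def by (elim exE conjE)
    then show "\<exists>q. 0 < fst q \<and> (\<forall>x\<in>ball a (fst q).
      ((\<lambda>\<alpha>. (\<Prod>b\<in>Basis. ((x - a) \<bullet> b) ^ \<alpha> b) *\<^sub>R snd q \<alpha>) has_sum f x \<bullet> b) multi_indices)"
      by (intro exI[of _ "(r, C)"]) simp
  qed
  from bchoice[OF this] obtain q where q: "\<And>b. b \<in> Basis \<Longrightarrow> 0 < fst (q b)"
    "\<And>b x. b \<in> Basis \<Longrightarrow> x \<in> ball a (fst (q b)) \<Longrightarrow>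
      ((\<lambda>\<alpha>. (\<Prod>b\<in>Basis. ((x - a) \<bullet> b) ^ \<alpha> b) *\<^sub>R snd (q b) \<alpha>) has_sum f x \<bullet> b) multi_indices" by blast
  define r where "r = Min ((\<lambda>b. fst (q b)) ` Basis)"
  have r: "0 < r" unfolding r_def by (subst Min_gr_iff) (use q in auto)
  have rle: "r \<le> fst (q b)" if "b \<in> Basis" for b unfolding r_def by (rule Min_le) (use that in auto)
  have "((\<lambda>\<alpha>. (\<Prod>b\<in>Basis. ((x - a) \<bullet> b) ^ \<alpha> b) *\<^sub>R (\<Sum>b\<in>Basis. snd (q b) \<alpha> *\<^sub>R b)) has_sum f x) multi_indices"
    if x: "x \<in> ball a r" for x
  proof -
    have "((\<lambda>\<alpha>. \<Sum>b\<in>Basis. ((\<Prod>b\<in>Basis. ((x - a) \<bullet> b) ^ \<alpha> b) *\<^sub>R snd (q b) \<alpha>) *\<^sub>R b) has_sum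
        (\<Sum>b\<in>Basis. (f x \<bullet> b) *\<^sub>R b)) multi_indices"
    proof (rule has_sum_finite_sum[OF finite_Basis])
      fix b :: 'f assume b: "b \<in> Basis"
      then have "x \<in> ball a (fst (q b))" using x rle[OF b] by auto
      from has_sum_bounded_linear[OF bounded_linear_scaleR_left[of b] q(2)[OF b this]]
      show "((\<lambda>\<alpha>. ((\<Prod>b\<in>Basis. ((x - a) \<bullet> b) ^ \<alpha> b) *\<^sub>R snd (q b) \<alpha>) *\<^sub>R b) has_sum (f x \<bullet> b) *\<^sub>R b) multi_indices" .
    qed
    then show ?thesis by (simp add: scaleR_sum_right euclidean_representation)
  qed
  with r show "power_series_at f a"
    unfolding power_series_at_def
    by (intro exI[of _ r] conjI exI[of _ "\<lambda>\<alpha>. \<Sum>b\<in>Basis. snd (q b) \<alpha> *\<^sub>R b"]) auto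
qed

text \<open>After shrinking the radius, the components of \<open>f x - f a\<close> have norm at most
  the radius of \<open>g\<close>, as \<open>ps_bound_compose\<close> demands.\<close>

lemma power_series_at_compose:
  fixes f :: "'e::euclidean_space \<Rightarrow> 'f::euclidean_space" and g :: "'f \<Rightarrow> 'g::euclidean_space"
  assumes f: "power_series_at f a" and g: "power_series_at g (f a)"
  shows "power_series_at (\<lambda>x. g (f x)) a"
proof (subst power_series_at_componentwise, intro ballI)
  fix b :: 'g assume b: "b \<in> Basis"
  then obtain s M where s: "0 < s" and M: "ps_bound (f a) s M (\<lambda>y. g y \<bullet> b)"
    using g power_series_at_componentwise power_series_at_iff_ps_bound by metis
  have "\<forall>c\<in>Basis. \<exists>r>0. ps_bound a r s (\<lambda>x. (f x - f a) \<bullet> c)"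
  proof
    fix c :: 'f assume c: "c \<in> Basis"
    then obtain r N where "0 < r" "ps_bound a r N (\<lambda>x. f x \<bullet> c)"
      using f power_series_at_componentwise power_series_at_iff_ps_bound by metis
    from ps_bound_small[OF this(2,1) s] show "\<exists>r>0. ps_bound a r s (\<lambda>x. (f x - f a) \<bullet> c)"
      by (metis (no_types, lifting) ext inner_diff_left)
  qed
  from bchoice[OF this] obtain r where r: "\<And>c. c \<in> Basis \<Longrightarrow> 0 < r c"
    "\<And>c. c \<in> Basis \<Longrightarrow> ps_bound a (r c) s (\<lambda>x. (f x - f a) \<bullet> c)" by blast
  define r0 where "r0 = Min (r ` Basis)"
  have r0: "0 < r0" unfolding r0_def by (subst Min_gr_iff) (use r in auto)
  have "r0 \<le> r c" if "c \<in> Basis" for c unfolding r0_def by (rule Min_le) (use that in auto)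
  then have "ps_bound a r0 M (\<lambda>x. g (f x) \<bullet> b)"
    using r0 by (intro ps_bound_compose[OF M] ps_bound_shrink[OF r(2)]) auto
  with r0 show "power_series_at (\<lambda>x. g (f x) \<bullet> b) a" unfolding power_series_at_iff_ps_bound by blast
qed

lemma power_series_at_cong:
  assumes f: "power_series_at f a" and S: "open S" "a \<in> S" "\<And>x. x \<in> S \<Longrightarrow> f x = g x"
  shows "power_series_at g a"
proof -
  obtain r C where r: "0 < r" and C: "\<And>x. x \<in> ball a r \<Longrightarrow>
      ((\<lambda>\<alpha>. (\<Prod>b\<in>Basis. ((x - a) \<bullet> b) ^ \<alpha> b) *\<^sub>R C \<alpha>) has_sum f x) multi_indices"
    using f unfolding power_series_at_def by blast
  obtain e where e: "0 < e" "ball a e \<subseteq> S" using S open_contains_ball by blast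
  have "((\<lambda>\<alpha>. (\<Prod>b\<in>Basis. ((x - a) \<bullet> b) ^ \<alpha> b) *\<^sub>R C \<alpha>) has_sum g x) multi_indices"
    if "x \<in> ball a (min r e)" for x
    using C[of x] S(3)[of x] e(2) that by (auto simp: subset_iff)
  moreover have "0 < min r e" using r e by simp
  ultimately show ?thesis
    unfolding power_series_at_def by (intro exI[of _ "min r e"] conjI exI[of _ C]) auto
qed

lemma power_series_at_differentiable:
  fixes f :: "'e::euclidean_space \<Rightarrow> 'f::euclidean_space"
  assumes "power_series_at f a"
  shows "f differentiable (at a)"
  unfolding differentiable_componentwise_within[of f a UNIV]
  using assms ps_bound_imp_differentiable power_series_at_componentwise power_series_at_iff_ps_bound by metis

lemma frechet_derivative_inner:
  assumes "f differentiable (at x)"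
  shows "frechet_derivative (\<lambda>y. f y \<bullet> b) (at x) v = frechet_derivative f (at x) v \<bullet> b"
proof -
  have "((\<lambda>y. f y \<bullet> b) has_derivative (\<lambda>h. frechet_derivative f (at x) h \<bullet> b)) (at x)"
    using assms by (auto intro!: has_derivative_inner_left simp: frechet_derivative_works[symmetric])
  from frechet_derivative_at[OF this] show ?thesis by metis
qed

lemma power_series_at_deriv:
  fixes f :: "'e::euclidean_space \<Rightarrow> 'f::euclidean_space"
  assumes S: "open S" "a \<in> S" and f: "\<And>x. x \<in> S \<Longrightarrow> power_series_at f x"
  shows "power_series_at (\<lambda>x. frechet_derivative f (at x) v) a"
proof (subst power_series_at_componentwise, intro ballI)
  fix b :: 'f assume b: "b \<in> Basis"
  then obtain r M where r: "0 < r" and M: "ps_bound a r M (\<lambda>x. f x \<bullet> b)"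
    using f[OF S(2)] power_series_at_componentwise power_series_at_iff_ps_bound by metis
  from ps_bound_deriv[OF M r, of v] obtain M' G where G: "ps_bound a (r/2) M' G"
    and eq: "\<And>x. \<forall>c\<in>Basis. \<bar>(x - a) \<bullet> c\<bar> < r / 2 \<Longrightarrow> frechet_derivative (\<lambda>x. f x \<bullet> b) (at x) v = G x" by blast
  have "power_series_at G a" using G r power_series_at_iff_ps_bound half_gt_zero by blast
  then show "power_series_at (\<lambda>x. frechet_derivative f (at x) v \<bullet> b) a"
  proof (rule power_series_at_cong)
    show "open (S \<inter> ball a (r/2))" "a \<in> S \<inter> ball a (r/2)" using S r by auto
    fix x assume x: "x \<in> S \<inter> ball a (r/2)"
    have "\<forall>c\<in>Basis. \<bar>(x - a) \<bullet> c\<bar> < r / 2"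
      using x Basis_le_norm[of _ "x - a"] by (force simp: dist_norm norm_minus_commute)
    from eq[OF this] show "G x = frechet_derivative f (at x) v \<bullet> b"
      using frechet_derivative_inner[of f x b v] power_series_at_differentiable[OF f, of x] x by simp
  qed
qed

lemma power_series_at_const: "power_series_at (\<lambda>x. c :: 'f::euclidean_space) a"
proof (subst power_series_at_componentwise, intro ballI)
  fix b :: 'f
  show "power_series_at (\<lambda>x. c \<bullet> b) a"
    using ps_bound_const[of a 1 "c \<bullet> b"] power_series_at_iff_ps_bound zero_less_one by blast
qed

lemma power_series_at_coord:
  fixes a :: "'e::euclidean_space"
  assumes "b \<in> Basis"
  shows "power_series_at (\<lambda>x. x \<bullet> b) a"
proof -
  have "ps_bound a 1 (1 + \<bar>a \<bullet> b\<bar>) (\<lambda>x. (x - a) \<bullet> b + a \<bullet> b)"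
    using assms by (intro ps_bound_add ps_bound_coord ps_bound_const) auto
  then have "ps_bound a 1 (1 + \<bar>a \<bullet> b\<bar>) (\<lambda>x. x \<bullet> b)" by (simp add: inner_diff_left)
  then show ?thesis using power_series_at_iff_ps_bound zero_less_one by blast
qed

lemma power_series_at_common_radius:
  fixes f g :: "'e::euclidean_space \<Rightarrow> real"
  assumes "power_series_at f a" "power_series_at g a"
  obtains r M N where "0 < r" "ps_bound a r M f" "ps_bound a r N g"
proof -
  obtain r1 M r2 N where "0 < r1" "ps_bound a r1 M f" "0 < r2" "ps_bound a r2 N g"
    using assms power_series_at_iff_ps_bound by metis
  then show thesis using that[of "min r1 r2" M N] ps_bound_shrink
    by (metis min.cobounded1 min.cobounded2 min_less_iff_conj order_less_imp_le)
qed

lemma power_series_at_add_real: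
  fixes f g :: "'e::euclidean_space \<Rightarrow> real"
  assumes "power_series_at f a" "power_series_at g a"
  shows "power_series_at (\<lambda>x. f x + g x) a"
proof -
  obtain r M N where r: "0 < r" and "ps_bound a r M f" "ps_bound a r N g"
    by (rule power_series_at_common_radius[OF assms])
  from ps_bound_add[OF this(2,3)] show ?thesis
    using r unfolding power_series_at_iff_ps_bound by (meson less_imp_le)
qed

lemma power_series_at_mult_real:
  fixes f g :: "'e::euclidean_space \<Rightarrow> real"
  assumes "power_series_at f a" "power_series_at g a"
  shows "power_series_at (\<lambda>x. f x * g x) a"
proof -
  obtain r M N where r: "0 < r" and "ps_bound a r M f" "ps_bound a r N g"
    by (rule power_series_at_common_radius[OF assms])
  from ps_bound_mult[OF this(2,3)] show ?thesis
    using r unfolding power_series_at_iff_ps_bound by (meson less_imp_le)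
qed

text \<open>The geometric series in \<open>- (x - a) / a\<close>; on the radius
  \<open>\<bar>a\<bar> / 2\<close> its ratio has norm 1/2.\<close>

lemma power_series_at_inverse_real:
  fixes a :: real
  assumes a: "a \<noteq> 0"
  shows "power_series_at inverse a"
proof -
  define r where "r = \<bar>a\<bar> / 2"
  have r: "0 < r" using a by (simp add: r_def)
  have ps: "ps_bound a r (\<bar>inverse a\<bar> * (\<bar>- inverse a\<bar> * r) ^ n) (\<lambda>x. inverse a * (- inverse a * (x - a)) ^ n)" for n
    using ps_bound_coord[of "1::real" a r] r
    by (intro ps_bound_cmult ps_bound_power) (auto simp: Basis_real_def)
  have q: "\<bar>- inverse a\<bar> * r = 1 / 2" using a by (simp add: r_def)
  have "(\<lambda>n::nat. \<bar>inverse a\<bar> * (1 / 2) ^ n) summable_on UNIV"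
    by (intro summable_on_cmult_right summable_on_UNIV_nonneg_real_iff[THEN iffD2] summable_geometric) auto
  then have "(\<lambda>n. \<bar>inverse a\<bar> * (\<bar>- inverse a\<bar> * r) ^ n) summable_on UNIV" unfolding q .
  have "ps_bound a r (infsum (\<lambda>n. \<bar>inverse a\<bar> * (\<bar>- inverse a\<bar> * r) ^ n) UNIV) inverse"
  proof (rule ps_bound_has_sum[OF ps \<open>(\<lambda>n. \<bar>inverse a\<bar> * (\<bar>- inverse a\<bar> * r) ^ n) summable_on UNIV\<close>])
    fix x assume x: "x \<in> box_at a r"
    let ?q = "- inverse a * (x - a)"
    have "\<bar>?q\<bar> \<le> \<bar>- inverse a\<bar> * r" using x by (auto simp: abs_mult box_at_def Basis_real_def intro!: mult_left_mono)
    then have q1: "norm ?q \<le> 1/2" using q by simp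
    have "(\<lambda>n. norm (inverse a * ?q ^ n)) summable_on UNIV"
    proof (rule summable_on_comparison_test[of "\<lambda>n. \<bar>inverse a\<bar> * (1 / 2) ^ n"])
      show "norm (inverse a * ?q ^ n) \<le> \<bar>inverse a\<bar> * (1 / 2) ^ n" for n
      proof -
        have "norm (inverse a * ?q ^ n) = norm (inverse a) * norm ?q ^ n" by (simp only: norm_mult norm_power)
        also have "\<dots> \<le> \<bar>inverse a\<bar> * (1 / 2) ^ n"
          using power_mono[OF q1, of n] by (simp only: real_norm_def) (intro mult_left_mono, auto)
        finally show ?thesis .
      qed
    qed (use \<open>(\<lambda>n::nat. \<bar>inverse a\<bar> * (1 / 2) ^ n) summable_on UNIV\<close> in auto)
    then have s: "(\<lambda>n. inverse a * ?q ^ n) summable_on UNIV" by (rule abs_summable_summable)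
    have "(\<lambda>n. inverse a * ?q ^ n) sums (inverse a * (1 / (1 - ?q)))"
      using q1 by (intro sums_mult geometric_sums) simp
    moreover have "inverse a * (1 / (1 - ?q)) = inverse x"
    proof -
      have "1 - ?q = x / a" using a by (simp add: field_simps)
      then show ?thesis using a by (simp add: inverse_eq_divide)
    qed
    ultimately show "((\<lambda>n. inverse a * ?q ^ n) has_sum inverse x) UNIV"
      using has_sum_infsum[OF s] has_sum_imp_sums sums_unique2 by metis
  qed (use r in auto)
  with r show ?thesis using power_series_at_iff_ps_bound by blast
qed

section \<open>Calculus of smooth and analytic maps\<close>

lemma frechet_derivative_eq:
  "(f has_derivative f') (at x) \<Longrightarrow> frechet_derivative f (at x) = f'"
  using frechet_derivative_at by metis

lemma has_derivative_frechet:
  "f differentiable (at x) \<Longrightarrow> (f has_derivative frechet_derivative f (at x)) (at x)"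
  by (simp add: frechet_derivative_works[symmetric])

lemma Ck_on_deriv: "Ck_on (Suc k) S f \<Longrightarrow> Ck_on k S (\<lambda>x. frechet_derivative f (at x) v)"
  by simp

lemma Ck_on_mono: "Ck_on (Suc k) S f \<Longrightarrow> Ck_on k S f"
proof (induction k arbitrary: f)
  case 0
  then show ?case
    by (auto intro!: continuous_at_imp_continuous_on differentiable_imp_continuous_within)
next
  case (Suc k)
  from Suc.prems Suc.IH show ?case by (simp del: Ck_on.simps(1))
qed

lemma Ck_on_subset: "Ck_on k S f \<Longrightarrow> T \<subseteq> S \<Longrightarrow> Ck_on k T f"
  by (induction k arbitrary: f) (auto intro: continuous_on_subset)

lemma Ck_on_cong:
  assumes "open S" "Ck_on k S f" "\<And>x. x \<in> S \<Longrightarrow> f x = g x"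
  shows "Ck_on k S g"
  using assms(2,3)
proof (induction k arbitrary: f g)
  case 0
  then show ?case using continuous_on_cong by force
next
  case (Suc k)
  have f: "(f has_derivative frechet_derivative f (at x)) (at x)" if "x \<in> S" for x
    using Suc.prems(1) that by (simp add: has_derivative_frechet)
  have g: "(g has_derivative frechet_derivative f (at x)) (at x)" if "x \<in> S" for x
    using has_derivative_transform_within_open[OF f[OF that] assms(1) that] Suc.prems(2) by simp
  have "Ck_on k S (\<lambda>x. frechet_derivative g (at x) v)" for v
    by (rule Suc.IH[of "\<lambda>x. frechet_derivative f (at x) v"])
      (use Suc.prems(1) frechet_derivative_eq[OF g] in auto)
  then show ?case using differentiableI[OF g] by auto
qed

lemma Ck_on_SucI:
  assumes "open S" "\<And>x. x \<in> S \<Longrightarrow> (f has_derivative f' x) (at x)" "\<And>v. Ck_on k S (\<lambda>x. f' x v)"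
  shows "Ck_on (Suc k) S f"
proof -
  have "Ck_on k S (\<lambda>x. frechet_derivative f (at x) v)" for v
    by (rule Ck_on_cong[OF assms(1) assms(3)[of v]]) (use frechet_derivative_eq[OF assms(2)] in auto)
  then show ?thesis using differentiableI[OF assms(2)] by auto
qed

lemma Ck_on_linear:
  assumes "open S" "bounded_linear L" "Ck_on k S f"
  shows "Ck_on k S (\<lambda>x. L (f x))"
  using assms(3)
proof (induction k arbitrary: f)
  case 0
  then show ?case using assms(2) bounded_linear.continuous_on by auto
next
  case (Suc k)
  show ?case
    by (rule Ck_on_SucI[OF assms(1) bounded_linear.has_derivative[OF assms(2) has_derivative_frechet]])
      (use Suc in auto)
qed

lemma Ck_on_const: "Ck_on k S (\<lambda>x. c)"
  by (induction k arbitrary: c) auto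

lemma Ck_on_bounded_linear:
  assumes "open S" "bounded_linear L"
  shows "Ck_on k S L"
proof (cases k)
  case 0
  then show ?thesis using assms(2) linear_continuous_on by auto
next
  case (Suc n)
  have "Ck_on (Suc n) S L"
    by (rule Ck_on_SucI[OF assms(1) bounded_linear_imp_has_derivative[OF assms(2)]]) (rule Ck_on_const)
  then show ?thesis using Suc by simp
qed

lemma Ck_on_add:
  assumes "open S" "Ck_on k S f" "Ck_on k S g"
  shows "Ck_on k S (\<lambda>x. f x + g x)"
  using assms(2,3)
proof (induction k arbitrary: f g)
  case 0
  then show ?case by (auto intro: continuous_on_add)
next
  case (Suc k)
  show ?case
    by (rule Ck_on_SucI[OF assms(1) has_derivative_add[OF has_derivative_frechet has_derivative_frechet]])
      (use Suc in auto)
qed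

lemma Ck_on_sum:
  assumes "open S" "finite K" "\<And>i. i \<in> K \<Longrightarrow> Ck_on k S (f i)"
  shows "Ck_on k S (\<lambda>x. \<Sum>i\<in>K. f i x)"
  using assms(2,3)
  by (induction K) (auto intro!: Ck_on_add[OF assms(1)] Ck_on_const simp del: Ck_on.simps)

lemma Ck_on_bilinear:
  assumes "open S" "bounded_bilinear B" "Ck_on k S f" "Ck_on k S g"
  shows "Ck_on k S (\<lambda>x. B (f x) (g x))"
  using assms(3,4)
proof (induction k arbitrary: f g)
  case 0
  then show ?case using bounded_bilinear.continuous_on[OF assms(2)] by auto
next
  case (Suc k)
  show ?case
  proof (rule Ck_on_SucI[OF assms(1) bounded_bilinear.FDERIV[OF assms(2) has_derivative_frechet has_derivative_frechet]])
    show "Ck_on k S (\<lambda>x. B (f x) (frechet_derivative g (at x) v) + B (frechet_derivative f (at x) v) (g x))" for v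
      by (intro Ck_on_add[OF assms(1)] Suc.IH Ck_on_mono[OF Suc.prems(1)] Ck_on_mono[OF Suc.prems(2)]
          Ck_on_deriv[OF Suc.prems(1)] Ck_on_deriv[OF Suc.prems(2)])
  qed (use Suc.prems in auto)
qed

lemma Ck_on_componentwise:
  fixes f :: "'e::euclidean_space \<Rightarrow> 'f::euclidean_space"
  assumes "open S"
  shows "Ck_on k S f \<longleftrightarrow> (\<forall>b\<in>Basis. Ck_on k S (\<lambda>x. f x \<bullet> b))"
proof
  assume "Ck_on k S f"
  then show "\<forall>b\<in>Basis. Ck_on k S (\<lambda>x. f x \<bullet> b)"
    using Ck_on_linear[OF assms bounded_linear_inner_left] by blast
next
  assume b: "\<forall>b\<in>Basis. Ck_on k S (\<lambda>x. f x \<bullet> b)"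
  have "Ck_on k S (\<lambda>x. \<Sum>b\<in>Basis. (f x \<bullet> b) *\<^sub>R b)"
    using b by (intro Ck_on_sum[OF assms] Ck_on_linear[OF assms bounded_linear_scaleR_left]) auto
  then show "Ck_on k S f" by (simp add: euclidean_representation)
qed

text \<open>The chain rule is expanded over the basis of the middle space. Its factors are
  components of derivatives of \<open>f\<close> and partial derivatives of \<open>g\<close> composed
  with \<open>f\<close>; the induction, with \<open>g\<close> arbitrary, covers the latter.\<close>

lemma Ck_on_compose:
  fixes f :: "'e::euclidean_space \<Rightarrow> 'f::euclidean_space" and g :: "'f \<Rightarrow> 'g::real_normed_vector"
  assumes "open S" "open T" "f ` S \<subseteq> T" "Ck_on k S f" "Ck_on k T g"
  shows "Ck_on k S (\<lambda>x. g (f x))"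
  using assms(4,5)
proof (induction k arbitrary: g)
  case 0
  then show ?case using assms(3) continuous_on_compose2 by (metis Ck_on.simps(1))
next
  case (Suc k)
  have fx: "f x \<in> T" if "x \<in> S" for x using that assms(3) by blast
  have d: "((\<lambda>x. g (f x)) has_derivative (\<lambda>v. frechet_derivative g (at (f x)) (frechet_derivative f (at x) v))) (at x)"
    if "x \<in> S" for x
    by (rule has_derivative_compose[OF has_derivative_frechet has_derivative_frechet])
      (use Suc.prems that fx in auto)
  have eq: "frechet_derivative g (at (f x)) (frechet_derivative f (at x) v)
      = (\<Sum>b\<in>Basis. (frechet_derivative f (at x) v \<bullet> b) *\<^sub>R frechet_derivative g (at (f x)) b)" if "x \<in> S" for x v
  proof -
    have "linear (frechet_derivative g (at (f x)))"
      using Suc.prems(2) fx[OF that] by (intro linear_frechet_derivative) auto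
    then show ?thesis
      by (subst euclidean_representation[of "frechet_derivative f (at x) v", symmetric])
        (simp add: linear_sum linear_cmul)
  qed
  have "Ck_on k S (\<lambda>x. \<Sum>b\<in>Basis. (frechet_derivative f (at x) v \<bullet> b) *\<^sub>R frechet_derivative g (at (f x)) b)" for v
    by (intro Ck_on_sum[OF assms(1)] Ck_on_bilinear[OF assms(1) bounded_bilinear_scaleR]
        Ck_on_linear[OF assms(1) bounded_linear_inner_left] finite_Basis Suc.IH Ck_on_mono[OF Suc.prems(1)]
        Ck_on_deriv[OF Suc.prems(1)] Ck_on_deriv[OF Suc.prems(2)])
  then have "Ck_on k S (\<lambda>x. frechet_derivative g (at (f x)) (frechet_derivative f (at x) v))" for v
    by (rule Ck_on_cong[OF assms(1)]) (simp add: eq)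
  with d show ?case by (rule Ck_on_SucI[OF assms(1)])
qed

lemma Ck_on_inverse:
  fixes S :: "real set"
  assumes "open S" "0 \<notin> S"
  shows "Ck_on k S inverse"
proof (induction k)
  case 0
  then show ?case using assms by (auto intro!: continuous_intros)
next
  case (Suc k)
  show ?case
  proof (rule Ck_on_SucI[OF assms(1)])
    show "(inverse has_derivative (\<lambda>h. - (inverse x * h * inverse x))) (at x)" if "x \<in> S" for x
      using that assms(2) by (intro has_derivative_inverse') auto
    have "Ck_on k S (\<lambda>x. (inverse x * inverse x) * (- v))" for v
      by (intro Ck_on_linear[OF assms(1) bounded_linear_mult_left] Ck_on_bilinear[OF assms(1) bounded_bilinear_mult] Suc)
    then show "Ck_on k S (\<lambda>x. - (inverse x * v * inverse x))" for v by (simp add: mult_ac)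
  qed
qed

section \<open>Closure properties shared by smooth and analytic maps\<close>

abbreviation reg :: "regularity \<Rightarrow> 'e set \<Rightarrow> ('e::euclidean_space \<Rightarrow> 'f::real_normed_vector) \<Rightarrow> bool" where
  "reg \<equiv> regular_on_open"

lemma reg_componentwise:
  fixes f :: "'e::euclidean_space \<Rightarrow> 'f::euclidean_space"
  assumes "open S"
  shows "reg \<rho> S f \<longleftrightarrow> (\<forall>b\<in>Basis. reg \<rho> S (\<lambda>x. f x \<bullet> b))"
  by (cases \<rho>) (use Ck_on_componentwise[OF assms, of _ f] power_series_at_componentwise[of f] in auto)

lemma reg_cong:
  assumes "open S" "reg \<rho> S f" "\<And>x. x \<in> S \<Longrightarrow> f x = g x"
  shows "reg \<rho> S g"
  using assms by (cases \<rho>) (auto intro: Ck_on_cong power_series_at_cong)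

lemma reg_subset: "reg \<rho> S f \<Longrightarrow> T \<subseteq> S \<Longrightarrow> reg \<rho> T f"
  by (cases \<rho>) (auto intro: Ck_on_subset)

lemma reg_const [simp]: "reg \<rho> S (\<lambda>x. c :: 'f::euclidean_space)"
  by (cases \<rho>) (auto intro: Ck_on_const power_series_at_const)

lemma reg_coord: "open S \<Longrightarrow> b \<in> Basis \<Longrightarrow> reg \<rho> S (\<lambda>x. x \<bullet> b)"
  by (cases \<rho>) (auto intro: Ck_on_bounded_linear bounded_linear_inner_left power_series_at_coord)

lemma reg_add_real:
  fixes f g :: "'e::euclidean_space \<Rightarrow> real"
  shows "open S \<Longrightarrow> reg \<rho> S f \<Longrightarrow> reg \<rho> S g \<Longrightarrow> reg \<rho> S (\<lambda>x. f x + g x)"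
  by (cases \<rho>) (auto intro: Ck_on_add power_series_at_add_real)

lemma reg_mult_real:
  fixes f g :: "'e::euclidean_space \<Rightarrow> real"
  shows "open S \<Longrightarrow> reg \<rho> S f \<Longrightarrow> reg \<rho> S g \<Longrightarrow> reg \<rho> S (\<lambda>x. f x * g x)"
  by (cases \<rho>) (auto intro: Ck_on_bilinear[OF _ bounded_bilinear_mult] power_series_at_mult_real)

lemma reg_compose:
  fixes f :: "'e::euclidean_space \<Rightarrow> 'f::euclidean_space" and g :: "'f \<Rightarrow> 'g::euclidean_space"
  assumes "open S" "open T" "f ` S \<subseteq> T" "reg \<rho> S f" "reg \<rho> T g"
  shows "reg \<rho> S (\<lambda>x. g (f x))"
  using assms by (cases \<rho>) (auto intro: Ck_on_compose power_series_at_compose)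

lemma reg_deriv:
  fixes f :: "'e::euclidean_space \<Rightarrow> 'f::euclidean_space"
  assumes "open S" "reg \<rho> S f"
  shows "reg \<rho> S (\<lambda>x. frechet_derivative f (at x) v)"
  using assms by (cases \<rho>) (auto intro: Ck_on_deriv power_series_at_deriv)

lemma reg_differentiable:
  fixes f :: "'e::euclidean_space \<Rightarrow> 'f::euclidean_space"
  assumes "reg \<rho> S f" "x \<in> S"
  shows "f differentiable (at x)"
proof (cases \<rho>)
  case Smooth
  then have "Ck_on (Suc 0) S f" using assms by (simp only: regular_on_open.simps)
  then show ?thesis using assms by simp
next
  case Analytic
  then show ?thesis using assms power_series_at_differentiable by auto
qed

lemma reg_has_derivative:
  fixes f :: "'e::euclidean_space \<Rightarrow> 'f::euclidean_space"
  assumes "reg \<rho> S f" "x \<in> S"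
  shows "(f has_derivative frechet_derivative f (at x)) (at x)"
  using reg_differentiable[OF assms] by (rule has_derivative_frechet)

lemma reg_inverse_real: "open S \<Longrightarrow> 0 \<notin> S \<Longrightarrow> reg \<rho> S (inverse :: real \<Rightarrow> real)"
  by (cases \<rho>) (auto intro: Ck_on_inverse power_series_at_inverse_real)

text \<open>Either class consists of differentiable maps and is stable under directional
  derivatives, which is all that \<open>Ck_on\<close> asks for.\<close>

lemma reg_imp_Smooth:
  fixes f :: "'e::euclidean_space \<Rightarrow> 'f::euclidean_space"
  assumes "open S" "reg \<rho> S f"
  shows "reg Smooth S f"
proof -
  have "Ck_on k S f" if "reg \<rho> S f" for k and f :: "'e \<Rightarrow> 'f"
    using that
  proof (induction k arbitrary: f)
    case 0
    then show ?case
      using reg_differentiable[OF 0]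
      by (auto intro!: continuous_at_imp_continuous_on differentiable_imp_continuous_within)
  next
    case (Suc k)
    then show ?case using reg_deriv[OF assms(1)] reg_differentiable by auto
  qed
  with assms show ?thesis by simp
qed

lemma reg_continuous_on:
  fixes f :: "'e::euclidean_space \<Rightarrow> 'f::euclidean_space"
  shows "reg \<rho> S f \<Longrightarrow> continuous_on S f"
  using reg_differentiable[of \<rho> S f]
  by (auto intro!: continuous_at_imp_continuous_on differentiable_imp_continuous_within)

lemma reg_local:
  fixes f :: "'e::euclidean_space \<Rightarrow> 'f::euclidean_space"
  assumes S: "open S" and f: "\<And>x. x \<in> S \<Longrightarrow> \<exists>U. open U \<and> x \<in> U \<and> reg \<rho> (U \<inter> S) f"
  shows "reg \<rho> S f"
proof (cases \<rho>)
  case Analytic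
  then show ?thesis using f by fastforce
next
  case Smooth
  have "Ck_on k S g" if "\<And>x. x \<in> S \<Longrightarrow> \<exists>U. open U \<and> x \<in> U \<and> reg Smooth (U \<inter> S) g" for k and g :: "'e \<Rightarrow> 'f"
    using that
  proof (induction k arbitrary: g)
    case 0
    have "g differentiable (at x)" if "x \<in> S" for x
      using 0[OF that] reg_differentiable[of Smooth _ g] that by blast
    then show ?case
      by (auto intro!: continuous_at_imp_continuous_on differentiable_imp_continuous_within)
  next
    case (Suc k)
    have "Ck_on k S (\<lambda>x. frechet_derivative g (at x) v)" for v
    proof (rule Suc.IH)
      fix x assume "x \<in> S"
      then obtain U where U: "open U" "x \<in> U" "reg Smooth (U \<inter> S) g" using Suc.prems by blast
      from U(1,2) reg_deriv[OF open_Int[OF U(1) S] U(3)]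
      show "\<exists>U. open U \<and> x \<in> U \<and> reg Smooth (U \<inter> S) (\<lambda>x. frechet_derivative g (at x) v)" by blast
    qed
    moreover have "g differentiable (at x)" if "x \<in> S" for x
      using Suc.prems[OF that] reg_differentiable[of Smooth _ g] that by blast
    ultimately show ?case by simp
  qed
  then show ?thesis using f Smooth by simp
qed

lemma reg_imp_regular_on: "open S \<Longrightarrow> reg \<rho> S f \<Longrightarrow> regular_on \<rho> S f"
  unfolding regular_on_def by blast

lemma regular_on_open_iff:
  fixes f :: "'e::euclidean_space \<Rightarrow> 'f::euclidean_space"
  assumes "open S"
  shows "regular_on \<rho> S f \<longleftrightarrow> reg \<rho> S f"
proof
  assume f: "regular_on \<rho> S f"
  show "reg \<rho> S f"
  proof (rule reg_local[OF assms])
    fix x assume "x \<in> S"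
    then obtain U g where U: "open U" "x \<in> U" "reg \<rho> U g" "\<forall>y\<in>U \<inter> S. g y = f y"
      using f unfolding regular_on_def by blast
    have "reg \<rho> (U \<inter> S) f"
      by (rule reg_cong[OF open_Int[OF U(1) assms] reg_subset[OF U(3)]]) (use U in auto)
    with U show "\<exists>U. open U \<and> x \<in> U \<and> reg \<rho> (U \<inter> S) f" by blast
  qed
qed (rule reg_imp_regular_on[OF assms])

lemma reg_sum_real:
  fixes f :: "'i \<Rightarrow> 'e::euclidean_space \<Rightarrow> real"
  assumes "open S" "\<And>i. i \<in> K \<Longrightarrow> reg \<rho> S (f i)"
  shows "reg \<rho> S (\<lambda>x. \<Sum>i\<in>K. f i x)"
  using assms(2) by (induction K rule: infinite_finite_induct) (auto intro: reg_add_real[OF assms(1)])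

lemma reg_linear:
  fixes f :: "'e::euclidean_space \<Rightarrow> 'f::euclidean_space" and L :: "'f \<Rightarrow> 'g::euclidean_space"
  assumes S: "open S" and L: "linear L" and f: "reg \<rho> S f"
  shows "reg \<rho> S (\<lambda>x. L (f x))"
proof (subst reg_componentwise[OF S], intro ballI)
  fix c :: 'g
  have "reg \<rho> S (\<lambda>x. \<Sum>b\<in>Basis. (f x \<bullet> b) * (L b \<bullet> c))"
    using f reg_componentwise[OF S, of \<rho> f] by (intro reg_sum_real[OF S] reg_mult_real[OF S] reg_const) auto
  moreover have "(\<Sum>b\<in>Basis. (f x \<bullet> b) * (L b \<bullet> c)) = L (f x) \<bullet> c" for x
  proof -
    have "L (f x) = L (\<Sum>b\<in>Basis. (f x \<bullet> b) *\<^sub>R b)" by (simp add: euclidean_representation)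
    then show ?thesis by (simp add: linear_sum[OF L] linear_cmul[OF L] inner_sum_left)
  qed
  ultimately show "reg \<rho> S (\<lambda>x. L (f x) \<bullet> c)" by simp
qed

lemma reg_id: "open S \<Longrightarrow> reg \<rho> S (\<lambda>x. x :: 'e::euclidean_space)"
  by (subst reg_componentwise) (auto intro: reg_coord)

lemma reg_bilinear:
  fixes f :: "'e::euclidean_space \<Rightarrow> 'f::euclidean_space" and g :: "'e \<Rightarrow> 'g::euclidean_space"
    and B :: "'f \<Rightarrow> 'g \<Rightarrow> 'h::euclidean_space"
  assumes S: "open S" and B: "bounded_bilinear B" and f: "reg \<rho> S f" and g: "reg \<rho> S g"
  shows "reg \<rho> S (\<lambda>x. B (f x) (g x))"
proof (subst reg_componentwise[OF S], intro ballI)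
  interpret B: bounded_bilinear B by (rule B)
  fix c :: 'h
  have "reg \<rho> S (\<lambda>x. \<Sum>a\<in>Basis. \<Sum>b\<in>Basis. (f x \<bullet> a) * (g x \<bullet> b) * (B a b \<bullet> c))"
    using f g reg_componentwise[OF S, of \<rho> f] reg_componentwise[OF S, of \<rho> g]
    by (intro reg_sum_real[OF S] reg_mult_real[OF S] reg_const) auto
  moreover have "(\<Sum>a\<in>Basis. \<Sum>b\<in>Basis. (f x \<bullet> a) * (g x \<bullet> b) * (B a b \<bullet> c)) = B (f x) (g x) \<bullet> c" for x
  proof -
    have "B (f x) (g x) = B (\<Sum>a\<in>Basis. (f x \<bullet> a) *\<^sub>R a) (\<Sum>b\<in>Basis. (g x \<bullet> b) *\<^sub>R b)"
      by (simp add: euclidean_representation)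
    also have "\<dots> = (\<Sum>a\<in>Basis. \<Sum>b\<in>Basis. ((f x \<bullet> a) * (g x \<bullet> b)) *\<^sub>R B a b)"
      unfolding B.sum_left by (simp add: B.sum_right B.scaleR_left B.scaleR_right scaleR_sum_right mult.commute)
    finally show ?thesis by (simp add: inner_sum_left)
  qed
  ultimately show "reg \<rho> S (\<lambda>x. B (f x) (g x) \<bullet> c)" by simp
qed

lemma reg_add:
  fixes f g :: "'e::euclidean_space \<Rightarrow> 'f::euclidean_space"
  assumes "open S" "reg \<rho> S f" "reg \<rho> S g"
  shows "reg \<rho> S (\<lambda>x. f x + g x)"
  using assms reg_componentwise[OF assms(1), of \<rho> f] reg_componentwise[OF assms(1), of \<rho> g]
  by (subst reg_componentwise) (auto simp: inner_add_left intro: reg_add_real)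

lemma reg_sum:
  fixes f :: "'i \<Rightarrow> 'e::euclidean_space \<Rightarrow> 'f::euclidean_space"
  assumes "open S" "\<And>i. i \<in> K \<Longrightarrow> reg \<rho> S (f i)"
  shows "reg \<rho> S (\<lambda>x. \<Sum>i\<in>K. f i x)"
  using assms(2) by (induction K rule: infinite_finite_induct) (auto intro: reg_add[OF assms(1)])

lemma reg_minus:
  fixes f :: "'e::euclidean_space \<Rightarrow> 'f::euclidean_space"
  shows "open S \<Longrightarrow> reg \<rho> S f \<Longrightarrow> reg \<rho> S (\<lambda>x. - f x)"
  by (rule reg_linear) (auto intro: linear_uminus)

lemma reg_diff:
  fixes f g :: "'e::euclidean_space \<Rightarrow> 'f::euclidean_space"
  shows "open S \<Longrightarrow> reg \<rho> S f \<Longrightarrow> reg \<rho> S g \<Longrightarrow> reg \<rho> S (\<lambda>x. f x - g x)"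
  using reg_add[OF _ _ reg_minus, of S \<rho> f g] by simp

lemma reg_scaleR:
  fixes f :: "'e::euclidean_space \<Rightarrow> real" and g :: "'e \<Rightarrow> 'f::euclidean_space"
  shows "open S \<Longrightarrow> reg \<rho> S f \<Longrightarrow> reg \<rho> S g \<Longrightarrow> reg \<rho> S (\<lambda>x. f x *\<^sub>R g x)"
  by (rule reg_bilinear[OF _ bounded_bilinear_scaleR])

lemma reg_mult:
  fixes f g :: "'e::euclidean_space \<Rightarrow> 'f::{euclidean_space, real_normed_algebra}"
  shows "open S \<Longrightarrow> reg \<rho> S f \<Longrightarrow> reg \<rho> S g \<Longrightarrow> reg \<rho> S (\<lambda>x. f x * g x)"
  by (rule reg_bilinear[OF _ bounded_bilinear_mult])

lemma reg_prod:
  fixes f :: "'i \<Rightarrow> 'e::euclidean_space \<Rightarrow> 'f::{euclidean_space, real_normed_field}"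
  assumes "open S" "\<And>i. i \<in> K \<Longrightarrow> reg \<rho> S (f i)"
  shows "reg \<rho> S (\<lambda>x. \<Prod>i\<in>K. f i x)"
  using assms(2) by (induction K rule: infinite_finite_induct) (auto intro: reg_mult[OF assms(1)])

lemma reg_inverse:
  fixes f :: "'e::euclidean_space \<Rightarrow> real"
  assumes "open S" "reg \<rho> S f" "\<And>x. x \<in> S \<Longrightarrow> f x \<noteq> 0"
  shows "reg \<rho> S (\<lambda>x. inverse (f x))"
  by (rule reg_compose[where g = inverse and T = "- {0}", OF assms(1) _ _ assms(2)])
    (use assms(3) in \<open>auto intro: reg_inverse_real\<close>)

lemma reg_cnj:
  fixes f :: "'e::euclidean_space \<Rightarrow> complex"
  shows "open S \<Longrightarrow> reg \<rho> S f \<Longrightarrow> reg \<rho> S (\<lambda>x. cnj (f x))"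
  by (rule reg_linear) (auto intro: bounded_linear.linear bounded_linear_cnj)

lemma reg_Re: "open S \<Longrightarrow> reg \<rho> S f \<Longrightarrow> reg \<rho> S (\<lambda>x. Re (f x))"
  by (rule reg_linear) (auto intro: bounded_linear.linear bounded_linear_Re)

lemma reg_Im: "open S \<Longrightarrow> reg \<rho> S f \<Longrightarrow> reg \<rho> S (\<lambda>x. Im (f x))"
  by (rule reg_linear) (auto intro: bounded_linear.linear bounded_linear_Im)

lemma reg_of_real: "open S \<Longrightarrow> reg \<rho> S f \<Longrightarrow> reg \<rho> S (\<lambda>x. complex_of_real (f x))"
  by (rule reg_linear) (auto intro: bounded_linear.linear bounded_linear_of_real)

text \<open>The reciprocal is the conjugate divided by the squared modulus, which reduces the claim
  to real inverses.\<close>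

lemma reg_inverse_complex:
  fixes f :: "'e::euclidean_space \<Rightarrow> complex"
  assumes "open S" "reg \<rho> S f" "\<And>x. x \<in> S \<Longrightarrow> f x \<noteq> 0"
  shows "reg \<rho> S (\<lambda>x. inverse (f x))"
proof -
  have eq: "inverse z = complex_of_real (inverse (Re z * Re z + Im z * Im z)) * cnj z" if "z \<noteq> 0" for z
    using that by (simp add: complex_eq_iff power2_eq_square divide_inverse mult.commute)
  have "reg \<rho> S (\<lambda>x. complex_of_real (inverse (Re (f x) * Re (f x) + Im (f x) * Im (f x))) * cnj (f x))"
    using assms(3) by (intro reg_mult reg_of_real reg_inverse reg_add reg_Re reg_Im reg_cnj assms)
      (simp add: complex_eq_iff sum_squares_eq_zero_iff)
  then show ?thesis by (rule reg_cong[OF assms(1)]) (simp add: eq assms(3))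
qed

lemma reg_vec_lambda:
  fixes f :: "'i::finite \<Rightarrow> 'e::euclidean_space \<Rightarrow> 'f::euclidean_space"
  assumes "open S" "\<And>i. reg \<rho> S (f i)"
  shows "reg \<rho> S (\<lambda>x. \<chi> i. f i x)"
proof -
  have "reg \<rho> S (\<lambda>x. \<Sum>i\<in>UNIV. axis i (f i x))"
    using assms by (intro reg_sum reg_linear[of S "axis _"])
      (auto intro!: linearI simp: axis_def vec_eq_iff)
  moreover have "(\<Sum>i\<in>UNIV. axis i (f i x)) = (\<chi> i. f i x)" for x
    by (simp add: vec_eq_iff axis_def sum.delta)
  ultimately show ?thesis by simp
qed

lemma reg_vec_nth:
  fixes f :: "'e::euclidean_space \<Rightarrow> 'f::euclidean_space ^ 'i"
  shows "open S \<Longrightarrow> reg \<rho> S f \<Longrightarrow> reg \<rho> S (\<lambda>x. f x $ i)"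
  by (rule reg_linear) (auto intro!: linearI)

lemma reg_Pair:
  fixes f :: "'e::euclidean_space \<Rightarrow> 'f::euclidean_space" and g :: "'e \<Rightarrow> 'g::euclidean_space"
  assumes "open S" "reg \<rho> S f" "reg \<rho> S g"
  shows "reg \<rho> S (\<lambda>x. (f x, g x))"
proof -
  have "reg \<rho> S (\<lambda>x. (f x, 0) + (0, g x))"
    using assms by (intro reg_add reg_linear[of S "\<lambda>y. (y, 0)"] reg_linear[of S "\<lambda>y. (0, y)"])
      (auto intro!: linearI)
  then show ?thesis by simp
qed

lemma reg_fst:
  fixes f :: "'e::euclidean_space \<Rightarrow> 'f::euclidean_space \<times> 'g::euclidean_space"
  shows "open S \<Longrightarrow> reg \<rho> S f \<Longrightarrow> reg \<rho> S (\<lambda>x. fst (f x))"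
  by (rule reg_linear) (auto intro: linear_fst)

lemma reg_snd:
  fixes f :: "'e::euclidean_space \<Rightarrow> 'f::euclidean_space \<times> 'g::euclidean_space"
  shows "open S \<Longrightarrow> reg \<rho> S f \<Longrightarrow> reg \<rho> S (\<lambda>x. snd (f x))"
  by (rule reg_linear) (auto intro: linear_snd)

section \<open>The prolongation argument\<close>

text \<open>Membership stands for being determined by certain data. Identities are used modulo such
  a ring, so long explicit terms never have to be carried along. Values off \<open>Dom\<close> are
  immaterial, and conjugation is included because the frames are closed under it.\<close>

locale function_ring =
  fixes Dom :: "'s set" and D :: "('s \<Rightarrow> complex) \<Rightarrow> bool"
  assumes cong: "D f \<Longrightarrow> (\<And>s. s \<in> Dom \<Longrightarrow> f s = g s) \<Longrightarrow> D g"
    and const [simp, intro]: "D (\<lambda>s. c)"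
    and add [simp, intro]: "D f \<Longrightarrow> D g \<Longrightarrow> D (\<lambda>s. f s + g s)"
    and mult [simp, intro]: "D f \<Longrightarrow> D g \<Longrightarrow> D (\<lambda>s. f s * g s)"
    and conj [simp, intro]: "D f \<Longrightarrow> D (\<lambda>s. cnj (f s))"
begin

lemma minus [simp, intro]: "D f \<Longrightarrow> D (\<lambda>s. - f s)"
  using mult[of "\<lambda>s. -1" f] by simp

lemma diff [simp, intro]: "D f \<Longrightarrow> D g \<Longrightarrow> D (\<lambda>s. f s - g s)"
  using add[of f "\<lambda>s. - g s"] by simp

lemma sum [simp, intro]: "(\<And>i. i \<in> K \<Longrightarrow> D (f i)) \<Longrightarrow> D (\<lambda>s. \<Sum>i\<in>K. f i s)"
  by (induction K rule: infinite_finite_induct) auto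

lemma zeroI: "(\<And>s. s \<in> Dom \<Longrightarrow> f s = 0) \<Longrightarrow> D f"
  using cong[OF const[of 0], of f] by simp

end

text \<open>Points of \<open>Dom\<close> are pairs of a CR-diffeomorphism and a point, \<open>\<delta> i\<close> is the derivation along the
  \<open>i\<close>-th field of a frame whose fields with index in \<open>I\<close> span \<open>H\<^sup>1\<^sup>,\<^sup>0\<close>, \<open>t\<close> is the transversal index and
  \<open>bar\<close> is complex conjugation of the frame. \<open>A\<close> is the matrix of the differential, \<open>c\<close> and
  \<open>c'\<close> are the structure functions of source and target and \<open>Ci\<close> inverts the Levi matrix of the source.
  Functions in \<open>D1\<close> and \<open>D2\<close> are expressed through the 1-jet, resp. the 1-jet and \<open>\<tau>\<close>.\<close>

locale cr_prolongation =
  Sm: function_ring Dom Sm + D1: function_ring Dom D1 + D2: function_ring Dom D2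
  for Dom :: "'s set" and Sm D1 D2 :: "('s \<Rightarrow> complex) \<Rightarrow> bool" +
  fixes I :: "'i::finite set" and t :: 'i and bar :: "'i \<Rightarrow> 'i"
    and \<delta> :: "'i \<Rightarrow> ('s \<Rightarrow> complex) \<Rightarrow> 's \<Rightarrow> complex"
    and A :: "'i \<Rightarrow> 'i \<Rightarrow> 's \<Rightarrow> complex" and ai :: "'s \<Rightarrow> complex"
    and c c' :: "'i \<Rightarrow> 'i \<Rightarrow> 'i \<Rightarrow> 's \<Rightarrow> complex" and Ci :: "'i \<Rightarrow> 'i \<Rightarrow> 's \<Rightarrow> complex"
    and \<tau> :: "'s \<Rightarrow> complex"
  assumes D12: "D1 f \<Longrightarrow> D2 f" and D2Sm: "D2 f \<Longrightarrow> Sm f"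
    and bar_bar [simp]: "bar (bar i) = i" and bar_t [simp]: "bar t = t" and t_notin: "t \<notin> I"
    and bar_I: "i \<in> I \<Longrightarrow> bar i \<notin> I" and index_cases: "i = t \<or> i \<in> I \<or> bar i \<in> I"
    and I_nonempty: "I \<noteq> {}"
    and \<delta>_Sm: "Sm f \<Longrightarrow> Sm (\<delta> i f)"
    and \<delta>_cong: "Sm f \<Longrightarrow> (\<And>s. s \<in> Dom \<Longrightarrow> f s = g s) \<Longrightarrow> s \<in> Dom \<Longrightarrow> \<delta> i f s = \<delta> i g s"
    and \<delta>_add: "Sm f \<Longrightarrow> Sm g \<Longrightarrow> s \<in> Dom \<Longrightarrow> \<delta> i (\<lambda>s. f s + g s) s = \<delta> i f s + \<delta> i g s"
    and \<delta>_mult: "Sm f \<Longrightarrow> Sm g \<Longrightarrow> s \<in> Dom \<Longrightarrow> \<delta> i (\<lambda>s. f s * g s) s = \<delta> i f s * g s + f s * \<delta> i g s"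
    and \<delta>_const: "s \<in> Dom \<Longrightarrow> \<delta> i (\<lambda>s. w) s = 0"
    and \<delta>_cnj: "Sm f \<Longrightarrow> s \<in> Dom \<Longrightarrow> \<delta> (bar i) (\<lambda>s. cnj (f s)) s = cnj (\<delta> i f s)"
    and \<delta>_commute: "Sm f \<Longrightarrow> s \<in> Dom \<Longrightarrow> \<delta> i (\<delta> j f) s - \<delta> j (\<delta> i f) s = (\<Sum>k\<in>UNIV. c i j k s * \<delta> k f s)"
    and A_D1: "D1 (A i j)" and ai_D1: "D1 ai" and c_D1: "D1 (c i j k)" and c'_D1: "D1 (c' i j k)"
    and Ci_D1: "D1 (Ci i j)"
    and \<delta>c_D1: "D1 (\<delta> l (c i j k))" and \<delta>\<delta>c_D1: "D1 (\<delta> m (\<delta> l (c i j k)))"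
    and \<delta>c'_D1: "D1 (\<delta> l (c' i j k))"
    and \<delta>\<delta>c'_D1: "(\<And>n. D1 (\<delta> m (A l n))) \<Longrightarrow> D1 (\<delta> m (\<delta> l (c' i j k)))"
    and A_cnj: "s \<in> Dom \<Longrightarrow> A (bar i) (bar j) s = cnj (A i j s)"
    and A_zero: "s \<in> Dom \<Longrightarrow> i \<in> I \<Longrightarrow> j \<notin> I \<Longrightarrow> A i j s = 0"
    and ai: "s \<in> Dom \<Longrightarrow> ai s * A t t s = 1"
    and Ci1: "s \<in> Dom \<Longrightarrow> a \<in> I \<Longrightarrow> b \<in> I \<Longrightarrow> (\<Sum>e\<in>I. c a (bar e) t s * Ci e b s) = (if a = b then 1 else 0)"
    and Ci2: "s \<in> Dom \<Longrightarrow> a \<in> I \<Longrightarrow> b \<in> I \<Longrightarrow> (\<Sum>e\<in>I. Ci a e s * c e (bar b) t s) = (if a = b then 1 else 0)"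
    and c'_skew: "s \<in> Dom \<Longrightarrow> c' i j k s = - c' j i k s"
    and bracket: "s \<in> Dom \<Longrightarrow> \<delta> i (A j k) s - \<delta> j (A i k) s =
      (\<Sum>p\<in>UNIV. c i j p s * A p k s) - (\<Sum>p\<in>UNIV. \<Sum>q\<in>UNIV. A i p s * A j q s * c' p q k s)"
    and \<tau>: "s \<in> Dom \<Longrightarrow> \<tau> s = \<delta> t (A t t) s" and \<tau>_D2: "D2 \<tau>"
    and \<delta>_D1: "(\<And>j k. D2 (\<delta> i (A j k))) \<Longrightarrow> D1 f \<Longrightarrow> D2 (\<delta> i f)"
    and \<delta>_D2: "(\<And>j k. D2 (\<delta> i (A j k))) \<Longrightarrow> D2 (\<delta> i \<tau>) \<Longrightarrow> D2 f \<Longrightarrow> D2 (\<delta> i f)"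
begin

lemma D1Sm: "D1 f \<Longrightarrow> Sm f" using D12 D2Sm by blast

lemmas base [simp, intro] = A_D1 ai_D1 c_D1 c'_D1 Ci_D1 \<delta>c_D1 \<delta>\<delta>c_D1 \<delta>c'_D1 \<tau>_D2
  D12[OF A_D1] D12[OF ai_D1] D12[OF c_D1] D12[OF c'_D1] D12[OF Ci_D1]
  D1Sm[OF A_D1] D1Sm[OF ai_D1] D1Sm[OF c_D1] D1Sm[OF c'_D1] D1Sm[OF Ci_D1] D2Sm[OF \<tau>_D2]

lemmas [simp, intro] = \<delta>_Sm

lemma \<delta>_uminus: "Sm f \<Longrightarrow> s \<in> Dom \<Longrightarrow> \<delta> i (\<lambda>s. - f s) s = - \<delta> i f s"
  using \<delta>_mult[of "\<lambda>s. -1" f s i] \<delta>_const[of s i "-1"] by simp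

lemma \<delta>_diff: "Sm f \<Longrightarrow> Sm g \<Longrightarrow> s \<in> Dom \<Longrightarrow> \<delta> i (\<lambda>s. f s - g s) s = \<delta> i f s - \<delta> i g s"
  using \<delta>_add[of f "\<lambda>s. - g s" s i] \<delta>_uminus[of g s i] by simp

lemma \<delta>_sum:
  "(\<And>k. k \<in> K \<Longrightarrow> Sm (f k)) \<Longrightarrow> s \<in> Dom \<Longrightarrow> \<delta> i (\<lambda>s. \<Sum>k\<in>K. f k s) s = (\<Sum>k\<in>K. \<delta> i (f k) s)"
  by (induction K rule: infinite_finite_induct) (auto simp: \<delta>_const \<delta>_add)

lemmas \<delta>_simps = \<delta>_const \<delta>_uminus \<delta>_diff \<delta>_sum \<delta>_mult \<delta>_add

section \<open>Vanishing pattern of \<open>A\<close> and its first derivatives along H\<close>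

lemma index_distinct: "i \<in> I \<Longrightarrow> i \<noteq> t" "i \<in> I \<Longrightarrow> bar i \<noteq> t" "bar i \<in> I \<Longrightarrow> i \<noteq> t" "bar i \<in> I \<Longrightarrow> i \<notin> I"
  using t_notin bar_I bar_bar bar_t by metis+

lemma A_zero': "s \<in> Dom \<Longrightarrow> bar i \<in> I \<Longrightarrow> bar j \<notin> I \<Longrightarrow> A i j s = 0"
  using A_cnj[of s "bar i" "bar j"] A_zero[of s "bar i" "bar j"] by simp

lemma A_zero_t: "s \<in> Dom \<Longrightarrow> i \<noteq> t \<Longrightarrow> A i t s = 0"
  using A_zero A_zero' index_cases t_notin bar_t by metis

lemma \<delta>A_vanish:
  assumes "\<And>s. s \<in> Dom \<Longrightarrow> A i j s = 0" "s \<in> Dom"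
  shows "\<delta> k (A i j) s = 0"
  using \<delta>_cong[of "\<lambda>s. 0" "A i j" s k] assms by (simp add: \<delta>_const)

lemma \<delta>A_zero: "s \<in> Dom \<Longrightarrow> i \<in> I \<Longrightarrow> j \<notin> I \<Longrightarrow> \<delta> k (A i j) s = 0"
  by (rule \<delta>A_vanish) (auto simp: A_zero)

lemma \<delta>A_zero': "s \<in> Dom \<Longrightarrow> bar i \<in> I \<Longrightarrow> bar j \<notin> I \<Longrightarrow> \<delta> k (A i j) s = 0"
  by (rule \<delta>A_vanish) (auto simp: A_zero')

lemma \<delta>A_zero_t: "s \<in> Dom \<Longrightarrow> i \<noteq> t \<Longrightarrow> \<delta> k (A i t) s = 0"
  by (rule \<delta>A_vanish) (auto simp: A_zero_t)

lemma \<delta>A_cnj: "s \<in> Dom \<Longrightarrow> \<delta> (bar k) (A (bar i) (bar j)) s = cnj (\<delta> k (A i j) s)"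
  using \<delta>_cong[of "\<lambda>s. cnj (A i j s)" "A (bar i) (bar j)" s "bar k"] \<delta>_cnj[of "A i j" s k]
  by (simp add: A_cnj Sm.conj)

lemma D1_\<delta>A_bar: "D1 (\<delta> k (A i j)) \<Longrightarrow> D1 (\<delta> (bar k) (A (bar i) (bar j)))"
  by (rule D1.cong[OF D1.conj]) (auto simp: \<delta>A_cnj)

lemma D2_\<delta>A_bar: "D2 (\<delta> k (A i j)) \<Longrightarrow> D2 (\<delta> (bar k) (A (bar i) (bar j)))"
  by (rule D2.cong[OF D2.conj]) (auto simp: \<delta>A_cnj)

text \<open>The known side of the bracket relation: \<open>\<delta> i (A j k)\<close> and
  \<open>\<delta> j (A i k)\<close> differ by \<open>R i j k\<close>, which is a function of the
  1-jet.\<close>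

definition R :: "'i \<Rightarrow> 'i \<Rightarrow> 'i \<Rightarrow> 's \<Rightarrow> complex" where
  "R i j k s = (\<Sum>p\<in>UNIV. c i j p s * A p k s) - (\<Sum>p\<in>UNIV. \<Sum>q\<in>UNIV. A i p s * A j q s * c' p q k s)"

lemma R_D1 [simp, intro]: "D1 (R i j k)"
  unfolding R_def[abs_def] by simp

lemma R_Sm [simp, intro]: "Sm (R i j k)" by (rule D1Sm) simp

lemma bracket': "s \<in> Dom \<Longrightarrow> \<delta> i (A j k) s = \<delta> j (A i k) s + R i j k s"
  using bracket[of s i j k] by (simp add: R_def algebra_simps)

lemma \<delta>R: "s \<in> Dom \<Longrightarrow> \<delta> l (R i j k) s =
    (\<Sum>p\<in>UNIV. \<delta> l (c i j p) s * A p k s + c i j p s * \<delta> l (A p k) s) -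
    (\<Sum>p\<in>UNIV. \<Sum>q\<in>UNIV. (\<delta> l (A i p) s * A j q s + A i p s * \<delta> l (A j q) s) * c' p q k s
        + A i p s * A j q s * \<delta> l (c' p q k) s)"
  unfolding R_def[abs_def] by (simp add: \<delta>_simps)

text \<open>The entry \<open>A i k\<close> vanishes identically, so of the two derivatives in the
  bracket relation only one is left, whatever \<open>j\<close> is.\<close>

lemma \<delta>A_mixed: "s \<in> Dom \<Longrightarrow> i \<in> I \<Longrightarrow> bar k \<in> I \<Longrightarrow> \<delta> i (A j k) s = R i j k s"
  using bracket'[of s i j k] \<delta>A_zero[of s i k j] index_distinct by auto

lemma \<delta>A_mixed': "s \<in> Dom \<Longrightarrow> bar i \<in> I \<Longrightarrow> k \<in> I \<Longrightarrow> \<delta> i (A j k) s = R i j k s"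
  using bracket'[of s i j k] \<delta>A_zero'[of s i k j] bar_I by auto

lemma D1_\<delta>A_mixed: "i \<in> I \<Longrightarrow> bar k \<in> I \<Longrightarrow> D1 (\<delta> i (A j k))"
  by (rule D1.cong[OF R_D1[of i j k]]) (simp add: \<delta>A_mixed)

lemma D1_\<delta>A_mixed': "bar i \<in> I \<Longrightarrow> k \<in> I \<Longrightarrow> D1 (\<delta> i (A j k))"
  by (rule D1.cong[OF R_D1[of i j k]]) (simp add: \<delta>A_mixed')

text \<open>Again \<open>A i t\<close> vanishes identically, now because \<open>E i\<close> lies in
  the complexification of H.\<close>

lemma \<delta>A_t: "s \<in> Dom \<Longrightarrow> i \<noteq> t \<Longrightarrow> \<delta> i (A j t) s = R i j t s"
  using bracket'[of s i j t] \<delta>A_zero_t[of s i j] by auto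

lemma D1_\<delta>A_t: "i \<noteq> t \<Longrightarrow> D1 (\<delta> i (A j t))"
  by (rule D1.cong[OF R_D1[of i j t]]) (simp add: \<delta>A_t)

text \<open>The transversal component of the bracket relation for \<open>H\<^sup>1\<^sup>,\<^sup>0\<close> and its conjugate is the
  invariance of the Levi form.\<close>

lemma levi0: "s \<in> Dom \<Longrightarrow> i \<noteq> t \<Longrightarrow> j \<noteq> t \<Longrightarrow> R i j t s = 0"
  using bracket'[of s i j t] \<delta>A_zero_t[of s i j] \<delta>A_zero_t[of s j i] by auto

text \<open>The Levi form of the target with a conjugate field of the source already pushed forward
  into its second slot. Unknown derivatives of \<open>A\<close> occur contracted with
  \<open>Z\<close>, and \<open>Y\<close> below is its inverse on \<open>I\<close>.\<close>

definition Z :: "'i \<Rightarrow> 'i \<Rightarrow> 's \<Rightarrow> complex" where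
  "Z p b s = (\<Sum>q\<in>UNIV. A (bar b) q s * c' p q t s)"

definition Y :: "'i \<Rightarrow> 'i \<Rightarrow> 's \<Rightarrow> complex" where
  "Y b p s = ai s * (\<Sum>a\<in>I. Ci b a s * A a p s)"

definition L :: "'i \<Rightarrow> 'i \<Rightarrow> 's \<Rightarrow> complex" where "L a b = c a (bar b) t"

lemma ZYL_D1 [simp, intro]: "D1 (Z p b)" "D1 (Y b p)" "D1 (L a b)"
  unfolding Z_def[abs_def] Y_def[abs_def] L_def by auto

lemma ZYL_D2 [simp, intro]: "D2 (Z p b)" "D2 (Y b p)" "D2 (L a b)"
  by (auto intro: D12)

lemma sum_I:
  assumes "\<And>p. p \<notin> I \<Longrightarrow> f p = (0::complex)"
  shows "(\<Sum>p\<in>UNIV. f p) = (\<Sum>p\<in>I. f p)"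
  using assms by (intro sum.mono_neutral_right) auto

text \<open>The transversal component of the bracket of \<open>E a\<close> with
  \<open>E (bar b)\<close>: since \<open>A p t\<close> vanishes for \<open>p \<noteq> t\<close>,
  only the Levi matrix survives on the source side.\<close>

lemma levi:
  assumes s: "s \<in> Dom" and ab: "a \<in> I" "b \<in> I"
  shows "(\<Sum>p\<in>I. A a p s * Z p b s) = A t t s * L a b s"
proof -
  have "(\<Sum>p\<in>UNIV. c a (bar b) p s * A p t s) = c a (bar b) t s * A t t s"
    using A_zero_t[OF s] by (intro trans[OF sum.mono_neutral_right[of UNIV "{t}"]]) auto
  moreover have "(\<Sum>p\<in>UNIV. \<Sum>q\<in>UNIV. A a p s * A (bar b) q s * c' p q t s) = (\<Sum>p\<in>I. A a p s * Z p b s)"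
    using A_zero[OF s ab(1)] by (subst sum_I) (auto simp: Z_def sum_distrib_left mult.assoc)
  ultimately show ?thesis
    using levi0[OF s, of a "bar b"] ab index_distinct by (simp add: R_def L_def mult.commute)
qed

lemma LCi: "s \<in> Dom \<Longrightarrow> a \<in> I \<Longrightarrow> b \<in> I \<Longrightarrow> (\<Sum>g\<in>I. L a g s * Ci g b s) = (if a = b then 1 else 0)"
  "s \<in> Dom \<Longrightarrow> a \<in> I \<Longrightarrow> b \<in> I \<Longrightarrow> (\<Sum>g\<in>I. Ci a g s * L g b s) = (if a = b then 1 else 0)"
  using Ci1 Ci2 by (auto simp: L_def)

lemma LY:
  assumes s: "s \<in> Dom" and a: "a \<in> I"
  shows "(\<Sum>b\<in>I. L a b s * Y b e s) = ai s * A a e s"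
proof -
  have "(\<Sum>b\<in>I. L a b s * Y b e s) = ai s * (\<Sum>b\<in>I. \<Sum>g\<in>I. L a b s * Ci b g s * A g e s)"
    by (simp add: Y_def sum_distrib_left mult_ac)
  also have "(\<Sum>b\<in>I. \<Sum>g\<in>I. L a b s * Ci b g s * A g e s) = (\<Sum>g\<in>I. (\<Sum>b\<in>I. L a b s * Ci b g s) * A g e s)"
    by (subst sum.swap) (simp add: sum_distrib_right)
  also have "\<dots> = (\<Sum>g\<in>I. if a = g then A g e s else 0)"
    by (intro sum.cong) (auto simp: LCi s a)
  finally show ?thesis using a by simp
qed

text \<open>Padding by the identity outside \<open>I\<close> turns the blocks into square matrices,
  for which a right inverse is also a left inverse.\<close>

lemma left_inverse_right_inverse:
  fixes F G :: "'i \<Rightarrow> 'i \<Rightarrow> complex"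
  assumes "\<And>a b. a \<in> I \<Longrightarrow> b \<in> I \<Longrightarrow> (\<Sum>g\<in>I. F a g * G g b) = (if a = b then 1 else 0)"
    and ab: "a \<in> I" "b \<in> I"
  shows "(\<Sum>g\<in>I. G a g * F g b) = (if a = b then 1 else 0)"
proof -
  define M :: "complex^'i^'i" where "M = (\<chi> a b. if a \<in> I \<and> b \<in> I then F a b else if a = b then 1 else 0)"
  define N :: "complex^'i^'i" where "N = (\<chi> a b. if a \<in> I \<and> b \<in> I then G a b else if a = b then 1 else 0)"
  have *: "(\<Sum>k\<in>UNIV. (if i \<in> I \<and> k \<in> I then f i k else if i = k then 1 else 0) *
      (if k \<in> I \<and> j \<in> I then g k j else if k = j then 1 else 0)) =
      (if i \<in> I \<and> j \<in> I then (\<Sum>k\<in>I. f i k * g k j) else if i = j then 1 else (0::complex))" for i j f g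
  proof (cases "i \<in> I")
    case True
    then have "(\<Sum>k\<in>UNIV. (if i \<in> I \<and> k \<in> I then f i k else if i = k then 1 else 0) *
      (if k \<in> I \<and> j \<in> I then g k j else if k = j then 1 else 0)) =
      (\<Sum>k\<in>I. f i k * (if j \<in> I then g k j else if k = j then 1 else 0))"
      by (subst sum_I) (auto intro!: sum.cong)
    then show ?thesis using True by (auto intro!: sum.neutral)
  next
    case False
    then have "(\<Sum>k\<in>UNIV. (if i \<in> I \<and> k \<in> I then f i k else if i = k then 1 else 0) *
      (if k \<in> I \<and> j \<in> I then g k j else if k = j then 1 else 0)) =
      (\<Sum>k\<in>UNIV. if i = k then (if k = j then 1 else 0) else 0)"
      by (intro sum.cong) auto
    then show ?thesis using False by (simp add: sum.delta)
  qed
  have "M ** N = mat 1"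
    unfolding M_def N_def matrix_matrix_mult_def by (simp add: vec_eq_iff * mat_def assms(1))
  then have "N ** M = mat 1" using matrix_left_right_inverse by blast
  then have "(N ** M) $ a $ b = (if a = b then 1 else 0)" by (simp add: mat_def)
  then show ?thesis using ab
    unfolding M_def N_def matrix_matrix_mult_def by (simp add: *)
qed

text \<open>By the invariance of the Levi form \<open>Y\<close> is a left inverse of
  \<open>Z\<close>, hence a right inverse. The inverse of \<open>Z\<close> is thus built from
  \<open>Ci\<close>, \<open>ai\<close> and \<open>A\<close>, all functions of the 1-jet.\<close>

lemma ZY:
  assumes s: "s \<in> Dom" and p: "p \<in> I" and e: "e \<in> I"
  shows "(\<Sum>b\<in>I. Z p b s * Y b e s) = (if p = e then 1 else 0)"
proof (rule left_inverse_right_inverse[OF _ p e])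
  fix b d assume bd: "b \<in> I" "d \<in> I"
  have "(\<Sum>g\<in>I. Y b g s * Z g d s) = ai s * (\<Sum>g\<in>I. \<Sum>a\<in>I. Ci b a s * (A a g s * Z g d s))"
    by (simp add: Y_def sum_distrib_left sum_distrib_right mult_ac)
  also have "(\<Sum>g\<in>I. \<Sum>a\<in>I. Ci b a s * (A a g s * Z g d s)) = (\<Sum>a\<in>I. Ci b a s * (\<Sum>g\<in>I. A a g s * Z g d s))"
    by (subst sum.swap) (simp add: sum_distrib_left)
  also have "\<dots> = (\<Sum>a\<in>I. Ci b a s * (A t t s * L a d s))"
    by (intro sum.cong refl) (simp add: levi s bd)
  also have "\<dots> = A t t s * (\<Sum>a\<in>I. Ci b a s * L a d s)"
    by (simp add: sum_distrib_left mult_ac)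
  also have "ai s * \<dots> = (\<Sum>a\<in>I. Ci b a s * L a d s)" using ai[OF s] by (simp add: mult.assoc[symmetric])
  finally show "(\<Sum>g\<in>I. Y b g s * Z g d s) = (if b = d then 1 else 0)" by (simp add: LCi s bd)
qed

lemma ZY_solve:
  assumes s: "s \<in> Dom" and e: "e \<in> I"
  shows "(\<Sum>b\<in>I. (\<Sum>p\<in>I. f p * Z p b s) * Y b e s) = f e"
proof -
  have "(\<Sum>b\<in>I. (\<Sum>p\<in>I. f p * Z p b s) * Y b e s) = (\<Sum>p\<in>I. f p * (\<Sum>b\<in>I. Z p b s * Y b e s))"
    by (simp add: sum_distrib_right sum_distrib_left mult.assoc) (rule sum.swap)
  also have "\<dots> = (\<Sum>p\<in>I. if p = e then f p else 0)"
    by (intro sum.cong refl) (simp add: ZY s e)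
  finally show ?thesis using e by simp
qed

text \<open>The invariance of the Levi form is differentiated along \<open>E d\<close>. Derivatives
  of the conjugate block are mixed, hence known, and so are those of the column \<open>t\<close>;
  what remains is \<open>\<delta> d (A a p)\<close> contracted with \<open>Z\<close>, which
  \<open>Y\<close> inverts.\<close>

lemma D1_\<delta>A_pure:
  assumes d: "d \<in> I" and a: "a \<in> I" and e: "e \<in> I"
  shows "D1 (\<delta> d (A a e))"
proof -
  have D: "D1 (\<lambda>s. \<Sum>p\<in>I. \<delta> d (A a p) s * Z p b s)" if b: "b \<in> I" for b
  proof (rule D1.cong)
    have 1: "D1 (\<delta> d (A (bar b) q))" for q
    proof (cases "bar q \<in> I")
      case True
      then show ?thesis using d by (intro D1_\<delta>A_mixed)
    next
      case False
      then show ?thesis using b by (intro D1.zeroI) (simp add: \<delta>A_zero')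
    qed
    have 2: "D1 (\<delta> d (A p t))" for p using index_distinct(1)[OF d] by (rule D1_\<delta>A_t)
    show "D1 (\<lambda>s. (\<Sum>p\<in>UNIV. \<delta> d (c a (bar b) p) s * A p t s + c a (bar b) p s * \<delta> d (A p t) s)
      - (\<Sum>p\<in>UNIV. \<Sum>q\<in>UNIV. A a p s * \<delta> d (A (bar b) q) s * c' p q t s
        + A a p s * A (bar b) q s * \<delta> d (c' p q t) s))"
      by (intro D1.diff D1.sum D1.add D1.mult base 1 2)
    fix s assume s: "s \<in> Dom"
    have "\<delta> d (R a (bar b) t) s = 0"
      using \<delta>_cong[of "\<lambda>s. 0" "R a (bar b) t" s d] levi0[of _ a "bar b"] a b index_distinct s
      by (simp add: \<delta>_const)
    moreover have "(\<Sum>p\<in>UNIV. \<Sum>q\<in>UNIV. \<delta> d (A a p) s * A (bar b) q s * c' p q t s)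
        = (\<Sum>p\<in>I. \<delta> d (A a p) s * Z p b s)"
      using \<delta>A_zero[OF s a] by (subst sum_I) (auto simp: Z_def sum_distrib_left mult.assoc)
    ultimately show "(\<Sum>p\<in>UNIV. \<delta> d (c a (bar b) p) s * A p t s + c a (bar b) p s * \<delta> d (A p t) s)
      - (\<Sum>p\<in>UNIV. \<Sum>q\<in>UNIV. A a p s * \<delta> d (A (bar b) q) s * c' p q t s
        + A a p s * A (bar b) q s * \<delta> d (c' p q t) s) = (\<Sum>p\<in>I. \<delta> d (A a p) s * Z p b s)"
      using s by (simp add: \<delta>R distrib_right sum.distrib algebra_simps)
  qed
  have "D1 (\<lambda>s. \<Sum>b\<in>I. (\<Sum>p\<in>I. \<delta> d (A a p) s * Z p b s) * Y b e s)"
    by (intro D1.sum D1.mult[OF D ZYL_D1(2)])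
  then show ?thesis by (rule D1.cong) (simp add: ZY_solve e)
qed

lemma D1_\<delta>A:
  assumes i: "i \<noteq> t" and j: "j \<noteq> t"
  shows "D1 (\<delta> i (A j k))"
proof -
  have main: "D1 (\<delta> i (A j k))" if i: "i \<noteq> t" and j: "j \<in> I" for i j k
  proof (cases "k \<in> I")
    case False
    then show ?thesis using j by (intro D1.zeroI) (simp add: \<delta>A_zero)
  next
    case True
    then show ?thesis using index_cases[of i] i j D1_\<delta>A_pure D1_\<delta>A_mixed' by blast
  qed
  show ?thesis
  proof (cases "j \<in> I")
    case True
    then show ?thesis using main i by blast
  next
    case False
    then have "bar j \<in> I" using index_cases j by blast
    moreover have "bar i \<noteq> t" using i bar_bar bar_t by metis
    ultimately have "D1 (\<delta> (bar i) (A (bar j) (bar k)))" using main by blast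
    from D1_\<delta>A_bar[OF this] show ?thesis by simp
  qed
qed

section \<open>Transversal derivatives and second derivatives modulo the 1-jet\<close>

definition v :: "'i \<Rightarrow> 'i \<Rightarrow> 's \<Rightarrow> complex" where
  "v a b s = (\<Sum>p\<in>I. \<delta> t (A a p) s * Z p b s)"

text \<open>\<open>v\<close> and \<open>w\<close> are the two contributions of the Leibniz rule when
  the invariance of the Levi form is differentiated along \<open>E t\<close>: from the block on
  \<open>I\<close> and from its conjugate.\<close>

definition w :: "'i \<Rightarrow> 'i \<Rightarrow> 's \<Rightarrow> complex" where
  "w a b s = (\<Sum>p\<in>UNIV. \<Sum>q\<in>UNIV. A a p s * \<delta> t (A (bar b) q) s * c' p q t s)"

lemma D1_\<delta>A_t_left: "i \<noteq> t \<Longrightarrow> k \<noteq> t \<Longrightarrow> D1 (\<lambda>s. \<delta> i (A t k) s - \<delta> t (A i k) s)"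
  by (rule D1.cong[OF R_D1[of i t k]]) (use bracket'[of _ i t k] in simp)

text \<open>Differentiating the invariance of the Levi form along \<open>E t\<close> leaves
  \<open>v\<close> and \<open>w\<close> on the target side and the derivative \<open>\<tau>\<close>
  of \<open>A t t\<close> on the source side as the only terms beyond the 1-jet.\<close>

lemma D1_levi_t:
  assumes a: "a \<in> I" and b: "b \<in> I"
  shows "D1 (\<lambda>s. v a b s + w a b s - \<tau> s * L a b s)"
proof (rule D1.cong)
  show "D1 (\<lambda>s. (\<Sum>p\<in>UNIV. \<delta> t (c a (bar b) p) s * A p t s)
     - (\<Sum>p\<in>UNIV. \<Sum>q\<in>UNIV. A a p s * A (bar b) q s * \<delta> t (c' p q t) s))"
    by (intro D1.diff D1.sum D1.mult base)
  fix s assume s: "s \<in> Dom"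
  have "\<delta> t (R a (bar b) t) s = 0"
    using \<delta>_cong[of "\<lambda>s. 0" "R a (bar b) t" s t] levi0[of _ a "bar b"] a b index_distinct s
    by (simp add: \<delta>_const)
  moreover have "(\<Sum>p\<in>UNIV. \<Sum>q\<in>UNIV. \<delta> t (A a p) s * A (bar b) q s * c' p q t s) = v a b s"
    using \<delta>A_zero[OF s a] by (subst sum_I) (auto simp: Z_def v_def sum_distrib_left mult.assoc)
  moreover have "(\<Sum>p\<in>UNIV. c a (bar b) p s * \<delta> t (A p t) s) = \<tau> s * L a b s"
    using \<delta>A_zero_t[OF s] \<tau>[OF s]
    by (intro trans[OF sum.mono_neutral_right[of UNIV "{t}"]]) (auto simp: L_def)
  ultimately show "(\<Sum>p\<in>UNIV. \<delta> t (c a (bar b) p) s * A p t s)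
     - (\<Sum>p\<in>UNIV. \<Sum>q\<in>UNIV. A a p s * A (bar b) q s * \<delta> t (c' p q t) s) = v a b s + w a b s - \<tau> s * L a b s"
    using s by (simp add: \<delta>R distrib_right sum.distrib w_def algebra_simps)
qed

lemma \<delta>\<delta>_cong:
  assumes "\<And>s. s \<in> Dom \<Longrightarrow> \<delta> i f s = g s" "Sm f" "s \<in> Dom"
  shows "\<delta> j (\<delta> i f) s = \<delta> j g s"
  using \<delta>_cong[OF \<delta>_Sm[OF assms(2)] assms(1)] assms(3) by blast

text \<open>\<open>\<delta> (bar b) (A d e)\<close> equals \<open>- R d (bar b) e\<close>, in which
  \<open>L d b * A t e\<close> is the one term whose derivative along \<open>E a\<close> is unknown;
  the bracket relation trades \<open>\<delta> a (A t e)\<close> for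
  \<open>\<delta> t (A a e)\<close>.\<close>

lemma D1_\<delta>\<delta>A_1:
  assumes a: "a \<in> I" and b: "b \<in> I" and d: "d \<in> I" and e: "e \<in> I"
  shows "D1 (\<lambda>s. \<delta> a (\<delta> (bar b) (A d e)) s + L d b s * \<delta> t (A a e) s)"
proof (rule D1.cong)
  have at: "a \<noteq> t" "bar b \<noteq> t" "d \<noteq> t" "e \<noteq> t" using a b d e index_distinct by auto
  have 1: "D1 (\<delta> a (A p e))" if "p \<noteq> t" for p using that at by (intro D1_\<delta>A)
  show "D1 (\<lambda>s. (\<Sum>p\<in>UNIV. \<Sum>q\<in>UNIV. (\<delta> a (A d p) s * A (bar b) q s + A d p s * \<delta> a (A (bar b) q) s) * c' p q e s
      + A d p s * A (bar b) q s * \<delta> a (c' p q e) s)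
     - (\<Sum>p\<in>UNIV. \<delta> a (c d (bar b) p) s * A p e s) - (\<Sum>p\<in>UNIV - {t}. c d (bar b) p s * \<delta> a (A p e) s)
     - L d b s * (\<delta> a (A t e) s - \<delta> t (A a e) s))"
    by (intro D1_\<delta>A_t_left D1.diff D1.add D1.sum D1.mult base ZYL_D1 1 D1_\<delta>A at) auto
  fix s assume s: "s \<in> Dom"
  have eq: "\<delta> (bar b) (A d e) s = - R d (bar b) e s" if "s \<in> Dom" for s
    using bracket'[of s d "bar b" e] that \<delta>A_zero'[of s "bar b" e d] b e bar_I by (simp add: eq_neg_iff_add_eq_0)
  have "\<delta> a (\<delta> (bar b) (A d e)) s = - \<delta> a (R d (bar b) e) s"
    using \<delta>\<delta>_cong[OF eq] s by (simp add: \<delta>_uminus)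
  moreover have "(\<Sum>p\<in>UNIV. c d (bar b) p s * \<delta> a (A p e) s)
      = L d b s * \<delta> a (A t e) s + (\<Sum>p\<in>UNIV - {t}. c d (bar b) p s * \<delta> a (A p e) s)"
    by (subst sum.remove[of _ t]) (auto simp: L_def)
  ultimately show "(\<Sum>p\<in>UNIV. \<Sum>q\<in>UNIV. (\<delta> a (A d p) s * A (bar b) q s + A d p s * \<delta> a (A (bar b) q) s) * c' p q e s
      + A d p s * A (bar b) q s * \<delta> a (c' p q e) s)
     - (\<Sum>p\<in>UNIV. \<delta> a (c d (bar b) p) s * A p e s) - (\<Sum>p\<in>UNIV - {t}. c d (bar b) p s * \<delta> a (A p e) s)
     - L d b s * (\<delta> a (A t e) s - \<delta> t (A a e) s) = \<delta> a (\<delta> (bar b) (A d e)) s + L d b s * \<delta> t (A a e) s"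
    using s by (simp only: \<delta>R sum.distrib) (simp add: algebra_simps)
qed

text \<open>The conjugate block behaves alike: \<open>L a g\<close> multiplies \<open>A t q\<close>,
  whose derivative along \<open>E (bar b)\<close> is traded for that of \<open>A (bar b) q\<close>
  along \<open>E t\<close>.\<close>

lemma D1_\<delta>\<delta>A_bar:
  assumes a: "a \<in> I" and b: "b \<in> I" and g: "g \<in> I"
  shows "D1 (\<lambda>s. \<delta> (bar b) (\<delta> a (A (bar g) q)) s - L a g s * \<delta> t (A (bar b) q) s)"
proof (cases "bar q \<in> I")
  case False
  have "\<delta> (bar b) (\<delta> a (A (bar g) q)) s = 0" if s: "s \<in> Dom" for s
    using \<delta>\<delta>_cong[of a "A (bar g) q" "\<lambda>s. 0" s "bar b"] \<delta>A_zero' False g s by (simp add: \<delta>_const)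
  then show ?thesis using False b by (intro D1.zeroI) (simp add: \<delta>A_zero')
next
  case q: True
  have at: "a \<noteq> t" "bar b \<noteq> t" "bar g \<noteq> t" "q \<noteq> t" using a b g q index_distinct by auto
  have 1: "D1 (\<delta> (bar b) (A p q))" if "p \<noteq> t" for p using that at by (intro D1_\<delta>A)
  show ?thesis
  proof (rule D1.cong)
    show "D1 (\<lambda>s. (\<Sum>p\<in>UNIV. \<delta> (bar b) (c a (bar g) p) s * A p q s)
       + (\<Sum>p\<in>UNIV - {t}. c a (bar g) p s * \<delta> (bar b) (A p q) s)
       + L a g s * (\<delta> (bar b) (A t q) s - \<delta> t (A (bar b) q) s)
       - (\<Sum>p\<in>UNIV. \<Sum>r\<in>UNIV. (\<delta> (bar b) (A a p) s * A (bar g) r s + A a p s * \<delta> (bar b) (A (bar g) r) s) * c' p r q s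
      + A a p s * A (bar g) r s * \<delta> (bar b) (c' p r q) s))"
      by (intro D1_\<delta>A_t_left D1.diff D1.add D1.sum D1.mult base ZYL_D1 1 D1_\<delta>A at) auto
    fix s assume s: "s \<in> Dom"
    have eq: "\<delta> a (A (bar g) q) s = R a (bar g) q s" if "s \<in> Dom" for s
      by (rule \<delta>A_mixed[OF that a q])
    have "\<delta> (bar b) (\<delta> a (A (bar g) q)) s = \<delta> (bar b) (R a (bar g) q) s"
      using \<delta>\<delta>_cong[OF eq] s by simp
    moreover have "(\<Sum>p\<in>UNIV. c a (bar g) p s * \<delta> (bar b) (A p q) s)
      = L a g s * \<delta> (bar b) (A t q) s + (\<Sum>p\<in>UNIV - {t}. c a (bar g) p s * \<delta> (bar b) (A p q) s)"
      by (subst sum.remove[of _ t]) (auto simp: L_def)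
    ultimately show "(\<Sum>p\<in>UNIV. \<delta> (bar b) (c a (bar g) p) s * A p q s)
       + (\<Sum>p\<in>UNIV - {t}. c a (bar g) p s * \<delta> (bar b) (A p q) s)
       + L a g s * (\<delta> (bar b) (A t q) s - \<delta> t (A (bar b) q) s)
       - (\<Sum>p\<in>UNIV. \<Sum>r\<in>UNIV. (\<delta> (bar b) (A a p) s * A (bar g) r s + A a p s * \<delta> (bar b) (A (bar g) r) s) * c' p r q s
      + A a p s * A (bar g) r s * \<delta> (bar b) (c' p r q) s)
      = \<delta> (bar b) (\<delta> a (A (bar g) q)) s - L a g s * \<delta> t (A (bar b) q) s"
      using s by (simp only: \<delta>R sum.distrib) (simp add: algebra_simps)
  qed
qed

text \<open>Here the unknown terms come from the quadratic part of \<open>R a t t\<close>: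
  differentiating \<open>A t q\<close> along \<open>E (bar b)\<close> produces
  \<open>\<delta> t (A (bar b) q)\<close>, and these terms add up to \<open>w a b\<close>.\<close>

lemma D1_\<delta>\<delta>A_tt:
  assumes a: "a \<in> I" and b: "b \<in> I"
  shows "D1 (\<lambda>s. \<delta> (bar b) (\<delta> a (A t t)) s + w a b s)"
proof (rule D1.cong)
  have at: "a \<noteq> t" "bar b \<noteq> t" using a b index_distinct by auto
  \<comment> \<open>If \<open>q\<close> is not a conjugate index, the first derivative is known by
    itself and the second one vanishes.\<close>
  have 1: "D1 (\<lambda>s. \<delta> (bar b) (A t q) s - \<delta> t (A (bar b) q) s)" for q
  proof (cases "bar q \<in> I")
    case True
    then show ?thesis using at index_distinct by (intro D1_\<delta>A_t_left) auto
  next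
    case False
    then have "D1 (\<delta> (bar b) (A t q))"
      using index_cases[of q] D1_\<delta>A_t[OF at(2)] D1_\<delta>A_mixed'[of "bar b" q t] b by auto
    moreover have "D1 (\<delta> t (A (bar b) q))" using False b by (intro D1.zeroI) (simp add: \<delta>A_zero')
    ultimately show ?thesis by auto
  qed
  have 2: "D1 (\<delta> (bar b) (A p t))" for p by (rule D1_\<delta>A_t[OF at(2)])
  show "D1 (\<lambda>s. (\<Sum>p\<in>UNIV. \<delta> (bar b) (c a t p) s * A p t s + c a t p s * \<delta> (bar b) (A p t) s)
     - (\<Sum>p\<in>UNIV. \<Sum>q\<in>UNIV. \<delta> (bar b) (A a p) s * A t q s * c' p q t s
         + A a p s * (\<delta> (bar b) (A t q) s - \<delta> t (A (bar b) q) s) * c' p q t s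
         + A a p s * A t q s * \<delta> (bar b) (c' p q t) s))"
    by (intro D1.diff[OF D1.sum D1.sum] D1.sum D1.add D1.mult base 1 2 D1_\<delta>A at)
  fix s assume s: "s \<in> Dom"
  have eq: "\<delta> a (A t t) s = R a t t s" if "s \<in> Dom" for s by (rule \<delta>A_t[OF that at(1)])
  have "\<delta> (bar b) (\<delta> a (A t t)) s = \<delta> (bar b) (R a t t) s"
    using \<delta>\<delta>_cong[OF eq] s by simp
  then show "(\<Sum>p\<in>UNIV. \<delta> (bar b) (c a t p) s * A p t s + c a t p s * \<delta> (bar b) (A p t) s)
     - (\<Sum>p\<in>UNIV. \<Sum>q\<in>UNIV. \<delta> (bar b) (A a p) s * A t q s * c' p q t s
         + A a p s * (\<delta> (bar b) (A t q) s - \<delta> t (A (bar b) q) s) * c' p q t s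
         + A a p s * A t q s * \<delta> (bar b) (c' p q t) s)
     = \<delta> (bar b) (\<delta> a (A t t)) s + w a b s"
    using s by (simp add: \<delta>R w_def algebra_simps sum.distrib sum_subtractf)
qed

lemma \<delta>\<delta>R:
  assumes s: "s \<in> Dom"
  shows "\<delta> m (\<delta> l (R i j k)) s =
    (\<Sum>p\<in>UNIV. \<delta> m (\<delta> l (c i j p)) s * A p k s + \<delta> l (c i j p) s * \<delta> m (A p k) s
       + (\<delta> m (c i j p) s * \<delta> l (A p k) s + c i j p s * \<delta> m (\<delta> l (A p k)) s)) -
    (\<Sum>p\<in>UNIV. \<Sum>q\<in>UNIV.
        (\<delta> m (\<delta> l (A i p)) s * A j q s + \<delta> l (A i p) s * \<delta> m (A j q) s
          + (\<delta> m (A i p) s * \<delta> l (A j q) s + A i p s * \<delta> m (\<delta> l (A j q)) s)) * c' p q k s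
        + (\<delta> l (A i p) s * A j q s + A i p s * \<delta> l (A j q) s) * \<delta> m (c' p q k) s
        + ((\<delta> m (A i p) s * A j q s + A i p s * \<delta> m (A j q) s) * \<delta> l (c' p q k) s
          + A i p s * A j q s * \<delta> m (\<delta> l (c' p q k)) s))"
proof -
  have [simp]: "Sm (\<delta> l (c' p q k))" "Sm (\<delta> l (c i j p))" for p q by (auto intro: D1Sm)
  show ?thesis
    using \<delta>\<delta>_cong[OF \<delta>R R_Sm s, of m l i j k] s by (simp add: \<delta>_simps)
qed

text \<open>The invariance of the Levi form is differentiated twice, along \<open>E a\<close> and
  \<open>E (bar b)\<close>. The two terms with \<open>w\<close> come from the second derivatives of
  the conjugate block and of \<open>A t t\<close>, respectively.\<close>

lemma D1_\<delta>\<delta>levi: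
  assumes a: "a \<in> I" and b: "b \<in> I" and d: "d \<in> I" and g: "g \<in> I"
  shows "D1 (\<lambda>s. (\<Sum>p\<in>I. \<delta> (bar b) (\<delta> a (A d p)) s * Z p g s) + L a g s * w d b s + L d g s * w a b s)"
proof (rule D1.cong)
  have at: "a \<noteq> t" "bar b \<noteq> t" "d \<noteq> t" "bar g \<noteq> t" "g \<noteq> t" using a b d g index_distinct by auto
  \<comment> \<open>By the chain rule, two derivations of \<open>c'\<close> bring in derivatives of
    \<open>A a n\<close> along \<open>E (bar b)\<close>, which are already known.\<close>
  have 1: "D1 (\<delta> (bar b) (\<delta> a (c' p q t)))" for p q
    using at by (intro \<delta>\<delta>c'_D1 D1_\<delta>A)
  have 2: "D1 (\<delta> (bar b) (\<delta> a (A p t)))" if "p \<noteq> t" for p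
    using \<delta>\<delta>_cong[of a "A p t" "\<lambda>s. 0" _ "bar b"] \<delta>A_zero_t that by (intro D1.zeroI) (simp add: \<delta>_const)
  have 3: "D1 (\<delta> (bar b) (A p t))" "D1 (\<delta> a (A p t))" for p using at D1_\<delta>A_t by auto
  have 4: "D1 (\<lambda>s. \<delta> (bar b) (\<delta> a (A (bar g) q)) s - L a g s * \<delta> t (A (bar b) q) s)" for q
    by (rule D1_\<delta>\<delta>A_bar[OF a b g])
  have 5: "D1 (\<lambda>s. \<delta> (bar b) (\<delta> a (A t t)) s + w a b s)" by (rule D1_\<delta>\<delta>A_tt[OF a b])
  show "D1 (\<lambda>s. (\<Sum>p\<in>UNIV. \<delta> (bar b) (\<delta> a (c d (bar g) p)) s * A p t s + \<delta> a (c d (bar g) p) s * \<delta> (bar b) (A p t) s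
       + \<delta> (bar b) (c d (bar g) p) s * \<delta> a (A p t) s)
     + (\<Sum>p\<in>UNIV - {t}. c d (bar g) p s * \<delta> (bar b) (\<delta> a (A p t)) s)
     + L d g s * (\<delta> (bar b) (\<delta> a (A t t)) s + w a b s)
     - (\<Sum>p\<in>UNIV. \<Sum>q\<in>UNIV.
        \<delta> a (A d p) s * \<delta> (bar b) (A (bar g) q) s * c' p q t s
        + \<delta> (bar b) (A d p) s * \<delta> a (A (bar g) q) s * c' p q t s
        + A d p s * (\<delta> (bar b) (\<delta> a (A (bar g) q)) s - L a g s * \<delta> t (A (bar b) q) s) * c' p q t s
        + (\<delta> a (A d p) s * A (bar g) q s + A d p s * \<delta> a (A (bar g) q) s) * \<delta> (bar b) (c' p q t) s
        + ((\<delta> (bar b) (A d p) s * A (bar g) q s + A d p s * \<delta> (bar b) (A (bar g) q) s) * \<delta> a (c' p q t) s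
          + A d p s * A (bar g) q s * \<delta> (bar b) (\<delta> a (c' p q t)) s)))"
    by (intro D1.diff[OF D1.add D1.sum] D1.sum D1.add[OF D1.sum D1.sum] D1.mult[OF _ 5] D1.mult[OF D1.mult[OF _ 4]]
        D1.add D1.mult base ZYL_D1 1 2 3 D1_\<delta>A at) auto
  fix s assume s: "s \<in> Dom"
  have "\<delta> a (R d (bar g) t) s = 0" if "s \<in> Dom" for s
    using \<delta>_cong[of "\<lambda>s. 0" "R d (bar g) t" s a] levi0[of _ d "bar g"] at that
    by (simp add: \<delta>_const)
  then have "\<delta> (bar b) (\<delta> a (R d (bar g) t)) s = 0"
    using \<delta>\<delta>_cong[of a "R d (bar g) t" "\<lambda>s. 0" s "bar b"] s by (simp add: \<delta>_const)
  moreover have "(\<Sum>p\<in>UNIV. \<Sum>q\<in>UNIV. \<delta> (bar b) (\<delta> a (A d p)) s * A (bar g) q s * c' p q t s)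
      = (\<Sum>p\<in>I. \<delta> (bar b) (\<delta> a (A d p)) s * Z p g s)"
    using \<delta>\<delta>_cong[of a "A d _" "\<lambda>s. 0" s "bar b"] \<delta>A_zero d s
    by (subst sum_I) (auto simp: Z_def sum_distrib_left mult.assoc \<delta>_const)
  moreover have "(\<Sum>p\<in>UNIV. c d (bar g) p s * \<delta> (bar b) (\<delta> a (A p t)) s)
     = L d g s * \<delta> (bar b) (\<delta> a (A t t)) s + (\<Sum>p\<in>UNIV - {t}. c d (bar g) p s * \<delta> (bar b) (\<delta> a (A p t)) s)"
    by (subst sum.remove[of _ t]) (auto simp: L_def)
  moreover have "L a g s * w d b s = (\<Sum>p\<in>UNIV. \<Sum>q\<in>UNIV. A d p s * (L a g s * \<delta> t (A (bar b) q) s) * c' p q t s)"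
    by (simp add: w_def sum_distrib_left mult_ac)
  ultimately show "(\<Sum>p\<in>UNIV. \<delta> (bar b) (\<delta> a (c d (bar g) p)) s * A p t s + \<delta> a (c d (bar g) p) s * \<delta> (bar b) (A p t) s
       + \<delta> (bar b) (c d (bar g) p) s * \<delta> a (A p t) s)
     + (\<Sum>p\<in>UNIV - {t}. c d (bar g) p s * \<delta> (bar b) (\<delta> a (A p t)) s)
     + L d g s * (\<delta> (bar b) (\<delta> a (A t t)) s + w a b s)
     - (\<Sum>p\<in>UNIV. \<Sum>q\<in>UNIV.
        \<delta> a (A d p) s * \<delta> (bar b) (A (bar g) q) s * c' p q t s
        + \<delta> (bar b) (A d p) s * \<delta> a (A (bar g) q) s * c' p q t s
        + A d p s * (\<delta> (bar b) (\<delta> a (A (bar g) q)) s - L a g s * \<delta> t (A (bar b) q) s) * c' p q t s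
        + (\<delta> a (A d p) s * A (bar g) q s + A d p s * \<delta> a (A (bar g) q) s) * \<delta> (bar b) (c' p q t) s
        + ((\<delta> (bar b) (A d p) s * A (bar g) q s + A d p s * \<delta> (bar b) (A (bar g) q) s) * \<delta> a (c' p q t) s
          + A d p s * A (bar g) q s * \<delta> (bar b) (\<delta> a (c' p q t)) s))
     = (\<Sum>p\<in>I. \<delta> (bar b) (\<delta> a (A d p)) s * Z p g s) + L a g s * w d b s + L d g s * w a b s"
    using \<delta>\<delta>R[OF s, of "bar b" a d "bar g" t]
    by (simp add: algebra_simps sum.distrib sum_subtractf)
qed

end

section \<open>Solving for the transversal derivatives by traces\<close>

context cr_prolongation begin

lemma c'_diag: "s \<in> Dom \<Longrightarrow> c' i i k s = 0"
  using c'_skew[of s i i k] by simp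

lemma contract:
  assumes s: "s \<in> Dom"
  shows "d \<in> I \<Longrightarrow> (\<Sum>a\<in>I. \<Sum>b\<in>I. Ci b a s * (L d b s * f a)) = f d"
    "g \<in> I \<Longrightarrow> (\<Sum>a\<in>I. \<Sum>b\<in>I. Ci b a s * (L a g s * f b)) = f g"
    "(\<Sum>a\<in>I. \<Sum>b\<in>I. Ci b a s * L a b s) = of_nat (card I)"
proof -
  assume d: "d \<in> I"
  have "(\<Sum>a\<in>I. \<Sum>b\<in>I. Ci b a s * (L d b s * f a)) = (\<Sum>a\<in>I. (\<Sum>b\<in>I. L d b s * Ci b a s) * f a)"
    by (simp add: sum_distrib_left sum_distrib_right mult_ac)
  also have "\<dots> = (\<Sum>a\<in>I. if d = a then f a else 0)" by (intro sum.cong) (auto simp: LCi s d)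
  finally show "(\<Sum>a\<in>I. \<Sum>b\<in>I. Ci b a s * (L d b s * f a)) = f d" using d by simp
next
  assume g: "g \<in> I"
  have "(\<Sum>a\<in>I. \<Sum>b\<in>I. Ci b a s * (L a g s * f b)) = (\<Sum>b\<in>I. (\<Sum>a\<in>I. Ci b a s * L a g s) * f b)"
    by (subst sum.swap) (simp add: sum_distrib_left sum_distrib_right mult_ac)
  also have "\<dots> = (\<Sum>b\<in>I. if b = g then f b else 0)" by (intro sum.cong) (auto simp: LCi s g)
  finally show "(\<Sum>a\<in>I. \<Sum>b\<in>I. Ci b a s * (L a g s * f b)) = f g" using g by simp
next
  have "(\<Sum>a\<in>I. \<Sum>b\<in>I. Ci b a s * L a b s) = (\<Sum>a\<in>I. 1)"
    by (intro sum.cong refl) (use LCi(1)[OF s] in \<open>simp add: mult.commute\<close>)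
  then show "(\<Sum>a\<in>I. \<Sum>b\<in>I. Ci b a s * L a b s) = of_nat (card I)" by simp
qed

text \<open>Commuting \<open>\<delta> a\<close> with \<open>\<delta> (bar b)\<close> on \<open>A d e\<close> determines the symmetrized product of the Levi form
  with \<open>v - \<tau> L / 2\<close>.\<close>

lemma D1_commutator:
  assumes a: "a \<in> I" and b: "b \<in> I" and d: "d \<in> I" and g: "g \<in> I"
  shows "D1 (\<lambda>s. L a b s * v d g s + L d b s * v a g s + L a g s * v d b s + L d g s * v a b s
      - \<tau> s * (L a g s * L d b s + L d g s * L a b s))"
proof (rule D1.cong)
  \<comment> \<open>In the commutator the second derivatives are known up to terms with
    \<open>v\<close> and \<open>w\<close>. The last two summands are the relations along
    \<open>E t\<close>, added in order to eliminate \<open>w\<close>.\<close>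
  show "D1 (\<lambda>s. (\<Sum>e\<in>I. (\<delta> a (\<delta> (bar b) (A d e)) s + L d b s * \<delta> t (A a e) s) * Z e g s)
     - ((\<Sum>p\<in>I. \<delta> (bar b) (\<delta> a (A d p)) s * Z p g s) + L a g s * w d b s + L d g s * w a b s)
     - (\<Sum>e\<in>I. (\<Sum>k\<in>UNIV - {t}. c a (bar b) k s * \<delta> k (A d e) s) * Z e g s)
     + L a g s * (v d b s + w d b s - \<tau> s * L d b s) + L d g s * (v a b s + w a b s - \<tau> s * L a b s))"
    by (intro D1_\<delta>\<delta>A_1 D1_\<delta>\<delta>levi D1_levi_t D1.diff[OF D1.diff] D1.add[OF D1.add] D1.sum
      D1.mult[OF _ ZYL_D1(1)] D1.mult[OF ZYL_D1(3)] D1.mult[OF c_D1] D1_\<delta>A a b d g)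
      (use d index_distinct in auto)
  fix s assume s: "s \<in> Dom"
  have "\<delta> a (\<delta> (bar b) (A d e)) s - \<delta> (bar b) (\<delta> a (A d e)) s
     = L a b s * \<delta> t (A d e) s + (\<Sum>k\<in>UNIV - {t}. c a (bar b) k s * \<delta> k (A d e) s)" for e
    using \<delta>_commute[of "A d e" s a "bar b"] s by (subst (asm) sum.remove[of UNIV t]) (auto simp: L_def)
  then have *: "(\<Sum>k\<in>UNIV - {t}. c a (bar b) k s * \<delta> k (A d e) s)
     = \<delta> a (\<delta> (bar b) (A d e)) s - \<delta> (bar b) (\<delta> a (A d e)) s - L a b s * \<delta> t (A d e) s" for e
    by (simp add: algebra_simps)
  show "(\<Sum>e\<in>I. (\<delta> a (\<delta> (bar b) (A d e)) s + L d b s * \<delta> t (A a e) s) * Z e g s)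
     - ((\<Sum>p\<in>I. \<delta> (bar b) (\<delta> a (A d p)) s * Z p g s) + L a g s * w d b s + L d g s * w a b s)
     - (\<Sum>e\<in>I. (\<Sum>k\<in>UNIV - {t}. c a (bar b) k s * \<delta> k (A d e) s) * Z e g s)
     + L a g s * (v d b s + w d b s - \<tau> s * L d b s) + L d g s * (v a b s + w a b s - \<tau> s * L a b s)
    = L a b s * v d g s + L d b s * v a g s + L a g s * v d b s + L d g s * v a b s
      - \<tau> s * (L a g s * L d b s + L d g s * L a b s)"
    unfolding * by (simp add: v_def algebra_simps sum.distrib sum_subtractf sum_distrib_left)
qed

definition M :: complex where "M = of_nat (card I)"

definition tr :: "'s \<Rightarrow> complex" where "tr s = (\<Sum>a\<in>I. \<Sum>b\<in>I. Ci b a s * v a b s)"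

lemma M_nonzero: "M + 1 \<noteq> 0" "M + 2 \<noteq> 0" "M \<noteq> 0"
proof -
  have "M + 1 = of_nat (card I + 1)" "M + 2 = of_nat (card I + 2)" by (simp_all add: M_def)
  then show "M + 1 \<noteq> 0" "M + 2 \<noteq> 0" by (simp_all only: of_nat_eq_0_iff)
  show "M \<noteq> 0" using I_nonempty by (simp add: M_def card_eq_0_iff)
qed

text \<open>Trace over \<open>a\<close> and \<open>b\<close> with the inverse Levi matrix. Of the
  four terms with \<open>v\<close> one gives \<open>M * v d g\<close>, two give \<open>v d g\<close>
  and one gives the trace of \<open>v\<close>; the two products of Levi matrices give
  \<open>1 + M\<close>.\<close>

lemma D1_trace1:
  assumes d: "d \<in> I" and g: "g \<in> I"
  shows "D1 (\<lambda>s. (M + 2) * v d g s + tr s * L d g s - (M + 1) * (\<tau> s * L d g s))"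
proof (rule D1.cong)
  show "D1 (\<lambda>s. \<Sum>a\<in>I. \<Sum>b\<in>I. Ci b a s * (L a b s * v d g s + L d b s * v a g s + L a g s * v d b s + L d g s * v a b s
      - \<tau> s * (L a g s * L d b s + L d g s * L a b s)))"
    by (intro D1.sum D1.mult[OF Ci_D1] D1_commutator d g)
  fix s assume s: "s \<in> Dom"
  have "(\<Sum>a\<in>I. \<Sum>b\<in>I. Ci b a s * (L a b s * v d g s + L d b s * v a g s + L a g s * v d b s + L d g s * v a b s
      - \<tau> s * (L a g s * L d b s + L d g s * L a b s)))
    = (\<Sum>a\<in>I. \<Sum>b\<in>I. Ci b a s * L a b s) * v d g s + (\<Sum>a\<in>I. \<Sum>b\<in>I. Ci b a s * (L d b s * v a g s))
      + (\<Sum>a\<in>I. \<Sum>b\<in>I. Ci b a s * (L a g s * v d b s)) + L d g s * tr s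
      - \<tau> s * ((\<Sum>a\<in>I. \<Sum>b\<in>I. Ci b a s * (L a g s * L d b s)) + L d g s * (\<Sum>a\<in>I. \<Sum>b\<in>I. Ci b a s * L a b s))"
    by (simp add: tr_def algebra_simps sum.distrib sum_subtractf sum_distrib_left)
  also have "\<dots> = (M + 2) * v d g s + tr s * L d g s - (M + 1) * (\<tau> s * L d g s)"
    using contract(1)[OF s d, of "\<lambda>a. v a g s"] contract(2)[OF s g, of "\<lambda>b. v d b s"]
      contract(2)[OF s g, of "\<lambda>b. L d b s"] contract(3)[OF s]
    by (simp add: M_def algebra_simps)
  finally show "(\<Sum>a\<in>I. \<Sum>b\<in>I. Ci b a s * (L a b s * v d g s + L d b s * v a g s + L a g s * v d b s + L d g s * v a b s
      - \<tau> s * (L a g s * L d b s + L d g s * L a b s)))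
     = (M + 2) * v d g s + tr s * L d g s - (M + 1) * (\<tau> s * L d g s)" .
qed

text \<open>A second trace leaves \<open>2 * (M + 1) * tr s\<close> against
  \<open>M * (M + 1) * \<tau> s\<close>, whence the factor \<open>M / 2\<close>.\<close>

lemma D1_trace2: "D1 (\<lambda>s. tr s - M / 2 * \<tau> s)"
proof (rule D1.cong)
  show "D1 (\<lambda>s. (1 / (2 * (M + 1))) * (\<Sum>d\<in>I. \<Sum>g\<in>I. Ci g d s *
      ((M + 2) * v d g s + tr s * L d g s - (M + 1) * (\<tau> s * L d g s))))"
    by (intro D1.mult[OF D1.const] D1.sum D1.mult[OF Ci_D1] D1_trace1)
  fix s assume s: "s \<in> Dom"
  have "(\<Sum>d\<in>I. \<Sum>g\<in>I. Ci g d s * ((M + 2) * v d g s + tr s * L d g s - (M + 1) * (\<tau> s * L d g s)))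
     = (M + 2) * tr s + tr s * (\<Sum>d\<in>I. \<Sum>g\<in>I. Ci g d s * L d g s) - (M + 1) * (\<tau> s * (\<Sum>d\<in>I. \<Sum>g\<in>I. Ci g d s * L d g s))"
  proof -
    have "(\<Sum>d\<in>I. \<Sum>g\<in>I. Ci g d s * ((M + 2) * v d g s)) = (M + 2) * tr s"
      by (simp add: tr_def sum_distrib_left mult_ac)
    then show ?thesis
      by (simp only: right_diff_distrib distrib_left sum.distrib sum_subtractf)
        (simp add: sum_distrib_left mult_ac)
  qed
  also have "\<dots> = 2 * (M + 1) * (tr s - M / 2 * \<tau> s)"
    using contract(3)[OF s] by (simp add: M_def algebra_simps)
  finally have *: "(\<Sum>d\<in>I. \<Sum>g\<in>I. Ci g d s * ((M + 2) * v d g s + tr s * L d g s - (M + 1) * (\<tau> s * L d g s)))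
     = 2 * (M + 1) * (tr s - M / 2 * \<tau> s)" .
  have n: "2 * (M + 1) \<noteq> 0" using M_nonzero(1) by (metis mult_eq_0_iff zero_neq_numeral)
  show "(1 / (2 * (M + 1))) * (\<Sum>d\<in>I. \<Sum>g\<in>I. Ci g d s *
      ((M + 2) * v d g s + tr s * L d g s - (M + 1) * (\<tau> s * L d g s))) = tr s - M / 2 * \<tau> s"
    unfolding * times_divide_eq_left mult_1_left by (rule nonzero_mult_div_cancel_left[OF n])
qed

text \<open>Once the trace is substituted, the coefficient of \<open>\<tau>\<close> is
  \<open>M + 1 - M / 2\<close>, half of \<open>M + 2\<close>.\<close>

lemma D1_v:
  assumes d: "d \<in> I" and g: "g \<in> I"
  shows "D1 (\<lambda>s. v d g s - \<tau> s / 2 * L d g s)"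
proof (rule D1.cong)
  show "D1 (\<lambda>s. (1 / (M + 2)) * (((M + 2) * v d g s + tr s * L d g s - (M + 1) * (\<tau> s * L d g s))
      - (tr s - M / 2 * \<tau> s) * L d g s))"
    by (intro D1.mult[OF D1.const] D1.diff[OF D1_trace1 D1.mult[OF D1_trace2]] d g ZYL_D1)
  fix s
  have "((M + 2) * v d g s + tr s * L d g s - (M + 1) * (\<tau> s * L d g s)) - (tr s - M / 2 * \<tau> s) * L d g s
    = (M + 2) * (v d g s - \<tau> s / 2 * L d g s)" by (simp add: algebra_simps)
  then show "(1 / (M + 2)) * (((M + 2) * v d g s + tr s * L d g s - (M + 1) * (\<tau> s * L d g s))
      - (tr s - M / 2 * \<tau> s) * L d g s) = v d g s - \<tau> s / 2 * L d g s"
    using M_nonzero by simp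
qed

text \<open>Contraction with \<open>Y\<close> frees the derivative of \<open>A\<close>. The factor
  1/2 reflects that the Levi form is quadratic: modulo the 1-jet, the block on \<open>I\<close>
  changes along \<open>E t\<close> like a square root of \<open>A t t\<close>.\<close>

lemma D1_\<delta>t:
  assumes a: "a \<in> I" and e: "e \<in> I"
  shows "D1 (\<lambda>s. \<delta> t (A a e) s - \<tau> s / 2 * (ai s * A a e s))"
proof (rule D1.cong)
  show "D1 (\<lambda>s. \<Sum>b\<in>I. (v a b s - \<tau> s / 2 * L a b s) * Y b e s)"
    by (intro D1.sum D1.mult[OF D1_v ZYL_D1(2)] a)
  fix s assume s: "s \<in> Dom"
  have "(\<Sum>b\<in>I. (v a b s - k * L a b s) * Y b e s)
    = (\<Sum>b\<in>I. v a b s * Y b e s) - k * (\<Sum>b\<in>I. L a b s * Y b e s)" for k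
    by (simp add: algebra_simps sum_subtractf sum_distrib_left)
  from this[of "\<tau> s / 2"] show "(\<Sum>b\<in>I. (v a b s - \<tau> s / 2 * L a b s) * Y b e s) = \<delta> t (A a e) s - \<tau> s / 2 * (ai s * A a e s)"
    unfolding v_def by (simp add: ZY_solve[OF s e] LY[OF s a])
qed

lemma D2_half_\<tau> [simp, intro]: "D2 (\<lambda>s. \<tau> s / 2)"
  using D2.mult[OF \<tau>_D2 D2.const[of "1/2"]] by simp

lemma D2_\<delta>t_A:
  assumes "j \<noteq> t" shows "D2 (\<delta> t (A j k))"
proof -
  have main: "D2 (\<delta> t (A j k))" if j: "j \<in> I" for j k
  proof (cases "k \<in> I")
    case False
    then show ?thesis using j by (intro D2.zeroI) (simp add: \<delta>A_zero)
  next
    case True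
    have "D2 (\<lambda>s. (\<delta> t (A j k) s - \<tau> s / 2 * (ai s * A j k s)) + \<tau> s / 2 * (ai s * A j k s))"
      by (intro D2.add[OF D12[OF D1_\<delta>t]] D2.mult base D2_half_\<tau> j True)
    then show ?thesis by simp
  qed
  show ?thesis
  proof (cases "j \<in> I")
    case True
    then show ?thesis using main by blast
  next
    case False
    then have "bar j \<in> I" using index_cases assms by blast
    from D2_\<delta>A_bar[OF main[OF this, of "bar k"]] show ?thesis by simp
  qed
qed

lemma D2_\<delta>A:
  assumes i: "i \<noteq> t" shows "D2 (\<delta> i (A j k))"
proof (cases "j = t")
  case False
  then show ?thesis using i by (intro D12 D1_\<delta>A)
next
  case j: True
  show ?thesis
  proof (cases "k = t")
    case True
    then show ?thesis using i D12[OF D1_\<delta>A_t] by blast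
  next
    case False
    have "D2 (\<lambda>s. (\<delta> i (A t k) s - \<delta> t (A i k) s) + \<delta> t (A i k) s)"
      by (intro D2.add[OF D12[OF D1_\<delta>A_t_left]] D2_\<delta>t_A i False)
    then show ?thesis using j by simp
  qed
qed

lemma D2_\<delta>_D1: "i \<noteq> t \<Longrightarrow> D1 f \<Longrightarrow> D2 (\<delta> i f)"
  by (rule \<delta>_D1[OF D2_\<delta>A])

lemma \<tau>_cnj: "s \<in> Dom \<Longrightarrow> cnj (\<tau> s) = \<tau> s"
  using \<delta>A_cnj[of s t t t] \<tau> by simp

lemma \<delta>\<tau>_bar: "s \<in> Dom \<Longrightarrow> \<delta> (bar i) \<tau> s = cnj (\<delta> i \<tau> s)"
  using \<delta>_cong[of "\<lambda>s. cnj (\<tau> s)" \<tau> s "bar i"] \<delta>_cnj[of \<tau> s i]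
  by (simp add: \<tau>_cnj Sm.conj)

text \<open>The commutator of \<open>E a\<close> and \<open>E (bar b)\<close> on
  \<open>A t e\<close>. One order of derivation stays known; in the other,
  \<open>\<delta> a (A t e)\<close> contains \<open>\<tau>\<close>, whose derivative thus appears
  next to the term \<open>\<delta> t (A t e)\<close> that the commutator contributes.\<close>

lemma D2_mixed:
  assumes a: "a \<in> I" and b: "b \<in> I" and e: "e \<in> I"
  shows "D2 (\<lambda>s. L a b s * \<delta> t (A t e) s + \<delta> (bar b) \<tau> s / 2 * (ai s * A a e s))"
proof (rule D2.cong)
  have at: "a \<noteq> t" "bar b \<noteq> t" "e \<noteq> t" using a b e index_distinct by auto
  \<comment> \<open>The part of \<open>\<delta> a (A t e)\<close> that depends on the 1-jet alone,
    so that \<open>\<tau>\<close> occurs only in one explicit product.\<close>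
  define G where "G s = R a t e s + (\<delta> t (A a e) s - \<tau> s / 2 * (ai s * A a e s))" for s
  have G: "D1 G" unfolding G_def[abs_def] by (intro D1.add R_D1 D1_\<delta>t a e)
  have aA: "D1 (\<lambda>s. ai s * A a e s)" by (intro D1.mult base)
  show "D2 (\<lambda>s. \<delta> a (\<delta> (bar b) (A t e)) s - \<tau> s / 2 * \<delta> (bar b) (\<lambda>s. ai s * A a e s) s - \<delta> (bar b) G s
      - (\<Sum>k\<in>UNIV - {t}. c a (bar b) k s * \<delta> k (A t e) s))"
    using at e b
    by (intro D2.diff D2.sum D2.mult D2_half_\<tau> D2_\<delta>_D1 G aA D1_\<delta>A_mixed' D2_\<delta>A base) auto
  fix s assume s: "s \<in> Dom"
  have "\<delta> a (A t e) s = \<tau> s / 2 * (ai s * A a e s) + G s" if "s \<in> Dom" for s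
    using bracket'[OF that, of a t e] by (simp add: G_def)
  from \<delta>\<delta>_cong[OF this, of s "bar b"]
  have "\<delta> (bar b) (\<delta> a (A t e)) s = \<delta> (bar b) (\<lambda>s. \<tau> s / 2 * (ai s * A a e s) + G s) s" using s by simp
  also have "\<dots> = \<delta> (bar b) (\<lambda>s. \<tau> s / 2) s * (ai s * A a e s) + \<tau> s / 2 * \<delta> (bar b) (\<lambda>s. ai s * A a e s) s + \<delta> (bar b) G s"
    unfolding \<delta>_add[OF Sm.mult[OF D2Sm[OF D2_half_\<tau>] D1Sm[OF aA]] D1Sm[OF G] s]
      \<delta>_mult[OF D2Sm[OF D2_half_\<tau>] D1Sm[OF aA] s] ..
  also have "\<delta> (bar b) (\<lambda>s. \<tau> s / 2) s = \<delta> (bar b) \<tau> s / 2"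
    using \<delta>_mult[of \<tau> "\<lambda>s. 1/2" s "bar b"] s by (simp add: \<delta>_const)
  finally have 1: "\<delta> (bar b) (\<delta> a (A t e)) s = \<delta> (bar b) \<tau> s / 2 * (ai s * A a e s)
     + \<tau> s / 2 * \<delta> (bar b) (\<lambda>s. ai s * A a e s) s + \<delta> (bar b) G s" .
  have 2: "\<delta> a (\<delta> (bar b) (A t e)) s - \<delta> (bar b) (\<delta> a (A t e)) s
     = L a b s * \<delta> t (A t e) s + (\<Sum>k\<in>UNIV - {t}. c a (bar b) k s * \<delta> k (A t e) s)"
    using \<delta>_commute[of "A t e" s a "bar b"] s by (subst (asm) sum.remove[of UNIV t]) (auto simp: L_def)
  show "\<delta> a (\<delta> (bar b) (A t e)) s - \<tau> s / 2 * \<delta> (bar b) (\<lambda>s. ai s * A a e s) s - \<delta> (bar b) G s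
      - (\<Sum>k\<in>UNIV - {t}. c a (bar b) k s * \<delta> k (A t e) s)
     = L a b s * \<delta> t (A t e) s + \<delta> (bar b) \<tau> s / 2 * (ai s * A a e s)"
    using 1 2 by (simp add: algebra_simps)
qed

text \<open>The mixed relation has two contractions; this is the one over the pair \<open>a\<close>,
  \<open>b\<close>. The unknowns are \<open>\<delta> t (A t e)\<close> and the derivatives of
  \<open>\<tau>\<close> along the conjugate fields.\<close>

lemma D2_contract1:
  assumes e: "e \<in> I"
  shows "D2 (\<lambda>s. M * \<delta> t (A t e) s + (\<Sum>b\<in>I. \<delta> (bar b) \<tau> s * Y b e s) / 2)"
proof (rule D2.cong)
  show "D2 (\<lambda>s. \<Sum>a\<in>I. \<Sum>b\<in>I. Ci b a s * (L a b s * \<delta> t (A t e) s + \<delta> (bar b) \<tau> s / 2 * (ai s * A a e s)))"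
    by (intro D2.sum D2.mult[OF D12[OF Ci_D1]] D2_mixed e)
  fix s assume s: "s \<in> Dom"
  have "(\<Sum>a\<in>I. \<Sum>b\<in>I. Ci b a s * (L a b s * \<delta> t (A t e) s + \<delta> (bar b) \<tau> s / 2 * (ai s * A a e s)))
    = (\<Sum>a\<in>I. \<Sum>b\<in>I. Ci b a s * L a b s) * \<delta> t (A t e) s
      + (\<Sum>a\<in>I. \<Sum>b\<in>I. \<delta> (bar b) \<tau> s / 2 * (ai s * (Ci b a s * A a e s)))"
    by (simp add: algebra_simps sum.distrib sum_distrib_left sum_distrib_right)
  also have "(\<Sum>a\<in>I. \<Sum>b\<in>I. \<delta> (bar b) \<tau> s / 2 * (ai s * (Ci b a s * A a e s))) = (\<Sum>b\<in>I. \<delta> (bar b) \<tau> s * Y b e s) / 2"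
    by (subst sum.swap) (simp add: Y_def sum_distrib_left sum_divide_distrib mult_ac)
  finally show "(\<Sum>a\<in>I. \<Sum>b\<in>I. Ci b a s * (L a b s * \<delta> t (A t e) s + \<delta> (bar b) \<tau> s / 2 * (ai s * A a e s)))
     = M * \<delta> t (A t e) s + (\<Sum>b\<in>I. \<delta> (bar b) \<tau> s * Y b e s) / 2"
    using contract(3)[OF s] by (simp add: M_def)
qed

text \<open>The other contraction: \<open>e\<close> is lowered by \<open>Z\<close> to an index
  \<open>g\<close>, which is contracted with \<open>a\<close>. The weights 1 and
  \<open>M / 2\<close>, against \<open>M\<close> and 1/2 before, make a system of determinant
  \<open>(M * M - 1) / 2\<close>.\<close>

lemma D2_contract2:
  assumes b: "b \<in> I"
  shows "D2 (\<lambda>s. (\<Sum>e\<in>I. \<delta> t (A t e) s * Z e b s) + M / 2 * \<delta> (bar b) \<tau> s)"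
proof (rule D2.cong)
  show "D2 (\<lambda>s. \<Sum>a\<in>I. \<Sum>g\<in>I. Ci g a s * (\<Sum>e\<in>I.
      (L a b s * \<delta> t (A t e) s + \<delta> (bar b) \<tau> s / 2 * (ai s * A a e s)) * Z e g s))"
    by (intro D2.sum D2.mult[OF D12[OF Ci_D1]] D2.mult[OF D2_mixed] ZYL_D2 b)
  fix s assume s: "s \<in> Dom"
  have "(\<Sum>e\<in>I. (L a b s * \<delta> t (A t e) s + \<delta> (bar b) \<tau> s / 2 * (ai s * A a e s)) * Z e g s)
    = L a b s * (\<Sum>e\<in>I. \<delta> t (A t e) s * Z e g s) + \<delta> (bar b) \<tau> s / 2 * L a g s"
    if "a \<in> I" "g \<in> I" for a g
  proof -
    have "(\<Sum>e\<in>I. (L a b s * \<delta> t (A t e) s + \<delta> (bar b) \<tau> s / 2 * (ai s * A a e s)) * Z e g s)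
      = L a b s * (\<Sum>e\<in>I. \<delta> t (A t e) s * Z e g s) + \<delta> (bar b) \<tau> s / 2 * (ai s * (\<Sum>e\<in>I. A a e s * Z e g s))"
      by (simp add: algebra_simps sum.distrib sum_distrib_left sum_divide_distrib)
    also have "ai s * (\<Sum>e\<in>I. A a e s * Z e g s) = L a g s"
      using levi[OF s that] ai[OF s] by (simp add: mult.assoc[symmetric])
    finally show ?thesis .
  qed
  then have "(\<Sum>a\<in>I. \<Sum>g\<in>I. Ci g a s * (\<Sum>e\<in>I.
      (L a b s * \<delta> t (A t e) s + \<delta> (bar b) \<tau> s / 2 * (ai s * A a e s)) * Z e g s))
     = (\<Sum>a\<in>I. \<Sum>g\<in>I. Ci g a s * (L a b s * (\<Sum>e\<in>I. \<delta> t (A t e) s * Z e g s) + \<delta> (bar b) \<tau> s / 2 * L a g s))"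
    by simp
  also have "\<dots> = (\<Sum>a\<in>I. \<Sum>g\<in>I. Ci g a s * (L a b s * (\<Sum>e\<in>I. \<delta> t (A t e) s * Z e g s)))
     + \<delta> (bar b) \<tau> s / 2 * (\<Sum>a\<in>I. \<Sum>g\<in>I. Ci g a s * L a g s)"
    by (simp only: distrib_left sum.distrib) (simp add: sum_distrib_left mult_ac)
  also have "\<dots> = (\<Sum>e\<in>I. \<delta> t (A t e) s * Z e b s) + M / 2 * \<delta> (bar b) \<tau> s"
    using contract(2)[OF s b, of "\<lambda>g. \<Sum>e\<in>I. \<delta> t (A t e) s * Z e g s"] contract(3)[OF s] by (simp add: M_def)
  finally show "(\<Sum>a\<in>I. \<Sum>g\<in>I. Ci g a s * (\<Sum>e\<in>I.
      (L a b s * \<delta> t (A t e) s + \<delta> (bar b) \<tau> s / 2 * (ai s * A a e s)) * Z e g s))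
     = (\<Sum>e\<in>I. \<delta> t (A t e) s * Z e b s) + M / 2 * \<delta> (bar b) \<tau> s" .
qed

text \<open>If \<open>I\<close> has a single index, the two contractions are proportional; then the non-integrability
  tensor has no transversal part and the derivative of \<open>\<tau>\<close> is computed directly.\<close>

lemma D2_contract3:
  assumes b: "b \<in> I" and I1: "I = {b}"
  shows "D2 (\<lambda>s. \<delta> (bar b) \<tau> s - (\<Sum>e\<in>I. \<delta> t (A t e) s * Z e b s))"
proof (rule D2.cong)
  have bt: "bar b \<noteq> t" "b \<noteq> t" "b \<noteq> bar b"
    using index_distinct(1,2)[OF b] bar_I[OF b] b by force+
  have "i \<in> {t, b, bar b}" for i
  proof -
    have "bar i = b \<Longrightarrow> i = bar b" using bar_bar[of i] by simp
    then show ?thesis using index_cases[of i] I1 by auto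
  qed
  then have UN: "UNIV = {t, b, bar b}" by blast
  have 1: "D2 (\<delta> t (A p q))" if "\<not> (p = t \<and> q \<noteq> t)" for p q
  proof (cases "p = t")
    case True
    then have "q = t" using that by simp
    then show ?thesis using True D2.cong[OF \<tau>_D2, of "\<delta> t (A t t)"] \<tau> by simp
  next
    case False
    then show ?thesis by (rule D2_\<delta>t_A)
  qed
  show "D2 (\<lambda>s. (\<Sum>p\<in>UNIV. \<delta> t (c (bar b) t p) s * A p t s + c (bar b) t p s * \<delta> t (A p t) s)
     - (\<Sum>p\<in>UNIV. \<Sum>q\<in>UNIV. \<delta> t (A (bar b) p) s * A t q s * c' p q t s + A (bar b) p s * A t q s * \<delta> t (c' p q t) s)
     - A (bar b) (bar b) s * \<delta> t (A t t) s * c' (bar b) t t s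
     + (\<Sum>k\<in>UNIV. c (bar b) t k s * \<delta> k (A t t) s))"
  proof -
    have "D2 (\<delta> k (A t t))" for k using 1 D2_\<delta>A by (cases "k = t") auto
    then show ?thesis
      by (intro D2.diff D2.add D2.sum D2.mult base D12[OF \<delta>c_D1] D12[OF \<delta>c'_D1]) (use 1 bt in auto)
  qed
  fix s assume s: "s \<in> Dom"
  have ne: "A (bar b) j s = 0" if "j \<noteq> bar b" for j
  proof -
    have "bar j \<noteq> b" using that bar_bar[of j] by auto
    then show ?thesis using A_zero'[OF s, of "bar b" j] b I1 by simp
  qed
  have Zb: "Z b b s = A (bar b) (bar b) s * c' b (bar b) t s"
    unfolding Z_def using ne
    by (intro trans[OF sum.mono_neutral_right[of UNIV "{bar b}"]]) auto
  have skew: "c' (bar b) b t s = - c' b (bar b) t s" by (rule c'_skew[OF s])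
  have "\<delta> (bar b) (A t t) s = R (bar b) t t s" if "s \<in> Dom" for s by (rule \<delta>A_t[OF that bt(1)])
  from \<delta>\<delta>_cong[OF this, of s t] have 2: "\<delta> t (\<delta> (bar b) (A t t)) s = \<delta> t (R (bar b) t t) s" using s by simp
  \<comment> \<open>Commuting the derivations lets \<open>E t\<close> act last, on the 1-jet
    function \<open>R (bar b) t t\<close>. Its only unknown term has
    \<open>\<delta> t (A t b)\<close>, and by skew-symmetry of \<open>c'\<close> the coefficient is
    \<open>Z b b\<close>.\<close>
  have "\<delta> (bar b) \<tau> s = \<delta> (bar b) (\<delta> t (A t t)) s"
    using \<delta>_cong[of \<tau> "\<delta> t (A t t)" s "bar b"] \<tau> s by simp
  also have "\<dots> = \<delta> t (R (bar b) t t) s + (\<Sum>k\<in>UNIV. c (bar b) t k s * \<delta> k (A t t) s)"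
    using \<delta>_commute[of "A t t" s "bar b" t] s 2 by (simp add: algebra_simps)
  finally have 3: "\<delta> (bar b) \<tau> s = \<delta> t (R (bar b) t t) s + (\<Sum>k\<in>UNIV. c (bar b) t k s * \<delta> k (A t t) s)" .
  have "(\<Sum>p\<in>UNIV. \<Sum>q\<in>UNIV. A (bar b) p s * \<delta> t (A t q) s * c' p q t s)
     = (\<Sum>q\<in>UNIV. A (bar b) (bar b) s * \<delta> t (A t q) s * c' (bar b) q t s)"
    using ne
    by (intro trans[OF sum.mono_neutral_right[of UNIV "{bar b}"]]) auto
  also have "\<dots> = A (bar b) (bar b) s * \<delta> t (A t t) s * c' (bar b) t t s - (\<Sum>e\<in>I. \<delta> t (A t e) s * Z e b s)"
    unfolding UN using bt by (simp add: c'_diag[OF s] skew I1 Zb mult_ac)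
  finally show "(\<Sum>p\<in>UNIV. \<delta> t (c (bar b) t p) s * A p t s + c (bar b) t p s * \<delta> t (A p t) s)
     - (\<Sum>p\<in>UNIV. \<Sum>q\<in>UNIV. \<delta> t (A (bar b) p) s * A t q s * c' p q t s + A (bar b) p s * A t q s * \<delta> t (c' p q t) s)
     - A (bar b) (bar b) s * \<delta> t (A t t) s * c' (bar b) t t s
     + (\<Sum>k\<in>UNIV. c (bar b) t k s * \<delta> k (A t t) s)
    = \<delta> (bar b) \<tau> s - (\<Sum>e\<in>I. \<delta> t (A t e) s * Z e b s)"
    using 3 s by (simp add: \<delta>R distrib_right sum.distrib)
qed

lemma D2_\<delta>t_At:
  assumes e: "e \<in> I"
  shows "D2 (\<delta> t (A t e))"
proof (cases "card I = 1")
  case True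
  then obtain b where I1: "I = {b}" by (auto simp: card_1_singleton_iff)
  then have b: "b \<in> I" and eb: "e = b" using e by auto
  have M1: "M = 1" using True by (simp add: M_def)
  \<comment> \<open>With x for the contracted \<open>\<delta> t (A t e)\<close> and y for the
    derivative of \<open>\<tau>\<close>, the data are \<open>x + y / 2\<close> and
    \<open>y - x\<close>; the first minus half of the second is \<open>3 * x / 2\<close>.\<close>
  have "D2 (\<lambda>s. (2/3) * ((\<Sum>e\<in>I. \<delta> t (A t e) s * Z e b s) + M / 2 * \<delta> (bar b) \<tau> s
      - (1/2) * (\<delta> (bar b) \<tau> s - (\<Sum>e\<in>I. \<delta> t (A t e) s * Z e b s))) * Y b e s)"
    by (intro D2.mult[OF D2.mult[OF D2.const D2.diff[OF D2_contract2 D2.mult[OF D2.const D2_contract3]]] ZYL_D2(2)] b I1)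
  then show ?thesis
  proof (rule D2.cong)
    fix s assume s: "s \<in> Dom"
    have "(\<Sum>b\<in>I. (\<Sum>p\<in>I. \<delta> t (A t p) s * Z p b s) * Y b e s) = \<delta> t (A t e) s"
      by (rule ZY_solve[OF s e])
    then show "(2/3) * ((\<Sum>e\<in>I. \<delta> t (A t e) s * Z e b s) + M / 2 * \<delta> (bar b) \<tau> s
      - (1/2) * (\<delta> (bar b) \<tau> s - (\<Sum>e\<in>I. \<delta> t (A t e) s * Z e b s))) * Y b e s = \<delta> t (A t e) s"
      using I1 M1 by (simp add: algebra_simps)
  qed
next
  case False
  have "M * M \<noteq> 1"
  proof -
    have "card I * card I \<noteq> 1" using False by simp
    then show ?thesis unfolding M_def by (metis of_nat_1 of_nat_eq_iff of_nat_mult)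
  qed
  \<comment> \<open>\<open>M\<close> times the first contraction minus the second one, raised by
    \<open>Y\<close>, eliminates the derivatives of \<open>\<tau>\<close>.\<close>
  have "D2 (\<lambda>s. (1 / (M * M - 1)) * (M * (M * \<delta> t (A t e) s + (\<Sum>b\<in>I. \<delta> (bar b) \<tau> s * Y b e s) / 2)
      - (\<Sum>b\<in>I. ((\<Sum>p\<in>I. \<delta> t (A t p) s * Z p b s) + M / 2 * \<delta> (bar b) \<tau> s) * Y b e s)))"
    by (intro D2.mult[OF D2.const] D2.diff[OF D2.mult[OF D2.const D2_contract1] D2.sum] D2.mult[OF D2_contract2] e ZYL_D2)
  then show ?thesis
  proof (rule D2.cong)
    fix s assume s: "s \<in> Dom"
    have "(\<Sum>b\<in>I. ((\<Sum>p\<in>I. \<delta> t (A t p) s * Z p b s) + M / 2 * \<delta> (bar b) \<tau> s) * Y b e s)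
       = \<delta> t (A t e) s + M / 2 * (\<Sum>b\<in>I. \<delta> (bar b) \<tau> s * Y b e s)"
      using ZY_solve[OF s e, of "\<lambda>p. \<delta> t (A t p) s"]
      by (simp only: distrib_right sum.distrib) (simp add: sum_distrib_left mult_ac)
    then have "M * (M * \<delta> t (A t e) s + (\<Sum>b\<in>I. \<delta> (bar b) \<tau> s * Y b e s) / 2)
      - (\<Sum>b\<in>I. ((\<Sum>p\<in>I. \<delta> t (A t p) s * Z p b s) + M / 2 * \<delta> (bar b) \<tau> s) * Y b e s)
      = (M * M - 1) * \<delta> t (A t e) s" by (simp add: algebra_simps)
    then show "(1 / (M * M - 1)) * (M * (M * \<delta> t (A t e) s + (\<Sum>b\<in>I. \<delta> (bar b) \<tau> s * Y b e s) / 2)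
      - (\<Sum>b\<in>I. ((\<Sum>p\<in>I. \<delta> t (A t p) s * Z p b s) + M / 2 * \<delta> (bar b) \<tau> s) * Y b e s)) = \<delta> t (A t e) s"
      using \<open>M * M \<noteq> 1\<close> by simp
  qed
qed

theorem D2_\<delta>A_all: "D2 (\<delta> i (A j k))"
proof (cases "i = t \<and> j = t")
  case False
  then show ?thesis using D2_\<delta>A D2_\<delta>t_A by (cases "i = t") auto
next
  case True
  consider "k = t" | "k \<in> I" | "bar k \<in> I" using index_cases by blast
  then show ?thesis
  proof cases
    case 1
    then show ?thesis using True D2.cong[OF \<tau>_D2, of "\<delta> t (A t t)"] \<tau> by simp
  next
    case 2
    then show ?thesis using True D2_\<delta>t_At by simp
  next
    case 3
    from D2_\<delta>A_bar[OF D2_\<delta>t_At[OF this]] show ?thesis using True by simp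
  qed
qed

text \<open>With \<open>\<delta> t (A t e)\<close> known, the second contraction yields the
  derivatives along the conjugate fields; those along \<open>I\<close> are their conjugates because
  \<open>\<tau>\<close> is real.\<close>

lemma D2_\<delta>\<tau>: "i \<noteq> t \<Longrightarrow> D2 (\<delta> i \<tau>)"
proof -
  have main: "D2 (\<delta> (bar b) \<tau>)" if b: "b \<in> I" for b
  proof -
    have "D2 (\<lambda>s. (2 / M) * (((\<Sum>e\<in>I. \<delta> t (A t e) s * Z e b s) + M / 2 * \<delta> (bar b) \<tau> s)
        - (\<Sum>e\<in>I. \<delta> t (A t e) s * Z e b s)))"
      by (intro D2.mult[OF D2.const] D2.diff[OF D2_contract2] D2.sum D2.mult D2_\<delta>A_all ZYL_D2 b)
    then show ?thesis by (rule D2.cong) (use M_nonzero in simp)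
  qed
  assume "i \<noteq> t"
  then consider "i \<in> I" | "bar i \<in> I" using index_cases by blast
  then show ?thesis
  proof cases
    case 1
    from D2.conj[OF main[OF this]] show ?thesis by (rule D2.cong) (simp add: \<delta>\<tau>_bar)
  next
    case 2
    from main[OF this] show ?thesis by simp
  qed
qed

text \<open>Brackets of fields in H reach the transversal direction: tracing the commutators of
  \<open>E a\<close> and \<open>E (bar b)\<close> on \<open>\<tau>\<close> leaves \<open>M\<close>
  times its derivative along \<open>E t\<close>.\<close>

theorem D2_\<delta>\<tau>_all: "D2 (\<delta> i \<tau>)"
proof (cases "i = t")
  case False
  then show ?thesis by (rule D2_\<delta>\<tau>)
next
  case True
  have D: "D2 (\<delta> j (\<delta> k \<tau>))" if "j \<noteq> t" "k \<noteq> t" for j k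
    by (rule \<delta>_D2[OF D2_\<delta>A_all D2_\<delta>\<tau>[OF that(1)] D2_\<delta>\<tau>[OF that(2)]])
  have "D2 (\<lambda>s. (1 / M) * (\<Sum>a\<in>I. \<Sum>b\<in>I. Ci b a s * (\<delta> a (\<delta> (bar b) \<tau>) s - \<delta> (bar b) (\<delta> a \<tau>) s
      - (\<Sum>k\<in>UNIV - {t}. c a (bar b) k s * \<delta> k \<tau> s))))"
    using index_distinct
    by (intro D2.mult[OF D2.const] D2.sum D2.mult[OF D12[OF Ci_D1]] D2.diff[OF D2.diff] D2.mult[OF D12[OF c_D1]] D D2_\<delta>\<tau>) auto
  then have "D2 (\<delta> t \<tau>)"
  proof (rule D2.cong)
    fix s assume s: "s \<in> Dom"
    have "\<delta> a (\<delta> (bar b) \<tau>) s - \<delta> (bar b) (\<delta> a \<tau>) s - (\<Sum>k\<in>UNIV - {t}. c a (bar b) k s * \<delta> k \<tau> s)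
      = L a b s * \<delta> t \<tau> s" for a b
      using \<delta>_commute[of \<tau> s a "bar b"] s by (subst (asm) sum.remove[of UNIV t]) (auto simp: L_def)
    then have "(\<Sum>a\<in>I. \<Sum>b\<in>I. Ci b a s * (\<delta> a (\<delta> (bar b) \<tau>) s - \<delta> (bar b) (\<delta> a \<tau>) s
      - (\<Sum>k\<in>UNIV - {t}. c a (bar b) k s * \<delta> k \<tau> s))) = (\<Sum>a\<in>I. \<Sum>b\<in>I. Ci b a s * L a b s) * \<delta> t \<tau> s"
      by (simp add: sum_distrib_right mult.assoc)
    then show "(1 / M) * (\<Sum>a\<in>I. \<Sum>b\<in>I. Ci b a s * (\<delta> a (\<delta> (bar b) \<tau>) s - \<delta> (bar b) (\<delta> a \<tau>) s
      - (\<Sum>k\<in>UNIV - {t}. c a (bar b) k s * \<delta> k \<tau> s))) = \<delta> t \<tau> s"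
      using contract(3)[OF s] M_nonzero by (simp add: M_def)
  qed
  then show ?thesis using True by simp
qed

end

section \<open>Matrix inverses, symmetry of second derivatives, complex derivations\<close>

text \<open>Cramer's rule: each entry is a polynomial in the entries of the matrix times the inverse
  of its determinant, hence smooth or analytic wherever the matrix is invertible.\<close>

definition minv :: "complex^'n^'n \<Rightarrow> complex^'n^'n" where
  "minv M = (\<chi> k l. det (\<chi> i j. if j = k then (if i = l then 1 else 0) else M $ i $ j) * inverse (det M))"

lemma minv_right:
  fixes M :: "complex^'n^'n"
  assumes d: "det M \<noteq> 0"
  shows "M ** minv M = mat 1"
proof -
  have "M *v column l (minv M) = axis l 1" for l
    unfolding cramer[OF d]
    by (simp add: column_def minv_def axis_def vec_eq_iff divide_inverse cong: if_cong)
  then have "(M ** minv M) $ i $ l = mat 1 $ i $ l" for i l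
    by (simp add: matrix_vector_mult_def matrix_matrix_mult_def column_def vec_eq_iff mat_def axis_def)
  then show ?thesis by (simp add: vec_eq_iff)
qed

lemma minv_left: "det M \<noteq> 0 \<Longrightarrow> minv M ** M = mat 1"
  using minv_right matrix_left_right_inverse by blast

lemma minv_sum:
  assumes "det M \<noteq> 0"
  shows "(\<Sum>k\<in>UNIV. M $ i $ k * minv M $ k $ j) = (if i = j then 1 else 0)"
    "(\<Sum>k\<in>UNIV. minv M $ i $ k * M $ k $ j) = (if i = j then 1 else 0)"
  using minv_right[OF assms] minv_left[OF assms]
  by (simp_all add: matrix_matrix_mult_def vec_eq_iff mat_def)

lemma reg_det:
  fixes F :: "'e::euclidean_space \<Rightarrow> complex^'n^'n"
  assumes S: "open S" and F: "\<And>i j. reg \<rho> S (\<lambda>x. F x $ i $ j)"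
  shows "reg \<rho> S (\<lambda>x. det (F x))"
  unfolding det_def by (intro reg_sum reg_mult reg_prod reg_const S F)

lemma reg_minv:
  fixes F :: "'e::euclidean_space \<Rightarrow> complex^'n^'n"
  assumes S: "open S" and F: "\<And>i j. reg \<rho> S (\<lambda>x. F x $ i $ j)" and d: "\<And>x. x \<in> S \<Longrightarrow> det (F x) \<noteq> 0"
  shows "reg \<rho> S (\<lambda>x. minv (F x) $ k $ l)"
proof -
  have "reg \<rho> S (\<lambda>x. (\<chi> i j. if j = k then (if i = l then 1 else 0) else F x $ i $ j) $ i $ j)" for i j
    using F by (cases "j = k") (auto simp: if_distrib)
  then show ?thesis
    unfolding minv_def by (simp, intro reg_mult reg_det reg_inverse_complex S F d) auto
qed

lemma line_deriv:
  fixes g :: "'e::euclidean_space \<Rightarrow> real"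
  assumes "g differentiable (at (a + s *\<^sub>R v))"
  shows "((\<lambda>s. g (a + s *\<^sub>R v)) has_field_derivative frechet_derivative g (at (a + s *\<^sub>R v)) v) (at s)"
proof -
  have "((\<lambda>s. g (a + s *\<^sub>R v)) has_derivative (\<lambda>h. frechet_derivative g (at (a + s *\<^sub>R v)) (h *\<^sub>R v))) (at s)"
    by (rule has_derivative_compose[of "\<lambda>s. a + s *\<^sub>R v" "\<lambda>h. h *\<^sub>R v" s UNIV g])
      (use has_derivative_frechet[OF assms] in \<open>auto intro!: derivative_eq_intros\<close>)
  moreover have "linear (frechet_derivative g (at (a + s *\<^sub>R v)))" by (rule linear_frechet_derivative[OF assms])
  ultimately show ?thesis
    unfolding has_field_derivative_def by (simp add: linear_cmul mult.commute[of _ "frechet_derivative _ _ _"] cong: )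
qed

text \<open>The mean value theorem twice: first for the difference over the step along
  \<open>w\<close>, as a function of the position along \<open>v\<close>, then for the derivative
  along \<open>v\<close>, as a function of the position along \<open>w\<close>.\<close>

lemma second_difference:
  fixes g :: "'e::euclidean_space \<Rightarrow> real"
  assumes S: "open S" and g: "reg Smooth S g" and r: "ball x r \<subseteq> S" and h: "0 < h" "h * (norm v + norm w) < r"
  shows "\<exists>y\<in>ball x r. dist x y \<le> h * (norm v + norm w) \<and>
    g (x + h *\<^sub>R v + h *\<^sub>R w) - g (x + h *\<^sub>R v) - g (x + h *\<^sub>R w) + g x
      = h * h * frechet_derivative (\<lambda>y. frechet_derivative g (at y) v) (at y) w"
proof -
  have near: "dist x (x + s *\<^sub>R v + u *\<^sub>R w) \<le> h * (norm v + norm w)"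
    if "0 \<le> s" "s \<le> h" "0 \<le> u" "u \<le> h" for s u
  proof -
    have "norm (s *\<^sub>R v + u *\<^sub>R w) \<le> s * norm v + u * norm w"
      using norm_triangle_ineq[of "s *\<^sub>R v" "u *\<^sub>R w"] that by simp
    also have "\<dots> \<le> h * norm v + h * norm w" using that by (intro add_mono mult_right_mono) auto
    finally show ?thesis by (simp add: dist_norm norm_minus_commute algebra_simps)
  qed
  have mem: "x + s *\<^sub>R v + u *\<^sub>R w \<in> S" if "0 \<le> s" "s \<le> h" "0 \<le> u" "u \<le> h" for s u
    using near[OF that] h r by (auto simp: subset_iff)
  let ?D = "\<lambda>y. frechet_derivative g (at y) v"
  have D: "reg Smooth S ?D" by (rule reg_deriv[OF S g])
  have "((\<lambda>s. g (x + h *\<^sub>R w + s *\<^sub>R v) - g (x + s *\<^sub>R v)) has_field_derivative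
      (?D (x + h *\<^sub>R w + s *\<^sub>R v) - ?D (x + s *\<^sub>R v))) (at s)" if "0 \<le> s" "s \<le> h" for s
    using mem[OF that, of h] mem[OF that, of 0] h
    by (intro DERIV_diff line_deriv reg_differentiable[OF g]) (auto simp: algebra_simps)
  from MVT2[OF h(1) this] obtain \<xi> where \<xi>: "0 < \<xi>" "\<xi> < h" and e1:
    "(g (x + h *\<^sub>R w + h *\<^sub>R v) - g (x + h *\<^sub>R v)) - (g (x + h *\<^sub>R w + 0 *\<^sub>R v) - g (x + 0 *\<^sub>R v))
      = (h - 0) * (?D (x + h *\<^sub>R w + \<xi> *\<^sub>R v) - ?D (x + \<xi> *\<^sub>R v))" by blast
  have "((\<lambda>u. ?D ((x + \<xi> *\<^sub>R v) + u *\<^sub>R w)) has_field_derivative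
      frechet_derivative ?D (at ((x + \<xi> *\<^sub>R v) + u *\<^sub>R w)) w) (at u)" if "0 \<le> u" "u \<le> h" for u
    using mem[of \<xi> u] \<xi> that by (intro line_deriv reg_differentiable[OF D]) auto
  from MVT2[OF h(1) this] obtain \<eta> where \<eta>: "0 < \<eta>" "\<eta> < h" and e2:
    "?D (x + \<xi> *\<^sub>R v + h *\<^sub>R w) - ?D (x + \<xi> *\<^sub>R v + 0 *\<^sub>R w)
      = (h - 0) * frechet_derivative ?D (at (x + \<xi> *\<^sub>R v + \<eta> *\<^sub>R w)) w" by blast
  have "g (x + h *\<^sub>R v + h *\<^sub>R w) - g (x + h *\<^sub>R v) - g (x + h *\<^sub>R w) + g x
      = h * (h * frechet_derivative ?D (at (x + \<xi> *\<^sub>R v + \<eta> *\<^sub>R w)) w)"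
    using e1 e2 by (simp add: algebra_simps)
  moreover have "dist x (x + \<xi> *\<^sub>R v + \<eta> *\<^sub>R w) \<le> h * (norm v + norm w)" using near[of \<xi> \<eta>] \<xi> \<eta> by simp
  moreover from this have "x + \<xi> *\<^sub>R v + \<eta> *\<^sub>R w \<in> ball x r" using h by simp
  ultimately show ?thesis
    by (intro bexI[of _ "x + \<xi> *\<^sub>R v + \<eta> *\<^sub>R w"] conjI) (simp_all only: mult.assoc)
qed

text \<open>The second difference is symmetric in \<open>v\<close> and \<open>w\<close>, so the two
  mixed derivatives share a value at points arbitrarily close to \<open>x\<close>, and both are
  continuous.\<close>

lemma schwarz_real:
  fixes g :: "'e::euclidean_space \<Rightarrow> real"
  assumes S: "open S" and g: "reg Smooth S g" and x: "x \<in> S"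
  shows "frechet_derivative (\<lambda>y. frechet_derivative g (at y) v) (at x) w =
    frechet_derivative (\<lambda>y. frechet_derivative g (at y) w) (at x) v"
proof (rule ccontr)
  let ?F = "\<lambda>y. frechet_derivative (\<lambda>y. frechet_derivative g (at y) v) (at y) w"
  let ?G = "\<lambda>y. frechet_derivative (\<lambda>y. frechet_derivative g (at y) w) (at y) v"
  assume ne: "?F x \<noteq> ?G x"
  define e where "e = \<bar>?F x - ?G x\<bar> / 2"
  have e: "0 < e" using ne by (simp add: e_def)
  have "continuous_on S ?F" "continuous_on S ?G"
    by (intro reg_continuous_on[of Smooth] reg_deriv S g)+
  then have "isCont ?F x" "isCont ?G x" using S x continuous_on_eq_continuous_at by blast+
  then obtain d1 d2 where d: "0 < d1" "0 < d2" "\<And>y. dist y x < d1 \<Longrightarrow> \<bar>?F y - ?F x\<bar> < e"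
    "\<And>y. dist y x < d2 \<Longrightarrow> \<bar>?G y - ?G x\<bar> < e"
    unfolding continuous_at_eps_delta dist_real_def using e by blast
  obtain r0 where r0: "0 < r0" "ball x r0 \<subseteq> S" using S x open_contains_ball by blast
  define r where "r = min r0 (min d1 d2)"
  have r: "0 < r" "ball x r \<subseteq> S" using r0 d by (auto simp: r_def)
  define h where "h = r / (2 * (norm v + norm w + 1))"
  have p: "0 < norm v + norm w + 1" by (smt (verit) norm_ge_zero)
  have h: "0 < h" using r p by (simp add: h_def)
  have "h * (norm v + norm w) < h * (2 * (norm v + norm w + 1))"
    by (rule mult_strict_left_mono[OF _ h]) (smt (verit) norm_ge_zero)
  also have "\<dots> = r" using p by (simp add: h_def)
  finally have hr: "h * (norm v + norm w) < r" .
  then have hr': "h * (norm w + norm v) < r" by (simp add: add.commute)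
  obtain y z where y: "y \<in> ball x r" "g (x + h *\<^sub>R v + h *\<^sub>R w) - g (x + h *\<^sub>R v) - g (x + h *\<^sub>R w) + g x = h * h * ?F y"
    and z: "z \<in> ball x r" "g (x + h *\<^sub>R w + h *\<^sub>R v) - g (x + h *\<^sub>R w) - g (x + h *\<^sub>R v) + g x = h * h * ?G z"
    using second_difference[OF S g r(2) h hr] second_difference[OF S g r(2) h hr'] by blast
  have "h * h * ?F y = h * h * ?G z" using y(2) z(2) by (simp add: algebra_simps)
  then have "?F y = ?G z" using h by simp
  moreover have "\<bar>?F y - ?F x\<bar> < e" "\<bar>?G z - ?G x\<bar> < e"
    using d(3)[of y] d(4)[of z] y(1) z(1) by (auto simp: r_def dist_commute)
  moreover have False if "\<bar>c - a\<bar> < \<bar>a - b\<bar> / 2" "\<bar>c - b\<bar> < \<bar>a - b\<bar> / 2" for a b c :: real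
    using that by argo
  ultimately show False unfolding e_def by metis
qed

lemma schwarz:
  fixes f :: "'e::euclidean_space \<Rightarrow> 'f::euclidean_space"
  assumes S: "open S" and f: "reg Smooth S f" and x: "x \<in> S"
  shows "frechet_derivative (\<lambda>y. frechet_derivative f (at y) v) (at x) w =
    frechet_derivative (\<lambda>y. frechet_derivative f (at y) w) (at x) v"
proof (rule euclidean_eqI)
  fix b :: 'f assume b: "b \<in> Basis"
  have fb: "reg Smooth S (\<lambda>y. f y \<bullet> b)" using f b reg_componentwise[OF S] by blast
  have "frechet_derivative (\<lambda>y. frechet_derivative f (at y) v) (at x) w \<bullet> b =
     frechet_derivative (\<lambda>y. frechet_derivative (\<lambda>y. f y \<bullet> b) (at y) v) (at x) w" for v w
  proof -
    have D: "reg Smooth S (\<lambda>y. frechet_derivative f (at y) v)" by (rule reg_deriv[OF S f])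
    have "((\<lambda>y. frechet_derivative f (at y) v \<bullet> b) has_derivative
        (\<lambda>w. frechet_derivative (\<lambda>y. frechet_derivative f (at y) v) (at x) w \<bullet> b)) (at x)"
      by (intro has_derivative_inner_left reg_has_derivative[OF D x])
    then have "((\<lambda>y. frechet_derivative (\<lambda>y. f y \<bullet> b) (at y) v) has_derivative
        (\<lambda>w. frechet_derivative (\<lambda>y. frechet_derivative f (at y) v) (at x) w \<bullet> b)) (at x)"
      by (rule has_derivative_transform_within_open[OF _ S x])
        (simp add: frechet_derivative_inner[OF reg_differentiable[OF f]])
    from frechet_derivative_eq[OF this] show ?thesis by simp
  qed
  with schwarz_real[OF S fb x] show "frechet_derivative (\<lambda>y. frechet_derivative f (at y) v) (at x) w \<bullet> b =
    frechet_derivative (\<lambda>y. frechet_derivative f (at y) w) (at x) v \<bullet> b" by simp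
qed

text \<open>The derivative along a complex tangent vector, by complex-linear extension of the
  differential.\<close>

definition cder :: "(real^'n \<Rightarrow> complex) \<Rightarrow> real^'n \<Rightarrow> complex^'n \<Rightarrow> complex" where
  "cder g x Z = (\<Sum>j\<in>UNIV. Z $ j * frechet_derivative g (at x) (axis j 1))"

lemma cder_linear:
  "cder g x (Z + W) = cder g x Z + cder g x W" "cder g x (a *s Z) = a * cder g x Z"
  "cder g x (\<Sum>i\<in>K. k i *s F i) = (\<Sum>i\<in>K. k i * cder g x (F i))"
proof -
  show "cder g x (\<Sum>i\<in>K. k i *s F i) = (\<Sum>i\<in>K. k i * cder g x (F i))"
    unfolding cder_def by (simp add: sum_distrib_left sum_distrib_right mult.assoc) (rule sum.swap)
qed (simp_all add: cder_def distrib_right sum.distrib sum_distrib_left mult.assoc)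

lemma vec_representation: "(v :: real^'n) = (\<Sum>j\<in>UNIV. v $ j *\<^sub>R axis j 1)"
  by (simp add: vec_eq_iff axis_def if_distrib[of "\<lambda>z. _ * z"] cong: if_cong)

lemma frechet_derivative_sum_axis:
  fixes g :: "real^'n \<Rightarrow> 'f::real_normed_vector"
  assumes "g differentiable (at x)"
  shows "frechet_derivative g (at x) v = (\<Sum>j\<in>UNIV. v $ j *\<^sub>R frechet_derivative g (at x) (axis j 1))"
proof -
  have "linear (frechet_derivative g (at x))" by (rule linear_frechet_derivative[OF assms])
  then have "frechet_derivative g (at x) (\<Sum>j\<in>UNIV. v $ j *\<^sub>R axis j 1)
      = (\<Sum>j\<in>UNIV. v $ j *\<^sub>R frechet_derivative g (at x) (axis j 1))"
    by (simp add: linear_sum linear_cmul)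
  then show ?thesis using vec_representation[of v] by simp
qed

lemma cder_const: "cder (\<lambda>x. k) x Z = 0"
  by (simp add: cder_def)

lemma cder_cong:
  assumes "open S" "x \<in> S" "g differentiable (at x)" "\<And>y. y \<in> S \<Longrightarrow> g y = h y"
  shows "cder g x Z = cder h x Z"
  unfolding cder_def using frechet_derivative_transform_within_open[OF assms(3,1,2,4)] by simp

lemma cder_add:
  assumes "g differentiable (at x)" "h differentiable (at x)"
  shows "cder (\<lambda>x. g x + h x) x Z = cder g x Z + cder h x Z"
  unfolding cder_def
    frechet_derivative_eq[OF has_derivative_add[OF assms[THEN has_derivative_frechet]]]
  by (simp add: distrib_left sum.distrib)

lemma cder_mult:
  assumes "g differentiable (at x)" "h differentiable (at x)"
  shows "cder (\<lambda>x. g x * h x) x Z = cder g x Z * h x + g x * cder h x Z"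
  unfolding cder_def
    frechet_derivative_eq[OF has_derivative_mult[OF assms[THEN has_derivative_frechet]]]
  by (simp add: distrib_left sum.distrib sum_distrib_left sum_distrib_right mult_ac)

lemma cder_sum:
  assumes "\<And>i. i \<in> K \<Longrightarrow> g i differentiable (at x)"
  shows "cder (\<lambda>x. \<Sum>i\<in>K. g i x) x Z = (\<Sum>i\<in>K. cder (g i) x Z)"
  using assms by (induction K rule: infinite_finite_induct) (auto simp: cder_const cder_add)

lemma cder_cnj:
  assumes "g differentiable (at x)"
  shows "cder (\<lambda>x. cnj (g x)) x (cnj_vec Z) = cnj (cder g x Z)"
  unfolding cder_def cnj_vec_def
    frechet_derivative_eq[OF bounded_linear.has_derivative[OF bounded_linear_cnj has_derivative_frechet[OF assms]]]
  by simp

lemma cder_chain: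
  fixes q :: "real^'n \<Rightarrow> 'q::euclidean_space" and G :: "'q \<Rightarrow> complex"
  assumes q: "q differentiable (at x)" and G: "G differentiable (at (q x))"
  shows "cder (\<lambda>x. G (q x)) x Z = (\<Sum>b\<in>Basis. cder (\<lambda>x. of_real (q x \<bullet> b)) x Z * frechet_derivative G (at (q x)) b)"
proof -
  have lin: "linear (frechet_derivative G (at (q x)))" by (rule linear_frechet_derivative[OF G])
  have 1: "frechet_derivative (\<lambda>x. G (q x)) (at x) v
      = (\<Sum>b\<in>Basis. of_real (frechet_derivative q (at x) v \<bullet> b) * frechet_derivative G (at (q x)) b)" for v
  proof -
    have "frechet_derivative (\<lambda>x. G (q x)) (at x) v = frechet_derivative G (at (q x)) (frechet_derivative q (at x) v)"
      by (subst frechet_derivative_eq[OF has_derivative_compose[OF has_derivative_frechet[OF q] has_derivative_frechet[OF G]]]) simp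
    also have "\<dots> = frechet_derivative G (at (q x)) (\<Sum>b\<in>Basis. (frechet_derivative q (at x) v \<bullet> b) *\<^sub>R b)"
      by (simp add: euclidean_representation)
    finally show ?thesis by (simp add: linear_sum[OF lin] linear_cmul[OF lin] scaleR_conv_of_real)
  qed
  have 2: "frechet_derivative (\<lambda>x. complex_of_real (q x \<bullet> b)) (at x) v = of_real (frechet_derivative q (at x) v \<bullet> b)" for b v
    by (subst frechet_derivative_eq[OF bounded_linear.has_derivative[OF bounded_linear_of_real has_derivative_inner_left[OF has_derivative_frechet[OF q]]]]) simp
  show ?thesis
    unfolding cder_def 1 2 by (simp add: sum_distrib_left sum_distrib_right mult.assoc) (rule sum.swap)
qed

lemma reg_cder:
  fixes g :: "real^'n \<Rightarrow> complex" and Z :: "real^'n \<Rightarrow> complex^'n"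
  assumes S: "open S" and g: "reg \<rho> S g" and Z: "reg \<rho> S Z"
  shows "reg \<rho> S (\<lambda>x. cder g x (Z x))"
  unfolding cder_def by (intro reg_sum reg_mult reg_vec_nth reg_deriv S g Z)

lemma frechet_derivative_vec_nth:
  assumes "Y differentiable (at x)"
  shows "frechet_derivative Y (at x) v $ k = frechet_derivative (\<lambda>y. Y y $ k) (at x) v"
  by (subst frechet_derivative_eq[OF bounded_linear.has_derivative[OF bounded_linear_vec_nth has_derivative_frechet[OF assms]]]) simp

lemma lie_bracket_nth:
  assumes "X differentiable (at x)" "Y differentiable (at x)"
  shows "lie_bracket X Y x $ k = cder (\<lambda>y. Y y $ k) x (X x) - cder (\<lambda>y. X y $ k) x (Y x)"
  unfolding lie_bracket_def cder_def
  by (simp add: sum_subtractf frechet_derivative_vec_nth assms)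

text \<open>The second derivatives of \<open>g\<close> cancel by their symmetry; the derivatives of
  the components of the fields are left, and they make up the bracket.\<close>

lemma cder_commute:
  fixes g :: "real^'n \<Rightarrow> complex" and X Y :: "real^'n \<Rightarrow> complex^'n"
  assumes S: "open S" and g: "reg Smooth S g" and X: "reg Smooth S X" and Y: "reg Smooth S Y" and x: "x \<in> S"
  shows "cder (\<lambda>y. cder g y (Y y)) x (X x) - cder (\<lambda>y. cder g y (X y)) x (Y x) = cder g x (lie_bracket X Y x)"
proof -
  let ?D = "\<lambda>j y. frechet_derivative g (at y) (axis j 1)"
  have D: "?D j differentiable (at x)" for j by (rule reg_differentiable[OF reg_deriv[OF S g] x])
  have diff: "(\<lambda>y. X y $ j) differentiable (at x)" "(\<lambda>y. Y y $ j) differentiable (at x)" for j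
    using reg_differentiable[OF reg_vec_nth[OF S X] x] reg_differentiable[OF reg_vec_nth[OF S Y] x] by auto
  have e: "cder (\<lambda>y. cder g y (W y)) x Z = (\<Sum>j\<in>UNIV. cder (\<lambda>y. W y $ j) x Z * ?D j x)
      + (\<Sum>j\<in>UNIV. \<Sum>l\<in>UNIV. W x $ j * Z $ l * frechet_derivative (?D j) (at x) (axis l 1))"
    if W: "\<And>j. (\<lambda>y. W y $ j) differentiable (at x)" for W :: "real^'n \<Rightarrow> complex^'n" and Z
  proof -
    have "cder (\<lambda>y. cder g y (W y)) x Z = (\<Sum>j\<in>UNIV. cder (\<lambda>y. W y $ j * ?D j y) x Z)"
      unfolding cder_def[of g] by (rule cder_sum) (intro differentiable_mult W D)
    also have "\<dots> = (\<Sum>j\<in>UNIV. cder (\<lambda>y. W y $ j) x Z * ?D j x + W x $ j * cder (?D j) x Z)"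
      by (intro sum.cong refl cder_mult W D)
    finally show ?thesis
      unfolding cder_def[of "?D _"] by (simp add: sum.distrib sum_distrib_left mult.assoc)
  qed
  have sw: "(\<Sum>j\<in>UNIV. \<Sum>l\<in>UNIV. Y x $ j * X x $ l * frechet_derivative (?D j) (at x) (axis l 1))
     = (\<Sum>j\<in>UNIV. \<Sum>l\<in>UNIV. X x $ j * Y x $ l * frechet_derivative (?D j) (at x) (axis l 1))"
    by (subst sum.swap) (simp add: schwarz[OF S g x, of "axis _ 1" "axis _ 1"] mult_ac)
  have "lie_bracket X Y x $ k = cder (\<lambda>y. Y y $ k) x (X x) - cder (\<lambda>y. X y $ k) x (Y x)" for k
    using X Y x by (intro lie_bracket_nth reg_differentiable)
  then show ?thesis
    unfolding e[OF diff(1)] e[OF diff(2)] sw unfolding cder_def[of g x "lie_bracket X Y x"]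
    by (simp add: left_diff_distrib sum_subtractf)
qed

section \<open>Quantities determined by a coordinate map\<close>

text \<open>The domain \<open>V\<close> of the representing function is prescribed, so such
  quantities can be combined without shrinking it.\<close>

definition determined ::
  "regularity \<Rightarrow> 's set \<Rightarrow> ('s \<Rightarrow> 'q::euclidean_space) \<Rightarrow> 'q set \<Rightarrow> ('s \<Rightarrow> 'v::euclidean_space) \<Rightarrow> bool" where
  "determined \<rho> Dom q V \<psi> \<longleftrightarrow> (\<exists>G. reg \<rho> V G \<and> (\<forall>s\<in>Dom. q s \<in> V \<and> \<psi> s = G (q s)))"

lemma function_ring_determined:
  assumes V: "open V" and q: "q ` Dom \<subseteq> V"
  shows "function_ring Dom (determined \<rho> Dom q V :: ('s \<Rightarrow> complex) \<Rightarrow> bool)"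
proof
  fix f g :: "'s \<Rightarrow> complex" and c
  note D = determined_def
  show "determined \<rho> Dom q V (\<lambda>s. c)" using q unfolding D by (intro exI[of _ "\<lambda>_. c"]) auto
  show "determined \<rho> Dom q V g" if "determined \<rho> Dom q V f" "\<And>s. s \<in> Dom \<Longrightarrow> f s = g s"
    using that unfolding D by auto
  show "determined \<rho> Dom q V (\<lambda>s. f s + g s)" if fg: "determined \<rho> Dom q V f" "determined \<rho> Dom q V g"
  proof -
    from fg obtain F G where F: "reg \<rho> V F" "\<forall>s\<in>Dom. q s \<in> V \<and> f s = F (q s)"
      and G: "reg \<rho> V G" "\<forall>s\<in>Dom. q s \<in> V \<and> g s = G (q s)" unfolding D by blast
    then show ?thesis unfolding D
      by (intro exI[of _ "\<lambda>z. F z + G z"] conjI reg_add[OF V]) auto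
  qed
  show "determined \<rho> Dom q V (\<lambda>s. f s * g s)" if fg: "determined \<rho> Dom q V f" "determined \<rho> Dom q V g"
  proof -
    from fg obtain F G where F: "reg \<rho> V F" "\<forall>s\<in>Dom. q s \<in> V \<and> f s = F (q s)"
      and G: "reg \<rho> V G" "\<forall>s\<in>Dom. q s \<in> V \<and> g s = G (q s)" unfolding D by blast
    then show ?thesis unfolding D
      by (intro exI[of _ "\<lambda>z. F z * G z"] conjI reg_mult[OF V]) auto
  qed
  show "determined \<rho> Dom q V (\<lambda>s. cnj (f s))" if f: "determined \<rho> Dom q V f"
  proof -
    from f obtain F where F: "reg \<rho> V F" "\<forall>s\<in>Dom. q s \<in> V \<and> f s = F (q s)" unfolding D by blast
    then show ?thesis unfolding D
      by (intro exI[of _ "\<lambda>z. cnj (F z)"] conjI reg_cnj[OF V]) auto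
  qed
qed

section \<open>Frames\<close>

text \<open>Frames are indexed by the coordinate type itself, so that their matrices are square:
  \<open>I\<close> labels the fields of type (1,0), its image under \<open>bar\<close> their
  conjugates, and \<open>t\<close> a real transversal field.\<close>

locale index_structure =
  fixes I :: "'n::finite set" and t :: 'n and bar :: "'n \<Rightarrow> 'n"
  assumes bar_bar [simp]: "bar (bar i) = i" and bar_t [simp]: "bar t = t" and t_notin: "t \<notin> I"
    and bar_I: "i \<in> I \<Longrightarrow> bar i \<notin> I" and index_cases: "i = t \<or> i \<in> I \<or> bar i \<in> I"
    and I_nonempty: "I \<noteq> {}"
begin

lemma sum_bar: "(\<Sum>k\<in>UNIV. f (bar k)) = (\<Sum>k\<in>UNIV. f k)"
  by (rule sum.reindex_bij_witness[of _ bar bar]) auto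

end

locale frame = index_structure I t bar
  for I :: "'n::finite set" and t :: 'n and bar :: "'n \<Rightarrow> 'n" +
  fixes \<rho> :: regularity and S :: "(real^'n) set" and E :: "'n \<Rightarrow> real^'n \<Rightarrow> complex^'n"
  assumes S: "open S" and reg_E: "reg \<rho> S (E i)"
    and det_E: "x \<in> S \<Longrightarrow> det (\<chi> i j. E i x $ j) \<noteq> 0"
    and E_bar: "x \<in> S \<Longrightarrow> E (bar i) x = cnj_vec (E i x)"
begin

definition coE :: "real^'n \<Rightarrow> complex^'n^'n" where "coE x = minv (\<chi> i j. E i x $ j)"

text \<open>The structure functions of the frame, that is, the components of its brackets, read off
  with the dual frame \<open>coE\<close>.\<close>

definition cs :: "'n \<Rightarrow> 'n \<Rightarrow> 'n \<Rightarrow> real^'n \<Rightarrow> complex" where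
  "cs i j k x = (\<Sum>l\<in>UNIV. lie_bracket (E i) (E j) x $ l * coE x $ l $ k)"

lemma reg_E_nth: "reg \<rho> S (\<lambda>x. E i x $ j)" by (rule reg_vec_nth[OF S reg_E])

lemma Smooth_E: "reg Smooth S (E i)" by (rule reg_imp_Smooth[OF S reg_E])

lemma reg_coE: "reg \<rho> S (\<lambda>x. coE x $ k $ l)"
  unfolding coE_def by (rule reg_minv[OF S _ det_E]) (use reg_E_nth in auto)

lemma E_coE:
  assumes "x \<in> S"
  shows "(\<Sum>l\<in>UNIV. E i x $ l * coE x $ l $ k) = (if i = k then 1 else 0)"
    "(\<Sum>i\<in>UNIV. coE x $ k $ i * E i x $ l) = (if k = l then 1 else 0)"
  using minv_sum[OF det_E[OF assms]] by (simp_all add: coE_def)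

lemma expand: "x \<in> S \<Longrightarrow> (\<Sum>k\<in>UNIV. (\<Sum>l\<in>UNIV. Z $ l * coE x $ l $ k) * E k x $ m) = Z $ m"
proof -
  assume x: "x \<in> S"
  have "(\<Sum>k\<in>UNIV. (\<Sum>l\<in>UNIV. Z $ l * coE x $ l $ k) * E k x $ m)
    = (\<Sum>l\<in>UNIV. Z $ l * (\<Sum>k\<in>UNIV. coE x $ l $ k * E k x $ m))"
    by (simp add: sum_distrib_left sum_distrib_right mult.assoc) (rule sum.swap)
  also have "\<dots> = (\<Sum>l\<in>UNIV. if l = m then Z $ l else 0)"
    by (intro sum.cong refl) (simp add: E_coE[OF x])
  finally show ?thesis by simp
qed

lemma expand_vec: "x \<in> S \<Longrightarrow> (\<Sum>k\<in>UNIV. (\<Sum>l\<in>UNIV. Z $ l * coE x $ l $ k) *s E k x) = Z"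
  using expand[of x Z] by (simp add: vec_eq_iff)

lemma coeff:
  assumes "x \<in> S"
  shows "(\<Sum>l\<in>UNIV. (\<Sum>i\<in>UNIV. u i * E i x $ l) * coE x $ l $ k) = u k"
proof -
  have "(\<Sum>l\<in>UNIV. (\<Sum>i\<in>UNIV. u i * E i x $ l) * coE x $ l $ k)
    = (\<Sum>i\<in>UNIV. u i * (\<Sum>l\<in>UNIV. E i x $ l * coE x $ l $ k))"
    by (simp add: sum_distrib_left sum_distrib_right mult.assoc) (rule sum.swap)
  also have "\<dots> = (\<Sum>i\<in>UNIV. if i = k then u i else 0)"
    by (intro sum.cong refl) (simp add: E_coE[OF assms])
  finally show ?thesis by simp
qed

lemma coeff_unique:
  assumes "x \<in> S" "\<And>m. (\<Sum>i\<in>UNIV. u i * E i x $ m) = (\<Sum>i\<in>UNIV. v i * E i x $ m)"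
  shows "u k = v k"
  using coeff[OF assms(1), of u k] coeff[OF assms(1), of v k] assms(2) by simp

lemma coE_bar:
  assumes x: "x \<in> S"
  shows "coE x $ l $ bar k = cnj (coE x $ l $ k)"
proof -
  have "(\<Sum>i\<in>UNIV. cnj (coE x $ l $ bar i) * E i x $ m) = (\<Sum>i\<in>UNIV. coE x $ l $ i * E i x $ m)" for m
  proof -
    have "(\<Sum>i\<in>UNIV. cnj (coE x $ l $ bar i) * E i x $ m) = (\<Sum>i\<in>UNIV. cnj (coE x $ l $ i) * E (bar i) x $ m)"
      by (subst sum_bar[symmetric]) simp
    also have "\<dots> = cnj (\<Sum>i\<in>UNIV. coE x $ l $ i * E i x $ m)"
      using x by (simp add: E_bar cnj_vec_def)
    also have "\<dots> = (\<Sum>i\<in>UNIV. coE x $ l $ i * E i x $ m)" by (simp add: E_coE[OF x])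
    finally show ?thesis .
  qed
  from coeff_unique[OF x this, of k] show ?thesis by (metis complex_cnj_cnj)
qed

lemma bracket_expand: "x \<in> S \<Longrightarrow> (\<Sum>k\<in>UNIV. cs i j k x *s E k x) = lie_bracket (E i) (E j) x"
  unfolding cs_def by (rule expand_vec)

lemma diff_E: "x \<in> S \<Longrightarrow> E i differentiable (at x)" by (rule reg_differentiable[OF reg_E])

lemma lie_bracket_E: "x \<in> S \<Longrightarrow> lie_bracket (E i) (E j) x $ l
   = cder (\<lambda>y. E j y $ l) x (E i x) - cder (\<lambda>y. E i y $ l) x (E j x)"
  by (rule lie_bracket_nth) (auto intro: diff_E)

lemma reg_cs: "reg \<rho> S (cs i j k)"
proof -
  have "reg \<rho> S (\<lambda>x. \<Sum>l\<in>UNIV. (cder (\<lambda>y. E j y $ l) x (E i x) - cder (\<lambda>y. E i y $ l) x (E j x)) * coE x $ l $ k)"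
    by (intro reg_sum reg_mult reg_diff reg_cder reg_E_nth reg_E reg_coE S)
  then show ?thesis
    by (rule reg_cong[OF S]) (simp add: cs_def lie_bracket_E)
qed

lemma cs_skew: "x \<in> S \<Longrightarrow> cs i j k x = - cs j i k x"
  unfolding cs_def by (simp add: lie_bracket_E sum_negf[symmetric] left_diff_distrib)

end

text \<open>The Levi matrix is padded by the identity outside \<open>I\<close>, which makes it a
  square matrix over the index type with the same determinant as the block.\<close>

locale cr_pair = M: frame I t bar \<rho> S E + M': frame I t bar \<rho> S' E'
  for I :: "'n::finite set" and t :: 'n and bar :: "'n \<Rightarrow> 'n"
    and \<rho> :: regularity and S :: "(real^'n) set" and E :: "'n \<Rightarrow> real^'n \<Rightarrow> complex^'n"
    and S' :: "(real^'n) set" and E' :: "'n \<Rightarrow> real^'n \<Rightarrow> complex^'n" +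
  assumes levi_det: "x \<in> S \<Longrightarrow>
    det (\<chi> a b. if a \<in> I \<and> b \<in> I then M.cs a (bar b) t x else if a = b then 1 else 0) \<noteq> 0"
begin

definition q :: "(real^'n \<Rightarrow> real^'n) \<times> (real^'n) \<Rightarrow> (real^'n) \<times> (real^'n) \<times> (real^'n^'n)" where
  "q s = (case s of (f, x) \<Rightarrow> (x, f x, \<chi> k. frechet_derivative f (at x) (axis k 1)))"

text \<open>The differential in the two frames as a function of the 1-jet coordinates, for arbitrary
  1-jets; \<open>A\<close> is its value along a map.\<close>

definition Afun :: "'n \<Rightarrow> 'n \<Rightarrow> (real^'n) \<times> (real^'n) \<times> (real^'n^'n) \<Rightarrow> complex" where
  "Afun i j z = (\<Sum>l\<in>UNIV. (\<Sum>k\<in>UNIV. E i (fst z) $ k * of_real (snd (snd z) $ k $ l)) * M'.coE (fst (snd z)) $ l $ j)"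

definition V1 :: "((real^'n) \<times> (real^'n) \<times> (real^'n^'n)) set" where
  "V1 = {z. fst z \<in> S \<and> fst (snd z) \<in> S' \<and> det (\<chi> i j. Afun i j z) \<noteq> 0}"

definition A :: "'n \<Rightarrow> 'n \<Rightarrow> (real^'n \<Rightarrow> real^'n) \<times> (real^'n) \<Rightarrow> complex" where
  "A i j s = Afun i j (q s)"

text \<open>The CR condition enters as the vanishing of the components of (1,0) fields outside
  \<open>I\<close>; the corresponding statement for (0,1) fields follows by conjugation, as the map
  is real.\<close>

definition solution :: "(real^'n) set \<Rightarrow> (real^'n \<Rightarrow> real^'n) \<Rightarrow> bool" where
  "solution U f \<longleftrightarrow> open U \<and> U \<subseteq> S \<and> f ` U \<subseteq> S' \<and> reg Smooth U f \<and>
     (\<forall>x\<in>U. q (f, x) \<in> V1 \<and> (\<forall>i\<in>I. \<forall>j. j \<notin> I \<longrightarrow> A i j (f, x) = 0))"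

definition Dom :: "((real^'n \<Rightarrow> real^'n) \<times> (real^'n)) set" where
  "Dom = {(f, x). \<exists>U. x \<in> U \<and> solution U f}"

text \<open>The largest open set on which \<open>f\<close> is a solution. Derivations act on the
  point with \<open>f\<close> fixed, so functions on \<open>Dom\<close> are differentiated on
  \<open>dom f\<close>.\<close>

definition dom :: "(real^'n \<Rightarrow> real^'n) \<Rightarrow> (real^'n) set" where "dom f = {x. (f, x) \<in> Dom}"

lemma DomD: "x \<in> dom f \<Longrightarrow> (f, x) \<in> Dom" "(f, x) \<in> Dom \<Longrightarrow> x \<in> dom f" by (auto simp: dom_def)

lemma open_dom: "open (dom f)"
proof -
  have "dom f = \<Union>{U. solution U f}" by (auto simp: dom_def Dom_def)
  then show ?thesis by (auto simp: solution_def)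
qed

lemma reg_on_dom: "reg Smooth (dom f) f"
proof (rule reg_local[OF open_dom])
  fix x assume "x \<in> dom f"
  then obtain U where "x \<in> U" "solution U f" by (auto simp: dom_def Dom_def)
  moreover from this have "reg Smooth U f" "open U" by (auto simp: solution_def simp del: regular_on_open.simps)
  ultimately show "\<exists>U. open U \<and> x \<in> U \<and> reg Smooth (U \<inter> dom f) f"
    by (intro exI[of _ U]) (auto simp del: regular_on_open.simps intro: reg_subset)
qed

lemma dom_facts:
  assumes "x \<in> dom f"
  shows "x \<in> S" "f x \<in> S'" "q (f, x) \<in> V1" "\<And>i j. i \<in> I \<Longrightarrow> j \<notin> I \<Longrightarrow> A i j (f, x) = 0"
  using assms by (auto simp: dom_def Dom_def solution_def)

lemma diff_f: "x \<in> dom f \<Longrightarrow> f differentiable (at x)" by (rule reg_differentiable[OF reg_on_dom])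

abbreviation F :: "'n \<Rightarrow> (real^'n \<Rightarrow> real^'n) \<Rightarrow> real^'n \<Rightarrow> complex" where
  "F l f y \<equiv> complex_of_real (f y $ l)"

lemma frechet_F: "x \<in> dom f \<Longrightarrow> frechet_derivative (F l f) (at x) v = of_real (frechet_derivative f (at x) v $ l)"
  by (subst frechet_derivative_eq[OF bounded_linear.has_derivative[OF bounded_linear_of_real
      bounded_linear.has_derivative[OF bounded_linear_vec_nth has_derivative_frechet[OF diff_f]]]]) auto

lemma cder_F: "x \<in> dom f \<Longrightarrow> cder (F l f) x (E i x) = (\<Sum>j\<in>UNIV. A i j (f, x) * E' j (f x) $ l)"
proof -
  assume x: "x \<in> dom f"
  have "cder (F l f) x (E i x) = (\<chi> l. \<Sum>k\<in>UNIV. E i x $ k * of_real (frechet_derivative f (at x) (axis k 1) $ l)) $ l"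
    by (simp add: cder_def frechet_F[OF x])
  also have "\<dots> = (\<Sum>j\<in>UNIV. A i j (f, x) * E' j (f x) $ l)"
    by (rule trans[OF M'.expand[OF dom_facts(2)[OF x], symmetric]]) (simp add: A_def Afun_def q_def)
  finally show ?thesis .
qed

definition Sm :: "((real^'n \<Rightarrow> real^'n) \<times> (real^'n) \<Rightarrow> complex) \<Rightarrow> bool" where
  "Sm \<psi> \<longleftrightarrow> (\<forall>f. reg Smooth (dom f) (\<lambda>x. \<psi> (f, x)))"

definition \<delta> :: "'n \<Rightarrow> ((real^'n \<Rightarrow> real^'n) \<times> (real^'n) \<Rightarrow> complex) \<Rightarrow> (real^'n \<Rightarrow> real^'n) \<times> (real^'n) \<Rightarrow> complex" where
  "\<delta> i \<psi> s = (case s of (f, x) \<Rightarrow> cder (\<lambda>y. \<psi> (f, y)) x (E i x))"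

lemma SmD: "Sm \<psi> \<Longrightarrow> x \<in> dom f \<Longrightarrow> (\<lambda>y. \<psi> (f, y)) differentiable (at x)"
  unfolding Sm_def using reg_differentiable by blast

sublocale Sm: function_ring Dom Sm
proof
  fix f g :: "_ \<Rightarrow> complex" and c
  show "Sm g" if "Sm f" "\<And>s. s \<in> Dom \<Longrightarrow> f s = g s"
    unfolding Sm_def
  proof
    fix h
    show "reg Smooth (dom h) (\<lambda>x. g (h, x))"
      by (rule reg_cong[OF open_dom, of _ h "\<lambda>x. f (h, x)"]) (use that DomD in \<open>auto simp: Sm_def\<close>)
  qed
qed (auto simp: Sm_def simp del: regular_on_open.simps intro!: reg_add reg_mult reg_cnj open_dom)

lemma Sm_\<delta>: "Sm \<psi> \<Longrightarrow> Sm (\<delta> i \<psi>)"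
proof -
  assume \<psi>: "Sm \<psi>"
  have "reg Smooth (dom f) (E i)" for f
    by (rule reg_subset[OF M.Smooth_E]) (use dom_facts(1) in auto)
  then show ?thesis
    using \<psi> unfolding Sm_def \<delta>_def by (auto simp del: regular_on_open.simps intro!: reg_cder open_dom)
qed

lemma \<delta>_cong: "Sm f \<Longrightarrow> (\<And>s. s \<in> Dom \<Longrightarrow> f s = g s) \<Longrightarrow> s \<in> Dom \<Longrightarrow> \<delta> i f s = \<delta> i g s"
  unfolding \<delta>_def using DomD
  by (cases s) (auto intro!: cder_cong[OF open_dom] SmD)

lemma \<delta>_add: "Sm f \<Longrightarrow> Sm g \<Longrightarrow> s \<in> Dom \<Longrightarrow> \<delta> i (\<lambda>s. f s + g s) s = \<delta> i f s + \<delta> i g s"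
  unfolding \<delta>_def using DomD by (cases s) (auto intro!: cder_add SmD)

lemma \<delta>_mult: "Sm f \<Longrightarrow> Sm g \<Longrightarrow> s \<in> Dom \<Longrightarrow> \<delta> i (\<lambda>s. f s * g s) s = \<delta> i f s * g s + f s * \<delta> i g s"
  unfolding \<delta>_def using DomD by (cases s) (auto intro!: cder_mult SmD)

lemma \<delta>_sum: "(\<And>k. k \<in> K \<Longrightarrow> Sm (f k)) \<Longrightarrow> s \<in> Dom \<Longrightarrow> \<delta> i (\<lambda>s. \<Sum>k\<in>K. f k s) s = (\<Sum>k\<in>K. \<delta> i (f k) s)"
  unfolding \<delta>_def using DomD by (cases s) (auto intro!: cder_sum SmD)

lemma \<delta>_cnj: "Sm f \<Longrightarrow> s \<in> Dom \<Longrightarrow> \<delta> (bar i) (\<lambda>s. cnj (f s)) s = cnj (\<delta> i f s)"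
proof (cases s)
  case (Pair h x)
  assume f: "Sm f" and s: "s \<in> Dom"
  then have x: "x \<in> dom h" using Pair DomD by auto
  show ?thesis
    unfolding \<delta>_def Pair using cder_cnj[OF SmD[OF f x]] M.E_bar[OF dom_facts(1)[OF x]] by simp
qed

definition c :: "'n \<Rightarrow> 'n \<Rightarrow> 'n \<Rightarrow> (real^'n \<Rightarrow> real^'n) \<times> (real^'n) \<Rightarrow> complex" where
  "c i j k s = M.cs i j k (snd s)"

definition c' :: "'n \<Rightarrow> 'n \<Rightarrow> 'n \<Rightarrow> (real^'n \<Rightarrow> real^'n) \<times> (real^'n) \<Rightarrow> complex" where
  "c' i j k s = M'.cs i j k (fst s (snd s))"

lemma \<delta>_commute: "Sm f \<Longrightarrow> s \<in> Dom \<Longrightarrow> \<delta> i (\<delta> j f) s - \<delta> j (\<delta> i f) s = (\<Sum>k\<in>UNIV. c i j k s * \<delta> k f s)"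
proof (cases s)
  case (Pair h x)
  assume f: "Sm f" and s: "s \<in> Dom"
  then have x: "x \<in> dom h" using Pair DomD by auto
  have E: "reg Smooth (dom h) (E i)" for i
    by (rule reg_subset[OF M.Smooth_E]) (use dom_facts(1) in auto)
  have "\<delta> i (\<delta> j f) s - \<delta> j (\<delta> i f) s = cder (\<lambda>y. f (h, y)) x (lie_bracket (E i) (E j) x)"
    using cder_commute[OF open_dom _ E E x, of "\<lambda>y. f (h, y)" j i] f
    by (simp add: Pair \<delta>_def Sm_def del: regular_on_open.simps)
  also have "\<dots> = (\<Sum>k\<in>UNIV. c i j k s * \<delta> k f s)"
    unfolding M.bracket_expand[OF dom_facts(1)[OF x], symmetric] cder_linear(3)
    by (simp add: c_def \<delta>_def Pair)
  finally show ?thesis .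
qed

lemma open_V0: "open (S \<times> S' \<times> (UNIV :: (real^'n^'n) set))"
  using M.S M'.S by (intro open_Times) auto

lemma reg_compose_fst:
  "open V \<Longrightarrow> (\<And>z. z \<in> V \<Longrightarrow> fst z \<in> S) \<Longrightarrow> reg \<rho> S h \<Longrightarrow> reg \<rho> V (\<lambda>z :: (real^'n) \<times> 'q::euclidean_space. h (fst z))"
  for h :: "real^'n \<Rightarrow> 'v::euclidean_space"
  by (rule reg_compose[OF _ M.S _ reg_fst[OF _ reg_id]]) auto

lemma reg_compose_fst_snd:
  "open V \<Longrightarrow> (\<And>z. z \<in> V \<Longrightarrow> fst (snd z) \<in> S') \<Longrightarrow> reg \<rho> S' h \<Longrightarrow>
    reg \<rho> V (\<lambda>z :: 'p::euclidean_space \<times> (real^'n) \<times> 'q::euclidean_space. h (fst (snd z)))"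
  for h :: "real^'n \<Rightarrow> 'v::euclidean_space"
  by (rule reg_compose[OF _ M'.S _ reg_fst[OF _ reg_snd[OF _ reg_id]]]) auto

lemma reg_Afun0: "reg \<rho> (S \<times> S' \<times> UNIV) (Afun i j)"
  unfolding Afun_def[abs_def]
  by (intro reg_sum reg_mult open_V0 reg_compose_fst[where h = "\<lambda>x. E i x $ _"] M.reg_E_nth
      reg_compose_fst_snd[where h = "\<lambda>y. M'.coE y $ _ $ _"] M'.reg_coE reg_of_real
      reg_vec_nth reg_snd reg_id) auto

lemma open_V1: "open V1"
proof -
  have "continuous_on (S \<times> S' \<times> UNIV) (\<lambda>z. det (\<chi> i j. Afun i j z))"
    by (intro reg_continuous_on[of \<rho>] reg_det open_V0) (simp add: reg_Afun0 del: regular_on_open.simps)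
  then have "open ((\<lambda>z. det (\<chi> i j. Afun i j z)) -` (- {0}) \<inter> (S \<times> S' \<times> UNIV))"
    using open_V0 continuous_on_open_vimage by blast
  moreover have "((\<lambda>z. det (\<chi> i j. Afun i j z)) -` (- {0}) \<inter> (S \<times> S' \<times> UNIV)) = V1"
    by (auto simp: V1_def)
  ultimately show ?thesis by simp
qed

lemma V1_fst: "z \<in> V1 \<Longrightarrow> fst z \<in> S" "z \<in> V1 \<Longrightarrow> fst (snd z) \<in> S'"
  by (auto simp: V1_def)

lemma reg_Afun: "reg \<rho> V1 (Afun i j)"
  by (rule reg_subset[OF reg_Afun0]) (auto simp: V1_def mem_Times_iff)

abbreviation "D1 \<equiv> determined \<rho> Dom q V1"

lemma q_Dom: "q ` Dom \<subseteq> V1" using DomD dom_facts(3) by auto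

sublocale D1: function_ring Dom D1
  by (rule function_ring_determined[OF open_V1 q_Dom])

lemma D1I: "reg \<rho> V1 G \<Longrightarrow> D1 (\<lambda>s. G (q s))"
  unfolding determined_def using q_Dom by blast

lemma A_D1: "D1 (A i j)" unfolding A_def[abs_def] by (rule D1I[OF reg_Afun])

lemma D1_source:
  fixes h :: "real^'n \<Rightarrow> complex"
  assumes "reg \<rho> S h" shows "D1 (\<lambda>s. h (snd s))"
proof -
  have "reg \<rho> V1 (\<lambda>z. h (fst z))" by (rule reg_compose_fst[OF open_V1 V1_fst(1) assms])
  from D1I[OF this] show ?thesis by (rule D1.cong) (auto simp: q_def split: prod.splits)
qed

lemma D1_target:
  fixes h :: "real^'n \<Rightarrow> complex"
  assumes "reg \<rho> S' h" shows "D1 (\<lambda>s. h (fst s (snd s)))"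
proof -
  have "reg \<rho> V1 (\<lambda>z. h (fst (snd z)))" by (rule reg_compose_fst_snd[OF open_V1 V1_fst(2) assms])
  from D1I[OF this] show ?thesis by (rule D1.cong) (auto simp: q_def split: prod.splits)
qed

lemma c_D1: "D1 (c i j k)" unfolding c_def[abs_def] by (rule D1_source[OF M.reg_cs])
lemma c'_D1: "D1 (c' i j k)" unfolding c'_def[abs_def] by (rule D1_target[OF M'.reg_cs])

lemma \<delta>_source: "\<delta> i (\<lambda>s. h (snd s)) = (\<lambda>s. cder h (snd s) (E i (snd s)))"
  by (auto simp: \<delta>_def split: prod.splits)

text \<open>The chain rule through \<open>f\<close>, whose differential in the frames is
  \<open>A\<close>.\<close>

lemma \<delta>_target:
  assumes h: "reg \<rho> S' h" and s: "s \<in> Dom"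
  shows "\<delta> i (\<lambda>s. h (fst s (snd s))) s = (\<Sum>j\<in>UNIV. A i j s * cder h (fst s (snd s)) (E' j (fst s (snd s))))"
proof (cases s)
  case (Pair f x)
  then have x: "x \<in> dom f" using s DomD by auto
  have fx: "f x \<in> S'" by (rule dom_facts(2)[OF x])
  have "cder (\<lambda>y. h (f y)) x (E i x) = (\<Sum>l\<in>UNIV. cder (F l f) x (E i x) * frechet_derivative h (at (f x)) (axis l 1))"
    by (subst cder_chain[OF diff_f[OF x] reg_differentiable[OF h fx]])
      (auto simp: Basis_vec_def inner_axis sum.UNION_disjoint axis_eq_axis intro!: trans[OF sum.reindex] inj_onI)
  also have "\<dots> = (\<Sum>j\<in>UNIV. A i j (f, x) * cder h (f x) (E' j (f x)))"
    unfolding cder_F[OF x] unfolding cder_def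
    by (simp add: sum_distrib_left sum_distrib_right mult.assoc) (rule sum.swap)
  finally show ?thesis by (simp add: \<delta>_def Pair)
qed

end

section \<open>Verification of the prolongation hypotheses\<close>

context cr_pair begin

lemma D1_F: "D1 (\<lambda>s. F l (fst s) (snd s))"
proof -
  have "reg \<rho> V1 (\<lambda>z. complex_of_real (fst (snd z) $ l))"
    by (intro reg_of_real reg_vec_nth reg_fst reg_snd reg_id open_V1)
  from D1I[OF this] show ?thesis by (rule D1.cong) (auto simp: q_def split: prod.splits)
qed

lemma A_cnj: "s \<in> Dom \<Longrightarrow> A (bar i) (bar j) s = cnj (A i j s)"
proof (cases s)
  case (Pair f x)
  assume "s \<in> Dom"
  then have x: "x \<in> dom f" using Pair DomD by auto
  show ?thesis
    using M.E_bar[OF dom_facts(1)[OF x]] M'.coE_bar[OF dom_facts(2)[OF x]]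
    by (simp add: A_def Afun_def q_def Pair cnj_vec_def)
qed

lemma A_zero: "s \<in> Dom \<Longrightarrow> i \<in> I \<Longrightarrow> j \<notin> I \<Longrightarrow> A i j s = 0"
  using DomD dom_facts(4) by (cases s) auto

lemma A_zero_t: "s \<in> Dom \<Longrightarrow> i \<noteq> t \<Longrightarrow> A i t s = 0"
  using A_zero[of s i t] A_zero[of s "bar i" t] A_cnj[of s "bar i" t] M.index_cases[of i] M.t_notin by auto

text \<open>On \<open>V1\<close> the whole matrix is invertible, but its entry at \<open>t\<close>,
  \<open>t\<close> may vanish, as arbitrary jets need not respect H. The entry of the inverse matrix
  is regular on all of \<open>V1\<close> and equals the reciprocal along solutions, where the column
  \<open>t\<close> vanishes off \<open>t\<close>.\<close>

definition ai :: "(real^'n \<Rightarrow> real^'n) \<times> (real^'n) \<Rightarrow> complex" where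
  "ai s = minv (\<chi> i j. Afun i j (q s)) $ t $ t"

lemma ai_D1: "D1 ai"
  unfolding ai_def[abs_def]
  by (rule D1I[OF reg_minv[OF open_V1]]) (auto simp: V1_def reg_Afun[unfolded V1_def] simp del: regular_on_open.simps)

lemma ai: "s \<in> Dom \<Longrightarrow> ai s * A t t s = 1"
proof -
  assume s: "s \<in> Dom"
  then have "det (\<chi> i j. Afun i j (q s)) \<noteq> 0" using q_Dom by (auto simp: V1_def)
  from minv_sum(2)[OF this, of t t]
  have "(\<Sum>k\<in>UNIV. minv (\<chi> i j. Afun i j (q s)) $ t $ k * A k t s) = 1" by (simp add: A_def)
  also have "(\<Sum>k\<in>UNIV. minv (\<chi> i j. Afun i j (q s)) $ t $ k * A k t s) = ai s * A t t s"
    using A_zero_t[OF s] by (intro trans[OF sum.mono_neutral_right[of UNIV "{t}"]]) (auto simp: ai_def)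
  finally show ?thesis .
qed

definition Lmat :: "real^'n \<Rightarrow> complex^'n^'n" where
  "Lmat x = (\<chi> a b. if a \<in> I \<and> b \<in> I then M.cs a (bar b) t x else if a = b then 1 else 0)"

definition Ci :: "'n \<Rightarrow> 'n \<Rightarrow> (real^'n \<Rightarrow> real^'n) \<times> (real^'n) \<Rightarrow> complex" where
  "Ci a b s = minv (Lmat (snd s)) $ a $ b"

lemma Ci_D1: "D1 (Ci a b)"
  unfolding Ci_def[abs_def]
proof (rule D1_source, rule reg_minv[OF M.S])
  show "reg \<rho> S (\<lambda>x. Lmat x $ i $ j)" for i j
    using M.reg_cs by (cases "i \<in> I \<and> j \<in> I") (auto simp: Lmat_def simp del: regular_on_open.simps)
qed (auto simp: Lmat_def levi_det)

lemma Ci: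
  assumes s: "s \<in> Dom" and ab: "a \<in> I" "b \<in> I"
  shows "(\<Sum>e\<in>I. c a (bar e) t s * Ci e b s) = (if a = b then 1 else 0)"
    "(\<Sum>e\<in>I. Ci a e s * c e (bar b) t s) = (if a = b then 1 else 0)"
proof -
  have x: "snd s \<in> S" using dom_facts(1)[OF DomD(2), of "fst s" "snd s"] s by simp
  have d: "det (Lmat (snd s)) \<noteq> 0" using levi_det[OF x] by (simp add: Lmat_def)
  have "(\<Sum>k\<in>UNIV. Lmat (snd s) $ a $ k * minv (Lmat (snd s)) $ k $ b) = (\<Sum>e\<in>I. c a (bar e) t s * Ci e b s)"
    using ab by (intro trans[OF sum.mono_neutral_right[of UNIV I]]) (auto simp: Lmat_def c_def Ci_def)
  then show "(\<Sum>e\<in>I. c a (bar e) t s * Ci e b s) = (if a = b then 1 else 0)" using minv_sum(1)[OF d] by simp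
  have "(\<Sum>k\<in>UNIV. minv (Lmat (snd s)) $ a $ k * Lmat (snd s) $ k $ b) = (\<Sum>e\<in>I. Ci a e s * c e (bar b) t s)"
    using ab by (intro trans[OF sum.mono_neutral_right[of UNIV I]]) (auto simp: Lmat_def c_def Ci_def)
  then show "(\<Sum>e\<in>I. Ci a e s * c e (bar b) t s) = (if a = b then 1 else 0)" using minv_sum(2)[OF d] by simp
qed

lemma Smooth_q: "reg Smooth (dom f) (\<lambda>x. q (f, x))"
  unfolding q_def prod.case by (intro reg_Pair reg_vec_lambda reg_deriv reg_id reg_on_dom open_dom)

lemma determined_Sm:
  assumes V: "open V" and p: "\<And>f. reg Smooth (dom f) (\<lambda>x. p (f, x))" and \<psi>: "determined \<rho> Dom p V \<psi>"
  shows "Sm \<psi>"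
proof -
  obtain G where G: "reg \<rho> V G" and eq: "\<And>s. s \<in> Dom \<Longrightarrow> p s \<in> V \<and> \<psi> s = G (p s)"
    using \<psi> unfolding determined_def by blast
  have "reg Smooth (dom f) (\<lambda>x. \<psi> (f, x))" for f
    by (rule reg_cong[OF open_dom reg_compose[OF open_dom V _ p reg_imp_Smooth[OF V G]]])
      (use eq DomD in auto)
  then show ?thesis by (simp add: Sm_def)
qed

lemma D1_Sm: "D1 \<psi> \<Longrightarrow> Sm \<psi>"
  by (rule determined_Sm[OF open_V1 Smooth_q])

text \<open>The chain rule: partial derivatives of the representing function are again determined by
  \<open>p\<close>, so it suffices that the derivatives of the coordinates of \<open>p\<close> lie
  in \<open>R\<close>.\<close>

lemma chain_ring:
  fixes p :: "(real^'n \<Rightarrow> real^'n) \<times> (real^'n) \<Rightarrow> 'q::euclidean_space"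
  assumes R: "function_ring Dom R" and V: "open V"
    and p: "\<And>f. reg Smooth (dom f) (\<lambda>x. p (f, x))"
    and sub: "\<And>\<psi>. determined \<rho> Dom p V \<psi> \<Longrightarrow> R \<psi>"
    and b: "\<And>b. b \<in> Basis \<Longrightarrow> R (\<delta> i (\<lambda>s. of_real (p s \<bullet> b)))"
    and \<psi>: "determined \<rho> Dom p V \<psi>"
  shows "R (\<delta> i \<psi>)"
proof -
  interpret R: function_ring Dom R by (rule R)
  obtain G where G: "reg \<rho> V G" and eq: "\<And>s. s \<in> Dom \<Longrightarrow> p s \<in> V \<and> \<psi> s = G (p s)"
    using \<psi> unfolding determined_def by blast
  have "R (\<lambda>s. frechet_derivative G (at (p s)) b)" for b
    by (rule sub) (use eq reg_deriv[OF V G] in \<open>auto simp: determined_def\<close>)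
  then have "R (\<lambda>s. \<Sum>b\<in>Basis. \<delta> i (\<lambda>s. of_real (p s \<bullet> b)) s * frechet_derivative G (at (p s)) b)"
    by (intro R.sum R.mult b)
  then show ?thesis
  proof (rule R.cong)
    fix s assume s: "s \<in> Dom"
    obtain f x where fx: "s = (f, x)" by (cases s)
    then have x: "x \<in> dom f" using s DomD by auto
    have "\<delta> i \<psi> s = cder (\<lambda>y. G (p (f, y))) x (E i x)"
      unfolding \<delta>_def fx prod.case
      by (rule cder_cong[OF open_dom x SmD[OF determined_Sm[OF V p \<psi>] x]]) (use eq DomD in auto)
    also have "\<dots> = (\<Sum>b\<in>Basis. cder (\<lambda>x. of_real (p (f, x) \<bullet> b)) x (E i x) * frechet_derivative G (at (p (f, x))) b)"
      by (rule cder_chain[OF reg_differentiable[OF p x] reg_differentiable[OF G]]) (use eq s fx in auto)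
    finally show "(\<Sum>b\<in>Basis. \<delta> i (\<lambda>s. of_real (p s \<bullet> b)) s * frechet_derivative G (at (p s)) b) = \<delta> i \<psi> s"
      by (simp add: \<delta>_def fx)
  qed
qed

lemma partial_\<delta>:
  assumes s: "(f, x) \<in> Dom"
  shows "frechet_derivative (\<lambda>y. \<psi> (f, y)) (at x) (axis k 1) = (\<Sum>i\<in>UNIV. M.coE x $ k $ i * \<delta> i \<psi> (f, x))"
proof -
  have x: "x \<in> S" by (rule dom_facts(1)[OF DomD(2)[OF s]])
  have "(\<Sum>i\<in>UNIV. M.coE x $ k $ i * \<delta> i \<psi> (f, x))
    = (\<Sum>l\<in>UNIV. (\<Sum>i\<in>UNIV. M.coE x $ k $ i * E i x $ l) * frechet_derivative (\<lambda>y. \<psi> (f, y)) (at x) (axis l 1))"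
    unfolding \<delta>_def cder_def prod.case
    by (simp add: sum_distrib_left sum_distrib_right mult.assoc) (rule sum.swap)
  also have "\<dots> = (\<Sum>l\<in>UNIV. if k = l then frechet_derivative (\<lambda>y. \<psi> (f, y)) (at x) (axis l 1) else 0)"
    by (intro sum.cong refl) (simp add: M.E_coE[OF x])
  finally show ?thesis by simp
qed

lemma \<delta>_F: "s \<in> Dom \<Longrightarrow> \<delta> i (\<lambda>s. F l (fst s) (snd s)) s = (\<Sum>j\<in>UNIV. A i j s * E' j (fst s (snd s)) $ l)"
  using cder_F DomD by (cases s) (auto simp: \<delta>_def)

lemma D1_E': "D1 (\<lambda>s. E' j (fst s (snd s)) $ l)"
  by (rule D1_target[OF M'.reg_E_nth])

lemma D1_coE: "D1 (\<lambda>s. M.coE (snd s) $ k $ l)"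
  by (rule D1_source[OF M.reg_coE])

lemma D1_\<delta>_F: "D1 (\<delta> i (\<lambda>s. F l (fst s) (snd s)))"
proof -
  have "D1 (\<lambda>s. \<Sum>j\<in>UNIV. A i j s * E' j (fst s (snd s)) $ l)" by (intro D1.sum D1.mult A_D1 D1_E')
  then show ?thesis by (rule D1.cong) (simp add: \<delta>_F)
qed

definition Pc :: "'n \<Rightarrow> 'n \<Rightarrow> (real^'n \<Rightarrow> real^'n) \<times> (real^'n) \<Rightarrow> complex" where
  "Pc k l s = of_real (snd (snd (q s)) $ k $ l)"

lemma Pc_eq: "s \<in> Dom \<Longrightarrow> Pc k l s = (\<Sum>i\<in>UNIV. M.coE (snd s) $ k $ i * (\<Sum>j\<in>UNIV. A i j s * E' j (fst s (snd s)) $ l))"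
proof (cases s)
  case (Pair f x)
  assume s: "s \<in> Dom"
  then have x: "x \<in> dom f" using Pair DomD by auto
  have "Pc k l s = frechet_derivative (F l f) (at x) (axis k 1)"
    by (simp add: Pc_def q_def Pair frechet_F[OF x])
  also have "\<dots> = (\<Sum>i\<in>UNIV. M.coE x $ k $ i * \<delta> i (\<lambda>s. F l (fst s) (snd s)) (f, x))"
    using partial_\<delta>[of f x "\<lambda>s. F l (fst s) (snd s)" k] s Pair by simp
  finally show ?thesis using \<delta>_F[OF s] Pair by simp
qed

lemma Basis_vec_cases: "b \<in> (Basis :: (real^'n) set) \<Longrightarrow> \<exists>l. b = axis l 1"
  "B \<in> (Basis :: (real^'n^'n) set) \<Longrightarrow> \<exists>k l. B = axis k (axis l 1)"
  by (auto simp: Basis_vec_def)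

lemma q_Basis:
  assumes "b \<in> Basis"
  obtains l where "(\<lambda>s. complex_of_real (q s \<bullet> b)) = (\<lambda>s. complex_of_real (snd s $ l))"
  | l where "(\<lambda>s. complex_of_real (q s \<bullet> b)) = (\<lambda>s. F l (fst s) (snd s))"
  | k l where "(\<lambda>s. complex_of_real (q s \<bullet> b)) = Pc k l"
proof -
  consider u where "u \<in> Basis" "b = (u, 0, 0)" | u where "u \<in> Basis" "b = (0, u, 0)" | u where "u \<in> Basis" "b = (0, 0, u)"
    using assms by (auto simp: Basis_prod_def zero_prod_def)
  then show thesis
  proof cases
    case 1
    with Basis_vec_cases(1) obtain l where "b = (axis l 1, 0, 0)" by blast
    then show thesis by (intro that(1)[of l]) (auto simp: q_def inner_axis split: prod.splits)
  next
    case 2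
    with Basis_vec_cases(1) obtain l where "b = (0, axis l 1, 0)" by blast
    then show thesis by (intro that(2)[of l]) (auto simp: q_def inner_axis split: prod.splits)
  next
    case 3
    with Basis_vec_cases(2) obtain k l where "b = (0, 0, axis k (axis l 1))" by blast
    then show thesis by (intro that(3)[of k l]) (auto simp: q_def Pc_def inner_axis split: prod.splits)
  qed
qed

lemma reg_coord_source: "reg \<rho> S (\<lambda>x. complex_of_real (x $ l))"
  by (intro reg_of_real reg_vec_nth reg_id M.S)

lemma D1_\<delta>_source:
  fixes h :: "real^'n \<Rightarrow> complex"
  assumes "reg \<rho> S h"
  shows "D1 (\<delta> i (\<lambda>s. h (snd s)))"
  unfolding \<delta>_source by (rule D1_source) (intro reg_cder assms M.S M.reg_E)

text \<open>Derivatives of the source and target coordinates are functions of the 1-jet; among the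
  1-jet coordinates only the Jacobian entries \<open>Pc\<close> have new derivatives.\<close>

lemma \<delta>_D1_ring:
  assumes R: "function_ring Dom R" and sub: "\<And>\<psi>. D1 \<psi> \<Longrightarrow> R \<psi>"
    and Pc: "\<And>k l. R (\<delta> i (Pc k l))" and f: "D1 f"
  shows "R (\<delta> i f)"
proof (rule chain_ring[OF R open_V1 Smooth_q sub _ f])
  fix b :: "(real^'n) \<times> (real^'n) \<times> (real^'n^'n)" assume b: "b \<in> Basis"
  show "R (\<delta> i (\<lambda>s. complex_of_real (q s \<bullet> b)))"
    using q_Basis[OF b]
  proof cases
    case (1 l)
    then show ?thesis using sub[OF D1_\<delta>_source[OF reg_coord_source]] by simp
  next
    case (2 l)
    then show ?thesis using sub[OF D1_\<delta>_F] by simp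
  next
    case (3 k l)
    then show ?thesis using Pc by simp
  qed
qed

text \<open>The Jacobian is the matrix \<open>A\<close> multiplied by the frames on both sides, so
  its derivatives are obtained from those of \<open>A\<close> and from known factors.\<close>

lemma Pc_ring:
  assumes R: "function_ring Dom R" and sub: "\<And>\<psi>. D1 \<psi> \<Longrightarrow> R \<psi>"
    and dA: "\<And>j k. R (\<delta> i (A j k))"
  shows "R (\<delta> i (Pc k l))"
proof -
  interpret R: function_ring Dom R by (rule R)
  have coE: "Sm (\<lambda>s. M.coE (snd s) $ k $ j)" for j by (rule D1_Sm[OF D1_coE])
  have E'S: "Sm (\<lambda>s. E' j (fst s (snd s)) $ l)" for j by (rule D1_Sm[OF D1_E'])
  have AS: "Sm (A m j)" for m j by (rule D1_Sm[OF A_D1])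
  have dcoE: "R (\<delta> i (\<lambda>s. M.coE (snd s) $ k $ j))" for j
    by (rule sub[OF D1_\<delta>_source[OF M.reg_coE]])
  have dE': "R (\<delta> i (\<lambda>s. E' j (fst s (snd s)) $ l))" for j
  proof -
    have "D1 (\<lambda>s. \<Sum>m\<in>UNIV. A i m s * cder (\<lambda>y. E' j y $ l) (fst s (snd s)) (E' m (fst s (snd s))))"
      by (intro D1.sum D1.mult A_D1 D1_target[where h = "\<lambda>y. cder (\<lambda>y. E' j y $ l) y (E' _ y)"]
        reg_cder M'.S M'.reg_E M'.reg_E_nth)
    from sub[OF this] show ?thesis by (rule R.cong) (simp add: \<delta>_target[OF M'.reg_E_nth])
  qed
  have "R (\<lambda>s. \<Sum>m\<in>UNIV. \<delta> i (\<lambda>s. M.coE (snd s) $ k $ m) s * (\<Sum>j\<in>UNIV. A m j s * E' j (fst s (snd s)) $ l)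
     + M.coE (snd s) $ k $ m * (\<Sum>j\<in>UNIV. \<delta> i (A m j) s * E' j (fst s (snd s)) $ l
        + A m j s * \<delta> i (\<lambda>s. E' j (fst s (snd s)) $ l) s))"
    by (intro R.sum R.add R.mult dcoE dE' dA sub[OF A_D1] sub[OF D1_E'] sub[OF D1_coE])
  then show ?thesis
  proof (rule R.cong)
    fix s assume s: "s \<in> Dom"
    have "\<delta> i (Pc k l) s = \<delta> i (\<lambda>s. \<Sum>m\<in>UNIV. M.coE (snd s) $ k $ m * (\<Sum>j\<in>UNIV. A m j s * E' j (fst s (snd s)) $ l)) s"
    proof (rule \<delta>_cong[symmetric, OF _ _ s])
      show "Sm (\<lambda>s. \<Sum>m\<in>UNIV. M.coE (snd s) $ k $ m * (\<Sum>j\<in>UNIV. A m j s * E' j (fst s (snd s)) $ l))"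
        by (intro Sm.sum Sm.mult coE AS E'S)
    qed (simp add: Pc_eq)
    also have "\<dots> = (\<Sum>m\<in>UNIV. \<delta> i (\<lambda>s. M.coE (snd s) $ k $ m) s * (\<Sum>j\<in>UNIV. A m j s * E' j (fst s (snd s)) $ l)
     + M.coE (snd s) $ k $ m * (\<Sum>j\<in>UNIV. \<delta> i (A m j) s * E' j (fst s (snd s)) $ l
        + A m j s * \<delta> i (\<lambda>s. E' j (fst s (snd s)) $ l) s))"
      using s coE AS E'S by (simp add: \<delta>_sum \<delta>_mult Sm.sum Sm.mult)
    finally show "(\<Sum>m\<in>UNIV. \<delta> i (\<lambda>s. M.coE (snd s) $ k $ m) s * (\<Sum>j\<in>UNIV. A m j s * E' j (fst s (snd s)) $ l)
     + M.coE (snd s) $ k $ m * (\<Sum>j\<in>UNIV. \<delta> i (A m j) s * E' j (fst s (snd s)) $ l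
        + A m j s * \<delta> i (\<lambda>s. E' j (fst s (snd s)) $ l) s)) = \<delta> i (Pc k l) s" by simp
  qed
qed

text \<open>The commutator of \<open>E i\<close> and \<open>E j\<close> is applied to the components
  of the map. Both sides are expanded in the target frame, where coefficients are unique.\<close>

lemma bracket:
  assumes s: "s \<in> Dom"
  shows "\<delta> i (A j k) s - \<delta> j (A i k) s =
      (\<Sum>p\<in>UNIV. c i j p s * A p k s) - (\<Sum>p\<in>UNIV. \<Sum>r\<in>UNIV. A i p s * A j r s * c' p r k s)"
proof -
  obtain f x where fx: "s = (f, x)" by (cases s)
  then have x: "x \<in> dom f" using s DomD by auto
  have y: "f x \<in> S'" by (rule dom_facts(2)[OF x])
  \<comment> \<open>Leibniz rule for the components of \<open>f\<close>; the second sum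
    differentiates the target frame along the image of \<open>E a\<close>.\<close>
  have e: "\<delta> a (\<delta> b (\<lambda>s. F l (fst s) (snd s))) s = (\<Sum>k\<in>UNIV. \<delta> a (A b k) s * E' k (f x) $ l)
      + (\<Sum>k\<in>UNIV. \<Sum>p\<in>UNIV. A b k s * A a p s * cder (\<lambda>y. E' k y $ l) (f x) (E' p (f x)))" for a b l
  proof -
    have "\<delta> a (\<delta> b (\<lambda>s. F l (fst s) (snd s))) s = \<delta> a (\<lambda>s. \<Sum>k\<in>UNIV. A b k s * E' k (fst s (snd s)) $ l) s"
      by (rule \<delta>_cong[OF D1_Sm[OF D1_\<delta>_F] \<delta>_F s])
    also have "\<dots> = (\<Sum>k\<in>UNIV. \<delta> a (A b k) s * E' k (f x) $ l + A b k s * \<delta> a (\<lambda>s. E' k (fst s (snd s)) $ l) s)"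
      using s by (simp add: \<delta>_sum \<delta>_mult Sm.mult D1_Sm[OF A_D1] D1_Sm[OF D1_E'] fx)
    finally show ?thesis
      using \<delta>_target[OF M'.reg_E_nth s] by (simp add: sum.distrib sum_distrib_left fx mult.assoc)
  qed
  have "(\<Sum>k\<in>UNIV. (\<delta> i (A j k) s - \<delta> j (A i k) s + (\<Sum>p\<in>UNIV. \<Sum>r\<in>UNIV. A i p s * A j r s * c' p r k s)) * E' k (f x) $ l)
     = (\<Sum>k\<in>UNIV. (\<Sum>p\<in>UNIV. c i j p s * A p k s) * E' k (f x) $ l)" for l
  proof -
    have "(\<Sum>k\<in>UNIV. (\<Sum>p\<in>UNIV. c i j p s * A p k s) * E' k (f x) $ l)
      = (\<Sum>p\<in>UNIV. c i j p s * (\<Sum>k\<in>UNIV. A p k s * E' k (f x) $ l))"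
      by (simp add: sum_distrib_left sum_distrib_right mult.assoc) (rule sum.swap)
    also have "\<dots> = \<delta> i (\<delta> j (\<lambda>s. F l (fst s) (snd s))) s - \<delta> j (\<delta> i (\<lambda>s. F l (fst s) (snd s))) s"
      using \<delta>_commute[OF D1_Sm[OF D1_F] s, of i j l] \<delta>_F[OF s, of _ l] by (simp add: fx)
    also have "\<dots> = (\<Sum>k\<in>UNIV. (\<delta> i (A j k) s - \<delta> j (A i k) s) * E' k (f x) $ l)
       + (\<Sum>p\<in>UNIV. \<Sum>r\<in>UNIV. A i p s * A j r s *
         (cder (\<lambda>y. E' r y $ l) (f x) (E' p (f x)) - cder (\<lambda>y. E' p y $ l) (f x) (E' r (f x))))"
      unfolding e
      by (subst sum.swap[of "\<lambda>k p. A j k s * A i p s * _ k p"])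
        (simp add: left_diff_distrib right_diff_distrib sum_subtractf mult_ac)
    also have "(\<Sum>p\<in>UNIV. \<Sum>r\<in>UNIV. A i p s * A j r s *
         (cder (\<lambda>y. E' r y $ l) (f x) (E' p (f x)) - cder (\<lambda>y. E' p y $ l) (f x) (E' r (f x))))
      = (\<Sum>p\<in>UNIV. \<Sum>r\<in>UNIV. A i p s * A j r s * (\<Sum>k\<in>UNIV. c' p r k s * E' k (f x) $ l))"
    proof (intro sum.cong refl arg_cong2[of _ _ _ _ "(*)"])
      fix p r
      have "(\<Sum>k\<in>UNIV. M'.cs p r k (f x) *s E' k (f x)) $ l = lie_bracket (E' p) (E' r) (f x) $ l"
        unfolding M'.bracket_expand[OF y] ..
      then show "cder (\<lambda>y. E' r y $ l) (f x) (E' p (f x)) - cder (\<lambda>y. E' p y $ l) (f x) (E' r (f x))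
        = (\<Sum>k\<in>UNIV. c' p r k s * E' k (f x) $ l)"
        by (simp add: M'.lie_bracket_E[OF y] c'_def fx)
    qed
    also have "\<dots> = (\<Sum>k\<in>UNIV. (\<Sum>p\<in>UNIV. \<Sum>r\<in>UNIV. A i p s * A j r s * c' p r k s) * E' k (f x) $ l)"
    proof -
      have "(\<Sum>p\<in>UNIV. \<Sum>r\<in>UNIV. A i p s * A j r s * (\<Sum>k\<in>UNIV. c' p r k s * E' k (f x) $ l))
        = (\<Sum>p\<in>UNIV. \<Sum>k\<in>UNIV. \<Sum>r\<in>UNIV. A i p s * A j r s * c' p r k s * E' k (f x) $ l)"
      proof (rule sum.cong[OF refl])
        fix p
        show "(\<Sum>r\<in>UNIV. A i p s * A j r s * (\<Sum>k\<in>UNIV. c' p r k s * E' k (f x) $ l))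
          = (\<Sum>k\<in>UNIV. \<Sum>r\<in>UNIV. A i p s * A j r s * c' p r k s * E' k (f x) $ l)"
          by (simp add: sum_distrib_left mult.assoc) (rule sum.swap)
      qed
      also have "\<dots> = (\<Sum>k\<in>UNIV. \<Sum>p\<in>UNIV. \<Sum>r\<in>UNIV. A i p s * A j r s * c' p r k s * E' k (f x) $ l)"
        by (rule sum.swap)
      finally show ?thesis by (simp add: sum_distrib_right)
    qed
    finally show ?thesis by (simp add: distrib_right sum.distrib)
  qed
  from M'.coeff_unique[OF y this, of k] show ?thesis by (simp add: algebra_simps)
qed

text \<open>The real part makes \<open>\<tau>\<close> a single real coordinate of \<open>q2\<close>;
  nothing is lost, as the derivative is real along solutions because
  \<open>bar t = t\<close>.\<close>

definition \<tau> :: "(real^'n \<Rightarrow> real^'n) \<times> (real^'n) \<Rightarrow> complex" where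
  "\<tau> s = of_real (Re (\<delta> t (A t t) s))"

definition q2 :: "(real^'n \<Rightarrow> real^'n) \<times> (real^'n) \<Rightarrow> ((real^'n) \<times> (real^'n) \<times> (real^'n^'n)) \<times> real" where
  "q2 s = (q s, Re (\<delta> t (A t t) s))"

abbreviation "D2 \<equiv> determined \<rho> Dom q2 (V1 \<times> UNIV)"

lemma open_V2: "open (V1 \<times> (UNIV :: real set))"
  by (intro open_Times open_V1) auto

lemma q2_Dom: "q2 ` Dom \<subseteq> V1 \<times> UNIV" using q_Dom by (auto simp: q2_def)

sublocale D2: function_ring Dom D2
  by (rule function_ring_determined[OF open_V2 q2_Dom])

lemma Smooth_q2: "reg Smooth (dom f) (\<lambda>x. q2 (f, x))"
  unfolding q2_def
  by (intro reg_Pair Smooth_q open_dom reg_Re) (use Sm_\<delta>[OF D1_Sm[OF A_D1]] in \<open>simp add: Sm_def del: regular_on_open.simps\<close>)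

lemma D12: "D1 \<psi> \<Longrightarrow> D2 \<psi>" for \<psi> :: "_ \<Rightarrow> complex"
proof -
  assume "D1 \<psi>"
  then obtain G where G: "reg \<rho> V1 G" "\<And>s. s \<in> Dom \<Longrightarrow> q s \<in> V1 \<and> \<psi> s = G (q s)"
    unfolding determined_def by blast
  have "reg \<rho> (V1 \<times> (UNIV :: real set)) (\<lambda>z. G (fst z))"
    by (rule reg_compose[OF open_V2 open_V1 _ reg_fst[OF open_V2 reg_id[OF open_V2]] G(1)]) auto
  then show "D2 \<psi>" unfolding determined_def using G(2) by (intro exI[of _ "\<lambda>z. G (fst z)"]) (auto simp: q2_def)
qed

lemma D2_Sm: "D2 \<psi> \<Longrightarrow> Sm \<psi>"
  by (rule determined_Sm[OF open_V2 Smooth_q2])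

lemma D2_\<tau>: "D2 \<tau>"
proof -
  have "reg \<rho> (V1 \<times> UNIV) (\<lambda>z. complex_of_real (snd z))"
    by (intro reg_of_real reg_snd reg_id open_V2)
  then show ?thesis unfolding determined_def using q2_Dom
    by (intro exI[of _ "\<lambda>z. complex_of_real (snd z)"]) (auto simp: q2_def \<tau>_def)
qed

lemma \<tau>: "s \<in> Dom \<Longrightarrow> \<tau> s = \<delta> t (A t t) s"
proof -
  assume s: "s \<in> Dom"
  have "cnj (\<delta> t (A t t) s) = \<delta> t (\<lambda>s. cnj (A t t s)) s"
    using \<delta>_cnj[OF D1_Sm[OF A_D1] s, of t t t] by simp
  also have "\<dots> = \<delta> t (A t t) s"
    using A_cnj[of _ t t] by (intro \<delta>_cong[OF _ _ s]) (auto intro: Sm.conj D1_Sm A_D1)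
  finally show ?thesis by (simp add: \<tau>_def complex_eq_iff)
qed

lemma \<delta>_D1:
  assumes "\<And>j k. D2 (\<delta> i (A j k))" "D1 f" shows "D2 (\<delta> i f)"
  by (rule \<delta>_D1_ring[OF D2.function_ring_axioms D12 Pc_ring[OF D2.function_ring_axioms D12 assms(1)] assms(2)])

lemma \<delta>_D2:
  assumes A: "\<And>j k. D2 (\<delta> i (A j k))" and \<tau>: "D2 (\<delta> i \<tau>)" and f: "D2 f"
  shows "D2 (\<delta> i f)"
proof (rule chain_ring[OF D2.function_ring_axioms open_V2 Smooth_q2 _ _ f])
  fix b :: "((real^'n) \<times> (real^'n) \<times> (real^'n^'n)) \<times> real" assume "b \<in> Basis"
  then consider u where "u \<in> Basis" "b = (u, 0)" | "b = (0, 1)"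
    by (auto simp: Basis_prod_def)
  then show "D2 (\<delta> i (\<lambda>s. complex_of_real (q2 s \<bullet> b)))"
  proof cases
    case (1 u)
    have "D1 (\<lambda>s. complex_of_real (q s \<bullet> u))"
      by (rule D1I[of "\<lambda>z. complex_of_real (z \<bullet> u)"]) (intro reg_of_real reg_coord open_V1 1)
    from \<delta>_D1[OF A this] show ?thesis using 1 by (simp add: q2_def)
  next
    case 2
    then show ?thesis using \<tau> by (simp add: q2_def \<tau>_def[abs_def])
  qed
qed

lemma cr_prolongation: "cr_prolongation Dom Sm D1 D2 I t bar \<delta> A ai c c' Ci \<tau>"
proof
  fix f g :: "(real^'n \<Rightarrow> real^'n) \<times> (real^'n) \<Rightarrow> complex" and s i j k l m a b w
  show "D1 f \<Longrightarrow> D2 f" by (rule D12)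
  show "D2 f \<Longrightarrow> Sm f" by (rule D2_Sm)
  show "bar (bar i) = i" "bar t = t" "t \<notin> I" "I \<noteq> {}" by (auto simp: M.t_notin M.I_nonempty)
  show "i \<in> I \<Longrightarrow> bar i \<notin> I" by (rule M.bar_I)
  show "i = t \<or> i \<in> I \<or> bar i \<in> I" by (rule M.index_cases)
  show "Sm f \<Longrightarrow> Sm (\<delta> i f)" by (rule Sm_\<delta>)
  show "Sm f \<Longrightarrow> (\<And>s. s \<in> Dom \<Longrightarrow> f s = g s) \<Longrightarrow> s \<in> Dom \<Longrightarrow> \<delta> i f s = \<delta> i g s" by (rule \<delta>_cong)
  show "Sm f \<Longrightarrow> Sm g \<Longrightarrow> s \<in> Dom \<Longrightarrow> \<delta> i (\<lambda>s. f s + g s) s = \<delta> i f s + \<delta> i g s" by (rule \<delta>_add)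
  show "Sm f \<Longrightarrow> Sm g \<Longrightarrow> s \<in> Dom \<Longrightarrow> \<delta> i (\<lambda>s. f s * g s) s = \<delta> i f s * g s + f s * \<delta> i g s" by (rule \<delta>_mult)
  show "\<delta> i (\<lambda>s. w) s = 0" by (cases s) (simp add: \<delta>_def cder_const)
  show "Sm f \<Longrightarrow> s \<in> Dom \<Longrightarrow> \<delta> (bar i) (\<lambda>s. cnj (f s)) s = cnj (\<delta> i f s)" by (rule \<delta>_cnj)
  show "Sm f \<Longrightarrow> s \<in> Dom \<Longrightarrow> \<delta> i (\<delta> j f) s - \<delta> j (\<delta> i f) s = (\<Sum>k\<in>UNIV. c i j k s * \<delta> k f s)" by (rule \<delta>_commute)
  show "D1 (A i j)" "D1 ai" "D1 (c i j k)" "D1 (c' i j k)" "D1 (Ci i j)"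
    by (rule A_D1 ai_D1 c_D1 c'_D1 Ci_D1)+
  have cs': "reg \<rho> S (\<lambda>x. cder (M.cs i j k) x (E l x))" by (intro reg_cder M.S M.reg_cs M.reg_E)
  show "D1 (\<delta> l (c i j k))" unfolding c_def[abs_def] by (rule D1_\<delta>_source[OF M.reg_cs])
  show "D1 (\<delta> m (\<delta> l (c i j k)))" unfolding c_def[abs_def] \<delta>_source[of l] by (rule D1_\<delta>_source[OF cs'])
  have c'1: "D1 (\<lambda>s. cder (M'.cs i j k) (fst s (snd s)) (E' n (fst s (snd s))))" for n
    by (rule D1_target[where h = "\<lambda>y. cder (M'.cs i j k) y (E' n y)"]) (intro reg_cder M'.S M'.reg_cs M'.reg_E)
  have c'2: "D1 (\<delta> m (\<lambda>s. cder (M'.cs i j k) (fst s (snd s)) (E' n (fst s (snd s)))))" for n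
  proof -
    let ?h = "\<lambda>y. cder (M'.cs i j k) y (E' n y)"
    have h: "reg \<rho> S' ?h" by (intro reg_cder M'.S M'.reg_cs M'.reg_E)
    have "D1 (\<lambda>s. \<Sum>p\<in>UNIV. A m p s * cder ?h (fst s (snd s)) (E' p (fst s (snd s))))"
      by (intro D1.sum D1.mult A_D1 D1_target[where h = "\<lambda>y. cder ?h y (E' _ y)"] reg_cder h M'.S M'.reg_E M'.reg_cs)
    then show ?thesis by (rule D1.cong) (simp add: \<delta>_target[OF h])
  qed
  have c'3: "\<delta> l (c' i j k) s = (\<Sum>n\<in>UNIV. A l n s * cder (M'.cs i j k) (fst s (snd s)) (E' n (fst s (snd s))))"
    if "s \<in> Dom" for s
    unfolding c'_def[abs_def] by (rule \<delta>_target[OF M'.reg_cs that])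
  have "D1 (\<lambda>s. \<Sum>n\<in>UNIV. A l n s * cder (M'.cs i j k) (fst s (snd s)) (E' n (fst s (snd s))))"
    by (intro D1.sum D1.mult A_D1 c'1)
  then show "D1 (\<delta> l (c' i j k))" by (rule D1.cong) (simp add: c'3)
  show "D1 (\<delta> m (\<delta> l (c' i j k)))" if "\<And>n. D1 (\<delta> m (A l n))"
  proof -
    have "D1 (\<lambda>s. \<Sum>n\<in>UNIV. \<delta> m (A l n) s * cder (M'.cs i j k) (fst s (snd s)) (E' n (fst s (snd s)))
        + A l n s * \<delta> m (\<lambda>s. cder (M'.cs i j k) (fst s (snd s)) (E' n (fst s (snd s)))) s)"
      by (intro D1.sum D1.add D1.mult that A_D1 c'1 c'2)
    then show ?thesis
    proof (rule D1.cong)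
      fix s assume s: "s \<in> Dom"
      have "\<delta> m (\<delta> l (c' i j k)) s =
          \<delta> m (\<lambda>s. \<Sum>n\<in>UNIV. A l n s * cder (M'.cs i j k) (fst s (snd s)) (E' n (fst s (snd s)))) s"
        by (rule \<delta>_cong[OF Sm_\<delta>[OF D1_Sm[OF c'_D1]] c'3 s])
      then show "(\<Sum>n\<in>UNIV. \<delta> m (A l n) s * cder (M'.cs i j k) (fst s (snd s)) (E' n (fst s (snd s)))
        + A l n s * \<delta> m (\<lambda>s. cder (M'.cs i j k) (fst s (snd s)) (E' n (fst s (snd s)))) s) = \<delta> m (\<delta> l (c' i j k)) s"
        using s by (simp add: \<delta>_sum \<delta>_mult Sm.mult D1_Sm[OF A_D1] D1_Sm[OF c'1])
    qed
  qed
  show "s \<in> Dom \<Longrightarrow> A (bar i) (bar j) s = cnj (A i j s)" by (rule A_cnj)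
  show "s \<in> Dom \<Longrightarrow> i \<in> I \<Longrightarrow> j \<notin> I \<Longrightarrow> A i j s = 0" by (rule A_zero)
  show "s \<in> Dom \<Longrightarrow> ai s * A t t s = 1" by (rule ai)
  show "s \<in> Dom \<Longrightarrow> a \<in> I \<Longrightarrow> b \<in> I \<Longrightarrow> (\<Sum>e\<in>I. c a (bar e) t s * Ci e b s) = (if a = b then 1 else 0)" by (rule Ci)
  show "s \<in> Dom \<Longrightarrow> a \<in> I \<Longrightarrow> b \<in> I \<Longrightarrow> (\<Sum>e\<in>I. Ci a e s * c e (bar b) t s) = (if a = b then 1 else 0)" by (rule Ci)
  show "c' i j k s = - c' j i k s" if "s \<in> Dom"
    unfolding c'_def using dom_facts(2)[OF DomD(2), of "fst s" "snd s"] that by (intro M'.cs_skew) simp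
  show "s \<in> Dom \<Longrightarrow> \<delta> i (A j k) s - \<delta> j (A i k) s =
      (\<Sum>p\<in>UNIV. c i j p s * A p k s) - (\<Sum>p\<in>UNIV. \<Sum>q\<in>UNIV. A i p s * A j q s * c' p q k s)" by (rule bracket)
  show "s \<in> Dom \<Longrightarrow> \<tau> s = \<delta> t (A t t) s" by (rule \<tau>)
  show "D2 \<tau>" by (rule D2_\<tau>)
  show "(\<And>j k. D2 (\<delta> i (A j k))) \<Longrightarrow> D1 f \<Longrightarrow> D2 (\<delta> i f)" by (rule \<delta>_D1)
  show "(\<And>j k. D2 (\<delta> i (A j k))) \<Longrightarrow> D2 (\<delta> i \<tau>) \<Longrightarrow> D2 f \<Longrightarrow> D2 (\<delta> i f)" by (rule \<delta>_D2)
qed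

text \<open>All derivatives of \<open>A\<close> and of \<open>\<tau>\<close> lie in
  \<open>D2\<close>, so this ring is stable under differentiation: the system is closed.\<close>

lemma D2_\<delta>: "D2 f \<Longrightarrow> D2 (\<delta> i f)"
  by (rule \<delta>_D2[OF cr_prolongation.D2_\<delta>A_all[OF cr_prolongation] cr_prolongation.D2_\<delta>\<tau>_all[OF cr_prolongation]])

section \<open>Third derivatives as functions of the 2-jet\<close>

definition part :: "'n \<Rightarrow> ((real^'n \<Rightarrow> real^'n) \<times> (real^'n) \<Rightarrow> complex) \<Rightarrow> (real^'n \<Rightarrow> real^'n) \<times> (real^'n) \<Rightarrow> complex" where
  "part k \<psi> s = frechet_derivative (\<lambda>y. \<psi> (fst s, y)) (at (snd s)) (axis k 1)"

lemma D2_part: "D2 \<psi> \<Longrightarrow> D2 (part k \<psi>)"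
proof -
  assume \<psi>: "D2 \<psi>"
  have "D2 (\<lambda>s. \<Sum>i\<in>UNIV. M.coE (snd s) $ k $ i * \<delta> i \<psi> s)"
    by (intro D2.sum D2.mult D12[OF D1_coE] D2_\<delta> \<psi>)
  then show ?thesis by (rule D2.cong) (auto simp: part_def partial_\<delta>)
qed

lemma part_of_real:
  assumes \<phi>: "reg Smooth (dom f) \<phi>" and eq: "\<And>y. y \<in> dom f \<Longrightarrow> \<psi> (f, y) = of_real (\<phi> y $ l)" and x: "x \<in> dom f"
  shows "part k \<psi> (f, x) = of_real (frechet_derivative \<phi> (at x) (axis k 1) $ l)"
proof -
  have "((\<lambda>y. complex_of_real (\<phi> y $ l)) has_derivative (\<lambda>v. of_real (frechet_derivative \<phi> (at x) v $ l))) (at x)"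
    by (intro bounded_linear.has_derivative[OF bounded_linear_of_real]
        bounded_linear.has_derivative[OF bounded_linear_vec_nth] reg_has_derivative[OF \<phi> x])
  then have "((\<lambda>y. \<psi> (f, y)) has_derivative (\<lambda>v. of_real (frechet_derivative \<phi> (at x) v $ l))) (at x)"
    by (rule has_derivative_transform_within_open[OF _ open_dom x]) (simp add: eq)
  from frechet_derivative_eq[OF this] show ?thesis by (simp add: part_def)
qed

lemma reg_iter_deriv: "reg Smooth (dom f) (iter_deriv vs f)"
  by (induction vs) (auto simp del: regular_on_open.simps intro: reg_on_dom reg_deriv open_dom)

text \<open>Stability of \<open>D2\<close> under differentiation gives partial derivatives of every
  order, starting from the components of \<open>f\<close> itself.\<close>

lemma D2_iter_deriv: "D2 (\<lambda>s. complex_of_real (iter_deriv (map (\<lambda>k. axis k 1) ks) (fst s) (snd s) $ l))"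
proof (induction ks)
  case Nil
  show ?case using D12[OF D1_F] by simp
next
  case (Cons k ks)
  from D2_part[OF Cons, of k] show ?case
  proof (rule D2.cong)
    fix s assume "s \<in> Dom"
    then show "part k (\<lambda>s. complex_of_real (iter_deriv (map (\<lambda>k. axis k 1) ks) (fst s) (snd s) $ l)) s =
        of_real (iter_deriv (map (\<lambda>k. axis k 1) (k # ks)) (fst s) (snd s) $ l)"
      using part_of_real[OF reg_iter_deriv, of "fst s" "\<lambda>s. complex_of_real (iter_deriv (map (\<lambda>k. axis k 1) ks) (fst s) (snd s) $ l)" _ l "snd s" k] DomD
      by (cases s) auto
  qed
qed

definition q3 :: "(real^'n \<Rightarrow> real^'n) \<times> (real^'n) \<Rightarrow> (real^'n) \<times> (real^'n) \<times> (real^'n^'n) \<times> (real^'n^'n^'n)" where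
  "q3 s = (case s of (f, x) \<Rightarrow> (x, f x, \<chi> i. iter_deriv [axis i 1] f x, \<chi> i j. iter_deriv [axis i 1, axis j 1] f x))"

definition V3 :: "((real^'n) \<times> (real^'n) \<times> (real^'n^'n) \<times> (real^'n^'n^'n)) set" where
  "V3 = {z. (fst z, fst (snd z), fst (snd (snd z))) \<in> V1}"

abbreviation proj1 :: "(real^'n) \<times> (real^'n) \<times> (real^'n^'n) \<times> (real^'n^'n^'n) \<Rightarrow> (real^'n) \<times> (real^'n) \<times> (real^'n^'n)" where
  "proj1 z \<equiv> (fst z, fst (snd z), fst (snd (snd z)))"

lemma reg_proj1: "open V \<Longrightarrow> reg r V proj1"
  by (intro reg_Pair reg_fst reg_snd reg_id)

lemma open_V3: "open V3"
proof -
  have "continuous_on UNIV proj1" by (intro continuous_intros)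
  from continuous_open_preimage[OF this open_UNIV open_V1] show ?thesis by (simp add: V3_def vimage_def)
qed

lemma proj1_q3: "proj1 (q3 s) = q s"
  by (cases s) (simp add: q3_def q_def)

lemma q3_Dom: "q3 ` Dom \<subseteq> V3" using q_Dom proj1_q3 by (auto simp: V3_def)

abbreviation "D3 \<equiv> determined \<rho> Dom q3 V3"

sublocale D3: function_ring Dom D3
  by (rule function_ring_determined[OF open_V3 q3_Dom])

lemma D13: "D1 \<psi> \<Longrightarrow> D3 \<psi>" for \<psi> :: "_ \<Rightarrow> complex"
proof -
  assume "D1 \<psi>"
  then obtain G where G: "reg \<rho> V1 G" "\<And>s. s \<in> Dom \<Longrightarrow> q s \<in> V1 \<and> \<psi> s = G (q s)"
    unfolding determined_def by blast
  have "reg \<rho> V3 (\<lambda>z. G (proj1 z))"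
    by (rule reg_compose[OF open_V3 open_V1 _ reg_proj1[OF open_V3] G(1)]) (auto simp: V3_def)
  then show "D3 \<psi>" unfolding determined_def using G(2) q3_Dom
    by (intro exI[of _ "\<lambda>z. G (proj1 z)"]) (auto simp: proj1_q3)
qed

lemma D3_\<delta>Pc: "D3 (\<delta> i (Pc k l))"
proof -
  have "D3 (\<lambda>s. complex_of_real (snd (snd (snd (q3 s))) $ m $ k $ l))" for m
    unfolding determined_def using q3_Dom
    by (intro exI[of _ "\<lambda>z. complex_of_real (snd (snd (snd z)) $ m $ k $ l)"] conjI reg_of_real reg_vec_nth reg_snd reg_id open_V3) auto
  then have "D3 (\<lambda>s. \<Sum>m\<in>UNIV. E i (snd s) $ m * complex_of_real (snd (snd (snd (q3 s))) $ m $ k $ l))"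
    by (intro D3.sum D3.mult D13[OF D1_source[OF M.reg_E_nth]])
  then show ?thesis
  proof (rule D3.cong)
    fix s assume "s \<in> Dom"
    then obtain f x where s: "s = (f, x)" "x \<in> dom f" using DomD by (cases s) auto
    have "\<delta> i (Pc k l) (f, x) = (\<Sum>m\<in>UNIV. E i x $ m * part m (Pc k l) (f, x))"
      by (simp add: \<delta>_def cder_def part_def)
    moreover have "part m (Pc k l) (f, x) = of_real (frechet_derivative (iter_deriv [axis k 1] f) (at x) (axis m 1) $ l)" for m
      by (rule part_of_real[OF reg_iter_deriv _ s(2)]) (simp add: Pc_def q_def)
    ultimately show "(\<Sum>m\<in>UNIV. E i (snd s) $ m * complex_of_real (snd (snd (snd (q3 s))) $ m $ k $ l)) = \<delta> i (Pc k l) s"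
      by (simp add: s q3_def)
  qed
qed

text \<open>\<open>\<tau>\<close> is a first derivative of \<open>A\<close>, hence itself a function
  of the 2-jet, and can be substituted into any function of the 1-jet and
  \<open>\<tau>\<close>.\<close>

lemma D23: "D2 \<psi> \<Longrightarrow> D3 \<psi>" for \<psi> :: "_ \<Rightarrow> complex"
proof -
  assume "D2 \<psi>"
  then obtain G where G: "reg \<rho> (V1 \<times> UNIV) G" "\<And>s. s \<in> Dom \<Longrightarrow> \<psi> s = G (q2 s)"
    unfolding determined_def by blast
  have "D3 (\<delta> t (A t t))"
    by (rule \<delta>_D1_ring[OF D3.function_ring_axioms D13 D3_\<delta>Pc A_D1])
  then obtain T where T: "reg \<rho> V3 T" "\<And>s. s \<in> Dom \<Longrightarrow> \<delta> t (A t t) s = T (q3 s)"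
    unfolding determined_def by blast
  have "reg \<rho> V3 (\<lambda>z. G (proj1 z, Re (T z)))"
    by (rule reg_compose[OF open_V3 open_V2 _ reg_Pair[OF open_V3 reg_proj1[OF open_V3] reg_Re[OF open_V3 T(1)]] G(1)])
      (auto simp: V3_def)
  then show "D3 \<psi>" unfolding determined_def using G(2) T(2) q3_Dom
    by (intro exI[of _ "\<lambda>z. G (proj1 z, Re (T z))"]) (auto simp: proj1_q3 q2_def)
qed

theorem third_derivatives:
  "\<exists>\<Gamma>. reg \<rho> V3 \<Gamma> \<and> (\<forall>s\<in>Dom. q3 s \<in> V3 \<and>
     (\<chi> i j k. iter_deriv [axis i 1, axis j 1, axis k 1] (fst s) (snd s)) = \<Gamma> (q3 s))"
proof -
  have "\<exists>G. reg \<rho> V3 G \<and> (\<forall>s\<in>Dom. complex_of_real (iter_deriv [axis i 1, axis j 1, axis k 1] (fst s) (snd s) $ l) = G (q3 s))"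
    for i j k l
    using D23[OF D2_iter_deriv[of "[i, j, k]" l]] unfolding determined_def by auto
  then obtain G where G: "\<And>i j k l. reg \<rho> V3 (G i j k l)"
    "\<And>i j k l s. s \<in> Dom \<Longrightarrow> complex_of_real (iter_deriv [axis i 1, axis j 1, axis k 1] (fst s) (snd s) $ l) = G i j k l (q3 s)"
    by metis
  have "reg \<rho> V3 (\<lambda>z. \<chi> i j k l. Re (G i j k l z))"
    by (intro reg_vec_lambda reg_Re open_V3 G)
  moreover have "iter_deriv [axis i 1, axis j 1, axis k 1] (fst s) (snd s) $ l = Re (G i j k l (q3 s))" if "s \<in> Dom" for s i j k l
    using G(2)[OF that, of i j k l] by (metis Re_complex_of_real)
  ultimately show ?thesis using q3_Dom
    by (intro exI[of _ "\<lambda>z. \<chi> i j k l. Re (G i j k l z)"] conjI ballI) (auto simp: vec_eq_iff)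
qed

end

section \<open>Adapted frames of almost CR structures\<close>

lemma Re_Im_vec_simps [simp]:
  "Re_vec (z + w) = Re_vec z + Re_vec w" "Im_vec (z + w) = Im_vec z + Im_vec w"
  "Re_vec (a *s z) = Re a *\<^sub>R Re_vec z - Im a *\<^sub>R Im_vec z"
  "Im_vec (a *s z) = Re a *\<^sub>R Im_vec z + Im a *\<^sub>R Re_vec z"
  "Re_vec (cnj_vec z) = Re_vec z" "Im_vec (cnj_vec z) = - Im_vec z"
  "Re_vec (z - w) = Re_vec z - Re_vec w" "Im_vec (z - w) = Im_vec z - Im_vec w"
  "Re_vec (- z) = - Re_vec z" "Im_vec (- z) = - Im_vec z"
  "Re_vec 0 = 0" "Im_vec 0 = 0"
  by (simp_all add: Re_vec_def Im_vec_def cnj_vec_def vec_eq_iff)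

lemma cnj_vec_simps [simp]:
  "cnj_vec (cnj_vec z) = z" "cnj_vec 0 = 0" "cnj_vec (- z) = - cnj_vec z" "cnj_vec (z + w) = cnj_vec z + cnj_vec w"
  "cnj_vec (a *s z) = cnj a *s cnj_vec z"
  by (simp_all add: cnj_vec_def vec_eq_iff)

lemma vec_eq_Re_Im: "z = w \<longleftrightarrow> Re_vec z = Re_vec w \<and> Im_vec z = Im_vec w"
  by (auto simp: Re_vec_def Im_vec_def vec_eq_iff complex_eq_iff)

definition cvec :: "real^'n \<Rightarrow> complex^'n" where "cvec v = (\<chi> m. of_real (v $ m))"

lemma Re_Im_cvec [simp]: "Re_vec (cvec v) = v" "Im_vec (cvec v) = 0" "cnj_vec (cvec v) = cvec v"
  by (simp_all add: cvec_def Re_vec_def Im_vec_def cnj_vec_def vec_eq_iff)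

locale complex_structure =
  fixes H :: "(real^'n) set" and J :: "real^'n \<Rightarrow> real^'n"
  assumes H: "subspace H" and J_mem: "v \<in> H \<Longrightarrow> J v \<in> H" and J_J: "v \<in> H \<Longrightarrow> J (J v) = - v"
    and J_add: "u \<in> H \<Longrightarrow> v \<in> H \<Longrightarrow> J (u + v) = J u + J v"
    and J_scaleR: "v \<in> H \<Longrightarrow> J (a *\<^sub>R v) = a *\<^sub>R J v"
begin

lemma J_neg: "v \<in> H \<Longrightarrow> J (- v) = - J v" using J_scaleR[of v "-1"] by simp

lemma J_diff: "u \<in> H \<Longrightarrow> v \<in> H \<Longrightarrow> J (u - v) = J u - J v"
  using J_add[of u "- v"] J_neg[of v] subspace_neg[OF H] by simp

lemmas H_closed = subspace_add[OF H] subspace_diff[OF H] subspace_scale[OF H] subspace_neg[OF H] subspace_0[OF H]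

text \<open>This is \<open>v - \<i> J v\<close>, the vector of type (1,0) with real part
  \<open>v\<close>; it identifies H with \<open>H10\<close>.\<close>

definition sharp :: "real^'n \<Rightarrow> complex^'n" where
  "sharp v = (\<chi> m. Complex (v $ m) (- J v $ m))"

lemma Re_Im_sharp [simp]: "Re_vec (sharp v) = v" "Im_vec (sharp v) = - J v"
  by (simp_all add: sharp_def Re_vec_def Im_vec_def vec_eq_iff)

lemma sharp_H10: "v \<in> H \<Longrightarrow> sharp v \<in> H10 H J"
  using J_neg[OF J_mem[of v]] J_J[of v] J_mem[of v] H_closed by (simp add: H10_def complexified_def)

lemma H10_sharp: "z \<in> H10 H J \<Longrightarrow> z = sharp (Re_vec z)"
  by (simp add: H10_def vec_eq_Re_Im)

lemma sharp_add: "u \<in> H \<Longrightarrow> v \<in> H \<Longrightarrow> sharp (u + v) = sharp u + sharp v"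
  by (simp add: vec_eq_Re_Im J_add)

lemma sharp_scaleR: "v \<in> H \<Longrightarrow> sharp (a *\<^sub>R v) = of_real a *s sharp v"
  by (simp add: vec_eq_Re_Im J_scaleR)

lemma sharp_sum: "finite K \<Longrightarrow> (\<And>i. i \<in> K \<Longrightarrow> f i \<in> H) \<Longrightarrow> sharp (\<Sum>i\<in>K. f i) = (\<Sum>i\<in>K. sharp (f i))"
proof (induction K rule: finite_induct)
  case empty
  show ?case using sharp_scaleR[of 0 0] H_closed by simp
next
  case (insert i K)
  then show ?case using subspace_sum[OF H, of K f] by (simp add: sharp_add)
qed

lemma complexified_subspace: "vec.subspace (complexified H)"
  by (auto simp: vec.subspace_def complexified_def intro!: H_closed)

lemma H10_subspace: "vec.subspace (H10 H J)"
proof (unfold vec.subspace_def, intro conjI ballI allI)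
  show "0 \<in> H10 H J" using sharp_H10[OF H_closed(5)] sharp_scaleR[OF H_closed(5), of 0] by simp
  show "z + w \<in> H10 H J" if "z \<in> H10 H J" "w \<in> H10 H J" for z w
    using that H_closed by (auto simp: H10_def complexified_def J_add)
  show "a *s z \<in> H10 H J" if "z \<in> H10 H J" for a z
    using that H_closed
    by (auto simp: H10_def complexified_def J_add J_diff J_scaleR algebra_simps)
qed

lemma H10_complexified: "z \<in> H10 H J \<Longrightarrow> z \<in> complexified H" by (simp add: H10_def)

lemma complexified_cnj: "z \<in> complexified H \<Longrightarrow> cnj_vec z \<in> complexified H"
  using H_closed by (auto simp: complexified_def)

lemma complexified_cvec: "cvec v \<in> complexified H \<longleftrightarrow> v \<in> H"
  using H_closed by (auto simp: complexified_def)

text \<open>For such a vector \<open>J\<close> sends the real part to the imaginary part with both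
  signs, so the imaginary part vanishes, and with it the real part.\<close>

lemma H10_cnj_zero:
  assumes "z \<in> H10 H J" "cnj_vec z \<in> H10 H J"
  shows "z = 0"
proof -
  have "Im_vec z \<in> H" "J (Re_vec z) = - Im_vec z" "J (Re_vec z) = Im_vec z" "J (Im_vec z) = Re_vec z"
    using assms by (auto simp: H10_def complexified_def)
  then have "Im_vec z = - Im_vec z" by metis
  then have "Im_vec z = 0" by (simp add: vec_eq_iff)
  moreover have "Re_vec z = J 0" using \<open>J (Im_vec z) = Re_vec z\<close> calculation by simp
  moreover have "J 0 = 0" using J_scaleR[OF H_closed(5), of 0] by simp
  ultimately show ?thesis by (simp add: vec_eq_Re_Im)
qed

lemma decomposition_unique:
  assumes v: "v \<notin> H" and z: "z \<in> H10 H J" and w: "cnj_vec w \<in> H10 H J" and eq: "z + w + a *s cvec v = 0"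
  shows "z = 0" "w = 0" "a = 0"
proof -
  have "w \<in> complexified H" using complexified_cnj[OF H10_complexified[OF w]] by simp
  then have "z + w \<in> complexified H" using vec.subspace_add[OF complexified_subspace H10_complexified[OF z]] by blast
  moreover have "a *s cvec v = (-1) *s (z + w)"
  proof -
    have "a *s cvec v = - (z + w)" using eq by (simp only: add_eq_0_iff)
    then show ?thesis by (simp add: vec_eq_iff)
  qed
  ultimately have av: "a *s cvec v \<in> complexified H" using vec.subspace_scale[OF complexified_subspace] by metis
  show a: "a = 0"
  proof (rule ccontr)
    assume "a \<noteq> 0"
    then have "cvec v = inverse a *s (a *s cvec v)" by (simp add: vec_eq_iff)
    then show False using vec.subspace_scale[OF complexified_subspace av] complexified_cvec v by metis
  qed
  then have zw: "w = (-1) *s z" using eq by (simp add: vec_eq_iff add_eq_0_iff)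
  have "cnj_vec z = (-1) *s cnj_vec w" by (simp add: zw vec_eq_iff)
  then have "cnj_vec z \<in> H10 H J" using vec.subspace_scale[OF H10_subspace w] by metis
  then show "z = 0" using H10_cnj_zero z by blast
  then show "w = 0" using zw by (simp add: vec_eq_iff)
qed

text \<open>After a multiple of \<open>v\<close> is removed, \<open>z\<close> is
  \<open>g + \<i> h\<close> with \<open>g\<close> and \<open>h\<close> in H; the combinations of
  \<open>sharp g\<close> and \<open>sharp h\<close> with the two signs of the imaginary unit yield
  its (1,0) part and the conjugate of its (0,1) part.\<close>

lemma decomposition:
  assumes v: "v \<notin> H" and dim: "dim H + 1 = CARD('n)"
  shows "\<exists>x\<in>H10 H J. \<exists>y\<in>H10 H J. \<exists>a. z = x + cnj_vec y + a *s cvec v"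
proof -
  have "insert v H \<subseteq> span (insert v H)" by (rule span_superset)
  have "dim (insert v H) = CARD('n)" using dim v dim_insert[of v H] by (simp add: span_eq_iff[THEN iffD2, OF H])
  then have "span (insert v H) = UNIV" using dim_eq_full[of "insert v H"] by (simp add: DIM_cart)
  then have r: "\<exists>k. u - k *\<^sub>R v \<in> H" for u
    using span_breakdown_eq[of u v H] by (auto simp: span_eq_iff[THEN iffD2, OF H])
  obtain k l where kl: "Re_vec z - k *\<^sub>R v \<in> H" "Im_vec z - l *\<^sub>R v \<in> H" using r by metis
  define g h where "g = Re_vec z - k *\<^sub>R v" and "h = Im_vec z - l *\<^sub>R v"
  have gh: "g \<in> H" "h \<in> H" using kl by (auto simp: g_def h_def)
  let ?x = "(1/2) *s (sharp g + \<i> *s sharp h)" and ?y = "(1/2) *s (sharp g + (-\<i>) *s sharp h)"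
  have "z = ?x + cnj_vec ?y + Complex k l *s cvec v"
  proof -
    have "Re_vec z = g + k *\<^sub>R v" "Im_vec z = h + l *\<^sub>R v" by (simp_all add: g_def h_def)
    then show ?thesis by (simp add: vec_eq_Re_Im)
  qed
  moreover have "?x \<in> H10 H J" "?y \<in> H10 H J"
    by (intro vec.subspace_scale vec.subspace_add H10_subspace sharp_H10 gh)+
  ultimately show ?thesis by blast
qed

text \<open>A basis of \<open>H10\<close>, its conjugate and the transversal vector together form a
  basis of the complexified space, and counting it gives the cardinality.\<close>

lemma exists_H10_basis:
  assumes v: "v \<notin> H" and dim: "dim H + 1 = CARD('n)" and X: "X \<subseteq> H10 H J" "H10 H J \<subseteq> vec.span X"
  shows "\<exists>B\<subseteq>X. vec.independent B \<and> H10 H J \<subseteq> vec.span B \<and> 2 * card B + 1 = CARD('n)"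
proof -
  obtain B where B: "B \<subseteq> X" "vec.independent B" "X \<subseteq> vec.span B"
    using vec.maximal_independent_subset[of X] by blast
  have BH: "B \<subseteq> H10 H J" using B(1) X(1) by blast
  have span: "H10 H J \<subseteq> vec.span B"
    using X(2) vec.span_mono[OF B(3)] by (simp add: vec.span_span)
  have fin: "finite B" by (rule vec.finiteI_independent[OF B(2)])
  let ?T = "insert (cvec v) (B \<union> cnj_vec ` B)"
  have nz: "0 \<notin> B" using B(2) vec.dependent_zero by blast
  have inj: "inj_on cnj_vec B" by (metis cnj_vec_simps(1) inj_onI)
  have disj: "B \<inter> cnj_vec ` B = {}"
    using H10_cnj_zero BH nz by force
  have BC: "B \<union> cnj_vec ` B \<subseteq> complexified H"
    using BH H10_complexified complexified_cnj by blast
  then have vn: "cvec v \<notin> B \<union> cnj_vec ` B" using complexified_cvec v by blast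
  have ind: "vec.independent ?T"
  proof
    assume "vec.dependent ?T"
    then obtain u where u: "\<exists>x\<in>?T. u x \<noteq> 0" and s: "(\<Sum>x\<in>?T. u x *s x) = 0"
      using vec.dependent_finite[of ?T] fin by auto
    have "(\<Sum>x\<in>B. u x *s x) + (\<Sum>x\<in>cnj_vec ` B. u x *s x) + u (cvec v) *s cvec v = 0"
      using s vn disj fin by (simp add: sum.union_disjoint add.commute add.left_commute)
    moreover have "(\<Sum>x\<in>B. u x *s x) \<in> H10 H J"
      by (intro vec.subspace_sum[OF H10_subspace] vec.subspace_scale[OF H10_subspace]) (use BH in auto)
    moreover have cn: "cnj_vec (\<Sum>x\<in>cnj_vec ` B. u x *s x) = (\<Sum>x\<in>B. cnj (u (cnj_vec x)) *s x)"
    proof -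
      have "cnj_vec (\<Sum>x\<in>K. f x) = (\<Sum>x\<in>K. cnj_vec (f x))" for K and f :: "complex^'n \<Rightarrow> complex^'n"
        by (simp add: cnj_vec_def vec_eq_iff)
      then show ?thesis by (simp add: sum.reindex[OF inj])
    qed
    moreover have "(\<Sum>x\<in>B. cnj (u (cnj_vec x)) *s x) \<in> H10 H J"
      by (intro vec.subspace_sum[OF H10_subspace] vec.subspace_scale[OF H10_subspace]) (use BH in auto)
    ultimately have 0: "(\<Sum>x\<in>B. u x *s x) = 0" "(\<Sum>x\<in>cnj_vec ` B. u x *s x) = 0" "u (cvec v) = 0"
      using decomposition_unique[OF v, of "\<Sum>x\<in>B. u x *s x" "\<Sum>x\<in>cnj_vec ` B. u x *s x" "u (cvec v)"] by auto
    have nd: "f x = 0" if "(\<Sum>x\<in>B. f x *s x) = 0" "x \<in> B" for f x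
      using B(2) that unfolding vec.dependent_finite[OF fin] by auto
    have "u x = 0" if "x \<in> B" for x by (rule nd[OF 0(1) that])
    moreover have "u (cnj_vec x) = 0" if "x \<in> B" for x
    proof -
      have "(\<Sum>x\<in>B. cnj (u (cnj_vec x)) *s x) = 0" using 0(2) cn by simp
      then have "cnj (u (cnj_vec x)) = 0" by (rule nd[OF _ that])
      then show ?thesis by simp
    qed
    ultimately show False using u 0(3) by auto
  qed
  have "vec.span ?T = UNIV"
  proof -
    have "z \<in> vec.span ?T" for z
    proof -
      obtain x y a where xy: "x \<in> H10 H J" "y \<in> H10 H J" "z = x + cnj_vec y + a *s cvec v"
        using decomposition[OF v dim] by blast
      have 1: "x \<in> vec.span ?T" using xy(1) span vec.span_mono[of B ?T] by blast
      have "cnj_vec y \<in> vec.span (cnj_vec ` B)"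
      proof -
        have "y \<in> vec.span B" using xy(2) span by blast
        then show ?thesis
          by (induction rule: vec.span_induct_alt)
            (auto intro: vec.span_zero vec.span_add vec.span_scale vec.span_base)
      qed
      then have 2: "cnj_vec y \<in> vec.span ?T" using vec.span_mono[of "cnj_vec ` B" ?T] by blast
      have 3: "cvec v \<in> vec.span ?T" by (rule vec.span_base) simp
      show ?thesis unfolding xy(3) by (intro vec.span_add vec.span_scale 1 2 3)
    qed
    then show ?thesis by blast
  qed
  then have "card ?T = vec.dim (UNIV :: (complex^'n) set)"
    using vec.basis_card_eq_dim[OF subset_UNIV _ ind] by simp
  also have "\<dots> = CARD('n)" by (simp add: vec.dim_UNIV card_cart_basis)
  finally have "card ?T = CARD('n)" .
  moreover have "card ?T = 2 * card B + 1"
    using fin vn disj card_image[OF inj] by (simp add: card_Un_disjoint)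
  ultimately show ?thesis using B span by auto
qed

end

text \<open>The indices other than \<open>t\<close> are split into two halves, and
  \<open>bar\<close> is a bijection between them together with its inverse.\<close>

lemma index_structure_exists:
  assumes "CARD('n::finite) = 2 * m + 1" "m \<noteq> 0"
  shows "\<exists>I t (bar :: 'n \<Rightarrow> 'n). index_structure I t bar"
proof -
  obtain t :: 'n where True by blast
  have "card (UNIV - {t}) = 2 * m" using assms by (simp add: card_Diff_singleton)
  then obtain I where I: "I \<subseteq> UNIV - {t}" "card I = m"
    by (metis finite_class.finite_UNIV obtain_subset_with_card_n mult_2 le_add1)
  define I' where "I' = UNIV - {t} - I"
  have "card I' = m" using I \<open>card (UNIV - {t}) = 2 * m\<close> unfolding I'_def by (subst card_Diff_subset) auto
  then obtain \<phi> where \<phi>: "bij_betw \<phi> I I'" using I(2) finite_same_card_bij[of I I'] by auto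
  define bar where "bar i = (if i = t then t else if i \<in> I then \<phi> i else inv_into I \<phi> i)" for i
  have 1: "\<phi> i \<in> I'" if "i \<in> I" for i using \<phi> that bij_betwE by blast
  have 2: "inv_into I \<phi> i \<in> I" if "i \<in> I'" for i using \<phi> that by (metis bij_betw_imp_surj_on inv_into_into)
  have 3: "inv_into I \<phi> (\<phi> i) = i" if "i \<in> I" for i using \<phi> that by (simp add: bij_betw_inv_into_left)
  have 4: "\<phi> (inv_into I \<phi> i) = i" if "i \<in> I'" for i using \<phi> that by (simp add: bij_betw_inv_into_right)
  have "index_structure I t bar"
  proof
    fix i
    consider "i = t" | "i \<in> I" | "i \<in> I'" by (auto simp: I'_def)
    moreover have "t \<notin> I" "t \<notin> I'" "\<And>j. j \<in> I' \<Longrightarrow> j \<notin> I" using I by (auto simp: I'_def)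
    ultimately show "bar (bar i) = i" using 1 2 3 4
      by cases (simp_all add: bar_def, (metis (full_types))+)
    show "i \<in> I \<Longrightarrow> bar i \<notin> I" using 1 I by (auto simp: bar_def I'_def)
    show "i = t \<or> i \<in> I \<or> bar i \<in> I" using 2 I by (auto simp: bar_def I'_def)
  qed (use I assms in \<open>auto simp: bar_def\<close>)
  then show ?thesis by blast
qed

lemma (in index_structure) card_I: "CARD('n) = 2 * card I + 1"
proof -
  have U: "UNIV = insert t (I \<union> bar ` I)"
  proof -
    have "i \<in> insert t (I \<union> bar ` I)" for i
      using index_cases[of i] bar_bar[of i] by (metis UnCI image_eqI insertCI)
    then show ?thesis by blast
  qed
  have "t \<notin> bar ` I" using t_notin bar_t bar_bar by (metis imageE)
  moreover have "I \<inter> bar ` I = {}" using bar_I by auto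
  moreover have "card (bar ` I) = card I" by (rule card_image) (metis bar_bar inj_onI)
  ultimately show ?thesis using t_notin by (subst U) (simp add: card_Un_disjoint)
qed

lemma complex_structure_point:
  assumes "almost_CR_on \<rho> S H J" "x \<in> S"
  shows "complex_structure (H x) (J x)"
  using assms unfolding almost_CR_on_def complex_structure_def by metis

text \<open>The given local frame of H need not be compatible with \<open>J\<close>. Its images
  under \<open>sharp\<close> span \<open>H10\<close>, and those forming a basis at \<open>x\<close>
  are selected; independence is claimed at \<open>x\<close> alone and is spread to a neighbourhood
  later by a determinant.\<close>

lemma basis_field:
  fixes H :: "'n::finite distribution"
  assumes CR: "almost_CR_on \<rho> S H J" and x: "x \<in> S" and v: "v \<notin> H x" and dim: "dim (H x) + 1 = CARD('n)"
  shows "\<exists>W (X :: nat \<Rightarrow> real^'n \<Rightarrow> complex^'n) m. open W \<and> x \<in> W \<and> W \<subseteq> S \<and> (\<forall>i<m. reg \<rho> W (X i)) \<and>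
    (\<forall>y\<in>W. \<forall>i<m. X i y \<in> H10 (H y) (J y)) \<and> 2 * m + 1 = CARD('n) \<and>
    (\<forall>u. (\<Sum>i<m. u i *s X i x) = 0 \<longrightarrow> (\<forall>i<m. u i = 0))"
proof -
  obtain W k and e :: "nat \<Rightarrow> real^'n \<Rightarrow> real^'n" where *: "open W \<and> x \<in> W \<and> W \<subseteq> S \<and>
        (\<forall>i<k. regular_on \<rho> W (e i) \<and> regular_on \<rho> W (\<lambda>y. J y (e i y))) \<and>
        (\<forall>y\<in>W. inj_on (\<lambda>i. e i y) {..<k} \<and> independent ((\<lambda>i. e i y) ` {..<k}) \<and>
           span ((\<lambda>i. e i y) ` {..<k}) = H y)"
    using bspec[OF CR[unfolded almost_CR_on_def, THEN conjunct2] x] by (elim exE)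
  have W: "open W" "x \<in> W" "W \<subseteq> S"
    and e: "\<And>i. i < k \<Longrightarrow> regular_on \<rho> W (e i)" "\<And>i. i < k \<Longrightarrow> regular_on \<rho> W (\<lambda>y. J y (e i y))"
    and sp: "\<And>y. y \<in> W \<Longrightarrow> inj_on (\<lambda>i. e i y) {..<k} \<and> independent ((\<lambda>i. e i y) ` {..<k}) \<and>
           span ((\<lambda>i. e i y) ` {..<k}) = H y"
    using * by simp_all
  \<comment> \<open>This is \<open>sharp\<close> written out in components, so that regularity in
    \<open>y\<close> can be read off.\<close>
  define X where "X i y = (\<chi> m. Complex (e i y $ m) (- J y (e i y) $ m))" for i y
  have eH: "e i y \<in> H y" if "y \<in> W" "i < k" for i y
    using sp[OF that(1)] span_base[of "e i y" "(\<lambda>i. e i y) ` {..<k}"] that(2) by auto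
  have cs: "complex_structure (H y) (J y)" if "y \<in> W" for y
    using complex_structure_point[OF CR] W(3) that by blast
  have Xs: "X i y = complex_structure.sharp (J y) (e i y)" if "y \<in> W" for i y
    by (simp add: X_def complex_structure.sharp_def[OF cs[OF that]])
  have X10: "X i y \<in> H10 (H y) (J y)" if "y \<in> W" "i < k" for i y
    unfolding Xs[OF that(1)] by (rule complex_structure.sharp_H10[OF cs[OF that(1)] eH[OF that]])
  have Xreg: "reg \<rho> W (X i)" if "i < k" for i
  proof -
    have 1: "reg \<rho> W (e i)" "reg \<rho> W (\<lambda>y. J y (e i y))"
      using e[OF that] by (simp_all add: regular_on_open_iff[OF W(1)])
    have "reg \<rho> W (\<lambda>y. \<chi> m. complex_of_real (e i y $ m) - \<i> * complex_of_real (J y (e i y) $ m))"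
      by (intro reg_vec_lambda reg_diff reg_mult reg_of_real reg_vec_nth reg_const W(1) 1)
    then show ?thesis by (rule reg_cong[OF W(1)]) (simp add: X_def vec_eq_iff complex_eq_iff)
  qed
  interpret C: complex_structure "H x" "J x" by (rule cs[OF W(2)])
  have "H10 (H x) (J x) \<subseteq> vec.span ((\<lambda>i. X i x) ` {..<k})"
  proof
    fix z assume z: "z \<in> H10 (H x) (J x)"
    then have "Re_vec z \<in> H x" by (simp add: H10_def complexified_def)
    then have "Re_vec z \<in> span ((\<lambda>i. e i x) ` {..<k})" using sp[OF W(2)] by simp
    then obtain r where "Re_vec z = (\<Sum>w\<in>(\<lambda>i. e i x) ` {..<k}. r w *\<^sub>R w)"
      using span_finite[of "(\<lambda>i. e i x) ` {..<k}"] by auto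
    then have r: "Re_vec z = (\<Sum>i<k. r (e i x) *\<^sub>R e i x)" using sp[OF W(2)] by (simp add: sum.reindex)
    have "z = C.sharp (\<Sum>i<k. r (e i x) *\<^sub>R e i x)" using C.H10_sharp[OF z] r by simp
    also have "\<dots> = (\<Sum>i<k. of_real (r (e i x)) *s X i x)"
      using eH[OF W(2)] by (subst C.sharp_sum) (auto simp: C.sharp_scaleR Xs[OF W(2)] intro: C.H_closed)
    also have "\<dots> \<in> vec.span ((\<lambda>i. X i x) ` {..<k})"
      by (intro vec.span_sum vec.span_scale vec.span_base) auto
    finally show "z \<in> vec.span ((\<lambda>i. X i x) ` {..<k})" .
  qed
  then obtain B where B: "B \<subseteq> (\<lambda>i. X i x) ` {..<k}" "vec.independent B" "2 * card B + 1 = CARD('n)"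
    using C.exists_H10_basis[OF v dim, of "(\<lambda>i. X i x) ` {..<k}"] X10[OF W(2)] by auto
  have finB: "finite B" using B(1) finite_subset by blast
  then obtain h where h: "bij_betw h {..<card B} B" using ex_bij_betw_nat_finite[of B] by (auto simp: atLeast0LessThan)
  have "\<forall>z\<in>B. \<exists>i<k. X i x = z" using B(1) by auto
  then obtain \<kappa> where \<kappa>: "\<And>z. z \<in> B \<Longrightarrow> \<kappa> z < k \<and> X (\<kappa> z) x = z" by metis
  have hB: "h i \<in> B" if "i < card B" for i using h that bij_betwE by blast
  show ?thesis
  proof (intro exI[of _ W] exI[of _ "\<lambda>i. X (\<kappa> (h i))"] exI[of _ "card B"] conjI allI ballI impI W B(3))
    show "reg \<rho> W (X (\<kappa> (h i)))" if "i < card B" for i using Xreg \<kappa>[OF hB[OF that]] by blast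
    show "X (\<kappa> (h i)) y \<in> H10 (H y) (J y)" if "y \<in> W" "i < card B" for y i
      using X10[OF that(1)] \<kappa>[OF hB[OF that(2)]] by blast
    fix u i assume s: "(\<Sum>i<card B. u i *s X (\<kappa> (h i)) x) = 0" and i: "i < card B"
    have "(\<Sum>i<card B. u i *s X (\<kappa> (h i)) x) = (\<Sum>i<card B. u (inv_into {..<card B} h (h i)) *s h i)"
      by (intro sum.cong refl) (use \<kappa> hB h in \<open>auto simp: bij_betw_def\<close>)
    also have "\<dots> = (\<Sum>z\<in>B. u (inv_into {..<card B} h z) *s z)"
      by (rule sum.reindex_bij_betw[OF h])
    finally have "(\<Sum>z\<in>B. u (inv_into {..<card B} h z) *s z) = 0" using s by simp
    then have "u (inv_into {..<card B} h (h i)) = 0"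
      using B(2) hB[OF i] unfolding vec.dependent_finite[OF finB] by auto
    then show "u i = 0" using h i by (simp add: bij_betw_def)
  qed
qed

context index_structure begin

lemma sum_index: "(\<Sum>i\<in>UNIV. f i) = f t + (\<Sum>i\<in>I. f i) + (\<Sum>i\<in>I. f (bar i))"
  for f :: "'n \<Rightarrow> 'v::comm_monoid_add"
proof -
  have U: "UNIV = insert t (I \<union> bar ` I)"
  proof -
    have "i \<in> insert t (I \<union> bar ` I)" for i
      using index_cases[of i] bar_bar[of i] by (metis UnCI image_eqI insertCI)
    then show ?thesis by blast
  qed
  have t: "t \<notin> bar ` I" using t_notin bar_t bar_bar by (metis imageE)
  have d: "I \<inter> bar ` I = {}" using bar_I by auto
  have inj: "inj_on bar I" by (metis bar_bar inj_onI)
  show ?thesis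
    using t t_notin d by (subst U) (simp add: sum.union_disjoint sum.reindex[OF inj] add.assoc)
qed

end

definition adapted :: "'n::finite set \<Rightarrow> (real^'n) set \<Rightarrow> ('n \<Rightarrow> real^'n \<Rightarrow> complex^'n) \<Rightarrow> 'n distribution \<Rightarrow> 'n endo_field \<Rightarrow> bool" where
  "adapted I U E H J \<longleftrightarrow> (\<forall>y\<in>U. \<forall>u. (\<Sum>i\<in>UNIV. u i *s E i y) \<in> H10 (H y) (J y) \<longleftrightarrow> (\<forall>j. j \<notin> I \<longrightarrow> u j = 0))"

text \<open>The transversal field is a constant real vector; the others are the chosen (1,0) fields
  and their conjugates. Independence at \<open>x\<close> is the nonvanishing of a determinant, which
  is an open condition.\<close>

lemma frame_exists:
  fixes H :: "'n::finite distribution"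
  assumes ix: "index_structure I t (bar :: 'n \<Rightarrow> 'n)"
    and CR: "almost_CR_on \<rho> S H J" and S: "open S" and dim: "\<And>x. x \<in> S \<Longrightarrow> dim (H x) + 1 = CARD('n)"
    and x: "x \<in> S"
  shows "\<exists>U E. x \<in> U \<and> U \<subseteq> S \<and> frame I t bar \<rho> U E \<and> adapted I U E H J \<and>
    (\<forall>y\<in>U. \<forall>u. (\<Sum>i\<in>UNIV. u i *s E i y) \<in> complexified (H y) \<longleftrightarrow> u t = 0)"
proof -
  interpret index_structure I t bar by (rule ix)
  have "H x \<noteq> UNIV" using dim[OF x] by (metis DIM_cart DIM_real add_eq_self_zero dim_UNIV mult.right_neutral zero_neq_one)
  then obtain v where v: "v \<notin> H x" by blast
  obtain W m and X :: "nat \<Rightarrow> real^'n \<Rightarrow> complex^'n" where *: "open W \<and> x \<in> W \<and> W \<subseteq> S \<and> (\<forall>i<m. reg \<rho> W (X i)) \<and>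
    (\<forall>y\<in>W. \<forall>i<m. X i y \<in> H10 (H y) (J y)) \<and> 2 * m + 1 = CARD('n) \<and>
    (\<forall>u. (\<Sum>i<m. u i *s X i x) = 0 \<longrightarrow> (\<forall>i<m. u i = 0))"
    using basis_field[OF CR x v dim[OF x]] by (elim exE)
  have W: "open W" "x \<in> W" "W \<subseteq> S"
    and X: "\<And>i. i < m \<Longrightarrow> reg \<rho> W (X i)" "\<And>y i. y \<in> W \<Longrightarrow> i < m \<Longrightarrow> X i y \<in> H10 (H y) (J y)"
    and m: "2 * m + 1 = CARD('n)" and ind: "\<And>u i. (\<Sum>i<m. u i *s X i x) = 0 \<Longrightarrow> i < m \<Longrightarrow> u i = 0"
    using * by simp_all
  have "card I = m" using card_I m by simp
  then obtain h where h: "bij_betw h I {..<m}" using finite_same_card_bij[of I "{..<m}"] by auto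
  have hm: "h i < m" if "i \<in> I" for i using h that bij_betwE by blast
  define E where "E i y = (if i = t then cvec v else if i \<in> I then X (h i) y else cnj_vec (X (h (bar i)) y))" for i y
  have tI: "i \<in> I \<Longrightarrow> i \<noteq> t" "i \<in> I \<Longrightarrow> bar i \<noteq> t" "i \<in> I \<Longrightarrow> bar i \<notin> I" for i
    using t_notin bar_I bar_bar bar_t by metis+
  have EI: "E t y = cvec v" "i \<in> I \<Longrightarrow> E i y = X (h i) y" "i \<in> I \<Longrightarrow> E (bar i) y = cnj_vec (X (h i) y)" for i y
    using tI by (auto simp: E_def)
  have Ebar: "E (bar i) y = cnj_vec (E i y)" for i y
    using index_cases[of i] EI(1)[of y] EI(2,3)[of i y] EI(2,3)[of "bar i" y] by auto
  have regE: "reg \<rho> W (E i)" for i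
  proof -
    have *: "reg \<rho> W (\<lambda>y. cnj_vec (X (h j) y))" if "j \<in> I" for j
      unfolding cnj_vec_def by (intro reg_vec_lambda reg_cnj reg_vec_nth W(1) X hm that)
    consider "i = t" | "i \<in> I" | "bar i \<in> I" using index_cases by blast
    then show ?thesis
    proof cases
      case 1 then show ?thesis by (simp add: E_def[abs_def] del: regular_on_open.simps)
    next
      case 2 then show ?thesis using X(1)[OF hm[OF 2]] tI(1)[OF 2] by (simp add: E_def[abs_def] del: regular_on_open.simps)
    next
      case 3
      then show ?thesis using *[OF 3] tI(1,2,3)[OF 3] by (simp add: E_def[abs_def] del: regular_on_open.simps)
    qed
  qed
  define Em where "Em y = (\<chi> i j. E i y $ j)" for y
  have reg_nth: "reg \<rho> W (\<lambda>y. Em y $ i $ j)" for i j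
    using reg_vec_nth[OF W(1) regE] by (simp add: Em_def del: regular_on_open.simps)
  have detx: "det (Em x) \<noteq> 0"
  proof -
    interpret C: complex_structure "H x" "J x" by (rule complex_structure_point[OF CR x])
    have "\<forall>i. u i = 0" if u: "(\<Sum>i\<in>UNIV. u i *s row i (Em x)) = 0" for u
    proof -
      have row: "row i (Em x) = E i x" for i by (simp add: row_def Em_def vec_eq_iff)
      have cn: "cnj_vec (\<Sum>i\<in>I. u (bar i) *s E (bar i) x) = (\<Sum>i\<in>I. cnj (u (bar i)) *s E i x)"
      proof -
        have "cnj_vec (\<Sum>i\<in>K. f i) = (\<Sum>i\<in>K. cnj_vec (f i))" for K and f :: "'n \<Rightarrow> complex^'n"
          by (simp add: cnj_vec_def vec_eq_iff)
        then show ?thesis by (simp add: Ebar)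
      qed
      have 10: "(\<Sum>i\<in>I. f i *s E i x) \<in> H10 (H x) (J x)" for f
        by (intro vec.subspace_sum[OF C.H10_subspace] vec.subspace_scale[OF C.H10_subspace]) (use X(2)[OF W(2) hm] EI in auto)
      have "(\<Sum>i\<in>I. u i *s E i x) + (\<Sum>i\<in>I. u (bar i) *s E (bar i) x) + u t *s cvec v = 0"
        using u by (simp add: sum_index row EI add.commute add.left_commute)
      note eq = this
      have w10: "cnj_vec (\<Sum>i\<in>I. u (bar i) *s E (bar i) x) \<in> H10 (H x) (J x)" unfolding cn by (rule 10)
      have 0: "(\<Sum>i\<in>I. u i *s E i x) = 0" "(\<Sum>i\<in>I. u (bar i) *s E (bar i) x) = 0" "u t = 0"
        by (rule C.decomposition_unique[OF v 10 w10 eq])+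
      have z: "f i = 0" if f: "(\<Sum>i\<in>I. f i *s E i x) = 0" and i: "i \<in> I" for f i
      proof -
        have "(\<Sum>i\<in>I. f i *s E i x) = (\<Sum>i\<in>I. f (inv_into I h (h i)) *s X (h i) x)"
          using h by (intro sum.cong refl) (auto simp: EI bij_betw_def)
        also have "\<dots> = (\<Sum>j<m. f (inv_into I h j) *s X j x)" by (rule sum.reindex_bij_betw[OF h])
        finally have "f (inv_into I h (h i)) = 0" using ind[of "\<lambda>j. f (inv_into I h j)"] hm[OF i] f by simp
        then show ?thesis using h i by (simp add: bij_betw_def)
      qed
      have "u i = 0" if "i \<in> I" for i by (rule z[OF 0(1) that])
      moreover have "u (bar i) = 0" if "i \<in> I" for i
      proof -
        have "(\<Sum>i\<in>I. cnj (u (bar i)) *s E i x) = 0" using cn 0(2) by simp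
        from z[OF this that] show ?thesis by simp
      qed
      ultimately show ?thesis using 0(3) index_cases bar_bar by metis
    qed
    then have "\<exists>B. Em x ** B = mat 1" using matrix_right_invertible_independent_rows[of "Em x"] by blast
    then have "invertible (Em x)" using matrix_left_right_inverse unfolding invertible_def by metis
    then show ?thesis by (simp add: invertible_det_nz)
  qed
  define U where "U = {y \<in> W. det (Em y) \<noteq> 0}"
  have "continuous_on W (\<lambda>y. det (Em y))"
    by (intro reg_continuous_on[of \<rho>] reg_det W(1) reg_nth)
  then have "open ((\<lambda>y. det (Em y)) -` (- {0}) \<inter> W)"
    using W(1) continuous_on_open_vimage by blast
  moreover have "(\<lambda>y. det (Em y)) -` (- {0}) \<inter> W = U" by (auto simp: U_def)
  ultimately have oU: "open U" by simp
  interpret F: frame I t bar \<rho> U E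
    by unfold_locales (use oU reg_subset[OF regE, of U] Ebar in \<open>auto simp: U_def Em_def simp del: regular_on_open.simps\<close>)
  have main: "((\<Sum>i\<in>UNIV. u i *s E i y) \<in> complexified (H y) \<longleftrightarrow> u t = 0) \<and>
     ((\<Sum>i\<in>UNIV. u i *s E i y) \<in> H10 (H y) (J y) \<longleftrightarrow> (\<forall>j. j \<notin> I \<longrightarrow> u j = 0))" if y: "y \<in> U" for y u
  proof -
    have yW: "y \<in> W" using y by (simp add: U_def)
    then have yS: "y \<in> S" using W(3) by blast
    interpret C: complex_structure "H y" "J y" by (rule complex_structure_point[OF CR yS])
    have 10: "(\<Sum>i\<in>I. f i *s E i y) \<in> H10 (H y) (J y)" for f
      by (intro vec.subspace_sum[OF C.H10_subspace] vec.subspace_scale[OF C.H10_subspace]) (use X(2)[OF yW hm] EI in auto)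
    have cn: "cnj_vec (\<Sum>i\<in>I. f i *s E (bar i) y) = (\<Sum>i\<in>I. cnj (f i) *s E i y)" for f
    proof -
      have "cnj_vec (\<Sum>i\<in>K. f i) = (\<Sum>i\<in>K. cnj_vec (f i))" for K and f :: "'n \<Rightarrow> complex^'n"
        by (simp add: cnj_vec_def vec_eq_iff)
      then show ?thesis by (simp add: Ebar)
    qed
    have 01: "cnj_vec (\<Sum>i\<in>I. f i *s E (bar i) y) \<in> H10 (H y) (J y)" for f unfolding cn by (rule 10)
    have c01: "(\<Sum>i\<in>I. f i *s E (bar i) y) \<in> complexified (H y)" for f
      using C.complexified_cnj[OF C.H10_complexified[OF 01[of f]]] by simp
    have split: "(\<Sum>i\<in>UNIV. f i *s E i y) = (\<Sum>i\<in>I. f i *s E i y) + (\<Sum>i\<in>I. f (bar i) *s E (bar i) y) + f t *s cvec v" for f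
      by (simp add: sum_index EI add.commute add.left_commute)
    have hc: "(\<Sum>i\<in>I. f i *s E i y) + (\<Sum>i\<in>I. g i *s E (bar i) y) \<in> complexified (H y)" for f g
      by (intro vec.subspace_add[OF C.complexified_subspace] C.H10_complexified 10 c01)
    \<comment> \<open>Transversality persists on \<open>U\<close> without further shrinking:
      otherwise all frame fields, which span the space, would lie in the complexification of
      H.\<close>
    have vy: "v \<notin> H y"
    proof
      assume "v \<in> H y"
      then have "cvec v \<in> complexified (H y)" by (simp add: C.complexified_cvec)
      then have all: "(\<Sum>i\<in>UNIV. f i *s E i y) \<in> complexified (H y)" for f
        unfolding split by (intro vec.subspace_add[OF C.complexified_subspace] hc vec.subspace_scale[OF C.complexified_subspace])
      have "w \<in> H y" for w
        using all[of "\<lambda>k. \<Sum>l\<in>UNIV. cvec w $ l * F.coE y $ l $ k"]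
        unfolding F.expand_vec[OF y] by (simp add: C.complexified_cvec)
      then have "H y = UNIV" by blast
      then show False using dim[OF yS]
        by (metis DIM_cart DIM_real add_eq_self_zero dim_UNIV mult.right_neutral zero_neq_one)
    qed
    have 1: "(\<Sum>i\<in>UNIV. u i *s E i y) \<in> complexified (H y) \<longleftrightarrow> u t = 0"
    proof
      assume "u t = 0"
      then show "(\<Sum>i\<in>UNIV. u i *s E i y) \<in> complexified (H y)" unfolding split using hc[of u "\<lambda>i. u (bar i)"] by simp
    next
      assume "(\<Sum>i\<in>UNIV. u i *s E i y) \<in> complexified (H y)"
      then have "u t *s cvec v \<in> complexified (H y)"
        using vec.subspace_diff[OF C.complexified_subspace _ hc[of u "\<lambda>i. u (bar i)"]] unfolding split by fastforce
      then show "u t = 0"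
      proof (rule contrapos_pp)
        assume ut: "u t \<noteq> 0"
        then have "inverse (u t) *s (u t *s cvec v) = cvec v" by (simp add: vec_eq_iff)
        then show "u t *s cvec v \<notin> complexified (H y)"
          using vec.subspace_scale[OF C.complexified_subspace, of "u t *s cvec v" "inverse (u t)"] C.complexified_cvec vy by auto
      qed
    qed
    have 2: "(\<Sum>i\<in>UNIV. u i *s E i y) \<in> H10 (H y) (J y) \<longleftrightarrow> (\<forall>j. j \<notin> I \<longrightarrow> u j = 0)"
    proof
      assume 0: "\<forall>j. j \<notin> I \<longrightarrow> u j = 0"
      then have "(\<Sum>i\<in>UNIV. u i *s E i y) = (\<Sum>i\<in>I. u i *s E i y)"
        by (intro sum.mono_neutral_right) auto
      then show "(\<Sum>i\<in>UNIV. u i *s E i y) \<in> H10 (H y) (J y)" using 10 by simp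
    next
      assume a: "(\<Sum>i\<in>UNIV. u i *s E i y) \<in> H10 (H y) (J y)"
      then have ut: "u t = 0" using 1 C.H10_complexified by blast
      have "(\<Sum>i\<in>I. u (bar i) *s E (bar i) y) = (\<Sum>i\<in>UNIV. u i *s E i y) - (\<Sum>i\<in>I. u i *s E i y)"
        unfolding split using ut by simp
      then have "(\<Sum>i\<in>I. u (bar i) *s E (bar i) y) \<in> H10 (H y) (J y)"
        using vec.subspace_diff[OF C.H10_subspace a 10[of u]] by simp
      from C.H10_cnj_zero[OF this 01] have z: "(\<Sum>i\<in>I. u (bar i) *s E (bar i) y) = 0" .
      then have "(\<Sum>i\<in>UNIV. u i *s E i y) = (\<Sum>i\<in>I. u i *s E i y)" unfolding split using ut by simp
      also have "\<dots> = (\<Sum>i\<in>UNIV. (if i \<in> I then u i else 0) *s E i y)"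
        by (intro sum.mono_neutral_cong_left) auto
      finally have "(\<Sum>i\<in>UNIV. u i *s E i y) $ k = (\<Sum>i\<in>UNIV. (if i \<in> I then u i else 0) *s E i y) $ k" for k
        by simp
      then have "(\<Sum>i\<in>UNIV. u i * E i y $ k) = (\<Sum>i\<in>UNIV. (if i \<in> I then u i else 0) * E i y $ k)" for k
        by simp
      from F.coeff_unique[OF y this] show "\<forall>j. j \<notin> I \<longrightarrow> u j = 0" by presburger
    qed
    from 1 2 show ?thesis by blast
  qed
  have "x \<in> U" "U \<subseteq> S" using W detx by (auto simp: U_def)
  then show ?thesis using main F.frame_axioms unfolding adapted_def by blast
qed

section \<open>Invertibility of the Levi matrix in an adapted frame\<close>

context frame begin

text \<open>The Levi form is defined through all local extensions of two vectors, so brackets are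
  needed for sections with variable coefficients.\<close>

lemma lie_bracket_sections:
  fixes x y :: "'n \<Rightarrow> real^'n \<Rightarrow> complex"
  assumes W: "open W" "W \<subseteq> S" "p \<in> W"
    and x: "\<And>i. reg Smooth W (x i)" and y: "\<And>i. reg Smooth W (y i)"
    and X: "\<And>q. q \<in> W \<Longrightarrow> X q = (\<Sum>i\<in>UNIV. x i q *s E i q)"
    and Y: "\<And>q. q \<in> W \<Longrightarrow> Y q = (\<Sum>i\<in>UNIV. y i q *s E i q)"
  shows "lie_bracket X Y p =
    (\<Sum>k\<in>UNIV. (cder (y k) p (X p) - cder (x k) p (Y p) + (\<Sum>i\<in>UNIV. \<Sum>j\<in>UNIV. x i p * y j p * cs i j k p)) *s E k p)"
proof -
  have p: "p \<in> S" using W by blast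
  have ES: "reg Smooth W (E i)" for i by (rule reg_subset[OF Smooth_E W(2)])
  have Enth: "reg Smooth W (\<lambda>q. E i q $ l)" for i l by (rule reg_vec_nth[OF W(1) ES])
  have regZ: "reg Smooth W Z" if "\<And>i. reg Smooth W (z i)" "\<And>q. q \<in> W \<Longrightarrow> Z q = (\<Sum>i\<in>UNIV. z i q *s E i q)"
    for z :: "'n \<Rightarrow> real^'n \<Rightarrow> complex" and Z
  proof -
    have "reg Smooth W (\<lambda>q. \<chi> l. \<Sum>i\<in>UNIV. z i q * E i q $ l)"
      by (intro reg_vec_lambda reg_sum reg_mult W(1) that(1) Enth)
    then show ?thesis by (rule reg_cong[OF W(1)]) (simp add: that(2) vec_eq_iff)
  qed
  have d: "cder (\<lambda>q. Z q $ l) p V = (\<Sum>i\<in>UNIV. cder (z i) p V * E i p $ l + z i p * cder (\<lambda>q. E i q $ l) p V)"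
    if z: "\<And>i. reg Smooth W (z i)" "\<And>q. q \<in> W \<Longrightarrow> Z q = (\<Sum>i\<in>UNIV. z i q *s E i q)"
    for z :: "'n \<Rightarrow> real^'n \<Rightarrow> complex" and Z V l
  proof -
    have diff: "z i differentiable (at p)" "(\<lambda>q. E i q $ l) differentiable (at p)" for i
      using reg_differentiable[OF z(1) W(3)] reg_differentiable[OF Enth W(3)] by auto
    have "cder (\<lambda>q. Z q $ l) p V = cder (\<lambda>q. \<Sum>i\<in>UNIV. z i q * E i q $ l) p V"
      by (rule cder_cong[OF W(1,3) reg_differentiable[OF reg_vec_nth[OF W(1) regZ[OF z]] W(3)]])
        (simp_all add: z(2))
    also have "\<dots> = (\<Sum>i\<in>UNIV. cder (\<lambda>q. z i q * E i q $ l) p V)"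
      by (rule cder_sum) (intro differentiable_mult diff)
    finally show ?thesis by (simp add: cder_mult diff)
  qed
  have dX: "cder (\<lambda>q. X q $ l) p V = (\<Sum>i\<in>UNIV. cder (x i) p V * E i p $ l + x i p * cder (\<lambda>q. E i q $ l) p V)" for V l
    by (rule d[OF x X])
  have dY: "cder (\<lambda>q. Y q $ l) p V = (\<Sum>i\<in>UNIV. cder (y i) p V * E i p $ l + y i p * cder (\<lambda>q. E i q $ l) p V)" for V l
    by (rule d[OF y Y])
  have lin: "cder g p (X p) = (\<Sum>i\<in>UNIV. x i p * cder g p (E i p))" "cder g p (Y p) = (\<Sum>i\<in>UNIV. y i p * cder g p (E i p))" for g
    unfolding X[OF W(3)] Y[OF W(3)] cder_linear(3) by auto
  have "lie_bracket X Y p $ l = (\<Sum>k\<in>UNIV. (cder (y k) p (X p) - cder (x k) p (Y p)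
      + (\<Sum>i\<in>UNIV. \<Sum>j\<in>UNIV. x i p * y j p * cs i j k p)) * E k p $ l)" for l
  proof -
    have "lie_bracket X Y p $ l = cder (\<lambda>q. Y q $ l) p (X p) - cder (\<lambda>q. X q $ l) p (Y p)"
      by (rule lie_bracket_nth[OF reg_differentiable[OF regZ[OF x X] W(3)] reg_differentiable[OF regZ[OF y Y] W(3)]])
    also have "\<dots> = (\<Sum>k\<in>UNIV. (cder (y k) p (X p) - cder (x k) p (Y p)) * E k p $ l)
       + ((\<Sum>j\<in>UNIV. y j p * cder (\<lambda>q. E j q $ l) p (X p)) - (\<Sum>i\<in>UNIV. x i p * cder (\<lambda>q. E i q $ l) p (Y p)))"
      by (simp add: dX dY sum.distrib left_diff_distrib sum_subtractf)
    also have "(\<Sum>j\<in>UNIV. y j p * cder (\<lambda>q. E j q $ l) p (X p)) - (\<Sum>i\<in>UNIV. x i p * cder (\<lambda>q. E i q $ l) p (Y p))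
       = (\<Sum>i\<in>UNIV. \<Sum>j\<in>UNIV. x i p * y j p * lie_bracket (E i) (E j) p $ l)"
    proof -
      have "(\<Sum>j\<in>UNIV. y j p * cder (\<lambda>q. E j q $ l) p (X p)) = (\<Sum>i\<in>UNIV. \<Sum>j\<in>UNIV. x i p * y j p * cder (\<lambda>q. E j q $ l) p (E i p))"
        unfolding lin by (subst sum.swap) (simp add: sum_distrib_left mult_ac)
      moreover have "(\<Sum>i\<in>UNIV. x i p * cder (\<lambda>q. E i q $ l) p (Y p)) = (\<Sum>i\<in>UNIV. \<Sum>j\<in>UNIV. x i p * y j p * cder (\<lambda>q. E i q $ l) p (E j p))"
        unfolding lin by (simp add: sum_distrib_left mult_ac)
      ultimately show ?thesis by (simp add: lie_bracket_E[OF p] right_diff_distrib sum_subtractf)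
    qed
    also have "\<dots> = (\<Sum>i\<in>UNIV. \<Sum>j\<in>UNIV. \<Sum>k\<in>UNIV. x i p * y j p * cs i j k p * E k p $ l)"
    proof -
      have "lie_bracket (E i) (E j) p $ l = (\<Sum>k\<in>UNIV. cs i j k p * E k p $ l)" for i j
        using arg_cong[OF bracket_expand[OF p, of i j], of "\<lambda>v. v $ l"] by simp
      then show ?thesis by (simp add: sum_distrib_left mult.assoc)
    qed
    also have "\<dots> = (\<Sum>k\<in>UNIV. (\<Sum>i\<in>UNIV. \<Sum>j\<in>UNIV. x i p * y j p * cs i j k p) * E k p $ l)"
    proof -
      have "(\<Sum>i\<in>UNIV. \<Sum>j\<in>UNIV. \<Sum>k\<in>UNIV. f i j k) = (\<Sum>k\<in>UNIV. \<Sum>i\<in>UNIV. \<Sum>j\<in>UNIV. f i j k)"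
        for f :: "'n \<Rightarrow> 'n \<Rightarrow> 'n \<Rightarrow> complex"
      proof -
        have "(\<Sum>i\<in>UNIV. \<Sum>j\<in>UNIV. \<Sum>k\<in>UNIV. f i j k) = (\<Sum>i\<in>UNIV. \<Sum>k\<in>UNIV. \<Sum>j\<in>UNIV. f i j k)"
          by (rule sum.cong[OF refl], rule sum.swap)
        also have "\<dots> = (\<Sum>k\<in>UNIV. \<Sum>i\<in>UNIV. \<Sum>j\<in>UNIV. f i j k)" by (rule sum.swap)
        finally show ?thesis .
      qed
      then show ?thesis by (simp add: sum_distrib_right)
    qed
    finally show ?thesis by (simp add: distrib_right sum.distrib)
  qed
  then show ?thesis by (simp add: vec_eq_iff distrib_right left_diff_distrib)
qed

lemma cnj_vec_sum: "cnj_vec (\<Sum>i\<in>K. f i) = (\<Sum>i\<in>K. cnj_vec (f i))" for f :: "'i \<Rightarrow> complex^'m"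
  by (simp add: cnj_vec_def vec_eq_iff)

text \<open>A kernel vector of the matrix would give a nonzero null vector of the Levi form. Values
  of the form are cosets collected over all extending sections, so every such bracket has to be
  shown to lie in the complexification of H.\<close>

lemma levi_matrix_invertible:
  assumes SU: "S \<subseteq> SS" and CR: "almost_CR_on \<rho> SS H J" and nondeg: "strongly_nondegenerate_at SS H J p"
    and p: "p \<in> S" and ad: "adapted I S E H J"
    and cx: "\<And>y u. y \<in> S \<Longrightarrow> (\<Sum>i\<in>UNIV. u i *s E i y) \<in> complexified (H y) \<longleftrightarrow> u t = 0"
  shows "det (\<chi> a b. if a \<in> I \<and> b \<in> I then cs a (bar b) t p else if a = b then 1 else 0) \<noteq> 0"
proof
  let ?L = "\<chi> a b. if a \<in> I \<and> b \<in> I then cs a (bar b) t p else if a = b then 1 else 0"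
  assume "det ?L = 0"
  then have "\<not> invertible ?L" by (simp add: invertible_det_nz)
  then obtain w where w: "?L *v w = 0" "w \<noteq> 0"
    using matrix_left_invertible_ker[of ?L] invertible_left_inverse[of ?L] by auto
  interpret C: complex_structure "H p" "J p" by (rule complex_structure_point[OF CR]) (use p SU in blast)
  have wI: "w $ a = 0" if "a \<notin> I" for a
  proof -
    have "(\<Sum>b\<in>UNIV. (if a \<in> I \<and> b \<in> I then cs a (bar b) t p else if a = b then 1 else 0) * w $ b) = 0"
      using arg_cong[OF w(1), of "\<lambda>v. v $ a"] by (simp add: matrix_vector_mult_def)
    also have "(\<Sum>b\<in>UNIV. (if a \<in> I \<and> b \<in> I then cs a (bar b) t p else if a = b then 1 else 0) * w $ b)
      = (\<Sum>b\<in>UNIV. if a = b then w $ b else 0)" using that by (intro sum.cong) auto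
    finally show ?thesis by simp
  qed
  have ker: "(\<Sum>b\<in>I. cs a (bar b) t p * w $ b) = 0" if "a \<in> I" for a
  proof -
    have "(\<Sum>b\<in>UNIV. (if a \<in> I \<and> b \<in> I then cs a (bar b) t p else if a = b then 1 else 0) * w $ b) = 0"
      using arg_cong[OF w(1), of "\<lambda>v. v $ a"] by (simp add: matrix_vector_mult_def)
    also have "(\<Sum>b\<in>UNIV. (if a \<in> I \<and> b \<in> I then cs a (bar b) t p else if a = b then 1 else 0) * w $ b)
      = (\<Sum>b\<in>I. cs a (bar b) t p * w $ b)"
      using that wI by (intro sum.mono_neutral_cong_right) auto
    finally show ?thesis .
  qed
  \<comment> \<open>The coefficients are conjugated because the Levi form is conjugate-linear in its
    first argument.\<close>
  define \<xi> where "\<xi> = (\<Sum>i\<in>UNIV. cnj (w $ i) *s E i p)"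
  have \<xi>10: "\<xi> \<in> H10 (H p) (J p)"
    unfolding \<xi>_def using ad p wI unfolding adapted_def by auto
  have "levi_form SS H J p \<xi> \<eta> = complexified (H p)" if \<eta>: "\<eta> \<in> H10 (H p) (J p)" for \<eta>
  proof -
    have br: "lie_bracket (\<lambda>y. cnj_vec (X y)) Y p \<in> complexified (H p)"
      if W: "open W" "p \<in> W" and X: "H10_section W H J X" and Y: "H10_section W H J Y" and X\<xi>: "X p = \<xi>" for W X Y
    proof -
      define W' where "W' = W \<inter> S"
      have W': "open W'" "W' \<subseteq> S" "p \<in> W'" using W S p by (auto simp: W'_def)
      define x y where "x i q = (\<Sum>l\<in>UNIV. X q $ l * coE q $ l $ i)" and "y i q = (\<Sum>l\<in>UNIV. Y q $ l * coE q $ l $ i)" for i q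
      have reg: "reg Smooth W' X" "reg Smooth W' Y"
        using X Y W(1) unfolding H10_section_def W'_def by (auto simp: regular_on_open_iff simp del: regular_on_open.simps intro: reg_subset)
      have coE: "reg Smooth W' (\<lambda>q. coE q $ l $ i)" for l i
        by (rule reg_subset[OF reg_imp_Smooth[OF S reg_coE] W'(2)])
      have xy: "reg Smooth W' (x i)" "reg Smooth W' (y i)" for i
        unfolding x_def[abs_def] y_def[abs_def]
        by (intro reg_sum reg_mult coE W'(1) reg_vec_nth[OF W'(1) reg(1)] reg_vec_nth[OF W'(1) reg(2)])+
      have ex: "X q = (\<Sum>i\<in>UNIV. x i q *s E i q)" "Y q = (\<Sum>i\<in>UNIV. y i q *s E i q)" if "q \<in> W'" for q
        using expand_vec[of q] W'(2) that unfolding x_def y_def by auto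
      have zero: "x j q = 0" "y j q = 0" if "q \<in> W'" "j \<notin> I" for j q
      proof -
        have "X q \<in> H10 (H q) (J q)" "Y q \<in> H10 (H q) (J q)"
          using X Y that unfolding H10_section_def W'_def by auto
        then show "x j q = 0" "y j q = 0"
          using ex[OF that(1)] ad that W'(2) unfolding adapted_def by auto
      qed
      have exb: "cnj_vec (X q) = (\<Sum>i\<in>UNIV. cnj (x (bar i) q) *s E i q)" if "q \<in> W'" for q
      proof -
        have "cnj_vec (X q) = (\<Sum>i\<in>UNIV. cnj (x i q) *s E (bar i) q)"
          unfolding ex(1)[OF that] cnj_vec_sum using W'(2) that by (auto simp: E_bar intro!: sum.cong)
        also have "\<dots> = (\<Sum>i\<in>UNIV. cnj (x (bar i) q) *s E i q)"
          by (subst sum_bar[symmetric]) simp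
        finally show ?thesis .
      qed
      have xp: "x i p = cnj (w $ i)" for i
      proof -
        have "(\<Sum>i\<in>UNIV. x i p * E i p $ m) = (\<Sum>i\<in>UNIV. cnj (w $ i) * E i p $ m)" for m
          using arg_cong[OF trans[OF ex(1)[OF W'(3), symmetric] trans[OF X\<xi> \<xi>_def]], of "\<lambda>v. v $ m"] by simp
        from coeff_unique[OF p this] show ?thesis .
      qed
      \<comment> \<open>The coefficients along \<open>E t\<close> vanish on a whole neighbourhood,
        so their derivatives drop out and only structure functions contribute to the transversal
        part of the bracket.\<close>
      have "cder (y t) p V = 0" for V
        using cder_cong[OF W'(1,3), of "\<lambda>q. 0" "y t" V] zero(2)[OF _ t_notin] by (simp add: cder_const)
      moreover have "cder (\<lambda>q. cnj (x (bar t) q)) p V = 0" for V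
        using cder_cong[OF W'(1,3), of "\<lambda>q. 0" "\<lambda>q. cnj (x t q)" V] zero(1)[OF _ t_notin] by (simp add: cder_const)
      moreover have "(\<Sum>i\<in>UNIV. \<Sum>j\<in>UNIV. cnj (x (bar i) p) * y j p * cs i j t p) = 0"
      proof -
        have "(\<Sum>i\<in>UNIV. \<Sum>j\<in>UNIV. cnj (x (bar i) p) * y j p * cs i j t p)
          = (\<Sum>i\<in>UNIV. \<Sum>j\<in>UNIV. cnj (x i p) * y j p * cs (bar i) j t p)"
          using sum_bar[of "\<lambda>i. \<Sum>j\<in>UNIV. cnj (x (bar i) p) * y j p * cs i j t p"] by simp
        also have "\<dots> = (\<Sum>j\<in>UNIV. y j p * (\<Sum>i\<in>UNIV. w $ i * cs (bar i) j t p))"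
          by (subst sum.swap) (simp add: xp sum_distrib_left mult_ac)
        also have "\<dots> = 0"
        proof (rule sum.neutral, intro ballI)
          fix j
          show "y j p * (\<Sum>i\<in>UNIV. w $ i * cs (bar i) j t p) = 0"
          proof (cases "j \<in> I")
            case True
            have "(\<Sum>i\<in>UNIV. w $ i * cs (bar i) j t p) = (\<Sum>i\<in>I. w $ i * cs (bar i) j t p)"
              using wI by (intro sum.mono_neutral_right) auto
            also have "\<dots> = - (\<Sum>i\<in>I. cs j (bar i) t p * w $ i)"
              by (subst cs_skew[OF p]) (simp add: sum_negf mult.commute)
            finally show ?thesis using ker[OF True] by simp
          next
            case False
            then show ?thesis using zero(2)[OF W'(3)] by simp
          qed
        qed
        finally show ?thesis .
      qed
      ultimately show ?thesis
        using cx[OF p, of "\<lambda>k. cder (y k) p (cnj_vec (X p)) - cder (\<lambda>q. cnj (x (bar k) q)) p (Y p) +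
            (\<Sum>i\<in>UNIV. \<Sum>j\<in>UNIV. cnj (x (bar i) p) * y j p * cs i j k p)"]
        by (simp only: lie_bracket_sections[OF W'(1,2,3) reg_cnj[OF W'(1) xy(1)] xy(2) exb ex(2)]) simp
    qed
    \<comment> \<open>Without a pair of extending sections the set representing the coset would be
      empty; constant coefficients in the frame provide one.\<close>
    have "\<exists>W X Y. open W \<and> p \<in> W \<and> W \<subseteq> SS \<and> H10_section W H J X \<and> H10_section W H J Y \<and> X p = \<xi> \<and> Y p = \<eta>"
    proof -
      define y where "y i = (\<Sum>l\<in>UNIV. \<eta> $ l * coE p $ l $ i)" for i
      have \<eta>y: "\<eta> = (\<Sum>i\<in>UNIV. y i *s E i p)" using expand_vec[OF p, of \<eta>] by (simp add: y_def)
      have yI: "y j = 0" if "j \<notin> I" for j using \<eta> \<eta>y ad p that unfolding adapted_def by auto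
      have sec: "H10_section S H J (\<lambda>q. \<Sum>i\<in>UNIV. u i *s E i q)" if "\<And>j. j \<notin> I \<Longrightarrow> u j = 0" for u
        unfolding H10_section_def
      proof
        have "reg Smooth S (\<lambda>q. \<chi> l. \<Sum>i\<in>UNIV. u i * E i q $ l)"
          by (intro reg_vec_lambda reg_sum reg_mult reg_const reg_vec_nth Smooth_E S)
        then have "reg Smooth S (\<lambda>q. \<Sum>i\<in>UNIV. u i *s E i q)"
          by (rule reg_cong[OF S]) (simp add: vec_eq_iff)
        then show "regular_on Smooth S (\<lambda>q. \<Sum>i\<in>UNIV. u i *s E i q)" by (rule reg_imp_regular_on[OF S])
        show "\<forall>y\<in>S. (\<Sum>i\<in>UNIV. u i *s E i y) \<in> H10 (H y) (J y)"
          using ad that unfolding adapted_def by auto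
      qed
      show ?thesis
        by (rule exI[of _ S], rule exI[of _ "\<lambda>q. \<Sum>i\<in>UNIV. cnj (w $ i) *s E i q"],
          rule exI[of _ "\<lambda>q. \<Sum>i\<in>UNIV. y i *s E i q"])
          (use sec[of "\<lambda>i. cnj (w $ i)"] sec[of y] wI yI S p SU \<eta>y \<xi>_def in simp)
    qed
    then obtain W X Y where WXY: "open W" "p \<in> W" "W \<subseteq> SS" "H10_section W H J X" "H10_section W H J Y" "X p = \<xi>" "Y p = \<eta>"
      by blast
    have iff: "z - (1 / (2 * \<i>)) *s b \<in> complexified (H p) \<longleftrightarrow> z \<in> complexified (H p)" if b: "b \<in> complexified (H p)" for z b
    proof -
      define c where "c = (1 / (2 * \<i>)) *s b"
      have c: "c \<in> complexified (H p)" unfolding c_def by (rule vec.subspace_scale[OF C.complexified_subspace b])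
      have "z - c \<in> complexified (H p) \<Longrightarrow> z - c + c \<in> complexified (H p)"
        by (rule vec.subspace_add[OF C.complexified_subspace _ c])
      moreover have "z \<in> complexified (H p) \<Longrightarrow> z - c \<in> complexified (H p)"
        by (rule vec.subspace_diff[OF C.complexified_subspace _ c])
      ultimately show ?thesis unfolding c_def[symmetric] by auto
    qed
    show ?thesis
    proof (intro set_eqI iffI)
      fix z assume "z \<in> levi_form SS H J p \<xi> \<eta>"
      then show "z \<in> complexified (H p)" unfolding levi_form_def using br iff by blast
    next
      fix z assume "z \<in> complexified (H p)"
      then show "z \<in> levi_form SS H J p \<xi> \<eta>"
        unfolding levi_form_def using WXY br[OF WXY(1,2,4,5,6)] iff by blast
    qed
  qed
  then have "\<xi> = 0" using nondeg \<xi>10 unfolding strongly_nondegenerate_at_def by blast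
  then have "(\<Sum>i\<in>UNIV. cnj (w $ i) * E i p $ m) = (\<Sum>i\<in>UNIV. 0 * E i p $ m)" for m
    using arg_cong[of \<xi> 0 "\<lambda>v. v $ m"] unfolding \<xi>_def sum_component by simp
  from coeff_unique[OF p this] have "w = 0" by (simp add: vec_eq_iff)
  then show False using w(2) by blast
qed

end

lemma det_of_real: "det (\<chi> i j. complex_of_real (P $ i $ j)) = of_real (det P)" for P :: "real^'n^'n"
  by (simp add: det_def of_real_sum of_real_prod)

context cr_pair begin

text \<open>The matrix is the Jacobian multiplied by two invertible frame matrices, so over
  \<open>S\<close> and \<open>S'\<close> the set \<open>V1\<close> is described by the
  Jacobian.\<close>

lemma det_Afun:
  assumes "x \<in> S" "y \<in> S'"
  shows "det (\<chi> i j. Afun i j (x, y, P)) \<noteq> 0 \<longleftrightarrow> det P \<noteq> 0"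
proof -
  have "(\<chi> i j. Afun i j (x, y, P)) = (\<chi> i j. E i x $ j) ** (\<chi> k l. of_real (P $ k $ l)) ** M'.coE y"
    by (simp add: Afun_def matrix_matrix_mult_def vec_eq_iff)
  moreover have "det (M'.coE y) \<noteq> 0"
  proof -
    have "M'.coE y ** (\<chi> i j. E' i y $ j) = mat 1"
      unfolding M'.coE_def by (rule minv_left[OF M'.det_E[OF assms(2)]])
    then have "det (M'.coE y) * det (\<chi> i j. E' i y $ j) = 1" by (metis det_mul det_I)
    then show ?thesis by auto
  qed
  ultimately show ?thesis using M.det_E[OF assms(1)] by (simp add: det_mul det_of_real)
qed

lemma V3_iff: "z \<in> V3 \<longleftrightarrow> fst z \<in> S \<and> fst (snd z) \<in> S' \<and> det (fst (snd (snd z))) \<noteq> 0"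
  unfolding V3_def V1_def using det_Afun[of "fst z" "fst (snd z)" "fst (snd (snd z))"] by auto

text \<open>The real differential, extended complex-linearly, intertwines the two structures and so
  maps \<open>H10\<close> into \<open>H10\<close>; in the adapted target frame this means that
  components outside \<open>I\<close> vanish.\<close>

lemma solutionI:
  assumes W: "open W" "W \<subseteq> S" and fW: "f ` W \<subseteq> S'" and f: "reg Smooth W f"
    and ad: "adapted I S E H J" and ad': "adapted I S' E' H' J'"
    and tr: "\<And>x. x \<in> W \<Longrightarrow> transforms_CR (frechet_derivative f (at x)) (H x) (J x) (H' (f x)) (J' (f x))"
    and det: "\<And>x. x \<in> W \<Longrightarrow> det (\<chi> k. frechet_derivative f (at x) (axis k 1)) \<noteq> 0"
  shows "solution W f"
  unfolding solution_def
proof (intro conjI W fW f ballI allI impI)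
  fix x assume x: "x \<in> W"
  have xS: "x \<in> S" "f x \<in> S'" using x W fW by auto
  show "q (f, x) \<in> V1" using det_Afun[OF xS] det[OF x] xS by (simp add: V1_def q_def)
  fix i j assume i: "i \<in> I" and j: "j \<notin> I"
  let ?D = "frechet_derivative f (at x)"
  have diff: "f differentiable (at x)" by (rule reg_differentiable[OF f x])
  have lin: "linear ?D" by (rule linear_frechet_derivative[OF diff])
  define Z where "Z = (\<chi> l. \<Sum>k\<in>UNIV. E i x $ k * of_real (?D (axis k 1) $ l))"
  have D: "?D v $ l = (\<Sum>k\<in>UNIV. v $ k * ?D (axis k 1) $ l)" for v l
    using arg_cong[OF frechet_derivative_sum_axis[OF diff, of v], of "\<lambda>w. w $ l"] by simp
  have Z: "Re_vec Z = ?D (Re_vec (E i x))" "Im_vec Z = ?D (Im_vec (E i x))"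
    unfolding vec_eq_iff D[of "Re_vec (E i x)"] D[of "Im_vec (E i x)"] by (simp_all add: Re_vec_def Im_vec_def Z_def)
  have "(\<Sum>k\<in>UNIV. (if k = i then 1 else 0) *s E k x) = (\<Sum>k\<in>UNIV. if k = i then E k x else 0)"
    by (rule sum.cong) auto
  then have e: "(\<Sum>k\<in>UNIV. (if k = i then 1 else 0) *s E k x) = E i x" by simp
  from ad xS(1) have "(\<Sum>k\<in>UNIV. u k *s E k x) \<in> H10 (H x) (J x) \<longleftrightarrow> (\<forall>j. j \<notin> I \<longrightarrow> u j = 0)" for u
    unfolding adapted_def by blast
  from this[of "\<lambda>k. if k = i then 1 else 0"] have "E i x \<in> H10 (H x) (J x)" unfolding e using i by auto
  then have "Z \<in> H10 (H' (f x)) (J' (f x))"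
    using tr[OF x] linear_neg[OF lin] unfolding H10_def complexified_def transforms_CR_def by (auto simp: Z)
  moreover have "(\<Sum>j\<in>UNIV. A i j (f, x) *s E' j (f x)) = Z"
    using M'.expand_vec[OF xS(2), of Z] by (simp add: A_def Afun_def q_def Z_def)
  ultimately show "A i j (f, x) = 0" using ad' xS(2) j unfolding adapted_def by auto
qed

end

text \<open>Frames disappear from the statement: what is left is a regular function of 2-jet
  coordinates, valid for every map from an open part of \<open>U\<close> into \<open>U'\<close> that
  respects the structures and has invertible Jacobian.\<close>

lemma local_system:
  fixes H H' :: "'n::finite distribution"
  assumes n: "CARD('n) \<ge> 2" and S: "open S" "open S'"
    and CR: "almost_CR_on \<rho> S H J" "almost_CR_on \<rho> S' H' J'"
    and dim: "\<And>x. x \<in> S \<Longrightarrow> dim (H x) + 1 = CARD('n)" "\<And>y. y \<in> S' \<Longrightarrow> dim (H' y) + 1 = CARD('n)"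
    and nondeg: "\<And>x. x \<in> S \<Longrightarrow> strongly_nondegenerate_at S H J x"
    and x0: "x0 \<in> S" and y0: "y0 \<in> S'"
  obtains U U' \<Gamma> where "open U" "x0 \<in> U" "U \<subseteq> S" "open U'" "y0 \<in> U'" "U' \<subseteq> S'"
    "open {z :: (real^'n) \<times> (real^'n) \<times> (real^'n^'n) \<times> (real^'n^'n^'n). fst z \<in> U \<and> fst (snd z) \<in> U' \<and> det (fst (snd (snd z))) \<noteq> 0}"
    "reg \<rho> {z. fst z \<in> U \<and> fst (snd z) \<in> U' \<and> det (fst (snd (snd z))) \<noteq> 0}
      (\<Gamma> :: (real^'n) \<times> (real^'n) \<times> (real^'n^'n) \<times> (real^'n^'n^'n) \<Rightarrow> real^'n^'n^'n^'n)"
    "\<And>W f x. open W \<Longrightarrow> W \<subseteq> U \<Longrightarrow> f ` W \<subseteq> U' \<Longrightarrow> reg Smooth W f \<Longrightarrow>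
      (\<And>x. x \<in> W \<Longrightarrow> transforms_CR (frechet_derivative f (at x)) (H x) (J x) (H' (f x)) (J' (f x))) \<Longrightarrow>
      (\<And>x. x \<in> W \<Longrightarrow> det (\<chi> k. frechet_derivative f (at x) (axis k 1)) \<noteq> 0) \<Longrightarrow> x \<in> W \<Longrightarrow>
      (\<chi> i j k. iter_deriv [axis i 1, axis j 1, axis k 1] f x) =
      \<Gamma> (x, f x, \<chi> i. iter_deriv [axis i 1] f x, \<chi> i j. iter_deriv [axis i 1, axis j 1] f x)"
proof -
  have "H x0 \<noteq> UNIV" using dim(1)[OF x0] by (metis DIM_cart DIM_real add_eq_self_zero dim_UNIV mult.right_neutral zero_neq_one)
  then obtain v where v: "v \<notin> H x0" by blast
  obtain W m and X :: "nat \<Rightarrow> real^'n \<Rightarrow> complex^'n" where *: "open W \<and> x0 \<in> W \<and> W \<subseteq> S \<and> (\<forall>i<m. reg \<rho> W (X i)) \<and>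
    (\<forall>y\<in>W. \<forall>i<m. X i y \<in> H10 (H y) (J y)) \<and> 2 * m + 1 = CARD('n) \<and>
    (\<forall>u. (\<Sum>i<m. u i *s X i x0) = 0 \<longrightarrow> (\<forall>i<m. u i = 0))"
    using basis_field[OF CR(1) x0 v dim(1)[OF x0]] by (elim exE)
  \<comment> \<open>\<open>2 * m + 1 \<ge> 2\<close> excludes \<open>m = 0\<close>, so that the
    index set \<open>I\<close> is nonempty.\<close>
  then have m: "CARD('n) = 2 * m + 1" "m \<noteq> 0" using n by auto
  from index_structure_exists[OF m] obtain I t and bar :: "'n \<Rightarrow> 'n" where ix: "index_structure I t bar"
    by (elim exE)
  have ex1: "\<exists>U E. x0 \<in> U \<and> U \<subseteq> S \<and> frame I t bar \<rho> U E \<and> adapted I U E H J \<and>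
    (\<forall>y\<in>U. \<forall>u. (\<Sum>i\<in>UNIV. u i *s E i y) \<in> complexified (H y) \<longleftrightarrow> u t = 0)"
    by (rule frame_exists[OF ix CR(1) S(1) dim(1) x0])
  have ex2: "\<exists>U E. y0 \<in> U \<and> U \<subseteq> S' \<and> frame I t bar \<rho> U E \<and> adapted I U E H' J' \<and>
    (\<forall>y\<in>U. \<forall>u. (\<Sum>i\<in>UNIV. u i *s E i y) \<in> complexified (H' y) \<longleftrightarrow> u t = 0)"
    by (rule frame_exists[OF ix CR(2) S(2) dim(2) y0])
  obtain U E where E: "x0 \<in> U \<and> U \<subseteq> S \<and> frame I t bar \<rho> U E \<and> adapted I U E H J \<and>
    (\<forall>y\<in>U. \<forall>u. (\<Sum>i\<in>UNIV. u i *s E i y) \<in> complexified (H y) \<longleftrightarrow> u t = 0)"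
    using ex1 by (elim exE)
  obtain U' E' where E': "y0 \<in> U' \<and> U' \<subseteq> S' \<and> frame I t bar \<rho> U' E' \<and> adapted I U' E' H' J' \<and>
    (\<forall>y\<in>U'. \<forall>u. (\<Sum>i\<in>UNIV. u i *s E' i y) \<in> complexified (H' y) \<longleftrightarrow> u t = 0)"
    using ex2 by (elim exE)
  interpret M: frame I t bar \<rho> U E using E by blast
  interpret M': frame I t bar \<rho> U' E' using E' by blast
  interpret cr_pair I t bar \<rho> U E U' E'
  proof
    fix x assume x: "x \<in> U"
    have US: "U \<subseteq> S" and ad: "adapted I U E H J"
      and cx: "\<And>y u. y \<in> U \<Longrightarrow> (\<Sum>i\<in>UNIV. u i *s E i y) \<in> complexified (H y) \<longleftrightarrow> u t = 0" using E by auto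
    show "det (\<chi> a b. if a \<in> I \<and> b \<in> I then M.cs a (bar b) t x else if a = b then 1 else 0) \<noteq> 0"
      by (rule M.levi_matrix_invertible[OF US CR(1) nondeg x ad cx]) (use x US in auto)
  qed
  from third_derivatives obtain \<Gamma> where \<Gamma>: "reg \<rho> V3 \<Gamma>" "\<And>s. s \<in> Dom \<Longrightarrow>
     (\<chi> i j k. iter_deriv [axis i 1, axis j 1, axis k 1] (fst s) (snd s)) = \<Gamma> (q3 s)" by blast
  have V3: "V3 = {z. fst z \<in> U \<and> fst (snd z) \<in> U' \<and> det (fst (snd (snd z))) \<noteq> 0}" using V3_iff by blast
  show ?thesis
  proof (rule that[of U U' \<Gamma>])
    fix W f x
    assume as: "open W" "W \<subseteq> U" "f ` W \<subseteq> U'" "reg Smooth W f"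
      "\<And>x. x \<in> W \<Longrightarrow> transforms_CR (frechet_derivative f (at x)) (H x) (J x) (H' (f x)) (J' (f x))"
      "\<And>x. x \<in> W \<Longrightarrow> det (\<chi> k. frechet_derivative f (at x) (axis k 1)) \<noteq> 0" and x: "x \<in> W"
    have "solution W f" by (rule solutionI[OF as(1-4) _ _ as(5,6)]) (use E E' in auto)
    then have "(f, x) \<in> Dom" using x by (auto simp: Dom_def)
    from \<Gamma>(2)[OF this] show "(\<chi> i j k. iter_deriv [axis i 1, axis j 1, axis k 1] f x) =
      \<Gamma> (x, f x, \<chi> i. iter_deriv [axis i 1] f x, \<chi> i j. iter_deriv [axis i 1, axis j 1] f x)"
      unfolding q3_def fst_conv snd_conv prod.case .
  qed (use E E' M.S M'.S \<Gamma>(1) V3 open_V3 in \<open>auto simp del: regular_on_open.simps\<close>)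
qed

section \<open>Contact of maps between Euclidean spaces\<close>

lemma iter_deriv_append: "iter_deriv (vs @ [v]) F = iter_deriv vs (\<lambda>x. frechet_derivative F (at x) v)"
  by (induction vs) simp_all

lemma reg_iter:
  fixes F :: "'e::euclidean_space \<Rightarrow> 'f::euclidean_space"
  shows "open S \<Longrightarrow> reg \<rho> S F \<Longrightarrow> reg \<rho> S (iter_deriv vs F)"
  by (induction vs) (simp_all add: reg_deriv del: regular_on_open.simps)

lemma iter_deriv_cong:
  fixes F G :: "'e::euclidean_space \<Rightarrow> 'f::euclidean_space"
  assumes S: "open S" and F: "reg Smooth S F" and eq: "\<And>x. x \<in> S \<Longrightarrow> F x = G x"
  shows "x \<in> S \<Longrightarrow> iter_deriv vs F x = iter_deriv vs G x"
proof (induction vs arbitrary: x)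
  case (Cons v vs)
  have "(iter_deriv vs G has_derivative frechet_derivative (iter_deriv vs F) (at x)) (at x)"
    by (rule has_derivative_transform_within_open[OF reg_has_derivative[OF reg_iter[OF S F] Cons.prems] S Cons.prems Cons.IH])
  from frechet_derivative_eq[OF this] show ?case by simp
qed (simp add: eq)

definition same_jet :: "nat \<Rightarrow> 'e::real_normed_vector \<Rightarrow> ('e \<Rightarrow> 'f::real_normed_vector) \<Rightarrow> ('e \<Rightarrow> 'f) \<Rightarrow> bool" where
  "same_jet k a F G \<longleftrightarrow> (\<forall>vs. length vs \<le> k \<longrightarrow> iter_deriv vs F a = iter_deriv vs G a)"

lemma same_jet_refl: "same_jet k a F F" by (simp add: same_jet_def)

lemma same_jet_sym: "same_jet k a F G \<Longrightarrow> same_jet k a G F" by (simp add: same_jet_def)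

lemma same_jet_trans: "same_jet k a F G \<Longrightarrow> same_jet k a G K \<Longrightarrow> same_jet k a F K" by (simp add: same_jet_def)

lemma same_jet_cong:
  fixes F G :: "'e::euclidean_space \<Rightarrow> 'f::euclidean_space"
  assumes "open S" "a \<in> S" "reg Smooth S F" "\<And>x. x \<in> S \<Longrightarrow> F x = G x"
  shows "same_jet k a F G"
  unfolding same_jet_def using iter_deriv_cong[OF assms(1,3,4,2)] by blast

lemma same_jet_0: "same_jet 0 a F G \<longleftrightarrow> F a = G a" by (simp add: same_jet_def)

text \<open>The last direction in a list is the one that acts first. Splitting it off gives a
  recursion in the order, on which the rules for sums, products and composites rest.\<close>

lemma same_jet_Suc: "same_jet (Suc k) a F G \<longleftrightarrow> F a = G a \<and>
    (\<forall>v. same_jet k a (\<lambda>x. frechet_derivative F (at x) v) (\<lambda>x. frechet_derivative G (at x) v))"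
proof (intro iffI conjI allI)
  assume *: "same_jet (Suc k) a F G"
  show "F a = G a" using *[unfolded same_jet_def, rule_format, of "[]"] by simp
  fix v
  show "same_jet k a (\<lambda>x. frechet_derivative F (at x) v) (\<lambda>x. frechet_derivative G (at x) v)"
    unfolding same_jet_def
  proof (intro allI impI)
    fix vs :: "'a list" assume "length vs \<le> k"
    then have "iter_deriv (vs @ [v]) F a = iter_deriv (vs @ [v]) G a"
      using * unfolding same_jet_def by (metis length_append_singleton Suc_le_mono)
    then show "iter_deriv vs (\<lambda>x. frechet_derivative F (at x) v) a = iter_deriv vs (\<lambda>x. frechet_derivative G (at x) v) a"
      by (simp only: iter_deriv_append)
  qed
next
  assume *: "F a = G a \<and> (\<forall>v. same_jet k a (\<lambda>x. frechet_derivative F (at x) v) (\<lambda>x. frechet_derivative G (at x) v))"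
  show "same_jet (Suc k) a F G"
    unfolding same_jet_def
  proof (intro allI impI)
    fix vs :: "'a list" assume l: "length vs \<le> Suc k"
    show "iter_deriv vs F a = iter_deriv vs G a"
    proof (cases vs rule: rev_cases)
      case (snoc ws v)
      then show ?thesis using * l unfolding same_jet_def by (simp add: iter_deriv_append)
    next
      case Nil
      then show ?thesis using * by simp
    qed
  qed
qed

text \<open>Formulas for derivatives of compound maps are available only near \<open>a\<close>;
  \<open>F'\<close> and \<open>G'\<close> stand for such formulas.\<close>

lemma same_jet_SucI:
  assumes "F a = G a" "\<And>v. same_jet k a (F' v) (\<lambda>x. frechet_derivative F (at x) v)"
    "\<And>v. same_jet k a (G' v) (\<lambda>x. frechet_derivative G (at x) v)" "\<And>v. same_jet k a (F' v) (G' v)"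
  shows "same_jet (Suc k) a F G"
  unfolding same_jet_Suc
  using assms(1) same_jet_trans[OF same_jet_trans[OF same_jet_sym[OF assms(2)] assms(4)] assms(3)] by blast

lemma same_jet_mono: "same_jet k a F G \<Longrightarrow> l \<le> k \<Longrightarrow> same_jet l a F G"
  by (auto simp: same_jet_def)

lemma same_jet_add:
  fixes F F' G G' :: "'e::euclidean_space \<Rightarrow> 'f::euclidean_space"
  assumes S: "open S" "a \<in> S"
  shows "reg Smooth S F \<Longrightarrow> reg Smooth S F' \<Longrightarrow> reg Smooth S G \<Longrightarrow> reg Smooth S G' \<Longrightarrow>
    same_jet k a F F' \<Longrightarrow> same_jet k a G G' \<Longrightarrow> same_jet k a (\<lambda>x. F x + G x) (\<lambda>x. F' x + G' x)"
proof (induction k arbitrary: F F' G G')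
  case (Suc k)
  have eq: "frechet_derivative (\<lambda>x. P x + Q x) (at x) v = frechet_derivative P (at x) v + frechet_derivative Q (at x) v"
    if "reg Smooth S P" "reg Smooth S Q" "x \<in> S" for P Q :: "'e \<Rightarrow> 'f" and x v
    using frechet_derivative_eq[OF has_derivative_add[OF reg_has_derivative[OF that(1,3)] reg_has_derivative[OF that(2,3)]]]
    by simp
  have c: "same_jet k a (\<lambda>x. frechet_derivative P (at x) v + frechet_derivative Q (at x) v) (\<lambda>x. frechet_derivative (\<lambda>x. P x + Q x) (at x) v)"
    if "reg Smooth S P" "reg Smooth S Q" for P Q :: "'e \<Rightarrow> 'f" and v
    by (rule same_jet_cong[OF S]) (use eq[OF that] in \<open>auto intro!: reg_add reg_deriv S that simp del: regular_on_open.simps\<close>)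
  have "same_jet k a (\<lambda>x. frechet_derivative F (at x) v + frechet_derivative G (at x) v)
      (\<lambda>x. frechet_derivative F' (at x) v + frechet_derivative G' (at x) v)" for v
    by (rule Suc.IH) (use Suc.prems in \<open>auto intro!: reg_deriv S simp: same_jet_Suc simp del: regular_on_open.simps\<close>)
  then show ?case
    by (intro same_jet_SucI[OF _ c[OF Suc.prems(1,3)] c[OF Suc.prems(2,4)]])
      (use Suc.prems(5,6) in \<open>simp_all add: same_jet_Suc del: regular_on_open.simps\<close>)
qed (simp only: same_jet_0)

lemma same_jet_sum:
  fixes F G :: "'i \<Rightarrow> 'e::euclidean_space \<Rightarrow> 'f::euclidean_space"
  assumes S: "open S" "a \<in> S" and "finite K"
    and r: "\<And>i. reg Smooth S (F i)" "\<And>i. reg Smooth S (G i)" and s: "\<And>i. same_jet k a (F i) (G i)"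
  shows "same_jet k a (\<lambda>x. \<Sum>i\<in>K. F i x) (\<lambda>x. \<Sum>i\<in>K. G i x)"
  using \<open>finite K\<close>
proof induction
  case (insert i K)
  then show ?case
    by (simp del: regular_on_open.simps, intro same_jet_add[OF S] reg_sum S r s) auto
qed (simp only: sum.empty same_jet_refl)

lemma same_jet_scaleR:
  fixes F F' :: "'e::euclidean_space \<Rightarrow> real" and G G' :: "'e \<Rightarrow> 'f::euclidean_space"
  assumes S: "open S" "a \<in> S"
  shows "reg Smooth S F \<Longrightarrow> reg Smooth S F' \<Longrightarrow> reg Smooth S G \<Longrightarrow> reg Smooth S G' \<Longrightarrow>
    same_jet k a F F' \<Longrightarrow> same_jet k a G G' \<Longrightarrow> same_jet k a (\<lambda>x. F x *\<^sub>R G x) (\<lambda>x. F' x *\<^sub>R G' x)"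
proof (induction k arbitrary: F F' G G')
  case (Suc k)
  have eq: "frechet_derivative (\<lambda>x. P x *\<^sub>R Q x) (at x) v = P x *\<^sub>R frechet_derivative Q (at x) v + frechet_derivative P (at x) v *\<^sub>R Q x"
    if "reg Smooth S P" "reg Smooth S Q" "x \<in> S" for P and Q :: "'e \<Rightarrow> 'f" and x v
    using frechet_derivative_eq[OF has_derivative_scaleR[OF reg_has_derivative[OF that(1,3)] reg_has_derivative[OF that(2,3)]]]
    by simp
  have c: "same_jet k a (\<lambda>x. P x *\<^sub>R frechet_derivative Q (at x) v + frechet_derivative P (at x) v *\<^sub>R Q x) (\<lambda>x. frechet_derivative (\<lambda>x. P x *\<^sub>R Q x) (at x) v)"
    if "reg Smooth S P" "reg Smooth S Q" for P and Q :: "'e \<Rightarrow> 'f" and v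
    by (rule same_jet_cong[OF S]) (use eq[OF that] in \<open>auto intro!: reg_add reg_scaleR reg_deriv S that simp del: regular_on_open.simps\<close>)
  have lower: "same_jet k a F F'" "same_jet k a G G'" using Suc.prems(5,6) same_jet_mono by fastforce+
  have "same_jet k a (\<lambda>x. F x *\<^sub>R frechet_derivative G (at x) v + frechet_derivative F (at x) v *\<^sub>R G x)
      (\<lambda>x. F' x *\<^sub>R frechet_derivative G' (at x) v + frechet_derivative F' (at x) v *\<^sub>R G' x)" for v
    by (intro same_jet_add[OF S] Suc.IH reg_scaleR reg_deriv S Suc.prems(1-4) lower)
      (use Suc.prems in \<open>auto simp: same_jet_Suc simp del: regular_on_open.simps\<close>)
  then show ?case
    by (intro same_jet_SucI[OF _ c[OF Suc.prems(1,3)] c[OF Suc.prems(2,4)]])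
      (use Suc.prems(5,6) in \<open>simp_all add: same_jet_Suc del: regular_on_open.simps\<close>)
qed (simp only: same_jet_0)

lemma frechet_derivative_sum_Basis:
  fixes F :: "'e::euclidean_space \<Rightarrow> 'f::real_normed_vector"
  assumes "F differentiable (at x)"
  shows "frechet_derivative F (at x) v = (\<Sum>b\<in>Basis. (v \<bullet> b) *\<^sub>R frechet_derivative F (at x) b)"
proof -
  have lin: "linear (frechet_derivative F (at x))" by (rule linear_frechet_derivative[OF assms])
  have "frechet_derivative F (at x) (\<Sum>b\<in>Basis. (v \<bullet> b) *\<^sub>R b) = (\<Sum>b\<in>Basis. (v \<bullet> b) *\<^sub>R frechet_derivative F (at x) b)"
    by (simp add: linear_sum[OF lin] linear_scale[OF lin])
  then show ?thesis by (simp add: euclidean_representation)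
qed

lemma frechet_derivative_compose_Basis:
  fixes f :: "'e::euclidean_space \<Rightarrow> 'f::euclidean_space" and g :: "'f \<Rightarrow> 'g::euclidean_space"
  assumes "f differentiable (at x)" "g differentiable (at (f x))"
  shows "frechet_derivative (\<lambda>x. g (f x)) (at x) v =
    (\<Sum>b\<in>Basis. (frechet_derivative f (at x) v \<bullet> b) *\<^sub>R frechet_derivative g (at (f x)) b)"
proof -
  have "frechet_derivative (\<lambda>x. g (f x)) (at x) v = frechet_derivative g (at (f x)) (frechet_derivative f (at x) v)"
    by (rule fun_cong[OF frechet_derivative_eq[OF has_derivative_compose[OF has_derivative_frechet[OF assms(1)]
        has_derivative_frechet[OF assms(2)]]]])
  then show ?thesis using frechet_derivative_sum_Basis[OF assms(2)] by metis
qed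

text \<open>Induction on the order with the ordinary chain rule: the derivative of a composite is a
  sum of products whose factors have contact of the lower order.\<close>

lemma same_jet_compose:
  fixes f f' :: "'e::euclidean_space \<Rightarrow> 'f::euclidean_space" and g g' :: "'f \<Rightarrow> 'g::euclidean_space"
  assumes S: "open S" "a \<in> S" and T: "open T" and fS: "f ` S \<subseteq> T" "f' ` S \<subseteq> T"
    and f: "reg Smooth S f" "reg Smooth S f'"
  shows "reg Smooth T g \<Longrightarrow> reg Smooth T g' \<Longrightarrow> same_jet k a f f' \<Longrightarrow> same_jet k (f a) g g' \<Longrightarrow>
    same_jet k a (\<lambda>x. g (f x)) (\<lambda>x. g' (f' x))"
proof (induction k arbitrary: g g')
  case (Suc k)
  have reg: "reg Smooth S (\<lambda>x. frechet_derivative P (at x) v \<bullet> b)" if "reg Smooth S P" for P :: "'e \<Rightarrow> 'f" and v b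
  proof -
    have "linear (\<lambda>w :: 'f. w \<bullet> b)" by (intro linearI) (auto simp: inner_add_left)
    from reg_linear[OF S(1) this reg_deriv[OF S(1) that]] show ?thesis .
  qed
  have c: "same_jet k a (\<lambda>x. \<Sum>b\<in>Basis. (frechet_derivative P (at x) v \<bullet> b) *\<^sub>R frechet_derivative Q (at (P x)) b)
      (\<lambda>x. frechet_derivative (\<lambda>x. Q (P x)) (at x) v)"
    if P: "reg Smooth S P" "P ` S \<subseteq> T" and Q: "reg Smooth T Q" for P :: "'e \<Rightarrow> 'f" and Q :: "'f \<Rightarrow> 'g" and v
  proof (rule same_jet_cong[OF S])
    show "reg Smooth S (\<lambda>x. \<Sum>b\<in>Basis. (frechet_derivative P (at x) v \<bullet> b) *\<^sub>R frechet_derivative Q (at (P x)) b)"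
      by (intro reg_sum reg_scaleR S reg_compose[OF S(1) T P(2,1) reg_deriv[OF T Q]] reg[OF P(1)])
    show "(\<Sum>b\<in>Basis. (frechet_derivative P (at x) v \<bullet> b) *\<^sub>R frechet_derivative Q (at (P x)) b) =
        frechet_derivative (\<lambda>x. Q (P x)) (at x) v" if x: "x \<in> S" for x
      by (rule frechet_derivative_compose_Basis[symmetric, OF reg_differentiable[OF P(1) x] reg_differentiable[OF Q]])
        (use P(2) x in blast)
  qed
  have fa: "f a = f' a" using Suc.prems(3) by (simp add: same_jet_Suc)
  have inn: "same_jet k a (\<lambda>x. P x \<bullet> b) (\<lambda>x. Q x \<bullet> b)" if P: "reg Smooth S P" and Q: "reg Smooth S Q" and PQ: "same_jet k a P Q"
    for P Q :: "'e \<Rightarrow> 'f" and b k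
    using P Q PQ
  proof (induction k arbitrary: P Q)
    case (Suc k)
    have eq: "frechet_derivative (\<lambda>x. P x \<bullet> b) (at x) v = frechet_derivative P (at x) v \<bullet> b" if "reg Smooth S P" "x \<in> S" for P v x
      using frechet_derivative_eq[OF has_derivative_inner_left[OF reg_has_derivative[OF that], of b]] by simp
    have c': "same_jet k a (\<lambda>x. frechet_derivative P (at x) v \<bullet> b) (\<lambda>x. frechet_derivative (\<lambda>x. P x \<bullet> b) (at x) v)" if "reg Smooth S P" for P v
      by (rule same_jet_cong[OF S reg[OF that]]) (simp add: eq[OF that])
    have "same_jet k a (\<lambda>x. frechet_derivative P (at x) v \<bullet> b) (\<lambda>x. frechet_derivative Q (at x) v \<bullet> b)" for v
      by (rule Suc.IH) (use Suc.prems in \<open>auto intro!: reg_deriv S simp: same_jet_Suc simp del: regular_on_open.simps\<close>)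
    then show ?case
      by (intro same_jet_SucI[OF _ c'[OF Suc.prems(1)] c'[OF Suc.prems(2)]])
        (use Suc.prems(3) in \<open>simp_all add: same_jet_Suc del: regular_on_open.simps\<close>)
  qed (simp only: same_jet_0)
  have low: "same_jet k a f f'" using Suc.prems(3) same_jet_mono by fastforce
  have "same_jet k a (\<lambda>x. \<Sum>b\<in>Basis. (frechet_derivative f (at x) v \<bullet> b) *\<^sub>R frechet_derivative g (at (f x)) b)
    (\<lambda>x. \<Sum>b\<in>Basis. (frechet_derivative f' (at x) v \<bullet> b) *\<^sub>R frechet_derivative g' (at (f' x)) b)" for v
  proof (rule same_jet_sum[OF S finite_Basis])
    fix b :: 'f
    have 1: "reg Smooth S (\<lambda>x. frechet_derivative g (at (f x)) b)" "reg Smooth S (\<lambda>x. frechet_derivative g' (at (f' x)) b)"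
      by (rule reg_compose[OF S(1) T fS(1) f(1) reg_deriv[OF T Suc.prems(1)]],
          rule reg_compose[OF S(1) T fS(2) f(2) reg_deriv[OF T Suc.prems(2)]])
    show "reg Smooth S (\<lambda>x. (frechet_derivative f (at x) v \<bullet> b) *\<^sub>R frechet_derivative g (at (f x)) b)"
      "reg Smooth S (\<lambda>x. (frechet_derivative f' (at x) v \<bullet> b) *\<^sub>R frechet_derivative g' (at (f' x)) b)"
      by (intro reg_scaleR S 1 reg f)+
    show "same_jet k a (\<lambda>x. (frechet_derivative f (at x) v \<bullet> b) *\<^sub>R frechet_derivative g (at (f x)) b)
      (\<lambda>x. (frechet_derivative f' (at x) v \<bullet> b) *\<^sub>R frechet_derivative g' (at (f' x)) b)"
    proof (rule same_jet_scaleR[OF S reg[OF f(1)] reg[OF f(2)] 1])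
      show "same_jet k a (\<lambda>x. frechet_derivative f (at x) v \<bullet> b) (\<lambda>x. frechet_derivative f' (at x) v \<bullet> b)"
        by (rule inn) (use Suc.prems(3) f in \<open>auto intro!: reg_deriv S simp: same_jet_Suc simp del: regular_on_open.simps\<close>)
      show "same_jet k a (\<lambda>x. frechet_derivative g (at (f x)) b) (\<lambda>x. frechet_derivative g' (at (f' x)) b)"
        by (rule Suc.IH[OF reg_deriv[OF T Suc.prems(1)] reg_deriv[OF T Suc.prems(2)] low])
          (use Suc.prems(4) in \<open>auto simp: same_jet_Suc\<close>)
    qed
  qed
  moreover have "g (f a) = g' (f' a)" using Suc.prems(4) fa by (simp add: same_jet_Suc)
  ultimately show ?case
    by (intro same_jet_SucI[OF _ c[OF f(1) fS(1) Suc.prems(1)] c[OF f(2) fS(2) Suc.prems(2)]])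
next
  case 0
  from 0(3,4) have "f a = f' a" "g (f a) = g' (f a)" unfolding same_jet_0 .
  then have "g (f a) = g' (f' a)" by metis
  then show ?case unfolding same_jet_0 .
qed

text \<open>Derivatives in arbitrary directions are combinations, with constant coefficients, of
  those along the axes.\<close>

lemma same_jet_axis:
  fixes F G :: "real^'n \<Rightarrow> 'f::euclidean_space"
  assumes S: "open S" "a \<in> S"
  shows "reg Smooth S F \<Longrightarrow> reg Smooth S G \<Longrightarrow>
    (\<And>is. length is \<le> k \<Longrightarrow> iter_deriv (map (\<lambda>i. axis i 1) is) F a = iter_deriv (map (\<lambda>i. axis i 1) is) G a) \<Longrightarrow>
    same_jet k a F G"
proof (induction k arbitrary: F G)
  case (Suc k)
  let ?D = "\<lambda>F i x. frechet_derivative F (at x) (axis i 1)"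
  have c: "same_jet k a (\<lambda>x. \<Sum>i\<in>UNIV. v $ i *\<^sub>R ?D P i x) (\<lambda>x. frechet_derivative P (at x) v)"
    if P: "reg Smooth S P" for P :: "real^'n \<Rightarrow> 'f" and v
    by (rule same_jet_cong[OF S])
      (use frechet_derivative_sum_axis[OF reg_differentiable[OF P]] in
        \<open>auto intro!: reg_sum reg_scaleR reg_deriv S P simp del: regular_on_open.simps\<close>)
  have "same_jet k a (?D F i) (?D G i)" for i
  proof (rule Suc.IH)
    fix js :: "'n list" assume "length js \<le> k"
    then have "iter_deriv (map (\<lambda>i. axis i 1) (js @ [i])) F a = iter_deriv (map (\<lambda>i. axis i 1) (js @ [i])) G a"
      by (intro Suc.prems(3)) simp
    then show "iter_deriv (map (\<lambda>i. axis i 1) js) (?D F i) a = iter_deriv (map (\<lambda>i. axis i 1) js) (?D G i) a"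
      by (simp add: iter_deriv_append)
  qed (rule reg_deriv[OF S(1) Suc.prems(1)], rule reg_deriv[OF S(1) Suc.prems(2)])
  then have "same_jet k a (\<lambda>x. \<Sum>i\<in>UNIV. v $ i *\<^sub>R ?D F i x) (\<lambda>x. \<Sum>i\<in>UNIV. v $ i *\<^sub>R ?D G i x)" for v
    by (intro same_jet_sum[OF S] same_jet_scaleR[OF S] same_jet_refl reg_scaleR reg_const reg_deriv S Suc.prems) auto
  moreover have "F a = G a" using Suc.prems(3)[of "[]"] by simp
  ultimately show ?case
    by (intro same_jet_SucI[OF _ c[OF Suc.prems(1)] c[OF Suc.prems(2)]])
next
  case 0
  from 0(3)[of "[]"] show ?case by (simp add: same_jet_0)
qed

section \<open>Jet coordinates and their transition maps\<close>

type_synonym 'n j2 = "(real^'n) \<times> (real^'n) \<times> (real^'n^'n) \<times> (real^'n^'n^'n)"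
type_synonym 'n j3 = "'n j2 \<times> (real^'n^'n^'n^'n)"

definition J2 :: "(real^'n \<Rightarrow> real^'n) \<Rightarrow> real^'n \<Rightarrow> 'n::finite j2" where
  "J2 F x = (x, F x, \<chi> i. iter_deriv [axis i 1] F x, \<chi> i j. iter_deriv [axis i 1, axis j 1] F x)"

definition J3 :: "(real^'n \<Rightarrow> real^'n) \<Rightarrow> real^'n \<Rightarrow> 'n::finite j3" where
  "J3 F x = (J2 F x, \<chi> i j k. iter_deriv [axis i 1, axis j 1, axis k 1] F x)"

lemma J2_same: "same_jet 2 a F G \<Longrightarrow> J2 F a = J2 G a"
  and J3_same: "same_jet 3 a F G \<Longrightarrow> J3 F a = J3 G a"
proof -
  assume "same_jet 2 a F G"
  then have *: "iter_deriv vs F a = iter_deriv vs G a" if "length vs \<le> 2" for vs using that by (simp add: same_jet_def)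
  show "J2 F a = J2 G a" using *[of "[]"] by (simp add: J2_def * del: iter_deriv.simps(2))
next
  assume "same_jet 3 a F G"
  then have *: "iter_deriv vs F a = iter_deriv vs G a" if "length vs \<le> 3" for vs using that by (simp add: same_jet_def)
  show "J3 F a = J3 G a" using *[of "[]"] by (simp add: J3_def J2_def * del: iter_deriv.simps(2))
qed

lemma length_le_3_cases:
  assumes "length is \<le> (3::nat)"
  obtains "is = []" | i where "is = [i]" | i j where "is = [i, j]" | i j k where "is = [i, j, k]"
  using assms by (cases "is"; cases "tl is"; cases "tl (tl is)"; cases "tl (tl (tl is))") auto

lemma J3_eq_iff:
  assumes S: "open S" "a \<in> S" and F: "reg Smooth S F" and G: "reg Smooth S G"
  shows "J3 F a = J3 G a \<longleftrightarrow> same_jet 3 a F G"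
proof
  assume *: "J3 F a = J3 G a"
  show "same_jet 3 a F G"
  proof (rule same_jet_axis[OF S F G])
    fix js :: "'a list" assume "length js \<le> 3"
    then show "iter_deriv (map (\<lambda>i. axis i 1) js) F a = iter_deriv (map (\<lambda>i. axis i 1) js) G a"
      using * by (cases rule: length_le_3_cases) (auto simp: J3_def J2_def vec_eq_iff simp del: iter_deriv.simps(2))
  qed
qed (rule J3_same)

lemma J2_eq_iff:
  assumes S: "open S" "a \<in> S" and F: "reg Smooth S F" and G: "reg Smooth S G"
  shows "J2 F a = J2 G a \<longleftrightarrow> same_jet 2 a F G"
proof
  assume *: "J2 F a = J2 G a"
  show "same_jet 2 a F G"
  proof (rule same_jet_axis[OF S F G])
    fix js :: "'a list" assume l: "length js \<le> 2"
    then have "length js \<le> 3" by simp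
    then show "iter_deriv (map (\<lambda>i. axis i 1) js) F a = iter_deriv (map (\<lambda>i. axis i 1) js) G a"
      using * l by (cases rule: length_le_3_cases) (auto simp: J3_def J2_def vec_eq_iff simp del: iter_deriv.simps(2))
  qed
qed (rule J2_same)

text \<open>\<open>B1\<close>, \<open>B2\<close> and \<open>B3\<close> are the multilinear maps
  whose values on the axes are the entries of the array.\<close>

definition B1 :: "real^'n^'n \<Rightarrow> real^'n \<Rightarrow> real^'n" where "B1 P u = (\<Sum>i\<in>UNIV. u $ i *\<^sub>R P $ i)"
definition B2 :: "real^'n^'n^'n \<Rightarrow> real^'n \<Rightarrow> real^'n \<Rightarrow> real^'n" where "B2 Q u v = (\<Sum>i\<in>UNIV. u $ i *\<^sub>R B1 (Q $ i) v)"
definition B3 :: "real^'n^'n^'n^'n \<Rightarrow> real^'n \<Rightarrow> real^'n \<Rightarrow> real^'n \<Rightarrow> real^'n" where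
  "B3 R u v w = (\<Sum>i\<in>UNIV. u $ i *\<^sub>R B2 (R $ i) v w)"

lemma B_zero [simp]: "B1 P 0 = 0" "B2 Q 0 v = 0" "B2 Q u 0 = 0" "B3 R 0 v w = 0" "B3 R u 0 w = 0" "B3 R u v 0 = 0"
  by (simp_all add: B1_def B2_def B3_def)

lemma B_axis [simp]: "B1 P (axis i 1) = P $ i" "B2 Q (axis i 1) v = B1 (Q $ i) v" "B3 R (axis i 1) v w = B2 (R $ i) v w"
  by (simp_all add: B1_def B2_def B3_def axis_def if_distrib[of "\<lambda>z. z *\<^sub>R _"] cong: if_cong)

lemma B2_sym: "(\<And>i j. Q $ i $ j = Q $ j $ i) \<Longrightarrow> B2 Q u v = B2 Q v u"
  unfolding B2_def B1_def scaleR_sum_right scaleR_scaleR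
  by (subst sum.swap) (metis (no_types, lifting) mult.commute sum.cong)

lemma B3_sym:
  assumes "\<And>i j k. R $ i $ j $ k = R $ j $ i $ k" "\<And>i j k. R $ i $ j $ k = R $ i $ k $ j"
  shows "B3 R u v w = B3 R v u w" "B3 R u v w = B3 R u w v"
proof -
  show "B3 R u v w = B3 R u w v" unfolding B3_def using assms(2) B2_sym by metis
  have "(\<Sum>i\<in>UNIV. u $ i *\<^sub>R (\<Sum>j\<in>UNIV. v $ j *\<^sub>R X i j)) = (\<Sum>j\<in>UNIV. v $ j *\<^sub>R (\<Sum>i\<in>UNIV. u $ i *\<^sub>R X i j))"
    for X :: "'a \<Rightarrow> 'a \<Rightarrow> real^'a"
    by (simp add: scaleR_sum_right mult.commute) (rule sum.swap)
  note swap = this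
  have r: "B1 (R $ i $ j) w = B1 (R $ j $ i) w" for i j using arg_cong[of "R $ i $ j" "R $ j $ i" "\<lambda>P. B1 P w"] assms(1) by (simp add: vec_eq_iff)
  have e: "B3 R v u w = (\<Sum>j\<in>UNIV. v $ j *\<^sub>R (\<Sum>i\<in>UNIV. u $ i *\<^sub>R B1 (R $ i $ j) w))"
    unfolding B3_def B2_def using r by (intro sum.cong refl arg_cong2[of _ _ _ _ scaleR]) auto
  from swap[of "\<lambda>i j. B1 (R $ i $ j) w"] have "B3 R u v w = (\<Sum>j\<in>UNIV. v $ j *\<^sub>R (\<Sum>i\<in>UNIV. u $ i *\<^sub>R B1 (R $ i $ j) w))"
    unfolding B3_def B2_def .
  with e show "B3 R u v w = B3 R v u w" by simp
qed

lemma has_derivative_B1: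
  assumes "(f has_derivative f') (at x)"
  shows "((\<lambda>x. B1 P (f x)) has_derivative (\<lambda>v. B1 P (f' v))) (at x)"
  unfolding B1_def
  by (intro has_derivative_sum has_derivative_scaleR_left bounded_linear.has_derivative[OF bounded_linear_vec_nth] assms)

lemma has_derivative_B2:
  assumes "(f has_derivative f') (at x)" "(g has_derivative g') (at x)"
  shows "((\<lambda>x. B2 Q (f x) (g x)) has_derivative (\<lambda>v. B2 Q (f x) (g' v) + B2 Q (f' v) (g x))) (at x)"
proof -
  have "((\<lambda>x. B2 Q (f x) (g x)) has_derivative (\<lambda>v. \<Sum>i\<in>UNIV. f x $ i *\<^sub>R B1 (Q $ i) (g' v) + f' v $ i *\<^sub>R B1 (Q $ i) (g x))) (at x)"
    unfolding B2_def
    by (intro has_derivative_sum has_derivative_scaleR has_derivative_B1 bounded_linear.has_derivative[OF bounded_linear_vec_nth] assms)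
  then show ?thesis by (simp add: B2_def sum.distrib)
qed

lemma has_derivative_B3:
  assumes "(f has_derivative f') (at x)" "(g has_derivative g') (at x)" "(h has_derivative h') (at x)"
  shows "((\<lambda>x. B3 R (f x) (g x) (h x)) has_derivative
    (\<lambda>v. (B3 R (f x) (g x) (h' v) + B3 R (f x) (g' v) (h x)) + B3 R (f' v) (g x) (h x))) (at x)"
proof -
  have "((\<lambda>x. B3 R (f x) (g x) (h x)) has_derivative (\<lambda>v. \<Sum>i\<in>UNIV. f x $ i *\<^sub>R (B2 (R $ i) (g x) (h' v) + B2 (R $ i) (g' v) (h x))
      + f' v $ i *\<^sub>R B2 (R $ i) (g x) (h x))) (at x)"
    unfolding B3_def
    by (intro has_derivative_sum has_derivative_scaleR has_derivative_B2 bounded_linear.has_derivative[OF bounded_linear_vec_nth] assms)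
  then show ?thesis by (simp add: B3_def sum.distrib scaleR_add_right)
qed

text \<open>The Taylor polynomial of order 3 at the source point, with the jet coordinates as
  coefficients.\<close>

definition cubic :: "'n::finite j3 \<Rightarrow> real^'n \<Rightarrow> real^'n" where
  "cubic z \<xi> = (case z of ((x, y, P, Q), R) \<Rightarrow>
     y + B1 P (\<xi> - x) + (1/2) *\<^sub>R B2 Q (\<xi> - x) (\<xi> - x) + (1/6) *\<^sub>R B3 R (\<xi> - x) (\<xi> - x) (\<xi> - x))"

lemma cubic_base [simp]: "cubic z (fst (fst z)) = fst (snd (fst z))"
  by (cases z) (auto simp: cubic_def)

lemma reg_cubic: "reg \<rho> UNIV (\<lambda>p. cubic (fst p) (snd p))"
  unfolding cubic_def case_prod_unfold B1_def B2_def B3_def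
  by (intro reg_add reg_diff reg_scaleR reg_sum reg_vec_nth reg_fst reg_snd reg_id reg_const open_UNIV)

lemma reg_cubic_right: "reg \<rho> UNIV (cubic z)"
  using reg_compose[OF open_UNIV open_UNIV _ reg_Pair[OF open_UNIV reg_const[where c=z] reg_id[OF open_UNIV]] reg_cubic[of \<rho>]]
  by (simp del: regular_on_open.simps)

lemma has_derivative_diff_const: "((\<lambda>\<xi>. \<xi> - x) has_derivative (\<lambda>v. v)) (at \<xi>)"
  by (auto intro!: derivative_eq_intros)

lemma has_derivative_cubic: "(cubic ((x, y, P, Q), R) has_derivative (\<lambda>v. B1 P v
    + (1/2) *\<^sub>R (B2 Q (\<xi> - x) v + B2 Q v (\<xi> - x))
    + (1/6) *\<^sub>R ((B3 R (\<xi> - x) (\<xi> - x) v + B3 R (\<xi> - x) v (\<xi> - x)) + B3 R v (\<xi> - x) (\<xi> - x)))) (at \<xi>)"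
proof -
  note d = has_derivative_diff_const
  have "((\<lambda>\<xi>. y + B1 P (\<xi> - x) + (1/2) *\<^sub>R B2 Q (\<xi> - x) (\<xi> - x) + (1/6) *\<^sub>R B3 R (\<xi> - x) (\<xi> - x) (\<xi> - x)) has_derivative
    (\<lambda>v. 0 + B1 P v
    + (1/2) *\<^sub>R (B2 Q (\<xi> - x) v + B2 Q v (\<xi> - x))
    + (1/6) *\<^sub>R ((B3 R (\<xi> - x) (\<xi> - x) v + B3 R (\<xi> - x) v (\<xi> - x)) + B3 R v (\<xi> - x) (\<xi> - x)))) (at \<xi>)"
    by (intro has_derivative_add has_derivative_const has_derivative_scaleR_right has_derivative_B1 has_derivative_B2 has_derivative_B3 d)
  then show ?thesis by (simp add: cubic_def[abs_def])
qed

lemma frechet_derivative_cubic: "frechet_derivative (cubic z) (at (fst (fst z))) (axis k 1) = fst (snd (snd (fst z))) $ k"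
  by (cases z) (auto simp: frechet_derivative_eq[OF has_derivative_cubic])

definition sym2 :: "real^'n^'n^'n \<Rightarrow> bool" where "sym2 Q \<longleftrightarrow> (\<forall>i j. Q $ i $ j = Q $ j $ i)"
definition sym3 :: "real^'n^'n^'n^'n \<Rightarrow> bool" where
  "sym3 R \<longleftrightarrow> (\<forall>i j k. R $ i $ j $ k = R $ j $ i $ k) \<and> (\<forall>i j k. R $ i $ j $ k = R $ i $ k $ j)"

text \<open>Symmetry enters because the polynomial sees only the symmetric part of the arrays, while
  the coordinates list every mixed partial derivative. It also absorbs the reversed order in which
  the directions of \<open>iter_deriv\<close> appear.\<close>

lemma J3_cubic:
  assumes "sym2 (snd (snd (snd (fst z))))" "sym3 (snd z)"
  shows "J3 (cubic z) (fst (fst z)) = z"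
proof -
  obtain x y P Q R where z: "z = ((x, y, P, Q), R)" by (metis surj_pair)
  have Q: "B2 Q u v = B2 Q v u" and R: "B3 R u v w = B3 R v u w" "B3 R u v w = B3 R u w v" for u v w
    using assms B2_sym[of Q] B3_sym[of R] by (auto simp: z sym2_def sym3_def)
  have e1: "iter_deriv [a] (cubic z) = (\<lambda>\<xi>. B1 P a + B2 Q a (\<xi> - x) + (1/2) *\<^sub>R B3 R a (\<xi> - x) (\<xi> - x))" for a
  proof
    fix \<xi>
    have "B3 R (\<xi> - x) (\<xi> - x) a = B3 R a (\<xi> - x) (\<xi> - x)" "B3 R (\<xi> - x) a (\<xi> - x) = B3 R a (\<xi> - x) (\<xi> - x)"
      "B2 Q (\<xi> - x) a = B2 Q a (\<xi> - x)" using Q R by metis+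
    then show "iter_deriv [a] (cubic z) \<xi> = B1 P a + B2 Q a (\<xi> - x) + (1/2) *\<^sub>R B3 R a (\<xi> - x) (\<xi> - x)"
      unfolding iter_deriv.simps z frechet_derivative_eq[OF has_derivative_cubic]
      by (simp add: scaleR_add_right[symmetric] scaleR_add_left[symmetric] vec_eq_iff)
  qed
  note d = has_derivative_diff_const
  have e2: "iter_deriv [a, b] (cubic z) = (\<lambda>\<xi>. B2 Q b a + B3 R b a (\<xi> - x))" for a b
  proof
    fix \<xi>
    have "((\<lambda>\<xi>. B1 P b + B2 Q b (\<xi> - x) + (1/2) *\<^sub>R B3 R b (\<xi> - x) (\<xi> - x)) has_derivative
      (\<lambda>v. 0 + (B2 Q b v + B2 Q 0 (\<xi> - x)) + (1/2) *\<^sub>R ((B3 R b (\<xi> - x) v + B3 R b v (\<xi> - x)) + B3 R 0 (\<xi> - x) (\<xi> - x)))) (at \<xi>)"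
      by (intro has_derivative_add has_derivative_const has_derivative_scaleR_right has_derivative_B1 has_derivative_B2 has_derivative_B3 d)
    from frechet_derivative_eq[OF this] have "iter_deriv [a, b] (cubic z) \<xi> = B2 Q b a + (1/2) *\<^sub>R (B3 R b (\<xi> - x) a + B3 R b a (\<xi> - x))"
      unfolding iter_deriv.simps(2)[of a "[b]"] e1 by simp
    also have "B3 R b (\<xi> - x) a = B3 R b a (\<xi> - x)" using R by metis
    finally show "iter_deriv [a, b] (cubic z) \<xi> = B2 Q b a + B3 R b a (\<xi> - x)" by (simp add: vec_eq_iff)
  qed
  have e3: "iter_deriv [c, a, b] (cubic z) = (\<lambda>\<xi>. B3 R b a c)" for a b c
  proof
    fix \<xi>
    have "((\<lambda>\<xi>. B2 Q b a + B3 R b a (\<xi> - x)) has_derivative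
      (\<lambda>v. 0 + ((B3 R b a v + B3 R b 0 (\<xi> - x)) + B3 R 0 a (\<xi> - x)))) (at \<xi>)"
      by (intro has_derivative_add has_derivative_const has_derivative_B3 d)
    from frechet_derivative_eq[OF this] show "iter_deriv [c, a, b] (cubic z) \<xi> = B3 R b a c"
      unfolding iter_deriv.simps(2)[of c "[a, b]"] e2 by simp
  qed
  have sR: "R $ k $ j $ i = R $ i $ j $ k" for i j k using assms(2) unfolding z sym3_def snd_conv by metis
  have sQ: "Q $ j $ i = Q $ i $ j" for i j using assms(1) unfolding z sym2_def fst_conv snd_conv by metis
  have "cubic z x = y" using cubic_base[of z] by (simp add: z)
  then show ?thesis
    unfolding J3_def J2_def e1 e2 e3 by (simp add: z vec_eq_iff sR sQ)
qed

text \<open>With \<open>z\<close> as a parameter, derivatives in \<open>\<xi>\<close> are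
  derivatives of the joint map in directions \<open>(0, v)\<close>, and as such they depend
  regularly on the parameter.\<close>

lemma iter_deriv_section:
  fixes H :: "'p::euclidean_space \<times> 'e::euclidean_space \<Rightarrow> 'f::euclidean_space"
  assumes D: "open D" and H: "reg Smooth D H"
  shows "(z, \<xi>) \<in> D \<Longrightarrow> iter_deriv vs (\<lambda>\<xi>. H (z, \<xi>)) \<xi> = iter_deriv (map (Pair 0) vs) H (z, \<xi>)"
proof (induction vs arbitrary: \<xi>)
  case (Cons v vs)
  define K where "K = iter_deriv (map (Pair 0) vs) H"
  have K: "(K has_derivative frechet_derivative K (at (z, \<xi>))) (at (z, \<xi>))"
    unfolding K_def by (rule reg_has_derivative[OF reg_iter[OF D H] Cons.prems])
  have "((\<lambda>\<xi>. (z, \<xi>)) has_derivative (\<lambda>v. (0, v))) (at \<xi>)" by (auto intro!: derivative_eq_intros)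
  from has_derivative_compose[OF this K]
  have d: "((\<lambda>\<xi>. K (z, \<xi>)) has_derivative (\<lambda>v. frechet_derivative K (at (z, \<xi>)) (0, v))) (at \<xi>)" .
  have "open (Pair z -` D)" by (rule open_vimage[OF D]) (intro continuous_intros)
  from has_derivative_transform_within_open[OF d this, of "iter_deriv vs (\<lambda>\<xi>. H (z, \<xi>))"] Cons
  have "(iter_deriv vs (\<lambda>\<xi>. H (z, \<xi>)) has_derivative (\<lambda>v. frechet_derivative K (at (z, \<xi>)) (0, v))) (at \<xi>)"
    by (simp add: K_def)
  from frechet_derivative_eq[OF this] show ?case by (simp add: K_def)
qed simp

lemma reg_J3_section:
  fixes H :: "'p::euclidean_space \<times> (real^'n) \<Rightarrow> real^'n" and a :: "'p \<Rightarrow> real^'n"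
  assumes D: "open D" and H: "reg \<rho> D H" and N: "open N" and a: "reg \<rho> N a" and aD: "\<And>z. z \<in> N \<Longrightarrow> (z, a z) \<in> D"
  shows "reg \<rho> N (\<lambda>z. J3 (\<lambda>\<xi>. H (z, \<xi>)) (a z))"
proof -
  have c: "reg \<rho> N (\<lambda>z. iter_deriv vs H (z, a z))" for vs
    by (rule reg_compose[OF N D _ reg_Pair[OF N reg_id[OF N] a] reg_iter[OF D H]]) (use aD in blast)
  have "reg \<rho> N (\<lambda>z. ((a z, iter_deriv [] H (z, a z), \<chi> i. iter_deriv [(0, axis i 1)] H (z, a z),
     \<chi> i j. iter_deriv [(0, axis i 1), (0, axis j 1)] H (z, a z)),
     \<chi> i j k. iter_deriv [(0, axis i 1), (0, axis j 1), (0, axis k 1)] H (z, a z)))"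
    by (intro reg_Pair N a reg_vec_lambda c)
  then show ?thesis
  proof (rule reg_cong[OF N])
    fix z assume "z \<in> N"
    note e = iter_deriv_section[OF D reg_imp_Smooth[OF D H] aD[OF this]]
    show "((a z, iter_deriv [] H (z, a z), \<chi> i. iter_deriv [(0, axis i 1)] H (z, a z),
     \<chi> i j. iter_deriv [(0, axis i 1), (0, axis j 1)] H (z, a z)),
     \<chi> i j k. iter_deriv [(0, axis i 1), (0, axis j 1), (0, axis k 1)] H (z, a z)) = J3 (\<lambda>\<xi>. H (z, \<xi>)) (a z)"
      unfolding J3_def J2_def e list.map by simp
  qed
qed

text \<open>Every jet is the jet of a polynomial depending polynomially on the jet coordinates; so changing the
  charts of source and target acts on jet coordinates regularly, without a formula for higher derivatives
  of composites.\<close>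

lemma reg_J3_transition:
  fixes S S' T :: "real^'n \<Rightarrow> real^'n"
  assumes O: "open O1" "open O2" "open O3" and S: "reg \<rho> O1 S" and S': "reg \<rho> O2 S'" "S' ` O2 \<subseteq> O1"
    and SS': "\<And>x. x \<in> O2 \<Longrightarrow> S (S' x) = x" and T: "reg \<rho> O3 T"
  shows "open {z :: 'n::finite j3. fst (fst z) \<in> O2 \<and> fst (snd (fst z)) \<in> O3}" (is "open ?N")
    and "reg \<rho> {z. fst (fst z) \<in> O2 \<and> fst (snd (fst z)) \<in> O3}
      (\<lambda>z. J3 (\<lambda>\<xi>. T (cubic z (S \<xi>))) (S' (fst (fst z))))"
proof -
  have "open ((\<lambda>z. (fst (fst z), fst (snd (fst z)))) -` (O2 \<times> O3) :: 'n j3 set)"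
    by (intro open_vimage open_Times O continuous_intros)
  moreover have "(\<lambda>z. (fst (fst z), fst (snd (fst z)))) -` (O2 \<times> O3) = ?N" by auto
  ultimately show N: "open ?N" by simp
  have U: "open ((UNIV :: 'n j3 set) \<times> O1)" by (intro open_Times O open_UNIV)
  have S2: "reg \<rho> (UNIV \<times> O1) (\<lambda>p :: 'n j3 \<times> (real^'n). S (snd p))"
    by (rule reg_compose[OF U O(1) _ reg_snd[OF U reg_id[OF U]] S]) auto
  have c: "reg \<rho> (UNIV \<times> O1) (\<lambda>p :: 'n j3 \<times> (real^'n). cubic (fst p) (S (snd p)))"
    using reg_compose[OF U open_UNIV _ reg_Pair[OF U reg_fst[OF U reg_id[OF U]] S2] reg_cubic] by (simp del: regular_on_open.simps)
  \<comment> \<open>Here the inner map lands in the domain of \<open>T\<close>; the set is open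
    jointly in the polynomial and the point.\<close>
  define D where "D = (\<lambda>p :: 'n j3 \<times> (real^'n). cubic (fst p) (S (snd p))) -` O3 \<inter> (UNIV \<times> O1)"
  have D: "open D"
    unfolding D_def using reg_continuous_on[OF c] continuous_on_open_vimage[OF U] O(3) by blast
  have TD: "reg \<rho> D (\<lambda>p. T (cubic (fst p) (S (snd p))))"
    by (rule reg_compose[OF D O(3) _ reg_subset[OF c] T]) (auto simp: D_def)
  have a: "reg \<rho> ?N (\<lambda>z. S' (fst (fst z)))"
    by (rule reg_compose[OF N O(2) _ reg_fst[OF N reg_fst[OF N reg_id[OF N]]] S'(1)]) auto
  have "(z, S' (fst (fst z))) \<in> D" if "z \<in> ?N" for z using that S'(2) by (auto simp: D_def SS')
  from reg_J3_section[OF D TD N a this] show "reg \<rho> ?N (\<lambda>z. J3 (\<lambda>\<xi>. T (cubic z (S \<xi>))) (S' (fst (fst z))))"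
    by (simp del: regular_on_open.simps)
qed

text \<open>Adjacent transpositions suffice. Exchanging the two derivatives that act first is an
  identity on a neighbourhood and can be differentiated once more.\<close>

lemma sym_J3:
  assumes S: "open S" "a \<in> S" and F: "reg Smooth S F"
  shows "sym2 (snd (snd (snd (J2 F a))))" "sym3 (snd (J3 F a))"
proof -
  have sw: "iter_deriv (v # w # vs) F x = iter_deriv (w # v # vs) F x" if "x \<in> S" for x v w vs
    using schwarz[OF S(1) reg_iter[OF S(1) F] that] by simp
  have "iter_deriv [u, v, w] F a = iter_deriv [u, w, v] F a" for u v w
  proof -
    have "same_jet 1 a (iter_deriv [v, w] F) (iter_deriv [w, v] F)"
      by (rule same_jet_cong[OF S reg_iter[OF S(1) F]]) (rule sw)
    then have "iter_deriv [u] (iter_deriv [v, w] F) a = iter_deriv [u] (iter_deriv [w, v] F) a"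
      unfolding same_jet_def by (metis One_nat_def length_Cons list.size(3) order_refl)
    then show ?thesis by simp
  qed
  then show "sym2 (snd (snd (snd (J2 F a))))" "sym3 (snd (J3 F a))"
    unfolding sym2_def sym3_def J2_def J3_def using sw[OF S(2)] by (auto simp del: iter_deriv.simps)
qed

section \<open>Local inverses\<close>

text \<open>The real Jacobian is inverted through the complex \<open>minv\<close>; taking real parts
  is harmless since the Jacobian has real entries.\<close>

lemma inverse_matrix_derivative:
  fixes L :: "real^'n \<Rightarrow> real^'n"
  assumes L: "linear L" and d: "det (\<chi> i. L (axis i 1)) \<noteq> 0"
  shows "L (\<chi> l. \<Sum>m\<in>UNIV. v $ m * Re (minv (\<chi> i j. of_real (L (axis i 1) $ j)) $ m $ l)) = v"
proof -
  define P where "P = (\<chi> i. L (axis i 1))"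
  define N where "N = minv (\<chi> i j. complex_of_real (P $ i $ j))"
  have N: "(\<Sum>l\<in>UNIV. N $ m $ l * of_real (P $ l $ j)) = (if m = j then 1 else 0)" for m j
    using minv_sum(2)[of "\<chi> i j. complex_of_real (P $ i $ j)" m j] d unfolding N_def det_of_real P_def[symmetric] by simp
  define M where "M = (\<chi> l. \<Sum>m\<in>UNIV. v $ m * Re (N $ m $ l))"
  have "L M $ j = v $ j" for j
  proof -
    have "L M = L (\<Sum>l\<in>UNIV. M $ l *\<^sub>R axis l 1)" using vec_representation[of M] by simp
    also have "\<dots> = (\<Sum>l\<in>UNIV. M $ l *\<^sub>R P $ l)" by (simp add: linear_sum[OF L] linear_scale[OF L] P_def)
    finally have "L M $ j = (\<Sum>l\<in>UNIV. \<Sum>m\<in>UNIV. v $ m * (Re (N $ m $ l) * P $ l $ j))"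
      by (simp add: M_def sum_distrib_right mult.assoc)
    also have "\<dots> = (\<Sum>m\<in>UNIV. v $ m * Re (\<Sum>l\<in>UNIV. N $ m $ l * of_real (P $ l $ j)))"
      by (subst sum.swap) (simp add: sum_distrib_left)
    also have "\<dots> = (\<Sum>m\<in>UNIV. if m = j then v $ m else 0)" unfolding N by (intro sum.cong) auto
    also have "\<dots> = v $ j" by simp
    finally show ?thesis .
  qed
  then have "L M = v" by (simp add: vec_eq_iff)
  then show ?thesis by (simp add: M_def N_def P_def)
qed

text \<open>The inverse function theorem gives a differentiable inverse. Its derivative is
  \<open>M (g y) v\<close>, where \<open>M\<close> inverts the Jacobian and is smooth by Cramer's
  rule; so if \<open>g\<close> is of some class, its derivative is of the same class, and the order
  grows by one at each step.\<close>

lemma local_inverse: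
  fixes f :: "real^'n \<Rightarrow> real^'n"
  assumes U: "open U" and f: "reg Smooth U f" and x0: "x0 \<in> U" and d: "det (\<chi> i. frechet_derivative f (at x0) (axis i 1)) \<noteq> 0"
    and O': "open O'" "f x0 \<in> O'"
  obtains V V' g where "open V" "x0 \<in> V" "V \<subseteq> U" "open V'" "V' \<subseteq> O'" "homeomorphism V V' f g" "reg Smooth V' g"
proof -
  let ?c = "\<lambda>x. \<chi> i j. complex_of_real (frechet_derivative f (at x) (axis i 1) $ j)"
  have cr: "reg Smooth U (\<lambda>x. ?c x $ i $ j)" for i j
    by (simp del: regular_on_open.simps, intro reg_of_real reg_vec_nth reg_deriv U f)
  define U1 where "U1 = (\<lambda>x. (f x, det (?c x))) -` (O' \<times> (- {0})) \<inter> U"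
  have "continuous_on U (\<lambda>x. (f x, det (?c x)))"
    by (intro continuous_on_Pair reg_continuous_on[OF f] reg_continuous_on[OF reg_det[OF U cr]])
  then have o: "open B \<Longrightarrow> open ((\<lambda>x. (f x, det (?c x))) -` B \<inter> U)" for B
    using continuous_on_open_vimage[OF U] by blast
  have U1: "open U1" unfolding U1_def by (intro o open_Times O' open_Compl closed_singleton)
  have cdet: "det (?c x) = of_real (det (\<chi> i. frechet_derivative f (at x) (axis i 1)))" for x
    using det_of_real[of "\<chi> i. frechet_derivative f (at x) (axis i 1)"] by simp
  have x01: "x0 \<in> U1" using x0 d O' by (simp add: U1_def cdet)
  have U1U: "U1 \<subseteq> U" by (auto simp: U1_def)
  have d1: "det (\<chi> i. frechet_derivative f (at x) (axis i 1)) \<noteq> 0" if "x \<in> U1" for x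
    using that unfolding U1_def cdet by simp
  have hd: "(f has_derivative frechet_derivative f (at x)) (at x)" if "x \<in> U1" for x
    using reg_has_derivative[OF f] that U1U by blast
  define f' where "f' x = Blinfun (frechet_derivative f (at x))" for x
  have f': "blinfun_apply (f' x) = frechet_derivative f (at x)" if "x \<in> U1" for x
    unfolding f'_def by (rule bounded_linear_Blinfun_apply[OF has_derivative_bounded_linear[OF hd[OF that]]])
  define M where "M x v = (\<chi> l. \<Sum>m\<in>UNIV. v $ m * Re (minv (?c x) $ m $ l))" for x v
  have fM: "frechet_derivative f (at x) (M x v) = v" if "x \<in> U1" for x v
    unfolding M_def by (rule inverse_matrix_derivative[OF has_derivative_linear[OF hd[OF that]] d1[OF that]])
  have linM: "linear (M x)" for x
    unfolding M_def by (intro linearI) (auto simp: vec_eq_iff distrib_right sum.distrib sum_distrib_left mult.assoc)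
  define h where "h = M x0"
  have "frechet_derivative f (at x0) \<circ> h = id" using fM[OF x01] by (auto simp: h_def)
  then have "h \<circ> frechet_derivative f (at x0) = id"
    using linear_inverse_left[OF has_derivative_linear[OF hd[OF x01]] linM[of x0]] unfolding h_def by blast
  then have h: "linear h" "\<And>x. h (frechet_derivative f (at x0) x) = x" using linM by (auto simp: h_def fun_eq_iff)
  have bh: "bounded_linear h" using h(1) linear_conv_bounded_linear by blast
  have invf: "Blinfun h o\<^sub>L f' x0 = id_blinfun"
    by (rule blinfun_eqI) (simp add: f'[OF x01] bounded_linear_Blinfun_apply[OF bh] h(2))
  have contf: "continuous_on U1 f'"
  proof (rule continuous_on_blinfun_componentwise)
    fix i :: "real^'n"
    have "continuous_on U1 (\<lambda>x. frechet_derivative f (at x) i)"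
      by (rule continuous_on_subset[OF reg_continuous_on[OF reg_deriv[OF U f]] U1U])
    then show "continuous_on U1 (\<lambda>x. blinfun_apply (f' x) i)" by (rule continuous_on_eq) (simp add: f')
  qed
  have derf: "(f has_derivative blinfun_apply (f' x)) (at x)" if "x \<in> U1" for x using hd[OF that] f'[OF that] by simp
  obtain V V' g g' where V: "open V" "V \<subseteq> U1" "x0 \<in> V" "open V'" "f x0 \<in> V'" "homeomorphism V V' f g"
    and g: "\<And>y. y \<in> V' \<Longrightarrow> (g has_derivative g' y) (at y)" "\<And>y. y \<in> V' \<Longrightarrow> g' y = inv (blinfun_apply (f' (g y)))"
      "\<And>y. y \<in> V' \<Longrightarrow> bij (blinfun_apply (f' (g y)))"
    using inverse_function_theorem[OF U1 derf contf x01 invf] by metis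
  have gV: "g y \<in> U1" if "y \<in> V'" for y using V(2,6) that by (auto simp: homeomorphism_def)
  have dg: "frechet_derivative g (at y) v = M (g y) v" if y: "y \<in> V'" for y v
  proof -
    have "frechet_derivative g (at y) v = inv (frechet_derivative f (at (g y))) v"
      using frechet_derivative_eq[OF g(1)[OF y]] g(2)[OF y] f'[OF gV[OF y]] by simp
    also have "\<dots> = M (g y) v"
      using g(3)[OF y] fM[OF gV[OF y], of v] f'[OF gV[OF y]] by (metis bij_is_inj inv_f_f)
    finally show ?thesis .
  qed
  have regM: "reg Smooth U1 (\<lambda>x. M x v)" for v
    unfolding M_def
    by (intro reg_vec_lambda reg_sum reg_mult reg_const reg_Re U1 reg_minv reg_subset[OF cr U1U]) (simp add: U1_def)
  have "Ck_on k V' g" for k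
  proof (induction k)
    case 0
    then show ?case using V(6) by (simp add: homeomorphism_def)
  next
    case (Suc k)
    have "Ck_on k V' (\<lambda>y. M (g y) v)" for v
      by (rule Ck_on_compose[OF V(4) U1 _ Suc.IH]) (use gV regM in auto)
    then have "Ck_on k V' (\<lambda>y. frechet_derivative g (at y) v)" for v
      by (rule Ck_on_cong[OF V(4)]) (simp_all add: dg)
    then show ?case using g(1) unfolding Ck_on.simps differentiable_def by blast
  qed
  then have "reg Smooth V' g" by simp
  moreover have "V' \<subseteq> O'" using V(2,6) by (auto simp: homeomorphism_def U1_def)
  ultimately show ?thesis using V U1U by (intro that[of V V' g]) auto
qed

section \<open>Manifolds and jets in charts\<close>

lemma topspace_atlas: "topspace (atlas_topology A) = \<Union> (fst ` A)"
proof
  show "topspace (atlas_topology A) \<subseteq> \<Union> (fst ` A)"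
    using openin_topspace[of "atlas_topology A"] unfolding openin_atlas_topology by blast
  have "openin (atlas_topology A) (\<Union> (fst ` A))"
    unfolding openin_atlas_topology by (auto intro!: exI[of _ UNIV])
  then show "\<Union> (fst ` A) \<subseteq> topspace (atlas_topology A)" by (rule openin_subset)
qed

abbreviation transition :: "('a, 'e) chart \<Rightarrow> ('a, 'f) chart \<Rightarrow> 'e \<Rightarrow> 'f" where
  "transition c d \<equiv> local_rep c d (\<lambda>p. p)"

abbreviation overlap :: "('a, 'e) chart \<Rightarrow> ('a, 'f) chart \<Rightarrow> 'e set" where
  "overlap c d \<equiv> snd c ` (fst c \<inter> fst d)"

locale atlas =
  fixes \<rho> :: regularity and A :: "('a, real^'n) chart set"
  assumes manifold: "manifold \<rho> A"
begin

lemma inj: "c \<in> A \<Longrightarrow> inj_on (snd c) (fst c)" and open_img: "c \<in> A \<Longrightarrow> open (snd c ` fst c)"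
  and open_overlap: "c \<in> A \<Longrightarrow> d \<in> A \<Longrightarrow> open (overlap c d)"
  using manifold unfolding manifold_def by auto

lemma reg_transition: "c \<in> A \<Longrightarrow> d \<in> A \<Longrightarrow> reg \<rho> (overlap c d) (transition c d)"
  using manifold regular_on_open_iff[OF open_overlap] unfolding manifold_def by blast

lemma Smooth_transition: "c \<in> A \<Longrightarrow> d \<in> A \<Longrightarrow> reg Smooth (overlap c d) (transition c d)"
  by (rule reg_imp_Smooth[OF open_overlap reg_transition])

lemma local_rep_at: "c \<in> A \<Longrightarrow> p \<in> fst c \<Longrightarrow> local_rep c d f (snd c p) = snd d (f p)"
  by (simp add: local_rep_def inv_into_f_f[OF inj])

lemma mem_img: "c \<in> A \<Longrightarrow> p \<in> fst c \<Longrightarrow> X \<subseteq> fst c \<Longrightarrow> snd c p \<in> snd c ` X \<longleftrightarrow> p \<in> X"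
  by (rule inj_on_image_mem_iff[OF inj])

lemma openin_chart:
  assumes c: "c \<in> A" and S: "open S"
  shows "openin (atlas_topology A) {p \<in> fst c. snd c p \<in> S}"
  unfolding openin_atlas_topology
proof (intro conjI ballI)
  fix d assume d: "d \<in> A"
  have "open (transition d c -` S \<inter> overlap d c)"
    using continuous_on_open_vimage[OF open_overlap[OF d c]] reg_continuous_on[OF reg_transition[OF d c]] S by blast
  moreover have "{p \<in> fst c. snd c p \<in> S} \<inter> fst d = {p \<in> fst d. snd d p \<in> transition d c -` S \<inter> overlap d c}"
  proof -
    have "snd d q \<in> transition d c -` S \<inter> overlap d c \<longleftrightarrow> q \<in> fst c \<and> snd c q \<in> S" if "q \<in> fst d" for q
      using mem_img[OF d that, of "fst d \<inter> fst c"] local_rep_at[OF d that, of c "\<lambda>p. p"] that by (simp add: conj_commute)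
    then show ?thesis by blast
  qed
  ultimately show "\<exists>S'. open S' \<and> {p \<in> fst c. snd c p \<in> S} \<inter> fst d = {p \<in> fst d. snd d p \<in> S'}" by blast
qed (use c in auto)

lemma openin_fst: "c \<in> A \<Longrightarrow> openin (atlas_topology A) (fst c)"
  using openin_chart[of c UNIV] by simp

lemma open_image:
  assumes c: "c \<in> A" and X: "openin (atlas_topology A) X" "X \<subseteq> fst c"
  shows "open (snd c ` X)"
proof -
  obtain S where S: "open S" "X \<inter> fst c = {p \<in> fst c. snd c p \<in> S}"
    using X(1) c unfolding openin_atlas_topology by blast
  have "snd c ` X = S \<inter> snd c ` fst c" using S(2) X(2) by auto
  then show ?thesis using S(1) open_img[OF c] by auto
qed

end

locale atlas_pair = A: atlas \<rho> A + B: atlas \<rho> B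
  for \<rho> :: regularity and A :: "('a, real^'n::finite) chart set" and B :: "('b, real^'n) chart set"
begin

abbreviation rep_dom :: "'a set \<Rightarrow> ('a \<Rightarrow> 'b) \<Rightarrow> ('a, real^'n) chart \<Rightarrow> ('b, real^'n) chart \<Rightarrow> 'a set" where
  "rep_dom W f c d \<equiv> {p \<in> W \<inter> fst c. f p \<in> fst d}"

lemma rep:
  assumes f: "regular_map Smooth A B W f" and c: "c \<in> A" and d: "d \<in> B"
  shows "openin (atlas_topology A) (rep_dom W f c d)" "open (snd c ` rep_dom W f c d)"
    "reg Smooth (snd c ` rep_dom W f c d) (local_rep c d f)"
proof -
  show o: "openin (atlas_topology A) (rep_dom W f c d)" using f c d unfolding regular_map_def Let_def by blast
  show o': "open (snd c ` rep_dom W f c d)" by (rule A.open_image[OF c o]) blast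
  show "reg Smooth (snd c ` rep_dom W f c d) (local_rep c d f)"
    using f c d regular_on_open_iff[OF o', of Smooth "local_rep c d f"] unfolding regular_map_def Let_def by blast
qed

text \<open>In new charts a representative is the old one composed with transition maps, and any
  \<open>K\<close> in contact with the old one may replace it. Both are restricted to a set that
  they map into the overlap of the target charts.\<close>

lemma chart_change:
  assumes f: "regular_map Smooth A B W f" and c: "c \<in> A" "c' \<in> A" and d: "d \<in> B" "d' \<in> B"
    and p: "p \<in> W" "p \<in> fst c" "p \<in> fst c'" "f p \<in> fst d" "f p \<in> fst d'"
    and K: "open O1" "snd c p \<in> O1" "reg Smooth O1 K" and j: "same_jet k (snd c p) (local_rep c d f) K"
  shows "same_jet k (snd c' p) (local_rep c' d' f) (\<lambda>\<xi>. transition d d' (K (transition c' c \<xi>)))"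
proof -
  let ?S = "transition c' c" and ?T = "transition d d'" and ?F = "local_rep c d f"
  define X where "X = rep_dom W f c d \<inter> rep_dom W f c' d'"
  have "openin (atlas_topology A) X" unfolding X_def by (intro openin_Int rep f c d)
  then have oX: "open (snd c' ` X)" by (rule A.open_image[OF c(2)]) (auto simp: X_def)
  have KO: "open (K -` overlap d d' \<inter> O1)"
    using continuous_on_open_vimage[OF K(1)] reg_continuous_on[OF K(3)] B.open_overlap[OF d] by blast
  define O2 where "O2 = (K -` overlap d d' \<inter> O1) \<inter> (?F -` overlap d d' \<inter> snd c ` rep_dom W f c d)"
  have "open (?F -` overlap d d' \<inter> snd c ` rep_dom W f c d)"
    using continuous_on_open_vimage[OF rep(2)[OF f c(1) d(1)]] reg_continuous_on[OF rep(3)[OF f c(1) d(1)]] B.open_overlap[OF d] by blast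
  then have O2: "open O2" using KO unfolding O2_def by blast
  define N where "N = (?S -` O2 \<inter> overlap c' c) \<inter> snd c' ` X"
  have "open (?S -` O2 \<inter> overlap c' c)"
    using continuous_on_open_vimage[OF A.open_overlap[OF c(2,1)]] reg_continuous_on[OF A.Smooth_transition[OF c(2,1)]] O2 by blast
  then have N: "open N" using oX unfolding N_def by blast
  have Fp: "?F (snd c p) = snd d (f p)" by (rule A.local_rep_at[OF c(1) p(2)])
  have "K (snd c p) = snd d (f p)" using same_jet_mono[OF j, of 0] Fp by (simp add: same_jet_0)
  then have p2: "snd c p \<in> O2" using p K(2) Fp by (auto simp: O2_def)
  have Sp: "?S (snd c' p) = snd c p" by (rule A.local_rep_at[OF c(2) p(3)])
  have pN: "snd c' p \<in> N" using p p2 Sp by (auto simp: N_def X_def)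
  have SN: "?S ` N \<subseteq> O2" by (auto simp: N_def)
  have rS: "reg Smooth N ?S" by (rule reg_subset[OF A.Smooth_transition[OF c(2,1)]]) (auto simp: N_def)
  have rT: "reg Smooth (overlap d d') ?T" by (rule B.Smooth_transition[OF d])
  have rF: "reg Smooth O2 ?F" by (rule reg_subset[OF rep(3)[OF f c(1) d(1)]]) (auto simp: O2_def)
  have rK: "reg Smooth O2 K" by (rule reg_subset[OF K(3)]) (auto simp: O2_def)
  have FT: "?F ` O2 \<subseteq> overlap d d'" "K ` O2 \<subseteq> overlap d d'" by (auto simp: O2_def)
  have 1: "same_jet k (snd c' p) (\<lambda>\<xi>. ?F (?S \<xi>)) (\<lambda>\<xi>. K (?S \<xi>))"
    by (rule same_jet_compose[OF N pN O2 SN SN rS rS rF rK same_jet_refl]) (simp add: Sp j)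
  have rFS: "reg Smooth N (\<lambda>\<xi>. ?F (?S \<xi>))" by (rule reg_compose[OF N O2 SN rS rF])
  have rKS: "reg Smooth N (\<lambda>\<xi>. K (?S \<xi>))" by (rule reg_compose[OF N O2 SN rS rK])
  have im: "(\<lambda>\<xi>. ?F (?S \<xi>)) ` N \<subseteq> overlap d d'" "(\<lambda>\<xi>. K (?S \<xi>)) ` N \<subseteq> overlap d d'" using SN FT unfolding image_subset_iff by blast+
  have 2: "same_jet k (snd c' p) (\<lambda>\<xi>. ?T (?F (?S \<xi>))) (\<lambda>\<xi>. ?T (K (?S \<xi>)))"
    by (rule same_jet_compose[OF N pN B.open_overlap[OF d] im rFS rKS rT rT 1 same_jet_refl])
  have "same_jet k (snd c' p) (\<lambda>\<xi>. ?T (?F (?S \<xi>))) (local_rep c' d' f)"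
  proof (rule same_jet_cong[OF N pN reg_compose[OF N B.open_overlap[OF d] im(1) rFS rT]])
    fix \<xi> assume "\<xi> \<in> N"
    then obtain q where q: "q \<in> X" "\<xi> = snd c' q" by (auto simp: N_def)
    then have "q \<in> fst c" "q \<in> fst c'" "f q \<in> fst d" by (auto simp: X_def)
    then show "?T (?F (?S \<xi>)) = local_rep c' d' f \<xi>" unfolding q(2)
      by (simp add: A.local_rep_at[OF c(2)] A.local_rep_at[OF c(1)] B.local_rep_at[OF d(1)])
  qed
  then show ?thesis using 2 same_jet_sym same_jet_trans by blast
qed

text \<open>Contact in one pair of charts passes to all others: in new charts both maps have contact
  with the same transported representative.\<close>

lemma contactI:
  assumes f: "regular_map Smooth A B W f" and g: "regular_map Smooth A B W' g" and p: "p \<in> W" "p \<in> W'" and gp: "g p = f p"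
    and c: "c \<in> A" "p \<in> fst c" and d: "d \<in> B" "f p \<in> fst d"
    and j: "same_jet k (snd c p) (local_rep c d f) (local_rep c d g)"
  shows "contact k A B p f g"
  unfolding contact_def
proof (intro conjI gp ballI impI)
  fix c' d' assume c': "c' \<in> A" and d': "d' \<in> B" and *: "p \<in> fst c' \<and> f p \<in> fst d'"
  note K = rep(2)[OF f c(1) d(1)] imageI[of p "rep_dom W f c d" "snd c"] rep(3)[OF f c(1) d(1)]
  have m: "snd c p \<in> snd c ` rep_dom W f c d" using p c d by auto
  have "same_jet k (snd c' p) (local_rep c' d' f) (\<lambda>\<xi>. transition d d' (local_rep c d f (transition c' c \<xi>)))"
    by (rule chart_change[OF f c(1) c' d(1) d' p(1) c(2) _ d(2) _ K(1) m K(3) same_jet_refl]) (use * in auto)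
  moreover have "same_jet k (snd c' p) (local_rep c' d' g) (\<lambda>\<xi>. transition d d' (local_rep c d f (transition c' c \<xi>)))"
    by (rule chart_change[OF g c(1) c' d(1) d' p(2) c(2) _ _ _ K(1) m K(3) same_jet_sym[OF j]]) (use * gp d in auto)
  ultimately have "same_jet k (snd c' p) (local_rep c' d' f) (local_rep c' d' g)"
    using same_jet_sym same_jet_trans by blast
  then show "\<forall>vs. length vs \<le> k \<longrightarrow> iter_deriv vs (local_rep c' d' g) (snd c' p) = iter_deriv vs (local_rep c' d' f) (snd c' p)"
    by (simp add: same_jet_def)
qed

lemma jet_eq:
  assumes "contact k A B p f g"
  shows "jet k A B p f = jet k A B p g"
proof -
  have "contact k A B p f h \<longleftrightarrow> contact k A B p g h" for h
    using assms unfolding contact_def by metis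
  then show ?thesis unfolding jet_def by simp
qed

lemma jet_rep:
  assumes f: "regular_map Smooth A B W f" "p \<in> W"
  obtains W' where "p \<in> W'" "regular_map Smooth A B W' (jet_rep (jet k A B p f))"
    "contact k A B p f (jet_rep (jet k A B p f))"
proof -
  have "f \<in> snd (jet k A B p f)" using f by (auto simp: jet_def contact_def)
  then have "jet_rep (jet k A B p f) \<in> snd (jet k A B p f)" unfolding jet_rep_def
    using someI[of "\<lambda>g. g \<in> snd (jet k A B p f)" f] by simp
  then show ?thesis using that by (auto simp: jet_def)
qed

lemma jet_target: "regular_map Smooth A B W f \<Longrightarrow> p \<in> W \<Longrightarrow> jet_target (jet k A B p f) = f p"
  unfolding jet_target_def using jet_rep[of W f p k] by (auto simp: jet_def contact_def)

text \<open>The coordinates are defined through a chosen member of the class, but all members have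
  the same derivatives at the source, so any map with this jet computes them.\<close>

lemma jet_coords:
  assumes f: "regular_map Smooth A B W f" "p \<in> W" and c: "c \<in> A" "p \<in> fst c" and d: "d \<in> B" "f p \<in> fst d"
  shows "jet2_coords c d (jet 2 A B p f) = J2 (local_rep c d f) (snd c p)"
    "jet3_coords c d (jet 3 A B p f) = J3 (local_rep c d f) (snd c p)"
proof -
  have fst: "fst (jet k A B p f) = p" for k by (simp add: jet_def)
  have *: "iter_deriv vs (local_rep c d (jet_rep (jet k A B p f))) (snd c p) = iter_deriv vs (local_rep c d f) (snd c p)"
    if "length vs \<le> k" for k vs
    using jet_rep[OF f, of k] c d that unfolding contact_def by metis
  from *[of "[]"] have 0: "local_rep c d (jet_rep (jet k A B p f)) (snd c p) = local_rep c d f (snd c p)" for k by simp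
  show "jet2_coords c d (jet 2 A B p f) = J2 (local_rep c d f) (snd c p)"
    unfolding jet2_coords_def J2_def Let_def fst by (simp add: * 0 del: iter_deriv.simps(2))
  show "jet3_coords c d (jet 3 A B p f) = J3 (local_rep c d f) (snd c p)"
    unfolding jet3_coords_def jet2_coords_def J3_def J2_def Let_def fst by (simp add: * 0 del: iter_deriv.simps(2))
qed

lemma diffeo_regular: "diffeo A B W W' f \<Longrightarrow> regular_map Smooth A B W f" by (simp add: diffeo_def)

abbreviation jet_dom :: "nat \<Rightarrow> ('a, real^'n) chart \<Rightarrow> ('b, real^'n) chart \<Rightarrow> ('a, 'b) jet set" where
  "jet_dom k c d \<equiv> {\<Lambda> \<in> jet_space k A B. fst \<Lambda> \<in> fst c \<and> jet_target \<Lambda> \<in> fst d}"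

lemma jet_spaceE:
  assumes "\<Lambda> \<in> jet_space k A B"
  obtains f W W' where "diffeo A B W W' f" "regular_map Smooth A B W f" "fst \<Lambda> \<in> W" "\<Lambda> = jet k A B (fst \<Lambda>) f" "jet_target \<Lambda> = f (fst \<Lambda>)"
proof -
  obtain p f W W' where *: "\<Lambda> = jet k A B p f" "p \<in> W" "diffeo A B W W' f" using assms by (auto simp: jet_space_def)
  have "fst \<Lambda> = p" by (simp add: *(1) jet_def)
  moreover have "jet_target \<Lambda> = f p" unfolding *(1) by (rule jet_target[OF diffeo_regular[OF *(3)] *(2)])
  ultimately show ?thesis using that[OF *(3) diffeo_regular[OF *(3)]] * by simp
qed

text \<open>Equal coordinates mean contact in \<open>c\<close> and \<open>d\<close>, hence equal
  classes. \<open>main\<close> treats both orders at once, with the coordinate expression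
  \<open>J\<close> as a parameter.\<close>

lemma inj_jet_coords:
  assumes c: "c \<in> A" and d: "d \<in> B"
  shows "inj_on (jet2_coords c d) (jet_dom 2 c d)" "inj_on (jet3_coords c d) (jet_dom 3 c d)"
proof -
  have main: "\<Lambda> = \<Lambda>'"
    if L: "\<Lambda> \<in> jet_dom k c d" "\<Lambda>' \<in> jet_dom k c d"
      and J: "\<And>F G S. open S \<Longrightarrow> snd c (fst \<Lambda>) \<in> S \<Longrightarrow> reg Smooth S F \<Longrightarrow> reg Smooth S G \<Longrightarrow>
        J F (snd c (fst \<Lambda>)) = J G (snd c (fst \<Lambda>)) \<Longrightarrow> same_jet k (snd c (fst \<Lambda>)) F G"
      and cf: "\<And>f p W. regular_map Smooth A B W f \<Longrightarrow> p \<in> W \<Longrightarrow> p \<in> fst c \<Longrightarrow> f p \<in> fst d \<Longrightarrow> cf (jet k A B p f) = J (local_rep c d f) (snd c p)"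
      and J12: "\<And>F G x y. J F x = J G y \<Longrightarrow> x = y \<and> F x = G y" and eq: "cf \<Lambda> = cf \<Lambda>'"
    for \<Lambda> \<Lambda>' k and J :: "(real^'n \<Rightarrow> real^'n) \<Rightarrow> real^'n \<Rightarrow> 'z" and cf
  proof -
    obtain f W W1 where f: "diffeo A B W W1 f" "regular_map Smooth A B W f" "fst \<Lambda> \<in> W" "\<Lambda> = jet k A B (fst \<Lambda>) f" "jet_target \<Lambda> = f (fst \<Lambda>)"
      using L(1) by (auto elim: jet_spaceE)
    obtain g W' W1' where g: "diffeo A B W' W1' g" "regular_map Smooth A B W' g" "fst \<Lambda>' \<in> W'" "\<Lambda>' = jet k A B (fst \<Lambda>') g" "jet_target \<Lambda>' = g (fst \<Lambda>')"
      using L(2) by (auto elim: jet_spaceE)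
    have m: "fst \<Lambda> \<in> fst c" "fst \<Lambda>' \<in> fst c" "f (fst \<Lambda>) \<in> fst d" "g (fst \<Lambda>') \<in> fst d" using L f(5) g(5) by auto
    have "cf \<Lambda> = J (local_rep c d f) (snd c (fst \<Lambda>))" using cf[OF f(2,3) m(1,3)] f(4) by simp
    moreover have "cf \<Lambda>' = J (local_rep c d g) (snd c (fst \<Lambda>'))" using cf[OF g(2,3) m(2,4)] g(4) by simp
    ultimately have e: "J (local_rep c d f) (snd c (fst \<Lambda>)) = J (local_rep c d g) (snd c (fst \<Lambda>'))" using eq by simp
    from J12[OF this] have "snd c (fst \<Lambda>) = snd c (fst \<Lambda>')" "local_rep c d f (snd c (fst \<Lambda>)) = local_rep c d g (snd c (fst \<Lambda>'))" by auto
    then have ff: "fst \<Lambda> = fst \<Lambda>'" and "snd d (f (fst \<Lambda>)) = snd d (g (fst \<Lambda>'))"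
      using inj_onD[OF A.inj[OF c] _ m(1,2)] A.local_rep_at[OF c m(1), of d f] A.local_rep_at[OF c m(2), of d g] by simp_all
    then have gf: "g (fst \<Lambda>) = f (fst \<Lambda>)" using inj_onD[OF B.inj[OF d]] m by auto
    let ?S = "snd c ` rep_dom W f c d \<inter> snd c ` rep_dom W' g c d"
    have "same_jet k (snd c (fst \<Lambda>)) (local_rep c d f) (local_rep c d g)"
    proof (rule J)
      show "open ?S" using rep(2)[OF f(2) c d] rep(2)[OF g(2) c d] by blast
      show "snd c (fst \<Lambda>) \<in> ?S" using m f(3) g(3) ff by auto
      show "reg Smooth ?S (local_rep c d f)" "reg Smooth ?S (local_rep c d g)"
        by (rule reg_subset[OF rep(3)[OF f(2) c d]], blast, rule reg_subset[OF rep(3)[OF g(2) c d]], blast)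
    qed (use e ff in simp)
    from contactI[OF f(2) g(2) f(3) _ gf c m(1) d m(3) this] g(3) ff have "contact k A B (fst \<Lambda>) f g" by simp
    from jet_eq[OF this] show ?thesis using f(4) g(4) ff by simp
  qed
  show "inj_on (jet2_coords c d) (jet_dom 2 c d)"
  proof (rule inj_onI)
    fix \<Lambda> \<Lambda>' assume *: "\<Lambda> \<in> jet_dom 2 c d" "\<Lambda>' \<in> jet_dom 2 c d" "jet2_coords c d \<Lambda> = jet2_coords c d \<Lambda>'"
    show "\<Lambda> = \<Lambda>'"
      by (rule main[OF *(1,2) _ _ _ *(3), of J2]) (use J2_eq_iff jet_coords(1)[OF _ _ c _ d] in \<open>blast, blast, simp add: J2_def\<close>)
  qed
  show "inj_on (jet3_coords c d) (jet_dom 3 c d)"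
  proof (rule inj_onI)
    fix \<Lambda> \<Lambda>' assume *: "\<Lambda> \<in> jet_dom 3 c d" "\<Lambda>' \<in> jet_dom 3 c d" "jet3_coords c d \<Lambda> = jet3_coords c d \<Lambda>'"
    show "\<Lambda> = \<Lambda>'"
      by (rule main[OF *(1,2) _ _ _ *(3), of J3]) (use J3_eq_iff jet_coords(2)[OF _ _ c _ d] in \<open>blast, blast, simp add: J3_def J2_def\<close>)
  qed
qed

text \<open>By the chain rule, the differential of the representative of the inverse map inverts the
  Jacobian.\<close>

lemma diffeo_det:
  assumes f: "diffeo A B W W' f" and c: "c \<in> A" and d: "d \<in> B" and p: "p \<in> W" "p \<in> fst c" "f p \<in> fst d"
  shows "det (\<chi> k. frechet_derivative (local_rep c d f) (at (snd c p)) (axis k 1)) \<noteq> 0"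
proof -
  interpret BA: atlas_pair \<rho> B A ..
  define g where "g = inv_into W f"
  have bij: "bij_betw f W W'" and rf: "regular_map Smooth A B W f" and rg: "regular_map Smooth B A W' g"
    using f by (auto simp: diffeo_def g_def)
  have gf: "g (f q) = q" "f q \<in> W'" if "q \<in> W" for q
    using bij that unfolding g_def by (auto simp: bij_betw_def)
  let ?F = "local_rep c d f" and ?G = "local_rep d c g" and ?x = "snd c p"
  have x: "?x \<in> snd c ` rep_dom W f c d" using p by auto
  have Fx: "?F ?x = snd d (f p)" by (rule A.local_rep_at[OF c p(2)])
  have y: "?F ?x \<in> snd d ` BA.rep_dom W' g d c" unfolding Fx using p gf[OF p(1)] by auto
  have dF: "(?F has_derivative frechet_derivative ?F (at ?x)) (at ?x)" by (rule reg_has_derivative[OF rep(3)[OF rf c d] x])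
  have dG: "(?G has_derivative frechet_derivative ?G (at (?F ?x))) (at (?F ?x))" by (rule reg_has_derivative[OF BA.rep(3)[OF rg d c] y])
  have "((\<lambda>x. ?G (?F x)) has_derivative (\<lambda>v. v)) (at ?x)"
  proof (rule has_derivative_transform_within_open[OF has_derivative_ident rep(2)[OF rf c d] x])
    fix \<xi> assume "\<xi> \<in> snd c ` rep_dom W f c d"
    then obtain q where q: "q \<in> W" "q \<in> fst c" "f q \<in> fst d" "\<xi> = snd c q" by auto
    then show "\<xi> = ?G (?F \<xi>)" by (simp add: A.local_rep_at[OF c] B.local_rep_at[OF d] gf)
  qed
  from has_derivative_unique[OF has_derivative_compose[OF dF dG] this]
  have id: "frechet_derivative ?G (at (?F ?x)) (frechet_derivative ?F (at ?x) v) = v" for v by (rule fun_cong)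
  define L L' where "L = frechet_derivative ?F (at ?x)" and "L' = frechet_derivative ?G (at (?F ?x))"
  let ?P = "\<chi> k. L (axis k 1)" and ?Q = "\<chi> k. L' (axis k 1)"
  have L': "L' w = (\<Sum>k\<in>UNIV. w $ k *\<^sub>R L' (axis k 1))" for w
    unfolding L'_def by (rule frechet_derivative_sum_axis[OF differentiableI[OF dG]])
  have e: "axis i 1 = (\<Sum>k\<in>UNIV. L (axis i 1) $ k *\<^sub>R L' (axis k 1))" for i
  proof -
    have "axis i 1 = L' (L (axis i 1))" unfolding L_def L'_def by (rule id[symmetric])
    also have "\<dots> = (\<Sum>k\<in>UNIV. L (axis i 1) $ k *\<^sub>R L' (axis k 1))" by (rule L')
    finally show ?thesis .
  qed
  have "(\<Sum>k\<in>UNIV. L (axis i 1) $ k * L' (axis k 1) $ j) = (if i = j then 1 else 0)" for i j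
  proof -
    have "(\<Sum>k\<in>UNIV. L (axis i 1) $ k * L' (axis k 1) $ j) = (\<Sum>k\<in>UNIV. L (axis i 1) $ k *\<^sub>R L' (axis k 1)) $ j" by simp
    also have "\<dots> = axis i 1 $ j" by (rule arg_cong[OF e[symmetric]])
    also have "\<dots> = (if i = j then 1 else 0)" by (auto simp: axis_def)
    finally show ?thesis .
  qed
  then have "?P ** ?Q = mat 1" by (simp add: matrix_matrix_mult_def mat_def vec_eq_iff)
  then have "det ?P * det ?Q = 1" by (metis det_mul det_I)
  then show ?thesis by (auto simp: L_def)
qed

text \<open>A smooth expression in one pair of charts is enough, since in any other pair it is
  composed with transition maps.\<close>

lemma regular_map_lift:
  assumes c: "c \<in> A" and d: "d \<in> B" and V: "open V" "V \<subseteq> snd c ` fst c" and F: "reg Smooth V F"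
    and \<phi>: "\<And>q. q \<in> fst c \<Longrightarrow> snd c q \<in> V \<Longrightarrow> \<phi> q \<in> fst d \<and> snd d (\<phi> q) = F (snd c q)"
  shows "regular_map Smooth A B {q \<in> fst c. snd c q \<in> V} \<phi>"
  unfolding regular_map_def Let_def
proof (intro conjI ballI)
  let ?W = "{q \<in> fst c. snd c q \<in> V}"
  show "openin (atlas_topology A) ?W" by (rule A.openin_chart[OF c V(1)])
  show "\<phi> ` ?W \<subseteq> points B" using \<phi> d by (auto simp: topspace_atlas)
  fix c' d' assume c': "c' \<in> A" and d': "d' \<in> B"
  let ?X = "{p \<in> ?W \<inter> fst c'. \<phi> p \<in> fst d'}"
  have FV: "open (F -` overlap d d' \<inter> V)"
    using continuous_on_open_vimage[OF V(1)] reg_continuous_on[OF F] B.open_overlap[OF d d'] by blast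
  have Xeq: "?X = {q \<in> fst c. snd c q \<in> F -` overlap d d' \<inter> V} \<inter> fst c'"
    using \<phi> B.mem_img[OF d, of _ "fst d \<inter> fst d'"] by auto (metis IntI image_eqI)+
  show X: "openin (atlas_topology A) ?X"
    unfolding Xeq by (rule openin_Int[OF A.openin_chart[OF c FV] A.openin_fst[OF c']])
  have oX: "open (snd c' ` ?X)" by (rule A.open_image[OF c' X]) blast
  have 1: "reg Smooth (snd c' ` ?X) (transition c' c)"
    by (rule reg_subset[OF A.Smooth_transition[OF c' c]]) auto
  have 2: "transition c' c ` (snd c' ` ?X) \<subseteq> F -` overlap d d' \<inter> V"
  proof safe
    fix q assume q: "q \<in> fst c" "snd c q \<in> V" "q \<in> fst c'" "\<phi> q \<in> fst d'"
    have "transition c' c (snd c' q) = snd c q" by (rule A.local_rep_at[OF c' q(3)])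
    moreover have "F (snd c q) \<in> overlap d d'" using q(4) \<phi>[OF q(1,2)] by (metis IntI image_eqI)
    ultimately show "transition c' c (snd c' q) \<in> F -` overlap d d'" "transition c' c (snd c' q) \<in> V" using q by simp_all
  qed
  have 3: "reg Smooth (F -` overlap d d' \<inter> V) (\<lambda>x. transition d d' (F x))"
    by (rule reg_compose[OF FV B.open_overlap[OF d d'] _ reg_subset[OF F] B.Smooth_transition[OF d d']]) auto
  have "reg Smooth (snd c' ` ?X) (\<lambda>\<xi>. transition d d' (F (transition c' c \<xi>)))"
    by (rule reg_compose[OF oX FV 2 1 3])
  then have "reg Smooth (snd c' ` ?X) (local_rep c' d' \<phi>)"
  proof (rule reg_cong[OF oX])
    fix \<xi> assume "\<xi> \<in> snd c' ` ?X"
    then obtain q where q: "q \<in> fst c" "snd c q \<in> V" "q \<in> fst c'" "\<xi> = snd c' q" by auto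
    have "transition d d' (snd d (\<phi> q)) = snd d' (\<phi> q)"
      by (rule B.local_rep_at[OF d]) (use \<phi>[OF q(1,2)] in blast)
    then show "transition d d' (F (transition c' c \<xi>)) = local_rep c' d' \<phi> \<xi>"
      using \<phi>[OF q(1,2)] by (simp add: q(4) A.local_rep_at[OF c' q(3)])
  qed
  then show "regular_on Smooth (snd c' ` ?X) (local_rep c' d' \<phi>)" by (rule reg_imp_regular_on[OF oX])
qed

end

lemma (in atlas_pair) diffeo_lift:
  assumes c: "c \<in> A" and d: "d \<in> B" and V: "open V" "V \<subseteq> snd c ` fst c" and V': "open V'" "V' \<subseteq> snd d ` fst d"
    and h: "homeomorphism V V' F G" and F: "reg Smooth V F" and G: "reg Smooth V' G"
  shows "diffeo A B {q \<in> fst c. snd c q \<in> V} {q \<in> fst d. snd d q \<in> V'} (\<lambda>q. inv_into (fst d) (snd d) (F (snd c q)))"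
    (is "diffeo A B ?W ?W' ?\<phi>")
proof -
  interpret BA: atlas_pair \<rho> B A ..
  have FV: "F x \<in> V'" "G (F x) = x" if "x \<in> V" for x using h that by (auto simp: homeomorphism_def)
  have GV: "G y \<in> V" "F (G y) = y" if "y \<in> V'" for y using h that by (auto simp: homeomorphism_def)
  have \<phi>: "?\<phi> q \<in> fst d \<and> snd d (?\<phi> q) = F (snd c q)" if "snd c q \<in> V" for q
    using FV(1)[OF that] V'(2) by (meson f_inv_into_f inv_into_into subsetD)
  define \<psi> where "\<psi> q = inv_into (fst c) (snd c) (G (snd d q))" for q
  have \<psi>: "\<psi> q \<in> fst c \<and> snd c (\<psi> q) = G (snd d q)" if "snd d q \<in> V'" for q
    unfolding \<psi>_def using GV(1)[OF that] V(2) by (meson f_inv_into_f inv_into_into subsetD)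
  have bij: "bij_betw ?\<phi> ?W ?W'"
  proof (rule bij_betw_byWitness[where f' = \<psi>])
    show "\<forall>q\<in>?W. \<psi> (?\<phi> q) = q"
    proof
      fix q assume "q \<in> ?W"
      then have q: "q \<in> fst c" "snd c q \<in> V" by auto
      have "snd d (?\<phi> q) \<in> V'" using \<phi>[OF q(2)] FV[OF q(2)] by simp
      from \<psi>[OF this] \<phi>[OF q(2)] FV[OF q(2)] show "\<psi> (?\<phi> q) = q" using inj_onD[OF A.inj[OF c]] q(1) by simp
    qed
    show "\<forall>q\<in>?W'. ?\<phi> (\<psi> q) = q"
    proof
      fix q assume "q \<in> ?W'"
      then have q: "q \<in> fst d" "snd d q \<in> V'" by auto
      have "snd c (\<psi> q) \<in> V" using \<psi>[OF q(2)] GV[OF q(2)] by simp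
      from \<phi>[OF this] \<psi>[OF q(2)] GV[OF q(2)] show "?\<phi> (\<psi> q) = q" using inj_onD[OF B.inj[OF d]] q(1) by simp
    qed
  qed (use \<phi> \<psi> FV GV in auto)
  have "regular_map Smooth A B ?W ?\<phi>" by (rule regular_map_lift[OF c d V F]) (use \<phi> in blast)
  moreover have "regular_map Smooth B A ?W' (inv_into ?W ?\<phi>)"
  proof (rule BA.regular_map_lift[OF d c V' G])
    fix q assume q: "q \<in> fst d" "snd d q \<in> V'"
    define r where "r = inv_into ?W ?\<phi> q"
    have "q \<in> ?\<phi> ` ?W" using bij q unfolding bij_betw_def by auto
    then have "r \<in> ?W" "?\<phi> r = q" using inv_into_into[of q ?\<phi> ?W] f_inv_into_f[of q ?\<phi> ?W] by (simp_all only: r_def)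
    then have "r \<in> fst c" "snd c r \<in> V" "F (snd c r) = snd d q" using \<phi>[of r] by auto
    then show "inv_into ?W ?\<phi> q \<in> fst c \<and> snd c (inv_into ?W ?\<phi> q) = G (snd d q)"
      using FV[of "snd c r"] unfolding r_def by metis
  qed
  ultimately show ?thesis using bij unfolding diffeo_def by blast
qed

text \<open>Coordinates of 2-jets with source in \<open>U\<close> and target in \<open>U'\<close>;
  invertibility of a jet is a condition on its Jacobian.\<close>

definition regular_j2 :: "(real^'n) set \<Rightarrow> (real^'n) set \<Rightarrow> 'n::finite j2 set" where
  "regular_j2 U U' = {z. fst z \<in> U \<and> fst (snd z) \<in> U' \<and> det (fst (snd (snd z))) \<noteq> 0}"

section \<open>Prolongation of 2-jets by cubic polynomials\<close>

context atlas_pair begin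

abbreviation jets_over :: "nat \<Rightarrow> 'a set \<Rightarrow> 'b set \<Rightarrow> ('a, 'b) jet set" where
  "jets_over k X Y \<equiv> {\<Lambda> \<in> jet_space k A B. fst \<Lambda> \<in> X \<and> jet_target \<Lambda> \<in> Y}"

lemma jet2_coords_base:
  assumes "c \<in> A" "fst \<Lambda> \<in> fst c"
  shows "fst (jet2_coords c d \<Lambda>) = snd c (fst \<Lambda>)" "fst (snd (jet2_coords c d \<Lambda>)) = snd d (jet_target \<Lambda>)"
  by (simp_all add: jet2_coords_def Let_def A.local_rep_at[OF assms] jet_target_def)

text \<open>Source and target are the first two components of the jet coordinates, so in each chart
  the set is cut out by an open condition on these.\<close>

lemma openin_jets_over:
  assumes X: "openin (atlas_topology A) X" and Y: "openin (atlas_topology B) Y"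
  shows "openin (atlas_topology (jet2_atlas A B)) (jets_over 2 X Y)"
  unfolding openin_atlas_topology
proof (intro conjI ballI)
  show "jets_over 2 X Y \<subseteq> \<Union> (fst ` jet2_atlas A B)"
  proof
    fix \<Lambda> assume L: "\<Lambda> \<in> jets_over 2 X Y"
    then have "fst \<Lambda> \<in> points A" "jet_target \<Lambda> \<in> points B" using openin_subset[OF X] openin_subset[OF Y] by auto
    then obtain c d where cd: "c \<in> A" "fst \<Lambda> \<in> fst c" "d \<in> B" "jet_target \<Lambda> \<in> fst d" unfolding topspace_atlas by blast
    have "(jet_dom 2 c d, jet2_coords c d) \<in> jet2_atlas A B" using cd unfolding jet_atlas_def by blast
    moreover have "\<Lambda> \<in> jet_dom 2 c d" using L cd by simp
    ultimately show "\<Lambda> \<in> \<Union> (fst ` jet2_atlas A B)" by force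
  qed
  fix C assume "C \<in> jet2_atlas A B"
  then obtain c d where C: "C = (jet_dom 2 c d, jet2_coords c d)" and c: "c \<in> A" and d: "d \<in> B" unfolding jet_atlas_def by blast
  obtain S where S: "open S" "X \<inter> fst c = {p \<in> fst c. snd c p \<in> S}" using X c unfolding openin_atlas_topology by blast
  obtain S' where S': "open S'" "Y \<inter> fst d = {p \<in> fst d. snd d p \<in> S'}" using Y d unfolding openin_atlas_topology by blast
  let ?S = "S \<times> S' \<times> (UNIV :: ((real^'n^'n) \<times> (real^'n^'n^'n)) set)"
  have "open ?S" by (intro open_Times S S' open_UNIV)
  moreover have "jets_over 2 X Y \<inter> fst C = {\<Lambda> \<in> fst C. snd C \<Lambda> \<in> ?S}"
  proof -
    have *: "jet2_coords c d \<Lambda> \<in> ?S \<longleftrightarrow> fst \<Lambda> \<in> X \<and> jet_target \<Lambda> \<in> Y" if "\<Lambda> \<in> jet_dom 2 c d" for \<Lambda>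
    proof -
      have "jet2_coords c d \<Lambda> \<in> ?S \<longleftrightarrow> snd c (fst \<Lambda>) \<in> S \<and> snd d (jet_target \<Lambda>) \<in> S'"
        using jet2_coords_base[OF c, of \<Lambda> d] that by (simp add: mem_Times_iff)
      moreover have "snd c (fst \<Lambda>) \<in> S \<longleftrightarrow> fst \<Lambda> \<in> X" "snd d (jet_target \<Lambda>) \<in> S' \<longleftrightarrow> jet_target \<Lambda> \<in> Y"
        using that S(2) S'(2) by blast+
      ultimately show ?thesis by simp
    qed
    have eq: "jets_over 2 X Y \<inter> jet_dom 2 c d = {\<Lambda> \<in> jet_dom 2 c d. fst \<Lambda> \<in> X \<and> jet_target \<Lambda> \<in> Y}" by blast
    show ?thesis unfolding C fst_conv snd_conv eq by (rule Collect_cong, rule conj_cong[OF refl], rule *[symmetric])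
  qed
  ultimately show "\<exists>S. open S \<and> jets_over 2 X Y \<inter> fst C = {p \<in> fst C. snd C p \<in> S}" by blast
qed

text \<open>Where the polynomial leaves the image of the target chart the value is arbitrary; only
  the germ at the source point enters a jet.\<close>

definition cubic_map :: "('a, real^'n) chart \<Rightarrow> ('b, real^'n) chart \<Rightarrow> 'n j3 \<Rightarrow> 'a \<Rightarrow> 'b" where
  "cubic_map c d z q = inv_into (fst d) (snd d) (cubic z (snd c q))"

text \<open>The linear part is invertible, so the polynomial is a diffeomorphism near the source
  point and its jet belongs to the jet space.\<close>

lemma cubic_map:
  assumes c: "c \<in> A" and d: "d \<in> B" and p: "p \<in> fst c" and q: "q \<in> fst d"
    and z: "fst (fst z) = snd c p" "fst (snd (fst z)) = snd d q" "det (fst (snd (snd (fst z)))) \<noteq> 0"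
  obtains W W' where "p \<in> W" "diffeo A B W W' (cubic_map c d z)" "cubic_map c d z p = q"
    "same_jet 3 (snd c p) (local_rep c d (cubic_map c d z)) (cubic z)"
proof -
  have x: "cubic z (snd c p) = snd d q" using cubic_base[of z] z by simp
  have dt: "det (\<chi> i. frechet_derivative (cubic z) (at (snd c p)) (axis i 1)) \<noteq> 0"
    using frechet_derivative_cubic[of z] z by simp
  have sm: "reg Smooth (snd c ` fst c) (cubic z)" by (rule reg_subset[OF reg_cubic_right]) simp
  have m: "snd c p \<in> snd c ` fst c" "cubic z (snd c p) \<in> snd d ` fst d" using p q x by auto
  obtain V V' g where V: "open V" "snd c p \<in> V" "V \<subseteq> snd c ` fst c" "open V'" "V' \<subseteq> snd d ` fst d"
    "homeomorphism V V' (cubic z) g" "reg Smooth V' g"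
    by (rule local_inverse[OF A.open_img[OF c] sm m(1) dt B.open_img[OF d] m(2)])
  have sV: "reg Smooth V (cubic z)" by (rule reg_subset[OF reg_cubic_right]) simp
  note df = diffeo_lift[OF c d V(1,3,4,5,6) sV V(7)]
  show ?thesis
  proof (rule that)
    show "p \<in> {q \<in> fst c. snd c q \<in> V}" using p V(2) by simp
    show "diffeo A B {q \<in> fst c. snd c q \<in> V} {q \<in> fst d. snd d q \<in> V'} (cubic_map c d z)"
      using df unfolding cubic_map_def[abs_def] .
    show "cubic_map c d z p = q" unfolding cubic_map_def x by (rule inv_into_f_f[OF B.inj[OF d] q])
    show "same_jet 3 (snd c p) (local_rep c d (cubic_map c d z)) (cubic z)"
    proof (rule same_jet_sym, rule same_jet_cong[OF V(1,2) sV])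
      fix \<xi> assume \<xi>: "\<xi> \<in> V"
      then obtain r where r: "r \<in> fst c" "\<xi> = snd c r" using V(3) by blast
      have "cubic z \<xi> \<in> snd d ` fst d" using \<xi> V(5,6) by (auto simp: homeomorphism_def)
      then have "snd d (cubic_map c d z r) = cubic z \<xi>" unfolding cubic_map_def r(2)[symmetric] by (rule f_inv_into_f)
      then show "cubic z \<xi> = local_rep c d (cubic_map c d z) \<xi>" using A.local_rep_at[OF c r(1), of d "cubic_map c d z"] r(2) by simp
    qed
  qed
qed

lemma jet2_regular:
  assumes L: "\<Lambda> \<in> jets_over 2 X Y" and c: "c \<in> A" "X \<subseteq> {p \<in> fst c. snd c p \<in> U}" and d: "d \<in> B" "Y \<subseteq> {q \<in> fst d. snd d q \<in> U'}"
  shows "jet2_coords c d \<Lambda> \<in> regular_j2 U U'"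
proof -
  obtain f W W' where f: "diffeo A B W W' f" "regular_map Smooth A B W f" "fst \<Lambda> \<in> W" "\<Lambda> = jet 2 A B (fst \<Lambda>) f" "jet_target \<Lambda> = f (fst \<Lambda>)"
    using L by (auto elim: jet_spaceE)
  have m: "fst \<Lambda> \<in> fst c" "f (fst \<Lambda>) \<in> fst d" "snd c (fst \<Lambda>) \<in> U" "snd d (jet_target \<Lambda>) \<in> U'"
    using L f(5) c(2) d(2) by auto
  have "jet2_coords c d \<Lambda> = J2 (local_rep c d f) (snd c (fst \<Lambda>))"
    using jet_coords(1)[OF f(2,3) c(1) m(1) d(1) m(2)] f(4) by simp
  then have "fst (snd (snd (jet2_coords c d \<Lambda>))) = (\<chi> k. frechet_derivative (local_rep c d f) (at (snd c (fst \<Lambda>))) (axis k 1))"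
    by (simp add: J2_def)
  then show ?thesis
    using diffeo_det[OF f(1) c(1) d(1) f(3) m(1,2)] jet2_coords_base[OF c(1) m(1), of d] m(3,4) unfolding regular_j2_def by simp
qed

text \<open>Jets are classes of maps, so the new 3-jet has to be named by a concrete map.\<close>

definition prolong :: "('a, real^'n) chart \<Rightarrow> ('b, real^'n) chart \<Rightarrow> ('n j2 \<Rightarrow> real^'n^'n^'n^'n) \<Rightarrow> ('a, 'b) jet \<Rightarrow> ('a, 'b) jet" where
  "prolong c d \<Gamma> \<Lambda> = jet 3 A B (fst \<Lambda>) (cubic_map c d (jet2_coords c d \<Lambda>, \<Gamma> (jet2_coords c d \<Lambda>)))"

context
  fixes c0 d0 U U' \<Gamma>
  assumes c0: "c0 \<in> A" and d0: "d0 \<in> B" and U: "open U" and U': "open U'"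
    and V: "open (regular_j2 U U')" and \<Gamma>: "reg \<rho> (regular_j2 U U') (\<Gamma> :: 'n j2 \<Rightarrow> real^'n^'n^'n^'n)"
begin

abbreviation "X0 \<equiv> {p \<in> fst c0. snd c0 p \<in> U}"
abbreviation "Y0 \<equiv> {q \<in> fst d0. snd d0 q \<in> U'}"
abbreviation "Z \<Lambda> \<equiv> (jet2_coords c0 d0 \<Lambda>, \<Gamma> (jet2_coords c0 d0 \<Lambda>))"

lemma prolong:
  assumes L: "\<Lambda> \<in> jets_over 2 X0 Y0"
  obtains W W' where "fst \<Lambda> \<in> W" "diffeo A B W W' (cubic_map c0 d0 (Z \<Lambda>))" "cubic_map c0 d0 (Z \<Lambda>) (fst \<Lambda>) = jet_target \<Lambda>"
    "same_jet 3 (snd c0 (fst \<Lambda>)) (local_rep c0 d0 (cubic_map c0 d0 (Z \<Lambda>))) (cubic (Z \<Lambda>))"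
    "prolong c0 d0 \<Gamma> \<Lambda> \<in> jet_space 3 A B" "fst (prolong c0 d0 \<Gamma> \<Lambda>) = fst \<Lambda>" "jet_target (prolong c0 d0 \<Gamma> \<Lambda>) = jet_target \<Lambda>"
proof -
  have m: "fst \<Lambda> \<in> fst c0" "jet_target \<Lambda> \<in> fst d0" using L by auto
  have dt: "det (fst (snd (snd (fst (Z \<Lambda>))))) \<noteq> 0"
    using jet2_regular[OF L c0 subset_refl d0 subset_refl] by (simp add: regular_j2_def)
  have z: "fst (fst (Z \<Lambda>)) = snd c0 (fst \<Lambda>)" "fst (snd (fst (Z \<Lambda>))) = snd d0 (jet_target \<Lambda>)"
    using jet2_coords_base[OF c0 m(1), of d0] by simp_all
  obtain W W' where W: "fst \<Lambda> \<in> W" "diffeo A B W W' (cubic_map c0 d0 (Z \<Lambda>))" "cubic_map c0 d0 (Z \<Lambda>) (fst \<Lambda>) = jet_target \<Lambda>"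
    "same_jet 3 (snd c0 (fst \<Lambda>)) (local_rep c0 d0 (cubic_map c0 d0 (Z \<Lambda>))) (cubic (Z \<Lambda>))"
    by (rule cubic_map[OF c0 d0 m z dt])
  show ?thesis
  proof (rule that[OF W])
    show "prolong c0 d0 \<Gamma> \<Lambda> \<in> jet_space 3 A B" unfolding prolong_def jet_space_def using W(1,2) by blast
    show "fst (prolong c0 d0 \<Gamma> \<Lambda>) = fst \<Lambda>" by (simp add: prolong_def jet_def)
    show "jet_target (prolong c0 d0 \<Gamma> \<Lambda>) = jet_target \<Lambda>"
      unfolding prolong_def using jet_target[OF diffeo_regular[OF W(2)] W(1)] W(3) by simp
  qed
qed

text \<open>In arbitrary charts the coordinate expression factors through \<open>c0\<close> and
  \<open>d0\<close>: a transition of 2-jets, then \<open>\<Gamma>\<close>, then a transition of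
  3-jets, all of them regular.\<close>

lemma regular_prolong: "regular_map \<rho> (jet2_atlas A B) (jet3_atlas A B) (jets_over 2 X0 Y0) (prolong c0 d0 \<Gamma>)"
  unfolding regular_map_def Let_def
proof (intro conjI ballI)
  let ?\<Phi> = "prolong c0 d0 \<Gamma>"
  have oX: "openin (atlas_topology A) X0" and oY: "openin (atlas_topology B) Y0"
    by (rule A.openin_chart[OF c0 U], rule B.openin_chart[OF d0 U'])
  show "openin (atlas_topology (jet2_atlas A B)) (jets_over 2 X0 Y0)" by (rule openin_jets_over[OF oX oY])
  have P: "?\<Phi> \<Lambda> \<in> jet_space 3 A B" "fst (?\<Phi> \<Lambda>) = fst \<Lambda>" "jet_target (?\<Phi> \<Lambda>) = jet_target \<Lambda>" if "\<Lambda> \<in> jets_over 2 X0 Y0" for \<Lambda>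
    by (rule prolong[OF that]; assumption)+
  show "?\<Phi> ` jets_over 2 X0 Y0 \<subseteq> points (jet3_atlas A B)"
  proof
    fix L assume "L \<in> ?\<Phi> ` jets_over 2 X0 Y0"
    then have L: "L \<in> jet_dom 3 c0 d0" using P by auto
    have "(jet_dom 3 c0 d0, jet3_coords c0 d0) \<in> jet3_atlas A B" unfolding jet_atlas_def using c0 d0 by blast
    from imageI[OF this, of fst] have "jet_dom 3 c0 d0 \<in> fst ` jet3_atlas A B" by simp
    from UnionI[OF this L] show "L \<in> points (jet3_atlas A B)" unfolding topspace_atlas .
  qed
  fix C C' assume "C \<in> jet2_atlas A B" "C' \<in> jet3_atlas A B"
  then obtain c d c' d' where C: "C = (jet_dom 2 c d, jet2_coords c d)" "C' = (jet_dom 3 c' d', jet3_coords c' d')"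
    and c: "c \<in> A" and d: "d \<in> B" and c': "c' \<in> A" and d': "d' \<in> B"
    unfolding jet_atlas_def by blast
  let ?V = "{\<Lambda> \<in> jets_over 2 X0 Y0 \<inter> fst C. ?\<Phi> \<Lambda> \<in> fst C'}"
  have Veq: "?V = jets_over 2 (X0 \<inter> fst c \<inter> fst c') (Y0 \<inter> fst d \<inter> fst d')"
    using P unfolding C fst_conv by auto
  show "openin (atlas_topology (jet2_atlas A B)) ?V"
    unfolding Veq by (intro openin_jets_over openin_Int oX oY A.openin_fst[OF c] A.openin_fst[OF c'] B.openin_fst[OF d] B.openin_fst[OF d'])
  define \<tau>1 where "\<tau>1 z = J3 (\<lambda>\<xi>. transition d d0 (cubic z (transition c0 c \<xi>))) (transition c c0 (fst (fst z)))" for z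
  define \<tau>2 where "\<tau>2 z = J3 (\<lambda>\<xi>. transition d0 d' (cubic z (transition c' c0 \<xi>))) (transition c0 c' (fst (fst z)))" for z
  define N1 where "N1 = {z :: 'n j3. fst (fst z) \<in> overlap c c0 \<and> fst (snd (fst z)) \<in> overlap d d0}"
  define N2 where "N2 = {z :: 'n j3. fst (fst z) \<in> overlap c0 c' \<and> fst (snd (fst z)) \<in> overlap d0 d'}"
  have tr: "transition a b ` overlap a b \<subseteq> overlap b a" "\<And>x. x \<in> overlap a b \<Longrightarrow> transition b a (transition a b x) = x"
    if "a \<in> A" "b \<in> A" for a b
    using A.local_rep_at[OF that(1), of _ b "\<lambda>p. p"] A.local_rep_at[OF that(2), of _ a "\<lambda>p. p"] by auto
  have N1: "open N1" and \<tau>1: "reg \<rho> N1 \<tau>1"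
    unfolding N1_def \<tau>1_def[abs_def]
    by (rule reg_J3_transition[OF A.open_overlap[OF c0 c] A.open_overlap[OF c c0] B.open_overlap[OF d d0]
        A.reg_transition[OF c0 c] A.reg_transition[OF c c0] tr[OF c c0] B.reg_transition[OF d d0]], assumption)+
  have N2: "open N2" and \<tau>2: "reg \<rho> N2 \<tau>2"
    unfolding N2_def \<tau>2_def[abs_def]
    by (rule reg_J3_transition[OF A.open_overlap[OF c' c0] A.open_overlap[OF c0 c'] B.open_overlap[OF d0 d']
        A.reg_transition[OF c' c0] A.reg_transition[OF c0 c'] tr[OF c0 c'] B.reg_transition[OF d0 d']], assumption)+
  \<comment> \<open>The 2-jet coordinates are completed by zero third derivatives, so that the
    transition of 3-jets can be used; its 2-jet part does not depend on this completion.\<close>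
  define N1' where "N1' = (\<lambda>\<zeta> :: 'n j2. (\<zeta>, 0)) -` N1"
  have oN1': "open N1'" unfolding N1'_def by (rule open_vimage[OF N1]) (intro continuous_intros)
  define g where "g \<zeta> = fst (\<tau>1 (\<zeta>, 0))" for \<zeta>
  have g: "reg \<rho> N1' g"
    unfolding g_def[abs_def]
    by (rule reg_fst[OF oN1' reg_compose[OF oN1' N1 _ reg_Pair[OF oN1' reg_id[OF oN1'] reg_const] \<tau>1]]) (auto simp: N1'_def)
  define N3 where "N3 = g -` regular_j2 U U' \<inter> N1'"
  have oN3: "open N3" unfolding N3_def using continuous_on_open_vimage[OF oN1'] reg_continuous_on[OF g] V by blast
  have g3: "reg \<rho> N3 g" by (rule reg_subset[OF g]) (auto simp: N3_def)
  have \<Gamma>g: "reg \<rho> N3 (\<lambda>\<zeta>. (g \<zeta>, \<Gamma> (g \<zeta>)))"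
    by (rule reg_Pair[OF oN3 g3 reg_compose[OF oN3 V _ g3 \<Gamma>]]) (auto simp: N3_def)
  define N4 where "N4 = (\<lambda>\<zeta>. (g \<zeta>, \<Gamma> (g \<zeta>))) -` N2 \<inter> N3"
  have oN4: "open N4" unfolding N4_def using continuous_on_open_vimage[OF oN3] reg_continuous_on[OF \<Gamma>g] N2 by blast
  have G: "reg \<rho> N4 (\<lambda>\<zeta>. \<tau>2 (g \<zeta>, \<Gamma> (g \<zeta>)))"
    by (rule reg_compose[OF oN4 N2 _ reg_subset[OF \<Gamma>g] \<tau>2]) (auto simp: N4_def)
  have key: "jet2_coords c d \<Lambda> \<in> N4 \<and> \<tau>2 (g (jet2_coords c d \<Lambda>), \<Gamma> (g (jet2_coords c d \<Lambda>))) = local_rep C C' ?\<Phi> (jet2_coords c d \<Lambda>)"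
    if L: "\<Lambda> \<in> ?V" for \<Lambda>
  proof -
    let ?\<zeta> = "jet2_coords c d \<Lambda>" and ?p = "fst \<Lambda>"
    have L0: "\<Lambda> \<in> jets_over 2 X0 Y0" using L by blast
    obtain f W W' where f: "diffeo A B W W' f" "regular_map Smooth A B W f" "?p \<in> W" "\<Lambda> = jet 2 A B ?p f" "jet_target \<Lambda> = f ?p"
      using L0 by (auto elim: jet_spaceE)
    have p: "?p \<in> fst c" "?p \<in> fst c'" "?p \<in> fst c0" and q: "f ?p \<in> fst d" "f ?p \<in> fst d'" "f ?p \<in> fst d0"
      using L f(5) unfolding Veq by auto
    let ?F = "local_rep c d f" and ?x = "snd c ?p"
    have x: "?x \<in> snd c ` rep_dom W f c d" using p q f(3) by auto
    have \<zeta>: "?\<zeta> = J2 ?F ?x" using jet_coords(1)[OF f(2,3) c p(1) d q(1)] f(4) by simp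
    \<comment> \<open>\<open>?\<zeta>\<close> comes from an actual smooth map, so its second-order
      part is symmetric and the polynomial realizes it.\<close>
    have "J3 (cubic (?\<zeta>, 0)) (fst (fst (?\<zeta>, 0 :: real^'n^'n^'n^'n))) = (?\<zeta>, 0)"
      by (rule J3_cubic) (use sym_J3(1)[OF rep(2)[OF f(2) c d] x rep(3)[OF f(2) c d]] \<zeta> in \<open>simp_all add: sym3_def\<close>)
    then have "J2 (cubic (?\<zeta>, 0)) ?x = ?\<zeta>" using jet2_coords_base(1)[OF c p(1), of d] by (simp add: J3_def)
    then have "same_jet 2 ?x ?F (cubic (?\<zeta>, 0))"
      using J2_eq_iff[OF rep(2)[OF f(2) c d] x rep(3)[OF f(2) c d] reg_subset[OF reg_cubic_right subset_UNIV]] \<zeta> by metis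
    from chart_change[OF f(2) c c0 d d0 f(3) p(1,3) q(1,3) open_UNIV UNIV_I reg_cubic_right this]
    have "J2 (local_rep c0 d0 f) (snd c0 ?p) = J2 (\<lambda>\<xi>. transition d d0 (cubic (?\<zeta>, 0) (transition c0 c \<xi>))) (snd c0 ?p)"
      by (rule J2_same)
    moreover have "transition c c0 (fst ?\<zeta>) = snd c0 ?p"
      using jet2_coords_base(1)[OF c p(1), of d] A.local_rep_at[OF c p(1), of c0 "\<lambda>p. p"] by simp
    moreover have "jet2_coords c0 d0 \<Lambda> = J2 (local_rep c0 d0 f) (snd c0 ?p)"
      using jet_coords(1)[OF f(2,3) c0 p(3) d0 q(3)] f(4) by simp
    ultimately have g\<Lambda>: "g ?\<zeta> = jet2_coords c0 d0 \<Lambda>"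
      by (simp add: g_def \<tau>1_def J3_def)
    have b: "fst ?\<zeta> = ?x" "fst (snd ?\<zeta>) = snd d (f ?p)" using jet2_coords_base[OF c p(1), of d] f(5) by simp_all
    have b0: "fst (jet2_coords c0 d0 \<Lambda>) = snd c0 ?p" "fst (snd (jet2_coords c0 d0 \<Lambda>)) = snd d0 (f ?p)"
      using jet2_coords_base[OF c0 p(3), of d0] f(5) by simp_all
    have "?\<zeta> \<in> N1'" using p q b by (auto simp: N1'_def N1_def)
    moreover have "g ?\<zeta> \<in> regular_j2 U U'" unfolding g\<Lambda> by (rule jet2_regular[OF L0 c0 subset_refl d0 subset_refl])
    moreover have "(g ?\<zeta>, \<Gamma> (g ?\<zeta>)) \<in> N2" unfolding g\<Lambda> N2_def using p q b0 by auto
    ultimately have 1: "?\<zeta> \<in> N4" by (simp add: N4_def N3_def)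
    obtain W1 W1' where W1: "?p \<in> W1" "diffeo A B W1 W1' (cubic_map c0 d0 (Z \<Lambda>))" "cubic_map c0 d0 (Z \<Lambda>) ?p = jet_target \<Lambda>"
      "same_jet 3 (snd c0 ?p) (local_rep c0 d0 (cubic_map c0 d0 (Z \<Lambda>))) (cubic (Z \<Lambda>))"
      by (rule prolong[OF L0])
    have tg: "cubic_map c0 d0 (Z \<Lambda>) ?p \<in> fst d0" "cubic_map c0 d0 (Z \<Lambda>) ?p \<in> fst d'" using W1(3) f(5) q by simp_all
    have "local_rep C C' ?\<Phi> ?\<zeta> = jet3_coords c' d' (?\<Phi> \<Lambda>)"
      unfolding local_rep_def C snd_conv fst_conv o_def
      using inv_into_f_f[OF inj_jet_coords(1)[OF c d], of \<Lambda>] L unfolding C fst_conv by simp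
    also have "\<dots> = J3 (local_rep c' d' (cubic_map c0 d0 (Z \<Lambda>))) (snd c' ?p)"
      unfolding prolong_def by (rule jet_coords(2)[OF diffeo_regular[OF W1(2)] W1(1) c' p(2) d' tg(2)])
    also have "\<dots> = J3 (\<lambda>\<xi>. transition d0 d' (cubic (Z \<Lambda>) (transition c' c0 \<xi>))) (snd c' ?p)"
      by (rule J3_same[OF chart_change[OF diffeo_regular[OF W1(2)] c0 c' d0 d' W1(1) p(3,2) tg open_UNIV UNIV_I reg_cubic_right W1(4)]])
    also have "\<dots> = \<tau>2 (Z \<Lambda>)"
      using A.local_rep_at[OF c0 p(3), of c' "\<lambda>p. p"] b0(1) by (simp add: \<tau>2_def)
    finally show ?thesis using 1 g\<Lambda> by simp
  qed
  \<comment> \<open>The coordinates of jets fill only part of the symmetric arrays and no open set,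
    so regularity means extension to the open set \<open>N4\<close>.\<close>
  show "regular_on \<rho> (snd C ` ?V) (local_rep C C' ?\<Phi>)"
    unfolding regular_on_def
  proof
    fix \<zeta> assume "\<zeta> \<in> snd C ` ?V"
    then have "\<zeta> \<in> N4" using key unfolding C snd_conv by blast
    then show "\<exists>U g. open U \<and> \<zeta> \<in> U \<and> reg \<rho> U g \<and> (\<forall>y\<in>U \<inter> snd C ` ?V. g y = local_rep C C' ?\<Phi> y)"
      using oN4 G key by (intro exI[of _ N4] exI[of _ "\<lambda>\<zeta>. \<tau>2 (g \<zeta>, \<Gamma> (g \<zeta>))"]) (auto simp: C simp del: regular_on_open.simps)
  qed
qed

text \<open>If \<open>\<Gamma>\<close> gives the third derivatives of \<open>f\<close>, then
  \<open>f\<close> and the polynomial have equal coordinates of order 3; this is contact, hence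
  equality of the 3-jets.\<close>

lemma jet_prolong:
  assumes L: "jet 2 A B p f \<in> jets_over 2 X0 Y0" and f: "regular_map Smooth A B W f" "p \<in> W"
    and J: "J3 (local_rep c0 d0 f) (snd c0 p) = (J2 (local_rep c0 d0 f) (snd c0 p), \<Gamma> (J2 (local_rep c0 d0 f) (snd c0 p)))"
  shows "jet 3 A B p f = prolong c0 d0 \<Gamma> (jet 2 A B p f)"
proof -
  let ?L = "jet 2 A B p f"
  have fst: "fst ?L = p" by (simp add: jet_def)
  have tg: "jet_target ?L = f p" by (rule jet_target[OF f])
  have m: "p \<in> fst c0" "f p \<in> fst d0" using L tg fst by auto
  have x: "snd c0 p \<in> snd c0 ` rep_dom W f c0 d0" using f m by auto
  note R = rep(2)[OF f(1) c0 d0] x rep(3)[OF f(1) c0 d0]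
  have co: "jet2_coords c0 d0 ?L = J2 (local_rep c0 d0 f) (snd c0 p)" by (rule jet_coords(1)[OF f c0 m(1) d0 m(2)])
  then have Z: "J3 (local_rep c0 d0 f) (snd c0 p) = Z ?L" using J by simp
  have "J3 (cubic (Z ?L)) (fst (fst (Z ?L))) = Z ?L"
    by (rule J3_cubic) (use sym_J3[OF R] Z co in simp_all)
  moreover have "fst (fst (Z ?L)) = snd c0 p" using jet2_coords_base(1)[OF c0, of ?L d0] m fst by simp
  ultimately have "J3 (local_rep c0 d0 f) (snd c0 p) = J3 (cubic (Z ?L)) (snd c0 p)" using Z by simp
  then have 1: "same_jet 3 (snd c0 p) (local_rep c0 d0 f) (cubic (Z ?L))"
    using J3_eq_iff[OF R reg_subset[OF reg_cubic_right subset_UNIV]] by blast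
  obtain W1 W1' where W1: "p \<in> W1" "diffeo A B W1 W1' (cubic_map c0 d0 (Z ?L))" "cubic_map c0 d0 (Z ?L) p = f p"
    "same_jet 3 (snd c0 p) (local_rep c0 d0 (cubic_map c0 d0 (Z ?L))) (cubic (Z ?L))"
    using prolong[OF L] unfolding fst tg by metis
  have "same_jet 3 (snd c0 p) (local_rep c0 d0 f) (local_rep c0 d0 (cubic_map c0 d0 (Z ?L)))"
    using same_jet_trans[OF 1 same_jet_sym[OF W1(4)]] .
  from contactI[OF f(1) diffeo_regular[OF W1(2)] f(2) W1(1,3) c0 m(1) d0 m(2) this]
  show ?thesis unfolding prolong_def fst by (rule jet_eq)
qed

end

end

theorem theorem2p1:
  fixes A :: "('a, real^'n) chart set" and B :: "('b, real^'n) chart set"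
    and H :: "('a, real^'n) chart \<Rightarrow> 'n distribution" and J :: "('a, real^'n) chart \<Rightarrow> 'n endo_field"
    and H' :: "('b, real^'n) chart \<Rightarrow> 'n distribution" and J' :: "('b, real^'n) chart \<Rightarrow> 'n endo_field"
    and \<rho> :: regularity and p\<^sub>0 :: 'a and \<Lambda>\<^sub>0 :: "('a, 'b) jet"
  assumes pos_CR_dim: "CARD('n) \<ge> 2"
    and M: "almost_CR_manifold \<rho> A H J" "hypersurface_type A H" "strongly_nondegenerate A H J"
    and M': "almost_CR_manifold \<rho> B H' J'" "hypersurface_type B H'" "strongly_nondegenerate B H' J'"
    and p\<^sub>0: "p\<^sub>0 \<in> points A"
    and \<Lambda>\<^sub>0: "\<Lambda>\<^sub>0 \<in> jet_space_at 2 A B p\<^sub>0"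
  shows "\<exists>\<Omega> \<Phi>. openin (atlas_topology (jet2_atlas A B)) \<Omega> \<and> \<Lambda>\<^sub>0 \<in> \<Omega> \<and>
           regular_map \<rho> (jet2_atlas A B) (jet3_atlas A B) \<Omega> \<Phi> \<and>
           (\<forall>W W' f p. CR_diffeo A H J B H' J' W W' f \<and> p \<in> W \<and> jet 2 A B p f \<in> \<Omega> \<longrightarrow>
              jet 3 A B p f = \<Phi> (jet 2 A B p f))"
proof -
  interpret A: atlas \<rho> A using M(1) by unfold_locales (simp add: almost_CR_manifold_def)
  interpret B: atlas \<rho> B using M'(1) by unfold_locales (simp add: almost_CR_manifold_def)
  interpret atlas_pair \<rho> A B ..
  have L0: "\<Lambda>\<^sub>0 \<in> jet_space 2 A B" "fst \<Lambda>\<^sub>0 = p\<^sub>0" using \<Lambda>\<^sub>0 by (auto simp: jet_space_at_def)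
  \<comment> \<open>A representative of the given jet locates the target point, around which the
    target chart is chosen.\<close>
  obtain f0 W0 W0' where f0: "regular_map Smooth A B W0 f0" "p\<^sub>0 \<in> W0" "jet_target \<Lambda>\<^sub>0 = f0 p\<^sub>0"
    using L0 by (auto elim: jet_spaceE)
  have "f0 p\<^sub>0 \<in> points B" using f0 unfolding regular_map_def by blast
  then obtain d0 where d0: "d0 \<in> B" "f0 p\<^sub>0 \<in> fst d0" unfolding topspace_atlas by blast
  obtain c0 where c0: "c0 \<in> A" "p\<^sub>0 \<in> fst c0" using p\<^sub>0 unfolding topspace_atlas by blast
  have CR: "almost_CR_on \<rho> (snd c0 ` fst c0) (H c0) (J c0)" "almost_CR_on \<rho> (snd d0 ` fst d0) (H' d0) (J' d0)"
    using M(1) M'(1) c0(1) d0(1) unfolding almost_CR_manifold_def by blast+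
  have dim: "dim (H c0 x) + 1 = CARD('n)" if "x \<in> snd c0 ` fst c0" for x
    using M(2) c0(1) that unfolding hypersurface_type_def by blast
  have dim': "dim (H' d0 y) + 1 = CARD('n)" if "y \<in> snd d0 ` fst d0" for y
    using M'(2) d0(1) that unfolding hypersurface_type_def by blast
  have nondeg: "strongly_nondegenerate_at (snd c0 ` fst c0) (H c0) (J c0) x" if "x \<in> snd c0 ` fst c0" for x
    using M(3) c0(1) that unfolding strongly_nondegenerate_def by blast
  obtain U U' \<Gamma> where U: "open U" "snd c0 p\<^sub>0 \<in> U" "open U'" "snd d0 (f0 p\<^sub>0) \<in> U'"
    and V: "open (regular_j2 U U' :: 'n j2 set)"
    and \<Gamma>: "reg \<rho> (regular_j2 U U') (\<Gamma> :: 'n j2 \<Rightarrow> real^'n^'n^'n^'n)"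
    and sys: "\<And>W f x. open W \<Longrightarrow> W \<subseteq> U \<Longrightarrow> f ` W \<subseteq> U' \<Longrightarrow> reg Smooth W f \<Longrightarrow>
      (\<And>x. x \<in> W \<Longrightarrow> transforms_CR (frechet_derivative f (at x)) (H c0 x) (J c0 x) (H' d0 (f x)) (J' d0 (f x))) \<Longrightarrow>
      (\<And>x. x \<in> W \<Longrightarrow> det (\<chi> k. frechet_derivative f (at x) (axis k 1)) \<noteq> 0) \<Longrightarrow> x \<in> W \<Longrightarrow>
      (\<chi> i j k. iter_deriv [axis i 1, axis j 1, axis k 1] f x) =
      \<Gamma> (x, f x, \<chi> i. iter_deriv [axis i 1] f x, \<chi> i j. iter_deriv [axis i 1, axis j 1] f x)"
    unfolding regular_j2_def
    by (rule local_system[OF pos_CR_dim A.open_img[OF c0(1)] B.open_img[OF d0(1)] CR dim dim' nondeg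
        imageI[OF c0(2)] imageI[OF d0(2)]]) blast+
  \<comment> \<open>Only source and target are localized; the remaining jet coordinates are
    unrestricted, since the local system holds for every invertible Jacobian.\<close>
  let ?\<Omega> = "jets_over 2 {p \<in> fst c0. snd c0 p \<in> U} {q \<in> fst d0. snd d0 q \<in> U'}"
  have reg: "regular_map \<rho> (jet2_atlas A B) (jet3_atlas A B) ?\<Omega> (prolong c0 d0 \<Gamma>)"
    by (rule regular_prolong[OF c0(1) d0(1) U(1,3) V \<Gamma>])
  moreover have "openin (atlas_topology (jet2_atlas A B)) ?\<Omega>" using reg unfolding regular_map_def by blast
  moreover have "\<Lambda>\<^sub>0 \<in> ?\<Omega>" using L0 c0(2) d0(2) U f0(3) by simp
  moreover have "jet 3 A B p f = prolong c0 d0 \<Gamma> (jet 2 A B p f)"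
    if f: "CR_diffeo A H J B H' J' W W' f" and p: "p \<in> W" and L: "jet 2 A B p f \<in> ?\<Omega>" for W W' f p
  proof (rule jet_prolong[OF c0(1) d0(1) U(1,3) V \<Gamma> L _ p])
    have df: "diffeo A B W W' f" using f by (simp add: CR_diffeo_def)
    show rf: "regular_map Smooth A B W f" by (rule diffeo_regular[OF df])
    let ?F = "local_rep c0 d0 f" and ?D = "snd c0 ` {p \<in> W \<inter> fst c0. f p \<in> fst d0}"
    have "fst (jet 2 A B p f) = p" "jet_target (jet 2 A B p f) = f p" using jet_target[OF rf p] by (simp_all add: jet_def)
    then have m: "p \<in> fst c0" "snd c0 p \<in> U" "f p \<in> fst d0" "snd d0 (f p) \<in> U'" using L by auto
    \<comment> \<open>Shrunk so that the representative maps into \<open>U'\<close>, as the local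
      system requires.\<close>
    define O1 where "O1 = (?F -` U' \<inter> ?D) \<inter> U"
    have "open (?F -` U' \<inter> ?D)"
      using continuous_on_open_vimage[OF rep(2)[OF rf c0(1) d0(1)]] reg_continuous_on[OF rep(3)[OF rf c0(1) d0(1)]] U(3) by blast
    then have o: "open O1" using U(1) unfolding O1_def by blast
    have x: "snd c0 p \<in> O1" using m p A.local_rep_at[OF c0(1) m(1), of d0 f] by (auto simp: O1_def)
    have *: "transforms_CR (frechet_derivative ?F (at x)) (H c0 x) (J c0 x) (H' d0 (?F x)) (J' d0 (?F x)) \<and>
      det (\<chi> k. frechet_derivative ?F (at x) (axis k 1)) \<noteq> 0" if x: "x \<in> O1" for x
    proof -
      obtain q where q: "q \<in> W" "q \<in> fst c0" "f q \<in> fst d0" "x = snd c0 q" using x by (auto simp: O1_def)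
      have "?F x = snd d0 (f q)" unfolding q(4) by (rule A.local_rep_at[OF c0(1) q(2)])
      then show ?thesis
        using f c0(1) d0(1) q diffeo_det[OF df c0(1) d0(1) q(1,2,3)] unfolding CR_diffeo_def by auto
    qed
    have "(\<chi> i j k. iter_deriv [axis i 1, axis j 1, axis k 1] ?F (snd c0 p)) = \<Gamma> (J2 ?F (snd c0 p))"
      unfolding J2_def
      by (rule sys[OF o _ _ reg_subset[OF rep(3)[OF rf c0(1) d0(1)]] _ _ x]) (use * in \<open>auto simp: O1_def\<close>)
    then show "J3 ?F (snd c0 p) = (J2 ?F (snd c0 p), \<Gamma> (J2 ?F (snd c0 p)))" by (simp add: J3_def del: iter_deriv.simps)
  qed
  ultimately show ?thesis by blast
qed

end
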